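(* Let $C$ be a smooth projective irreducible curve over a finite field $\mathbb{F}_q$ of characteristic $p>3$, with function field $K=\mathbb{F}_q(C)$, let $E/K$ be a non-constant elliptic curve, let $\varphi:\mathcal{E}\to C$ be its minimal regular model, and let $j_{\mathcal{E}}:C\to\mathbb{P}^1$ be the induced $j$-map. Let $B\ge 1$ be an integer, let $\alpha,\beta\in[0,\pi]$, and put $$\pi(B,\alpha,\beta)=\#\{P\in C_0\;|\;\deg(P)\le B\text{ and }\alpha\le\theta(\mathcal{E}_P)\le\beta\}.$$ For $k\ge 1$ put $t_{\alpha}(k)=2q^{k/2}\cos(\alpha)$ and $t_{\beta}(k)=2q^{k/2}\cos(\beta)$, and for an integer $t$ let $N_k(t)$ be the number of $\mathbb{F}_{q^k}$-isomorphism classes of elliptic curves $\mathbf{E}/\mathbb{F}_{q^k}$ with $\#\mathbf{E}(\mathbb{F}_{q^k})=q^k+1-t$. Then $$\pi(B,\alpha,\beta)\le\Bigg(\sum_{\substack{1\le k\le B\\ t_{\beta}(k)\le t\le t_{\alpha}(k)\\ t^2\le 4q^k}}N_k(t)\Bigg)\deg(j_{\mathcal{E}}),$$ where the sum is over pairs of integers $(k,t)$ satisfying the displayed conditions.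
   Context: "Non-constant" means that the $j$-invariant $j(E)\in K$ is not algebraic over $\mathbb{F}_q$, so $j_{\mathcal{E}}$ is a non-constant morphism, of degree $\deg(j_{\mathcal{E}})$. Points $P\in C$ are closed points; $\kappa_P$ is the residue field at $P$, $\deg(P)=[\kappa_P:\mathbb{F}_q]$, $q_P=q^{\deg(P)}$, and $\mathcal{E}_P=\varphi^{-1}(P)$ is the fiber. $C_0$ is the set of $P\in C$ such that $\mathcal{E}_P$ is an elliptic curve over $\kappa_P$; for such $P$ one has $j_{\mathcal{E}}(P)=j(\mathcal{E}_P)$, and $t(\mathcal{E}_P)=q_P+1-\#\mathcal{E}_P(\kappa_P)$ is the trace of Frobenius at $P$. By Hasse–Weil there is a unique angle $\theta(\mathcal{E}_P)\in[0,\pi]$ with $t(\mathcal{E}_P)=2q_P^{1/2}\cos(\theta(\mathcal{E}_P))$. *)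

theory Defs
  imports Complex_Main "HOL-Library.Extended_Nat" "HOL-Algebra.Algebra"
begin

text \<open>
  Integral schemes are represented as models in the sense of Zariski (Zariski--Samuel,
  Commutative Algebra II, Ch. VI, Sect. 17): an integral separated scheme of finite type with
  function field \<open>F\<close> is the set of its local rings, which are subrings of \<open>F\<close>. A point is
  its local ring, \<open>S\<close> specialises to \<open>R\<close> iff \<open>R \<subseteq> S\<close>, and a birational map (or, more
  generally, a dominant rational map given by an inclusion of function fields) is a morphism
  iff every local ring of the source dominates a local ring of the target, which is then
  the image point.
\<close>

section \<open>Local rings and models\<close>

definition nonunits :: "('a, 'b) ring_scheme \<Rightarrow> 'a set \<Rightarrow> 'a set" where
  "nonunits F R = R - Units (F\<lparr>carrier := R\<rparr>)"

definition dominates :: "('a, 'b) ring_scheme \<Rightarrow> 'a set \<Rightarrow> 'a set \<Rightarrow> bool" where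
  "dominates F R S \<longleftrightarrow> S \<subseteq> R \<and> nonunits F S = S \<inter> nonunits F R"

definition residue_field :: "('a, 'b) ring_scheme \<Rightarrow> 'a set \<Rightarrow> 'a set ring" where
  "residue_field F R = F\<lparr>carrier := R\<rparr> Quot nonunits F R"

definition residue :: "('a, 'b) ring_scheme \<Rightarrow> 'a set \<Rightarrow> 'a \<Rightarrow> 'a set" where
  "residue F R a = nonunits F R +>\<^bsub>F\<^esub> a"

definition localization :: "('a, 'b) ring_scheme \<Rightarrow> 'a set \<Rightarrow> 'a set \<Rightarrow> 'a set" where
  "localization F A \<pp> = {a \<otimes>\<^bsub>F\<^esub> inv\<^bsub>F\<^esub> s | a s. a \<in> A \<and> s \<in> A - \<pp>}"

definition affine_model :: "('a, 'b) ring_scheme \<Rightarrow> 'a set \<Rightarrow> 'a set set" where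
  "affine_model F A = {localization F A \<pp> | \<pp>. primeideal \<pp> (F\<lparr>carrier := A\<rparr>)}"

definition chart :: "('a, 'b) ring_scheme \<Rightarrow> 'a set \<Rightarrow> 'a list \<Rightarrow> 'a \<Rightarrow> 'a set" where
  "chart F k zs z = generate_ring F (k \<union> {w \<otimes>\<^bsub>F\<^esub> inv\<^bsub>F\<^esub> z | w. w \<in> set zs})"

text \<open>
  The closure in projective space over \<open>k\<close> of the point with homogeneous coordinates \<open>zs\<close>
  (all assumed nonzero), covered by the affine charts on which one coordinate does not vanish.
\<close>

definition proj_model :: "('a, 'b) ring_scheme \<Rightarrow> 'a set \<Rightarrow> 'a list \<Rightarrow> 'a set set" where
  "proj_model F k zs = (\<Union>z\<in>set zs. affine_model F (chart F k zs z))"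

text \<open>\<open>M\<close> is an integral projective scheme over \<open>k\<close> with function field \<open>K \<subseteq> F\<close>.\<close>

definition projective_variety ::
  "('a, 'b) ring_scheme \<Rightarrow> 'a set \<Rightarrow> 'a set \<Rightarrow> 'a set set \<Rightarrow> bool" where
  "projective_variety F k K M \<longleftrightarrow>
     (\<exists>zs. zs \<noteq> [] \<and> set zs \<subseteq> K - {\<zero>\<^bsub>F\<^esub>} \<and>
        generate_field F (k \<union> {w \<otimes>\<^bsub>F\<^esub> inv\<^bsub>F\<^esub> z | w z. w \<in> set zs \<and> z \<in> set zs}) = K \<and>
        M = proj_model F k zs)"

definition krull_dim :: "('a, 'b) ring_scheme \<Rightarrow> enat" where
  "krull_dim R =
     (SUP ps\<in>{ps. ps \<noteq> [] \<and> (\<forall>\<pp>\<in>set ps. primeideal \<pp> R) \<and> sorted_wrt (\<subset>) ps}.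
        enat (length ps - 1))"

definition regular_local_ring :: "('a, 'b) ring_scheme \<Rightarrow> bool" where
  "regular_local_ring R \<longleftrightarrow> cring R \<and> noetherian_ring R \<and>
     (\<exists>m G. {I. maximalideal I R} = {m} \<and> finite G \<and> G \<subseteq> carrier R \<and>
        m = genideal R G \<and> enat (card G) = krull_dim R)"

definition ext_degree :: "('a, 'b) ring_scheme \<Rightarrow> 'a set \<Rightarrow> 'a set \<Rightarrow> nat" where
  "ext_degree F k L = (THE n. ring.dimension F n k L)"


section \<open>Curves\<close>

text \<open>\<open>K\<close> is an algebraic function field of one variable over \<open>k\<close>, i.e. of dimension one.\<close>

definition function_field_one_var :: "('a, 'b) ring_scheme \<Rightarrow> 'a set \<Rightarrow> 'a set \<Rightarrow> bool" where
  "function_field_one_var F k K \<longleftrightarrow>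
     (\<exists>t\<in>K. ring.transcendental F k t \<and>
        (\<exists>n. ring.dimension F n (generate_field F (insert t k)) K))"

text \<open>
  The ground field \<open>k\<close> will be finite, hence perfect, so smoothness over \<open>k\<close> is regularity of
  all local rings.
\<close>

definition smooth_projective_curve ::
  "('a, 'b) ring_scheme \<Rightarrow> 'a set \<Rightarrow> 'a set \<Rightarrow> 'a set set \<Rightarrow> bool" where
  "smooth_projective_curve F k K C \<longleftrightarrow>
     projective_variety F k K C \<and> function_field_one_var F k K \<and>
     (\<forall>P\<in>C. regular_local_ring (F\<lparr>carrier := P\<rparr>))"

text \<open>The only non-closed point of an integral curve is its generic point, with local ring \<open>K\<close>.\<close>

definition closed_points :: "'a set \<Rightarrow> 'a set set \<Rightarrow> 'a set set" where
  "closed_points K C = C - {K}"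

definition point_degree :: "('a, 'b) ring_scheme \<Rightarrow> 'a set \<Rightarrow> 'a set \<Rightarrow> nat" where
  "point_degree F k P =
     ext_degree (residue_field F P) (residue F P ` k) (carrier (residue_field F P))"


section \<open>Weierstrass equations\<close>

text \<open>
  \<open>Weierstrass a1 a2 a3 a4 a6\<close> stands for
  \<open>y\<^sup>2 + a1 x y + a3 y = x\<^sup>3 + a2 x\<^sup>2 + a4 x + a6\<close>.
\<close>

datatype 'a weierstrass = Weierstrass 'a 'a 'a 'a 'a

context
  fixes R :: "('a, 'b) ring_scheme" (structure)
begin

fun weierstrass_eq :: "'a weierstrass \<Rightarrow> 'a \<Rightarrow> 'a \<Rightarrow> bool" where
  "weierstrass_eq (Weierstrass a1 a2 a3 a4 a6) x y \<longleftrightarrow>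
     y [^] (2::nat) \<oplus> a1 \<otimes> x \<otimes> y \<oplus> a3 \<otimes> y =
     x [^] (3::nat) \<oplus> a2 \<otimes> x [^] (2::nat) \<oplus> a4 \<otimes> x \<oplus> a6"

fun wei_b2 :: "'a weierstrass \<Rightarrow> 'a" where
  "wei_b2 (Weierstrass a1 a2 a3 a4 a6) = a1 [^] (2::nat) \<oplus> [(4::nat)] \<cdot> a2"

fun wei_b4 :: "'a weierstrass \<Rightarrow> 'a" where
  "wei_b4 (Weierstrass a1 a2 a3 a4 a6) = [(2::nat)] \<cdot> a4 \<oplus> a1 \<otimes> a3"

fun wei_b6 :: "'a weierstrass \<Rightarrow> 'a" where
  "wei_b6 (Weierstrass a1 a2 a3 a4 a6) = a3 [^] (2::nat) \<oplus> [(4::nat)] \<cdot> a6"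

fun wei_b8 :: "'a weierstrass \<Rightarrow> 'a" where
  "wei_b8 (Weierstrass a1 a2 a3 a4 a6) =
     a1 [^] (2::nat) \<otimes> a6 \<oplus> [(4::nat)] \<cdot> (a2 \<otimes> a6) \<ominus> a1 \<otimes> a3 \<otimes> a4
       \<oplus> a2 \<otimes> a3 [^] (2::nat) \<ominus> a4 [^] (2::nat)"

definition wei_c4 :: "'a weierstrass \<Rightarrow> 'a" where
  "wei_c4 W = wei_b2 W [^] (2::nat) \<ominus> [(24::nat)] \<cdot> wei_b4 W"

definition discriminant :: "'a weierstrass \<Rightarrow> 'a" where
  "discriminant W =
     [(9::nat)] \<cdot> (wei_b2 W \<otimes> wei_b4 W \<otimes> wei_b6 W) \<ominus> wei_b2 W [^] (2::nat) \<otimes> wei_b8 W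
       \<ominus> [(8::nat)] \<cdot> (wei_b4 W [^] (3::nat)) \<ominus> [(27::nat)] \<cdot> (wei_b6 W [^] (2::nat))"

definition j_invariant :: "'a weierstrass \<Rightarrow> 'a" where
  "j_invariant W = wei_c4 W [^] (3::nat) \<otimes> inv (discriminant W)"

definition elliptic_curves :: "'a set \<Rightarrow> 'a weierstrass set" where
  "elliptic_curves k = {W. set_weierstrass W \<subseteq> k \<and> discriminant W \<noteq> \<zero>}"

text \<open>
  Isomorphism of elliptic curves: the substitution
  \<open>x = u\<^sup>2 x' + r\<close>, \<open>y = u\<^sup>3 y' + s u\<^sup>2 x' + t\<close> turns the first equation into the second.
\<close>

fun weierstrass_change ::
  "'a \<Rightarrow> 'a \<Rightarrow> 'a \<Rightarrow> 'a \<Rightarrow> 'a weierstrass \<Rightarrow> 'a weierstrass \<Rightarrow> bool" where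
  "weierstrass_change u r s t (Weierstrass a1 a2 a3 a4 a6) (Weierstrass a1' a2' a3' a4' a6') \<longleftrightarrow>
     u \<otimes> a1' = a1 \<oplus> [(2::nat)] \<cdot> s \<and>
     u [^] (2::nat) \<otimes> a2' = a2 \<ominus> s \<otimes> a1 \<oplus> [(3::nat)] \<cdot> r \<ominus> s [^] (2::nat) \<and>
     u [^] (3::nat) \<otimes> a3' = a3 \<oplus> r \<otimes> a1 \<oplus> [(2::nat)] \<cdot> t \<and>
     u [^] (4::nat) \<otimes> a4' =
       a4 \<ominus> s \<otimes> a3 \<oplus> [(2::nat)] \<cdot> (r \<otimes> a2) \<ominus> (t \<oplus> r \<otimes> s) \<otimes> a1
         \<oplus> [(3::nat)] \<cdot> (r [^] (2::nat)) \<ominus> [(2::nat)] \<cdot> (s \<otimes> t) \<and>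
     u [^] (6::nat) \<otimes> a6' =
       a6 \<oplus> r \<otimes> a4 \<oplus> r [^] (2::nat) \<otimes> a2 \<oplus> r [^] (3::nat) \<ominus> t \<otimes> a3
         \<ominus> t [^] (2::nat) \<ominus> r \<otimes> t \<otimes> a1"

definition weierstrass_iso :: "('a weierstrass \<times> 'a weierstrass) set" where
  "weierstrass_iso =
     {(W, W'). W \<in> elliptic_curves (carrier R) \<and> W' \<in> elliptic_curves (carrier R) \<and>
        (\<exists>u r s t. u \<in> carrier R - {\<zero>} \<and> {r, s, t} \<subseteq> carrier R \<and>
           weierstrass_change u r s t W W')}"

text \<open>\<open>None\<close> is the point at infinity.\<close>

definition weierstrass_points :: "'a weierstrass \<Rightarrow> ('a \<times> 'a) option set" where
  "weierstrass_points W =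
     insert None (Some ` {(x, y). x \<in> carrier R \<and> y \<in> carrier R \<and> weierstrass_eq W x y})"

definition num_iso_classes :: "int \<Rightarrow> nat" where
  "num_iso_classes t =
     card ({W \<in> elliptic_curves (carrier R).
              int (card (weierstrass_points W)) = int (card (carrier R)) + 1 - t}
           // weierstrass_iso)"

end

text \<open>
  \<open>F\<close> is the function field over \<open>K\<close> of the elliptic curve \<open>W\<close> over \<open>K\<close>, with coordinate
  functions \<open>x\<close> and \<open>y\<close>. The curve itself is then the projective plane cubic
  \<open>weierstrass_model F K x y\<close>, and \<open>weierstrass_origin F K x y\<close> is its point \<open>[0:1:0]\<close>.
\<close>

definition elliptic_function_field ::
  "('a, 'b) ring_scheme \<Rightarrow> 'a set \<Rightarrow> 'a weierstrass \<Rightarrow> 'a \<Rightarrow> 'a \<Rightarrow> bool" where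
  "elliptic_function_field F K W x y \<longleftrightarrow>
     W \<in> elliptic_curves F K \<and> x \<in> carrier F \<and> y \<in> carrier F \<and>
     weierstrass_eq F W x y \<and> ring.transcendental F K x \<and>
     generate_field F (K \<union> {x, y}) = carrier F"

definition weierstrass_model :: "('a, 'b) ring_scheme \<Rightarrow> 'a set \<Rightarrow> 'a \<Rightarrow> 'a \<Rightarrow> 'a set set" where
  "weierstrass_model F K x y = proj_model F K [x, y, \<one>\<^bsub>F\<^esub>]"

definition weierstrass_origin :: "('a, 'b) ring_scheme \<Rightarrow> 'a set \<Rightarrow> 'a \<Rightarrow> 'a \<Rightarrow> 'a set" where
  "weierstrass_origin F K x y =
     (let A = chart F K [x, y, \<one>\<^bsub>F\<^esub>] y
      in localization F A
           (genideal (F\<lparr>carrier := A\<rparr>) {x \<otimes>\<^bsub>F\<^esub> inv\<^bsub>F\<^esub> y, inv\<^bsub>F\<^esub> y}))"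

text \<open>
  For the non-constant \<open>j\<close>-invariant of an elliptic curve over the function field \<open>K\<close> of a curve
  over \<open>k\<close>, the degree of the induced finite morphism to the projective line is \<open>[K : k(j)]\<close>.
\<close>

definition deg_j_map ::
  "('a, 'b) ring_scheme \<Rightarrow> 'a set \<Rightarrow> 'a set \<Rightarrow> 'a weierstrass \<Rightarrow> nat" where
  "deg_j_map F k K W = ext_degree F (generate_field F (insert (j_invariant F W) k)) K"


section \<open>Minimal regular models and their fibres\<close>

text \<open>
  Here \<open>C\<close> is a projective curve over \<open>k\<close> with function field \<open>K\<close>, \<open>E\<close> is a curve over \<open>K\<close> with
  function field \<open>F\<close>, and \<open>M\<close> is a regular model of \<open>E\<close> that is projective over \<open>C\<close>
  (equivalently, over \<open>k\<close>). The structure morphism \<open>\<phi>\<close> sends a point of \<open>M\<close>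
  to the point of \<open>C\<close> it dominates; it is flat because \<open>M\<close> is integral and dominates \<open>C\<close>.
  The generic fibre consists of the local rings containing \<open>K\<close>.
\<close>

definition regular_model ::
  "('a, 'b) ring_scheme \<Rightarrow> 'a set \<Rightarrow> 'a set \<Rightarrow> 'a set set \<Rightarrow> 'a set set \<Rightarrow> 'a set set \<Rightarrow> bool"
  where
  "regular_model F k K C E M \<longleftrightarrow>
     projective_variety F k (carrier F) M \<and>
     (\<forall>R\<in>M. regular_local_ring (F\<lparr>carrier := R\<rparr>)) \<and>
     (\<forall>R\<in>M. \<exists>P\<in>C. dominates F R P) \<and>
     {R \<in> M. K \<subseteq> R} = E"

text \<open>Minimality: for every regular model \<open>M'\<close> of \<open>E\<close>, the birational map from \<open>M'\<close> to \<open>M\<close>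
  is a morphism.\<close>

definition minimal_regular_model ::
  "('a, 'b) ring_scheme \<Rightarrow> 'a set \<Rightarrow> 'a set \<Rightarrow> 'a set set \<Rightarrow> 'a set set \<Rightarrow> 'a set set \<Rightarrow> bool"
  where
  "minimal_regular_model F k K C E M \<longleftrightarrow>
     regular_model F k K C E M \<and>
     (\<forall>M'. regular_model F k K C E M' \<longrightarrow> (\<forall>R'\<in>M'. \<exists>R\<in>M. dominates F R' R))"

definition fibre :: "('a, 'b) ring_scheme \<Rightarrow> 'a set set \<Rightarrow> 'a set \<Rightarrow> 'a set set" where
  "fibre F M P = {R \<in> M. dominates F R P}"

text \<open>
  The scheme-theoretic fibre over \<open>P\<close> has the stalks \<open>R / m\<^sub>P R\<close>. It is integral with generic
  point \<open>\<eta>\<close> iff \<open>\<eta>\<close> specialises to all its points \<open>R\<close> and each stalk embeds into the residue field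
  of \<open>\<eta>\<close>, i.e. \<open>m\<^sub>P R = R \<inter> m\<^sub>\<eta>\<close>.
\<close>

definition integral_fibre :: "('a, 'b) ring_scheme \<Rightarrow> 'a set set \<Rightarrow> 'a set \<Rightarrow> 'a set \<Rightarrow> bool" where
  "integral_fibre F M P \<eta> \<longleftrightarrow>
     \<eta> \<in> fibre F M P \<and>
     (\<forall>R\<in>fibre F M P. R \<subseteq> \<eta> \<and>
        genideal (F\<lparr>carrier := R\<rparr>) (nonunits F P) = R \<inter> nonunits F \<eta>)"

text \<open>
  The fibre over \<open>P\<close> is an elliptic curve over the residue field of \<open>P\<close>: as a scheme over that field
  (which is embedded in the residue field of \<open>\<eta>\<close>) it is a nonsingular Weierstrass cubic. Its
  origin is the point where it meets the zero section, i.e. the closure of the origin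
  \<open>Z\<close> of the generic fibre.
\<close>

definition elliptic_fibre :: "('a, 'b) ring_scheme \<Rightarrow> 'a set set \<Rightarrow> 'a set \<Rightarrow> 'a set \<Rightarrow> bool" where
  "elliptic_fibre F M Z P \<longleftrightarrow>
     (\<exists>\<eta> W x y. integral_fibre F M P \<eta> \<and>
        elliptic_function_field (residue_field F \<eta>) (residue F \<eta> ` P) W x y \<and>
        bij_betw (\<lambda>R. residue F \<eta> ` R) (fibre F M P)
          (weierstrass_model (residue_field F \<eta>) (residue F \<eta> ` P) x y) \<and>
        (\<forall>R\<in>fibre F M P. R \<subseteq> Z \<longleftrightarrow>
           residue F \<eta> ` R = weierstrass_origin (residue_field F \<eta>) (residue F \<eta> ` P) x y))"

text \<open>The set \<open>C\<^sub>0\<close>.\<close>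

definition good_points ::
  "('a, 'b) ring_scheme \<Rightarrow> 'a set \<Rightarrow> 'a set set \<Rightarrow> 'a set set \<Rightarrow> 'a set \<Rightarrow> 'a set set" where
  "good_points F K C M Z = {P \<in> closed_points K C. elliptic_fibre F M Z P}"

text \<open>Rational points of the fibre: the points whose residue field is that of \<open>P\<close>.\<close>

definition rational_points :: "('a, 'b) ring_scheme \<Rightarrow> 'a set set \<Rightarrow> 'a set \<Rightarrow> 'a set set" where
  "rational_points F M P =
     {R \<in> fibre F M P. residue F R ` P = carrier (residue_field F R)}"

definition frobenius_trace ::
  "('a, 'b) ring_scheme \<Rightarrow> 'a set \<Rightarrow> 'a set set \<Rightarrow> 'a set \<Rightarrow> int" where
  "frobenius_trace F k M P =
     int (card k ^ point_degree F k P) + 1 - int (card (rational_points F M P))"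

text \<open>
  The Frobenius angle is introduced as a relation, so that its definition does not depend on the
  Hasse--Weil bound, which guarantees the existence of \<open>\<theta>\<close>; uniqueness is injectivity of the
  cosine on \<open>[0, \<pi>]\<close>.
\<close>

definition frobenius_angle ::
  "('a, 'b) ring_scheme \<Rightarrow> 'a set \<Rightarrow> 'a set set \<Rightarrow> 'a set \<Rightarrow> real \<Rightarrow> bool" where
  "frobenius_angle F k M P \<theta> \<longleftrightarrow>
     0 \<le> \<theta> \<and> \<theta> \<le> pi \<and>
     of_int (frobenius_trace F k M P) = 2 * sqrt (real (card k ^ point_degree F k P)) * cos \<theta>"

definition angle_points ::
  "('a, 'b) ring_scheme \<Rightarrow> 'a set \<Rightarrow> 'a set \<Rightarrow> 'a set set \<Rightarrow> 'a set set \<Rightarrow> 'a set \<Rightarrow>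
     nat \<Rightarrow> real \<Rightarrow> real \<Rightarrow> 'a set set" where
  "angle_points F k K C M Z B \<alpha> \<beta> =
     {P \<in> good_points F K C M Z. point_degree F k P \<le> B \<and>
        (\<exists>\<theta>. frobenius_angle F k M P \<theta> \<and> \<alpha> \<le> \<theta> \<and> \<theta> \<le> \<beta>)}"

definition trace_bound :: "nat \<Rightarrow> real \<Rightarrow> nat \<Rightarrow> real" where
  "trace_bound q \<alpha> k = 2 * real q powr (real k / 2) * cos \<alpha>"

end

(* The valuation rings of the fibre of the minimal model over a good point P dominate P, and their reductions
   modulo the generic point of the fibre are the places of a Weierstrass function field over the residue field of P.
   A uniformizer scaling produces a short equation with coefficients in P, nonvanishing reduced discriminant and the
   same j-invariant, and the rational points of the fibre correspond to the points of the reduced equation. Sending a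
   good point of degree n to the isomorphism class of its reduced equation over the field with q^n elements, two points
   in one fibre of this map induce the same prime of k[j], so that each fibre has at most [K : k(j)] elements. *)

theory Submission
  imports Defs "HOL-Decision_Procs.Commutative_Ring" "HOL-Library.Reflection"
begin

text \<open>The fibre is known only abstractly: its local rings match those of some nonsingular
  cubic over the residue field, whose coordinates are unrelated to \<open>x\<close> and
  \<open>y\<close>. That the generic equation, suitably rescaled, keeps a nonzero discriminant has
  to be proved. A bad rescaling would reduce to a conic or a singular cubic; over a finite field
  these can be parametrized, so the residue function field would be rational, which an elliptic
  function field never is. Non-rationality is shown by comparing pole orders at infinity.

  Isomorphism classes live over \<open>GF n\<close>, so every residue field of degree n must be
  identified with \<open>GF n\<close>. For equal classes to give equal primes of k[j] these
  identifications must agree on \<open>k\<close>; they all extend one embedding of \<open>k\<close>.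
  The points over one prime are counted by weak approximation: functions that are units at one point
  and nonunits at the others are independent over k(j). All rings are subsets of one field, so they
  can be compared by inclusion.\<close>

notation monoid.mult (infixl "$\<index>" 70)
notation ring.add (infixl "+.\<index>" 65)
notation a_minus ("(_ -.\<index> _)" [65,66] 65)
notation a_inv ("-.\<index> _" [81] 80)
notation add_pow ("[_] #.\<index> _" [81,81] 80)
notation ring.zero ("0.\<index>")
notation monoid.one ("1.\<index>")

section \<open>Normalization of ring identities by reflection\<close>

datatype rterm = RVar nat | RZero | ROne | RMult num rterm | RAdd rterm rterm | RSub rterm rterm
 | RNeg rterm | RMul rterm rterm | RPow rterm num

datatype requation = REq rterm rterm

primrec to_polex :: "rterm => polex" where
 "to_polex (RVar n) = Var n"
| "to_polex RZero = Const 0"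
| "to_polex ROne = Const 1"
| "to_polex (RMult n P) = Mul (Const (numeral n)) (to_polex P)"
| "to_polex (RAdd P Q) = Add (to_polex P) (to_polex Q)"
| "to_polex (RSub P Q) = Sub (to_polex P) (to_polex Q)"
| "to_polex (RNeg P) = Neg (to_polex P)"
| "to_polex (RMul P Q) = Mul (to_polex P) (to_polex Q)"
| "to_polex (RPow P n) = Pow (to_polex P) (numeral n)"

text \<open>The bound keeps \<open>xs ! n\<close> within the list, where it agrees with the variable
  lookup of \<open>Ipolex\<close>.\<close>

primrec rvars_below :: "nat => rterm => bool" where
 "rvars_below m (RVar n) \<longleftrightarrow> n < m"
| "rvars_below m RZero \<longleftrightarrow> True"
| "rvars_below m ROne \<longleftrightarrow> True"
| "rvars_below m (RMult n P) \<longleftrightarrow> rvars_below m P"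
| "rvars_below m (RAdd P Q) \<longleftrightarrow> rvars_below m P & rvars_below m Q"
| "rvars_below m (RSub P Q) \<longleftrightarrow> rvars_below m P & rvars_below m Q"
| "rvars_below m (RNeg P) \<longleftrightarrow> rvars_below m P"
| "rvars_below m (RMul P Q) \<longleftrightarrow> rvars_below m P & rvars_below m Q"
| "rvars_below m (RPow P n) \<longleftrightarrow> rvars_below m P"

context cring

begin

primrec rval :: "rterm => 'a list => 'a" where
 "rval (RVar n) xs = xs ! n"
| "rval RZero xs = 0."
| "rval ROne xs = 1."
| "rval (RMult n P) xs = [(numeral n :: nat)] #. rval P xs"
| "rval (RAdd P Q) xs = rval P xs+.rval Q xs"
| "rval (RSub P Q) xs = rval P xs-.rval Q xs"
| "rval (RNeg P) xs =-.rval P xs"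
| "rval (RMul P Q) xs = rval P xs$rval Q xs"
| "rval (RPow P n) xs = rval P xs [^] (numeral n :: nat)"

primrec rholds :: "requation => 'a list => bool" where
 "rholds (REq P Q) xs \<longleftrightarrow> rval P xs = rval Q xs"

lemmas rsimps = rval.simps rholds.simps

lemma of_nat_mult: "a : carrier R ==> \<guillemotleft>int n\<guillemotright>$a = [n] #. a"
 by (induct n) (simp_all add: of_integer_def l_distr a_comm nat_add_distrib)

lemma rval_to_polex:
 "in_carrier xs ==> rvars_below (length xs) P ==>
 rval P xs = Ipolex xs (to_polex P) & rval P xs : carrier R"
proof (induct P)
 case (RVar n)
 then show ?case
 by (auto simp: in_carrier_def hd_drop_conv_nth Cons_nth_drop_Suc[symmetric])
next
 case (RMult n P)
 then show ?case using of_nat_mult[of "Ipolex xs (to_polex P)" "numeral n"] by auto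
qed (auto simp del: of_int_add)

text \<open>The difference of both sides normalizes to the zero polynomial over the integers, so the
  identity holds in every commutative ring. Inverses have no constructor in \<open>rterm\<close> and
  are reified as variables; identities proved in this way therefore keep products such as
  \<open>s$inv s\<close>, which are cancelled in a separate simplification.\<close>

lemma ring_id:
 assumes "set xs <= carrier R"
 and "length xs = n"
 and "rvars_below n P & rvars_below n Q &
 norm (Sub (to_polex P) (to_polex Q)) = Pc 0"
 shows "rholds (REq P Q) xs"
proof -
 have xs: "in_carrier xs" using assms(1) by (auto simp: in_carrier_def)
 have "Ipolex xs (Sub (to_polex P) (to_polex Q)) = 0."
 using norm_ci[OF xs, of "Sub (to_polex P) (to_polex Q)"] assms(3) by simp
 then show ?thesis
 using rval_to_polex[OF xs, of P] rval_to_polex[OF xs, of Q] assms(2,3)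
 r_right_minus_eq[of "rval P xs" "rval Q xs"] by auto
qed

end

section \<open>Local subrings, valuation rings and localizations inside a field\<close>

definition local_subring :: "('a, 'b) ring_scheme => 'a set => bool" where
 "local_subring F V \<longleftrightarrow> subring V F &
 (\<forall>a\<in>nonunits F V. \<forall>b\<in>nonunits F V. a +.\<^bsub>F\<^esub> b : nonunits F V)"

text \<open>Relative to a subfield \<open>E\<close>, because valuation rings of the base field, of
  k(x) and of the whole field are compared inside one ambient field.\<close>

definition valuation_ring :: "('a, 'b) ring_scheme => 'a set => 'a set => bool" where
 "valuation_ring F E V \<longleftrightarrow> E <= carrier F & subring V F & V <= E &
 (\<forall>a\<in>E - {0.\<^bsub>F\<^esub>}. a : V \<or> inv\<^bsub>F\<^esub> a : V)"

text \<open>The residue field is \<open>k\<close>: every element is congruent to a constant.\<close>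

definition rational_over :: "('a, 'b) ring_scheme => 'a set => 'a set => bool" where
 "rational_over F k V \<longleftrightarrow> k <= V & (\<forall>a\<in>V. \<exists>c\<in>k. a -.\<^bsub>F\<^esub> c : nonunits F V)"

text \<open>Elementwise form of \<open>primeideal\<close> without the restricted ring record;
  \<open>prime_in_iff\<close> links the two.\<close>

definition prime_in :: "('a, 'b) ring_scheme => 'a set => 'a set => bool" where
 "prime_in F A I \<longleftrightarrow> I <= A & 0.\<^bsub>F\<^esub> : I & 1.\<^bsub>F\<^esub> ~: I &
 (\<forall>a\<in>I. \<forall>b\<in>I. a +.\<^bsub>F\<^esub> b : I) & (\<forall>a\<in>A. \<forall>b\<in>I. a $\<^bsub>F\<^esub> b : I) &
 (\<forall>a\<in>A. \<forall>b\<in>A. a $\<^bsub>F\<^esub> b : I --> a : I \<or> b : I)"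

context ring

begin

lemma subring_minus: "subring V R ==> a : V ==> b : V ==> a-.b : V"
 unfolding minus_eq by (simp add: subringE(5,7))

lemma subring_pow: "subring V R ==> a : V ==> a [^] (n::nat) : V"
 by (induct n) (simp_all add: subringE(3,6))

lemma subring_nat: "subring V R ==> a : V ==> [(n::nat)] #. a : V"
 by (induct n) (simp_all add: subringE(2,7))

lemmas subcl = subringE(2,3,5,6,7) subring_minus subring_pow subring_nat

lemma subcarr: "subring V R ==> a : V ==> a : carrier R"
 using subringE(1) by blast

end

context field

begin

lemma inv_closed [simp]: "a : carrier R ==> a ~= 0. ==> inv a : carrier R"
 by (simp add: field_Units)

lemma inv_mult [simp]: "a : carrier R ==> a ~= 0. ==> a$inv a = 1."
 "a : carrier R ==> a ~= 0. ==> inv a$a = 1."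
 by (simp_all add: field_Units)

lemma inv_nonzero [simp]: "a : carrier R ==> a ~= 0. ==> inv a ~= 0."
 using inv_mult(1)[of a] one_not_zero by fastforce

lemma inv_inv_field [simp]: "a : carrier R ==> a ~= 0. ==> inv (inv a) = a"
 by (simp add: field_Units)

lemma inv_unique_field: "a : carrier R ==> b : carrier R ==> a$b = 1. ==> inv a = b"
 by (simp add: comm_inv_char)

lemma mult_nonzero [simp]:
 "a : carrier R ==> b : carrier R ==> a$b = 0. \<longleftrightarrow> a = 0. \<or> b = 0."
 using integral_iff by auto

lemma inv_mult_distrib: "a : carrier R ==> a ~= 0. ==> b : carrier R ==> b ~= 0. ==>
 inv (a$b) = inv a$inv b"
proof -
 assume c: "a : carrier R" "a ~= 0." "b : carrier R" "b ~= 0."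
 have "a$b$(inv a$inv b) = (a$inv a)$(b$inv b)"
 by (reify rsimps, rule ring_id, simp add: c, simp, code_simp)
 then show ?thesis using c by (intro inv_unique_field) auto
qed

lemma mult_inv_cancel [simp]:
 "a : carrier R ==> a ~= 0. ==> b : carrier R ==> a$(inv a$b) = b"
 "a : carrier R ==> a ~= 0. ==> b : carrier R ==> inv a$(a$b) = b"
 by (simp_all flip: m_assoc)

lemma pow_nonzero [simp]: "a : carrier R ==> a ~= 0. ==> a [^] (n::nat) ~= 0."
 by (induct n) simp_all

lemma sf_facts:
 assumes "subfield K R"
 shows "subring K R" and "!!a. a : K ==> a : carrier R"
 and "!!a. a : K ==> a ~= 0. ==> inv a : K"
 using assms subfieldE(1,3) subfield_m_inv(1) subfield.axioms subdomainE subcringE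
 by (blast intro: subfieldE)+

lemma subfieldI_inv:
 assumes "subring K R" "!!a. a : K ==> a ~= 0. ==> inv a : K"
 shows "subfield K R"
 using assms by (intro subfieldI') auto

text \<open>An inverse in a subring is the inverse in the field. Being a unit thus becomes a
  question of membership, which allows units of different subrings to be compared.\<close>

lemma Units_sub_iff:
 assumes V: "subring V R"
 shows "a : Units (R(|carrier := V|)) \<longleftrightarrow> a : V & a ~= 0. & inv a : V"
proof
 assume "a : Units (R(|carrier := V|))"
 then obtain b where b: "a : V" "b : V" "a$b = 1." by (auto simp: Units_def)
 then have "inv a = b" using subcarr[OF V] by (intro inv_unique_field) auto
 then show "a : V & a ~= 0. & inv a : V" using b subcarr[OF V] by auto
next
 assume "a : V & a ~= 0. & inv a : V"
 then show "a : Units (R(|carrier := V|))"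
 using subcarr[OF V] by (auto simp: Units_def intro!: bexI[of _ "inv a"])
qed

lemma nonunits_iff:
 "subring V R ==> a : nonunits R V \<longleftrightarrow> a : V & (a = 0. \<or> inv a ~: V)"
 by (auto simp: nonunits_def Units_sub_iff)

lemma nonunits_mult:
 assumes V: "subring V R" and a: "a : nonunits R V" and b: "b : V"
 shows "a$b : nonunits R V"
proof -
 note c = subcarr[OF V] and n = nonunits_iff[OF V] and s = subcl[OF V]
 have "inv (a$b) ~: V" if "a$b ~= 0."
 proof
 assume i: "inv (a$b) : V"
 have nz: "a ~= 0." "b ~= 0." and ab: "a : carrier R" "b : carrier R"
 using that a b c n by auto
 then have "inv a = b$inv (a$b)" by (simp add: inv_mult_distrib m_lcomm[of b])
 then have "inv a : V" using s b i by simp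
 then show False using a n nz by auto
 qed
 then show ?thesis using a b s n by auto
qed

lemma nonunits_neg:
 assumes V: "subring V R" and a: "a : nonunits R V"
 shows "-. a : nonunits R V"
proof -
 have "a : carrier R" using a subcarr[OF V] nonunits_iff[OF V] by auto
 then have "a$( -. 1.) =-.a" by (simp add: r_minus)
 then show ?thesis using nonunits_mult[OF V a, of "-. 1."] subcl[OF V] by simp
qed

lemma zero_nonunit: "subring V R ==> 0. : nonunits R V"
 by (simp add: nonunits_iff subcl)

lemma one_unit: "subring V R ==> 1. ~: nonunits R V"
 by (simp add: nonunits_iff subcl)

lemma lsubD:
 assumes "local_subring R V"
 shows "subring V R" "!!a b. a : nonunits R V ==> b : nonunits R V ==> a+.b : nonunits R V"
 "!!a b. a : nonunits R V ==> b : nonunits R V ==> a-.b : nonunits R V"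
 using assms nonunits_neg by (auto simp: local_subring_def minus_eq)

lemma unit_add_nonunit:
 assumes V: "local_subring R V" and a: "a : V" "a ~: nonunits R V" and b: "b : nonunits R V"
 shows "a+.b : V" "a+.b ~: nonunits R V"
proof -
 note s = lsubD[OF V]
 have c: "a : carrier R" "b : carrier R" "b : V"
 using a b nonunits_iff[OF s(1)] subcarr[OF s(1)] by auto
 then show "a+.b : V" using a subcl[OF s(1)] by auto
 show "a+.b ~: nonunits R V"
 proof
 assume "a+.b : nonunits R V"
 then have "(a+.b)-.b : nonunits R V" using s(3) b by blast
 moreover have "(a+.b)-.b = a" using c by (simp add: minus_eq a_assoc r_neg)
 ultimately show False using a by simp
 qed
qed

lemma unit_mult:
 assumes V: "subring V R" and a: "a : V" "a ~: nonunits R V" and b: "b : V" "b ~: nonunits R V"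
 shows "a$b : V" "a$b ~: nonunits R V"
proof -
 have c: "a : carrier R" "b : carrier R" "a ~= 0." "b ~= 0." "inv a : V" "inv b : V"
 using a b nonunits_iff[OF V] subcarr[OF V] by auto
 then show "a$b : V" "a$b ~: nonunits R V"
 using a b nonunits_iff[OF V] subcl[OF V] by (auto simp: inv_mult_distrib)
qed

lemma unit_inv:
 assumes V: "subring V R" and a: "a : V" "a ~: nonunits R V"
 shows "a ~= 0." "inv a : V" "inv a ~: nonunits R V"
 using a nonunits_iff[OF V] subcarr[OF V] by auto

lemma valuation_ringD:
 assumes "valuation_ring R E V"
 shows "subring V R" "V <= E" "!!a. a : E ==> a ~: V ==> inv a : nonunits R V"
 "!!a. a : E ==> a ~= 0. ==> a : V \<or> inv a : V" "E <= carrier R"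
proof -
 show s: "subring V R" "V <= E" "!!a. a : E ==> a ~= 0. ==> a : V \<or> inv a : V"
 "E <= carrier R"
 using assms by (auto simp: valuation_ring_def)
 fix a assume a: "a : E" "a ~: V"
 moreover have "a ~= 0." using a subcl[OF s(1)] by auto
 ultimately show "inv a : nonunits R V" using s nonunits_iff[OF s(1)] by auto
qed

text \<open>Of b/a and a/b one is integral, so the sum of two nonzero nonunits is an integral
  multiple of one of them.\<close>

lemma valuation_ring_local:
 assumes "valuation_ring R E V" and E: "subfield E R"
 shows "local_subring R V"
proof -
 note v = valuation_ringD[OF assms(1)] note s = subcl[OF v(1)]
 note c = subcarr[OF v(1)] note n = nonunits_iff[OF v(1)]
 have *: "a+.b : nonunits R V"
 if a: "a : nonunits R V" and b: "b : nonunits R V" and ab: "a ~= 0." "inv a$b : V" for a b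
 proof -
 have "a$( 1.+.inv a$b) = a+.b"
 using a b ab c n by (simp add: r_distr)
 moreover have "1.+.inv a$b : V" using ab s by auto
 ultimately show ?thesis using nonunits_mult[OF v(1) a] by metis
 qed
 have "a+.b : nonunits R V" if a: "a : nonunits R V" and b: "b : nonunits R V" for a b
 proof (cases "a = 0. \<or> b = 0.")
 case True
 have "a : carrier R" "b : carrier R" using a b c n by blast+
 then show ?thesis using True a b by auto
 next
 case False
 have abV: "a : V" "b : V" using a b n by blast+
 have ab: "a : carrier R" "b : carrier R" using abV c by blast+
 have "a : E" "b : E" using abV v(2) by blast+
 then have "inv a$b : E"
 using False sf_facts(3)[OF E] subcl(4)[OF sf_facts(1)[OF E]] by simp
 moreover have "inv (inv a$b) = inv b$a" using ab False by (simp add: inv_mult_distrib m_comm)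
 ultimately consider "inv a$b : V" | "inv b$a : V"
 using v(4)[of "inv a$b"] False ab by auto
 then show ?thesis
 using *[OF a b] *[OF b a] False ab by cases (auto simp: a_comm)
 qed
 then show ?thesis using v(1) by (auto simp: local_subring_def)
qed

text \<open>Valuation rings are maximal for domination: an element of \<open>T\<close> outside
  \<open>V\<close> has its inverse among the nonunits of \<open>V\<close>, hence among those of
  \<open>T\<close>, although it is invertible in \<open>T\<close>.\<close>

lemma dominating_eq:
 assumes V: "valuation_ring R E V" and T: "subring T R" "T <= E" "V <= T" "nonunits R V <= nonunits R T"
 shows "T = V"
proof -
 note v = valuation_ringD[OF V]
 have "a : V" if "a : T" for a
 proof (rule ccontr)
 assume a: "a ~: V"
 then have "inv a : nonunits R T" using v(3)[of a] that T by auto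
 moreover have "a ~= 0." using a subcl[OF v(1)] by auto
 ultimately show False using that nonunits_iff[OF T(1)] subcarr[OF T(1) that] by auto
 qed
 then show ?thesis using T by auto
qed

lemma subfield_unit:
 assumes k: "subfield k R" "k <= V" and V: "subring V R" and c: "c : k" "c ~= 0."
 shows "c : V" "c ~: nonunits R V"
 using sf_facts[OF k(1)] c k(2) nonunits_iff[OF V] by auto

text \<open>With common residue field \<open>k\<close>, inclusion already is domination. A nonunit
  \<open>a\<close> of \<open>V\<close> is congruent in \<open>T\<close> to some constant
  \<open>c\<close>; for nonzero \<open>c\<close> the difference \<open>a-.c\<close> would be a unit
  of \<open>V\<close>, hence of \<open>T\<close>.\<close>

lemma rational_over_nonunits:
 assumes k: "subfield k R" and V: "local_subring R V" "rational_over R k V"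
 and T: "local_subring R T" "rational_over R k T" and VT: "V <= T"
 shows "nonunits R V <= nonunits R T"
proof
 fix a assume a: "a : nonunits R V"
 note v = lsubD[OF V(1)] note t = lsubD[OF T(1)]
 have aV: "a : V" "a : T" "a : carrier R"
 using a VT nonunits_iff[OF v(1)] subcarr[OF v(1)] by auto
 then obtain c where c: "c : k" "a-.c : nonunits R T"
 using T(2) unfolding rational_over_def by blast
 have cc: "c : carrier R" using sf_facts(2)[OF k c(1)] .
 have ac: "a-.c =-.c+.a" using aV cc by (simp add: minus_eq a_comm)
 have "c = 0."
 proof (rule ccontr)
 assume "c ~= 0."
 have kV: "k <= V" using V(2) by (simp add: rational_over_def)
 have "-. c : k" "-. c ~= 0."
 using subcl(5)[OF sf_facts(1)[OF k]] c \<open>c \<noteq> \<zero>\<close> cc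
 by (auto simp: subringE(5)[OF sf_facts(1)[OF k]])
 then have "-. c : V" "-. c ~: nonunits R V" using subfield_unit[OF k kV v(1)] by auto
 then have "a-.c : V" "a-.c ~: nonunits R V"
 using unit_add_nonunit[OF V(1) _ _ a] ac by auto
 then have "a-.c ~= 0." "inv (a-.c) : T" using unit_inv[OF v(1)] VT by auto
 then show False using c(2) nonunits_iff[OF t(1)] by auto
 qed
 then show "a : nonunits R T" using c(2) aV by (simp add: minus_eq)
qed

lemma prime_in_iff:
 assumes A: "subring A R"
 shows "prime_in R A I \<longleftrightarrow> primeideal I (R(|carrier := A|))"
proof -
 interpret A: domain "R(|carrier := A|)" using subring_is_domain[OF A] .
 show ?thesis
 proof
 assume p: "prime_in R A I"
 show "primeideal I (R(|carrier := A|))"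
 proof (rule primeidealI)
 show "ideal I (R(|carrier := A|))"
 proof (rule idealI)
 show "ring (R(|carrier := A|))" by (rule A.ring_axioms)
 show "subgroup I (add_monoid (R(|carrier := A|)))"
 proof (rule A.add.subgroupI)
 fix a assume a: "a : I"
 then have aA: "a : A" "a : carrier R" using p subcarr[OF A] by (auto simp: prime_in_def)
 have "( -. 1.)$a : I" using p a subcl[OF A] by (auto simp: prime_in_def)
 then have "-. a : I" using aA by (simp add: l_minus)
 moreover have "-.\<^bsub>R(|carrier := A|)\<^esub> a =-.a"
 using aA subcl[OF A] by (intro A.minus_equality) (auto simp: l_neg)
 ultimately show "-.\<^bsub>R(|carrier := A|)\<^esub> a : I" by simp
 qed (use p in \<open>auto simp: prime_in_def\<close>)
 next
 fix a x assume "a : I" "x : carrier (R(|carrier := A|))"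
 then show "x $\<^bsub>R(|carrier := A|)\<^esub> a : I" "a $\<^bsub>R(|carrier := A|)\<^esub> x : I"
 using p subcarr[OF A] m_comm[of a x] by (auto simp: prime_in_def subset_iff)
 qed
 qed (use p A.cring_axioms subcl[OF A] in \<open>auto simp: prime_in_def\<close>)
 next
 assume "primeideal I (R(|carrier := A|))"
 then interpret I: primeideal I "R(|carrier := A|)" .
 show "prime_in R A I"
 using I.a_subset I.I_prime I.I_notcarr I.one_imp_carrier I.I_l_closed
 I.a_closed I.additive_subgroup_axioms additive_subgroup.zero_closed[OF I.additive_subgroup_axioms]
 by (auto simp: prime_in_def)
 qed
qed

lemma subset_localization:
 assumes A: "subring A R" and I: "prime_in R A I" and a: "a : A"
 shows "a : localization R A I"
proof -
 have "a = a$inv 1." using subcarr[OF A a] by simp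
 moreover have "1. : A - I" using I subcl[OF A] by (auto simp: prime_in_def)
 ultimately show ?thesis unfolding localization_def using a by blast
qed

lemma fraction_add:
 assumes "a : carrier R" "b : carrier R" "s : carrier R" "t : carrier R" "s ~= 0." "t ~= 0."
 shows "a$inv s+.b$inv t = (a$t+.b$s)$inv (s$t)"
proof -
 have "(a$t+.b$s)$(inv s$inv t) = a$inv s$(t$inv t)+.b$inv t$(s$inv s)"
 by (reify rsimps, rule ring_id, simp add: assms, simp, code_simp)
 then show ?thesis using assms by (simp add: inv_mult_distrib)
qed

lemma fraction_mult:
 assumes "a : carrier R" "b : carrier R" "s : carrier R" "t : carrier R" "s ~= 0." "t ~= 0."
 shows "(a$inv s)$(b$inv t) = (a$b)$inv (s$t)"
 using assms by (simp add: inv_mult_distrib m_ac)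

lemma fraction_inv:
 assumes "a : carrier R" "s : carrier R" "s ~= 0." "a ~= 0."
 shows "inv (a$inv s) = s$inv a"
 using assms by (simp add: inv_mult_distrib m_ac)

lemma fraction_eq_iff:
 assumes "a : carrier R" "b : carrier R" "s : carrier R" "t : carrier R" "s ~= 0." "t ~= 0."
 shows "a$inv s = b$inv t \<longleftrightarrow> a$t = b$s"
proof
 assume "a$inv s = b$inv t"
 then have "(a$inv s)$(s$t) = (b$inv t)$(s$t)" by simp
 moreover have "(a$inv s)$(s$t) = a$t$(inv s$s)"
 "(b$inv t)$(s$t) = b$s$(inv t$t)"
 by ((reify rsimps, rule ring_id, simp add: assms, simp, code_simp)+)
 ultimately show "a$t = b$s" using assms by simp
next
 assume "a$t = b$s"
 then have "a$t$(inv s$inv t) = b$s$(inv s$inv t)" by simp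
 moreover have "a$t$(inv s$inv t) = a$inv s$(t$inv t)"
 "b$s$(inv s$inv t) = b$inv t$(s$inv s)"
 by ((reify rsimps, rule ring_id, simp add: assms, simp, code_simp)+)
 ultimately show "a$inv s = b$inv t" using assms by simp
qed

lemma localization_facts:
 assumes A: "subring A R" and I: "prime_in R A I"
 shows "local_subring R (localization R A I)"
 and "nonunits R (localization R A I) = {a$inv s | a s. a : I & s : A - I}"
 and "A \<inter> nonunits R (localization R A I) = I"
proof -
 let ?L = "localization R A I"
 note cl = subcl[OF A] subcarr[OF A]
 have pr: "I <= A" "0. : I" "1. ~: I" "!!a b. a : I ==> b : I ==> a+.b : I"
 "!!a b. a : A ==> b : I ==> a$b : I"
 "!!a b. a : A ==> b : A ==> a$b : I ==> a : I \<or> b : I"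
 using I by (auto simp: prime_in_def)
 have LI: "a$inv s : ?L" if "a : A" "s : A - I" for a s
 using that by (auto simp: localization_def)
 have LE: "\<exists>a s. z = a$inv s & a : A & s : A & s ~: I & a : carrier R & s : carrier R & s ~= 0."
 if z: "z : ?L" for z
 proof -
 obtain a s where "z = a$inv s" "a : A" "s : A" "s ~: I"
 using z unfolding localization_def by blast
 moreover from this have "a : carrier R" "s : carrier R" "s ~= 0."
 using pr(2) subcarr[OF A] by blast+
 ultimately show ?thesis by blast
 qed
 have sL: "subring ?L R"
 proof (rule subringI)
 show "?L <= carrier R"
 proof
 fix z assume "z : ?L"
 from LE[OF this] show "z : carrier R" by auto
 qed
 show "1. : ?L" using subset_localization[OF A I] cl by blast
 fix z assume "z : ?L"
 then obtain a s where z: "z = a$inv s" "a : A" "s : A" "s ~: I" "a : carrier R" "s : carrier R" "s ~= 0."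
 using LE by blast
 have "-. z = ( -. a)$inv s" using z by (simp add: l_minus)
 then show "-. z : ?L" using LI[of "-. a" s] z cl(3)[of a] by simp
 fix w assume "w : ?L"
 then obtain b t where w: "w = b$inv t" "b : A" "t : A" "t ~: I" "b : carrier R" "t : carrier R" "t ~= 0."
 using LE by blast
 have st: "s$t : A - I" using pr(6)[of s t] z w cl(4)[of s t] by blast
 show "z$w : ?L" using LI[OF cl(4) st, of a b] fraction_mult[of a b s t] z w by simp
 show "z+.w : ?L"
 using LI[OF cl(5)[OF cl(4) cl(4)] st, of a t b s] fraction_add[of a b s t] z w by simp
 qed
 have N: "a$inv s : nonunits R ?L \<longleftrightarrow> a : I" if as: "a : A" "s : A - I" for a s
 proof -
 have c: "a : carrier R" "s : carrier R" "s ~= 0."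
 using as pr(2) subcarr[OF A] by auto
 show ?thesis
 proof (cases "a : I")
 case True
 have False if nz: "a ~= 0." and "inv (a$inv s) : ?L"
 proof -
 from LE[OF that(2)] obtain b t where b: "s$inv a = b$inv t" "b : A" "t : A" "t ~: I"
 "b : carrier R" "t : carrier R" "t ~= 0." using fraction_inv[OF c nz] by auto
 then have "s$t = b$a" using fraction_eq_iff[of s b a t] c nz by auto
 then show False using pr(5)[of b a] pr(6)[of s t] b as True by auto
 qed
 then have "a$inv s = 0. \<or> inv (a$inv s) ~: ?L" using c by auto
 then show ?thesis using True nonunits_iff[OF sL, of "a$inv s"] LI[OF as] by blast
 next
 case False
 then have a0: "a ~= 0." using pr(2) by auto
 have "inv (a$inv s) : ?L" "a$inv s ~= 0."
 using fraction_inv[OF c a0] LI[of s a] False as a0 c by auto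
 then show ?thesis using False nonunits_iff[OF sL] by blast
 qed
 qed
 show NE: "nonunits R ?L = {a$inv s | a s. a : I & s : A - I}" (is "_ = ?N")
 proof
 show "nonunits R ?L <= ?N"
 proof
 fix z assume z: "z : nonunits R ?L"
 then have "z : ?L" using nonunits_iff[OF sL] by blast
 then obtain a s where "z = a$inv s" "a : A" "s : A - I" unfolding localization_def by blast
 then show "z : ?N" using N z by auto
 qed
 show "?N <= nonunits R ?L" using N pr(1) by auto
 qed
 show "A \<inter> nonunits R ?L = I"
 proof -
 have "a : nonunits R ?L \<longleftrightarrow> a : I" if "a : A" for a
 using N[of a \<one>] that pr(3) cl(2) subcarr[OF A that] by simp
 then show ?thesis using pr(1) by blast
 qed
 have "z+.w : nonunits R ?L" if zw: "z : nonunits R ?L" "w : nonunits R ?L" for z w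
 proof -
 obtain a s b t where *: "z = a$inv s" "w = b$inv t" "a : I" "b : I" "s : A - I" "t : A - I"
 using zw unfolding NE by blast
 have **: "a : A" "b : A" "s : A" "t : A" "s ~= 0." "t ~= 0." using * pr(1,2) by auto
 have ***: "a : carrier R" "b : carrier R" "s : carrier R" "t : carrier R"
 using ** subcarr[OF A] by blast+
 have st: "s$t : A - I" using pr(6)[of s t] *(5,6) cl(4)[of s t] by blast
 have "t$a+.s$b : I" using pr(4)[OF pr(5) pr(5)] * ** by blast
 then have "a$t+.b$s : I" using *** by (simp add: m_comm)
 then show ?thesis unfolding NE using *(1,2) st fraction_add[of a b s t] ** *** by blast
 qed
 then show "local_subring R ?L" using sL by (auto simp: local_subring_def)
qed

text \<open>Universal property: a local ring over \<open>A\<close> inverts everything outside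
  \<open>I\<close> as soon as its center on \<open>A\<close> lies in \<open>I\<close>.\<close>

lemma localization_least:
 assumes A: "subring A R" and I: "prime_in R A I" and T: "local_subring R T" "A <= T"
 "A \<inter> nonunits R T <= I"
 shows "localization R A I <= T"
 and "I <= nonunits R T ==> nonunits R (localization R A I) <= nonunits R T"
proof -
 note t = lsubD[OF T(1)]
 have u: "inv s : T" if "s : A - I" for s
 using that T unit_inv(2)[OF t(1), of s] by auto
 then show "localization R A I <= T"
 using T(2) subcl(4)[OF t(1)] unfolding localization_def by blast
 assume "I <= nonunits R T"
 then show "nonunits R (localization R A I) <= nonunits R T"
 using u nonunits_mult[OF t(1)] unfolding localization_facts(2)[OF A I] by blast
qed

lemma prime_in_center:
 assumes A: "subring A R" and T: "local_subring R T" "A <= T"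
 shows "prime_in R A (A \<inter> nonunits R T)"
proof -
 note t = lsubD[OF T(1)]
 have "a : nonunits R T \<or> b : nonunits R T"
 if "a : A" "b : A" "a$b : nonunits R T" for a b
 using unit_mult(2)[OF t(1), of a b] that T(2) by blast
 moreover have "a$b : nonunits R T" if "a : A" "b : A" "b : nonunits R T" for a b
 using nonunits_mult[OF t(1) that(3), of a] that T(2) m_comm[of a b] subcarr[OF A] by auto
 ultimately show ?thesis
 using t(2) subcl(1,2,4,5)[OF A] zero_nonunit[OF t(1)] one_unit[OF t(1)]
 by (auto simp: prime_in_def)
qed

text \<open>If A = k + I, then I is maximal with residue field k. For a product ab in I with a
  congruent to a nonzero constant c, the element b = (ab - b(a - c))/c lies in I. Fractions inherit
  the residues c/d of their numerators and denominators.\<close>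

lemma rational_prime:
 assumes A: "subring A R" and k: "subfield k R" "k <= A"
 and I: "I <= A" "0. : I" "1. ~: I" "!!a b. a : I ==> b : I ==> a+.b : I"
 "!!a b. a : A ==> b : I ==> a$b : I"
 and r: "!!a. a : A ==> \<exists>c\<in>k. a-.c : I"
 shows "prime_in R A I" "rational_over R k (localization R A I)"
proof -
 note cl = subcl[OF A] subcarr[OF A] note kf = sf_facts[OF k(1)]
 have kI: "c = 0." if "c : k" "c : I" for c
 proof (rule ccontr)
 assume "c ~= 0."
 then have "inv c$c : I" using I(5) kf(3)[OF that(1)] k(2) that by blast
 then show False using I(3) \<open>c \<noteq> \<zero>\<close> kf(2)[OF that(1)] by simp
 qed
 have "a : I \<or> b : I" if ab: "a : A" "b : A" "a$b : I" for a b
 proof (rule ccontr)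
 assume n: "~ (a : I \<or> b : I)"
 obtain c where c: "c : k" "a-.c : I" using r ab by blast
 have cc: "c : carrier R" "a : carrier R" "b : carrier R"
 using kf(2)[OF c(1)] ab subcarr[OF A] by blast+
 have "c ~= 0." using c(2) n cc by (auto simp: minus_eq)
 note cc = cc this
 have "b = inv c$(a$b+.( -. b)$(a-.c))"
 proof -
 have "a$b+.( -. b)$(a-.c) = c$b"
 by (reify rsimps, rule ring_id, simp add: cc, simp, code_simp)
 then show ?thesis using cc by simp
 qed
 moreover have "inv c$(a$b+.( -. b)$(a-.c)) : I"
 proof -
 have "inv c : A" "-. b : A"
 using k(2) kf(3)[OF c(1) cc(4)] ab(2) subcl(3)[OF A] by auto
 then show ?thesis using I(5)[OF _ I(4)[OF ab(3) I(5)[OF _ c(2)]]] by blast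
 qed
 ultimately show False using n by simp
 qed
 then show p: "prime_in R A I" using I by (auto simp: prime_in_def)
 note L = localization_facts[OF A p]
 show "rational_over R k (localization R A I)"
 unfolding rational_over_def
 proof (intro conjI ballI)
 show "k <= localization R A I" using k subset_localization[OF A p] by auto
 fix z assume "z : localization R A I"
 then obtain a s where z: "z = a$inv s" "a : A" "s : A" "s ~: I" by (auto simp: localization_def)
 obtain c d where c: "c : k" "a-.c : I" and d: "d : k" "s-.d : I" using r z by meson
 have cc: "c : carrier R" "a : carrier R" "d : carrier R" "s : carrier R"
 using kf(2)[OF c(1)] kf(2)[OF d(1)] z subcarr[OF A] by blast+
 have "d ~= 0." "s ~= 0." using z(4) I(2) d(2) cc by (auto simp: minus_eq)
 note cc = cc this
 have "z-.c$inv d = ((a-.c)-.(c$inv d)$(s-.d))$inv s"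
 proof -
 have "((a-.c)-.(c$inv d)$(s-.d))$inv s =
 a$inv s-.c$inv d$(s$inv s)+.c$inv s$((d$inv d)-.1.)"
 by (reify rsimps, rule ring_id, simp add: cc, simp, code_simp)
 then show ?thesis using cc z by (simp add: minus_eq r_neg)
 qed
 moreover have "(a-.c)-.(c$inv d)$(s-.d) : I"
 proof -
 have "(a-.c)-.(c$inv d)$(s-.d) = (a-.c)+.( -. c$inv d)$(s-.d)"
 by (reify rsimps, rule ring_id, simp add: cc, simp, code_simp)
 moreover have "-. c$inv d : A"
 using cl(4)[OF cl(3), of c "inv d"] k(2) c(1) kf(3)[OF d(1) cc(5)] by blast
 ultimately show ?thesis using I(4)[OF c(2) I(5)[OF _ d(2)]] by simp
 qed
 ultimately have "z-.c$inv d : nonunits R (localization R A I)"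
 using L(2) z by blast
 moreover have "c$inv d : k" using kf(3)[OF d(1)] c(1) cc subcl(4)[OF kf(1)] by simp
 ultimately show "\<exists>c\<in>k. z-.c : nonunits R (localization R A I)" by blast
 qed
qed

end

section \<open>Polynomials in one element, the field k(x) and its valuation rings\<close>

context field

begin

lemma eval_Cons: "eval (a # p) x = a$x [^] length p+.eval p x"
 by simp

declare eval.simps(2) [simp del]

lemma eval_closed [simp]: "set p <= carrier R ==> x : carrier R ==> eval p x : carrier R"
 by (rule eval_in_carrier)

lemma eval_in_subring:
 assumes V: "subring V R" and x: "x : V" and p: "set p <= V"
 shows "eval p x : V"
 using p
proof (induct p)
 case Nil then show ?case using subcl(1)[OF V] by simp
next
 case (Cons a p)
 then show ?case
 using subcl(5)[OF V subcl(4)[OF V _ subcl(7)[OF V x]]]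
 by (simp add: eval_Cons)
qed

lemma eval_snoc: "set p <= carrier R ==> b : carrier R ==> x : carrier R ==>
 eval (p @ [b]) x = eval p x$x+.b"
 by (rule eval_append_aux)

lemma eval_zero_prefix: "set p <= carrier R ==> x : carrier R ==> eval ( 0. # p) x = eval p x"
 by (simp add: eval_Cons)

lemma eval_zeros: "set p <= {0.} ==> x : carrier R ==> eval p x = 0."
 by (induct p) (auto simp: eval_Cons)

lemma eval_map_mult:
 assumes "c : carrier R" "x : carrier R" "set p <= carrier R"
 shows "eval (map (%a. c$a) p) x = c$eval p x"
 using assms(3) by (induct p) (use assms in \<open>auto simp: eval_Cons r_distr m_assoc\<close>)

lemma eval_map2_minus:
 assumes "d : carrier R" "x : carrier R" "set p <= carrier R" "set q <= carrier R" "length p = length q"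
 shows "eval (map2 (%s t. s-.d$t) p q) x = eval p x-.d$eval q x"
 using assms(5,3,4)
proof (induct p q rule: list_induct2)
 case Nil then show ?case using assms by (simp add: minus_eq)
next
 case (Cons a p b q)
 have c: "a : carrier R" "b : carrier R" "set p <= carrier R" "set q <= carrier R"
 "x [^] length q : carrier R" "eval p x : carrier R" "eval q x : carrier R"
 using Cons assms by auto
 have IH: "eval (map2 (%s t. s-.d$t) p q) x = eval p x-.d$eval q x" using Cons c by simp
 have "eval (map2 (%s t. s-.d$t) (a # p) (b # q)) x =
 (a-.d$b)$x [^] length q+.(eval p x-.d$eval q x)"
 using IH Cons(1) by (simp add: eval_Cons)
 also have "... = (a$x [^] length q+.eval p x)-.d$(b$x [^] length q+.eval q x)"
 by (reify rsimps, rule ring_id, simp add: c assms(1), simp, code_simp)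
 finally show ?case using Cons(1) by (simp add: eval_Cons)
qed

lemma set_map2_minus:
 assumes "subring V R" "d : V" "set p <= V" "set q <= V"
 shows "set (map2 (%s t. s-.d$t) p q) <= V"
proof
 fix z assume "z : set (map2 (%s t. s-.d$t) p q)"
 then obtain s t where "z = s-.d$t" "s : set p" "t : set q"
 by (auto dest: set_zip_leftD set_zip_rightD)
 then show "z : V"
 using assms(3,4) subcl(6)[OF assms(1) _ subcl(4)[OF assms(1,2)], of s t] by blast
qed

text \<open>Coefficient lists may start with zeros here, unlike members of \<open>k[X]\<close>, so
  that lists can be padded and combined without renormalizing.\<close>

lemma transcendental_iff:
 assumes k: "subring k R" and x: "x : carrier R"
 shows "transcendental k x \<longleftrightarrow> (\<forall>p. set p <= k --> eval p x = 0. --> set p <= {0.})"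
proof
 assume t: "transcendental k x"
 show "\<forall>p. set p <= k --> eval p x = 0. --> set p <= {0.}"
 proof (intro allI impI)
 fix p assume p: "set p <= k" "eval p x = 0."
 then have "eval p x = 0. ==> set p <= k ==> set p <= {0.}"
 proof (induct p)
 case (Cons a p)
 show ?case
 proof (cases "a = 0.")
 case True
 have "set p <= carrier R" using Cons(3) subringE(1)[OF k] by auto
 then have "eval p x = 0." using Cons(2) True x by (simp add: eval_zero_prefix)
 then show ?thesis using Cons True by auto
 next
 case False
 then have "polynomial k (a # p)" using Cons by (intro polynomialI) auto
 then have "a # p : carrier (k[X])" by (simp add: univ_poly_carrier)
 then have "a # p = []"
 using eval_transcendental[of k x "a # p"] t Cons(2) by (simp add: over_def)
 then show ?thesis by simp
 qed
 qed simp
 then show "set p <= {0.}" using p by blast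
 qed
next
 assume h: "\<forall>p. set p <= k --> eval p x = 0. --> set p <= {0.}"
 have "p = []" if "p : carrier (k[X])" "eval p x = 0." for p
 proof -
 have P: "polynomial k p" using that by (simp add: univ_poly_carrier)
 then have "set p <= {0.}" using h that polynomial_incl[OF P] by blast
 then show ?thesis using P by (cases p) (auto simp: polynomial_def)
 qed
 then have "a_kernel (k[X]) R (%p. eval p x) <= {[]}" unfolding a_kernel_def' by auto
 moreover have "[] : a_kernel (k[X]) R (%p. eval p x)"
 unfolding a_kernel_def' by (auto simp: univ_poly_def)
 ultimately show "transcendental k x"
 using trivial_ker_imp_transcendental[OF k x] by (auto simp: over_def)
qed

lemma polys_iff:
 assumes k: "subring k R" and x: "x : carrier R"
 shows "z : simple_extension k x \<longleftrightarrow> (\<exists>p. set p <= k & z = eval p x)"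
proof
 assume "z : simple_extension k x"
 then show "\<exists>p. set p <= k & z = eval p x"
 proof induct
 case zero show ?case by (rule exI[of _ "[]"]) simp
 next
 case (lin k1 k2)
 then obtain p where p: "set p <= k" "k1 = eval p x" by blast
 moreover have "set p <= carrier R" "k2 : carrier R" using p lin subringE(1)[OF k] by auto
 ultimately show ?case using lin(3) x by (intro exI[of _ "p @ [k2]"]) (simp add: eval_snoc)
 qed
next
 assume "\<exists>p. set p <= k & z = eval p x"
 then obtain p where p: "set p <= k" "z = eval p x" by blast
 have "set p <= k ==> eval p x : simple_extension k x"
 proof (induct p rule: rev_induct)
 case (snoc a p)
 then have "set p <= carrier R" "a : carrier R" using subringE(1)[OF k] by auto
 then show ?case using snoc x by (simp add: eval_snoc simple_extension.lin)
 qed simp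
 then show "z : simple_extension k x" using p by blast
qed

lemma polys_subring:
 assumes "subring k R" "x : carrier R"
 shows "subring (simple_extension k x) R" "k <= simple_extension k x" "x : simple_extension k x"
 using simple_extension_is_subring[OF assms] simple_extension_mem[OF assms]
 simple_extension_incl[OF subringE(1)[OF assms(1)] assms(2)] by auto

lemma zero_prime: "subring A R ==> prime_in R A {0.}"
 using subcl(1) subcarr by (auto simp: prime_in_def)

lemma fractions_subfield:
 assumes A: "subring A R"
 shows "subfield (localization R A {0.}) R"
proof -
 note L = localization_facts[OF A zero_prime[OF A]]
 note s = lsubD(1)[OF L(1)]
 have "nonunits R (localization R A {0.}) <= {0.}"
 unfolding L(2) using subcarr[OF A] by auto
 then show ?thesis using nonunits_iff[OF s] by (intro subfieldI_inv[OF s]) auto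
qed

lemma generate_field_eq_fractions:
 assumes A: "subring A R" and H: "H <= A" "!!B. subring B R ==> H <= B ==> A <= B"
 shows "generate_field R H = localization R A {0.}"
proof
 have Hc: "H <= carrier R" using H(1) subringE(1)[OF A] by blast
 have "A <= localization R A {0.}" using subset_localization[OF A zero_prime[OF A]] by blast
 then show "generate_field R H <= localization R A {0.}"
 using H(1) by (intro generate_field_min_subfield1[OF Hc fractions_subfield[OF A]]) blast
 let ?G = "generate_field R H"
 have G: "subfield ?G R" by (rule generate_field_is_subfield[OF Hc])
 note g = sf_facts[OF G]
 have "H <= ?G" by (auto intro: generate_field.incl)
 then have AG: "A <= ?G" by (rule H(2)[OF g(1)])
 show "localization R A {0.} <= ?G"
 proof
 fix z assume "z : localization R A {0.}"
 then obtain a s where z: "z = a$inv s" "a : A" "s : A" "s ~= 0."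
 unfolding localization_def by blast
 have "a : ?G" "inv s : ?G" using AG z g(3)[of s] by auto
 then show "z : ?G" unfolding z(1) by (rule subcl(4)[OF g(1)])
 qed
qed

text \<open>The field k(x) as the fractions of k[x], for which \<open>simple_extension k x\<close>
  stands also when \<open>x\<close> is transcendental.\<close>

definition funfield :: "'a set => 'a => 'a set" where
 "funfield k x = localization R (simple_extension k x) {0.}"

lemma generate_field_insert:
 assumes k: "subring k R" and x: "x : carrier R"
 shows "generate_field R (insert x k) = funfield k x"
 unfolding funfield_def
proof (rule generate_field_eq_fractions)
 show "subring (simple_extension k x) R" "insert x k <= simple_extension k x"
 using polys_subring[OF k x] by auto
 show "simple_extension k x <= B" if "subring B R" "insert x k <= B" for B
 using simple_extension_subring_incl[OF that(1), of k x] that(2) by auto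
qed

lemma funfield_facts:
 assumes k: "subring k R" and x: "x : carrier R"
 shows "subfield (funfield k x) R" "simple_extension k x <= funfield k x" "k <= funfield k x" "x : funfield k x"
 "!!z. z : funfield k x ==> \<exists>u w. u : simple_extension k x & w : simple_extension k x & w ~= 0. & z = u$inv w"
 "!!E. subfield E R ==> k <= E ==> x : E ==> funfield k x <= E"
proof -
 note p = polys_subring[OF k x]
 show "subfield (funfield k x) R" unfolding funfield_def by (rule fractions_subfield[OF p(1)])
 show s: "simple_extension k x <= funfield k x"
 unfolding funfield_def using subset_localization[OF p(1) zero_prime[OF p(1)]] by blast
 show "k <= funfield k x" "x : funfield k x" using s p by auto
 show "!!z. z : funfield k x ==> \<exists>u w. u : simple_extension k x & w : simple_extension k x & w ~= 0. & z = u$inv w"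
 unfolding funfield_def localization_def by blast
 fix E assume E: "subfield E R" "k <= E" "x : E"
 have "insert x k <= carrier R" using subringE(1)[OF k] x by auto
 then show "funfield k x <= E"
 using generate_field_min_subfield1[of "insert x k" E] E generate_field_insert[OF k x] by auto
qed

text \<open>Long division. The remainder is padded to exactly \<open>length bs\<close> coefficients,
  so that the subtraction of a multiple of the divisor is a plain \<open>map2\<close>.\<close>

lemma poly_division:
 assumes k: "subfield k R" and x: "x : carrier R"
 and b: "b : k" "b ~= 0." and bs: "set bs <= k" and p: "set p <= k"
 shows "\<exists>q r. set q <= k & set r <= k & length r = length bs & length q <= length p - length bs &
 eval p x = eval q x$eval (b # bs) x+.eval r x"
 using p
proof (induct p rule: rev_induct)
 case Nil
 have z: "0. : k" "b : carrier R" using sf_facts[OF k] subcl(1) b by blast+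
 have "set bs <= carrier R" using bs sf_facts(2)[OF k] by auto
 moreover have "eval (replicate (length bs) 0.) x = 0." using x by (intro eval_zeros) auto
 ultimately show ?case
 using z x by (intro exI[of _ "[]"] exI[of _ "replicate (length bs) 0."]) (auto simp: eval_Cons)
next
 case (snoc c p)
 note kf = sf_facts[OF k] note cl = subcl[OF kf(1)]
 let ?B = "eval (b # bs) x"
 from snoc have c: "c : k" "set p <= k" by auto
 then have cc: "c : carrier R" "set p <= carrier R" "b : carrier R" "set bs <= carrier R"
 using kf(2) b bs by auto
 show ?case
 proof (cases "length (p @ [c]) <= length bs")
 case True
 let ?r = "replicate (length bs - length (p @ [c])) 0. @ (p @ [c])"
 have "eval ?r x = eval (p @ [c]) x" using cc x by (intro eval_replicate) auto
 moreover have "set ?r <= k" using c cl(1) by auto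
 moreover have "length ?r = length bs" using True by simp
 moreover have "?B : carrier R" using cc x by simp
 ultimately show ?thesis using cc x
 by (intro exI[of _ "[]"] exI[of _ ?r]) auto
 next
 case False
 from snoc(1)[OF c(2)] obtain q r where q: "set q <= k" "set r <= k" "length r = length bs"
 "length q <= length p - length bs" "eval p x = eval q x$?B+.eval r x" by blast
 obtain e es where e: "r @ [c] = e # es" by (cases "r @ [c]") auto
 have ek: "e : k" "set es <= k" using arg_cong[OF e, of set] q(2) c by auto
 have les: "length es = length bs" using arg_cong[OF e, of length] q(3) by simp
 let ?d = "e$inv b"
 have d: "?d : k" using ek kf(3)[OF b] cl(4) by blast
 let ?r = "map2 (%s t. s-.?d$t) es bs"
 have car: "set q <= carrier R" "set r <= carrier R" "e : carrier R" "set es <= carrier R" "?d : carrier R"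
 "x [^] length bs : carrier R"
 using q ek d kf(2) x by auto
 note car' = eval_closed[OF car(1) x] eval_closed[OF car(2) x] eval_closed[OF car(4) x]
 eval_closed[OF cc(4) x]
 have 1: "eval ?r x = eval es x-.?d$eval bs x"
 by (rule eval_map2_minus[OF car(5) x car(4) cc(4) les])
 have 2: "eval r x$x+.c = e$x [^] length bs+.eval es x"
 using eval_snoc[OF car(2) cc(1) x] e les by (simp add: eval_Cons)
 have 3: "?d$b = e" using car(3) cc(3) b by (simp add: m_assoc)
 have "eval (p @ [c]) x = (eval q x$?B+.eval r x)$x+.c"
 using eval_snoc[OF cc(2) cc(1) x] q(5) by simp
 also have "... = (eval q x$x)$?B+.(eval r x$x+.c)"
 by (reify rsimps, rule ring_id, simp add: car' cc x, simp, code_simp)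
 also have "... = (eval q x$x)$?B+.((?d$b)$x [^] length bs+.eval es x)"
 unfolding 2 3 ..
 also have "... = (eval q x$x+.?d)$?B+.(eval es x-.?d$eval bs x)"
 unfolding eval_Cons
 by (reify rsimps, rule ring_id, simp add: car' cc x car kf(2)[OF kf(3)[OF b]], simp, code_simp)
 also have "... = eval (q @ [?d]) x$?B+.eval ?r x"
 unfolding 1 eval_snoc[OF car(1) car(5) x] ..
 finally have "eval (p @ [c]) x = eval (q @ [?d]) x$?B+.eval ?r x" .
 moreover have "set ?r <= k" by (rule set_map2_minus[OF kf(1) d ek(2) bs])
 ultimately show ?thesis using q(1,4) d les False
 by (intro exI[of _ "q @ [?d]"] exI[of _ ?r]) auto
 qed
qed

text \<open>\<open>(x-.a)$w-.1.\<close> is a polynomial in \<open>x\<close> with the same leading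
  coefficient as \<open>w\<close>, so it cannot vanish at a transcendental element. Hence
  \<open>x-.a\<close> generates a proper ideal of k[x].\<close>

lemma transcendental_poly_nonconstant:
 assumes k: "subfield k R" and x: "x : carrier R" "transcendental k x"
 and a: "a : k" and w: "w : simple_extension k x"
 shows "(x-.a)$w ~= 1."
proof
 assume h: "(x-.a)$w = 1."
 note kf = sf_facts[OF k] note cl = subcl[OF kf(1)]
 note T = transcendental_iff[OF kf(1) x(1), THEN iffD1, OF x(2), rule_format]
 have ac: "a : carrier R" using a kf by blast
 have P: "set p <= k ==> w = eval p x ==> False" for p
 proof (induct p)
 case Nil then show False using h x ac by simp
 next
 case (Cons b bs)
 have bk: "b : k" "set bs <= k" "b : carrier R" "set bs <= carrier R" using Cons(2) kf(2) by auto
 show False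
 proof (cases "b = 0.")
 case True then show False using Cons bk x eval_zero_prefix by auto
 next
 case False
 \<comment> \<open>\<open>?l\<close> lists the coefficients of \<open>(x-.a)$w\<close> below the
   leading one: \<open>bs @ [0.]\<close> is the shift by \<open>x\<close>. \<open>?o\<close> is the
   constant 1 padded to the same length.\<close>
 let ?l = "map2 (%s t. s-.a$t) (bs @ [0.]) (b # bs)"
 let ?o = "replicate (length bs) 0. @ [1.]"
 let ?m = "map2 (%s t. s-.1.$t) ?l ?o"
 have l: "set ?l <= k"
 by (rule set_map2_minus[OF kf(1) a]) (use bk cl(1) in auto)
 have m: "set ?m <= k"
 by (rule set_map2_minus[OF kf(1) cl(2) l]) (use cl(1,2) in auto)
 have lm: "length ?m = Suc (length bs)" "length ?l = Suc (length bs)" by auto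
 have lc: "set ?l <= carrier R" using l kf(2) by blast
 have "eval (replicate (length bs) 0. @ [1.]) x = eval [1.] x" using x by (intro eval_replicate) auto
 then have o: "eval ?o x = 1." using x by (simp add: eval_Cons)
 have el: "eval ?l x = eval (bs @ [0.]) x-.a$eval (b # bs) x"
 by (rule eval_map2_minus[OF ac x(1)]) (use bk in auto)
 have "eval ?m x = eval ?l x-.1.$eval ?o x"
 by (rule eval_map2_minus[OF one_closed x(1) lc]) auto
 also have "... = (eval bs x$x+.0.)-.a$eval (b # bs) x-.1."
 unfolding o el eval_snoc[OF bk(4) zero_closed x(1)] by simp
 finally have em: "eval ?m x = (eval bs x$x+.0.)-.a$(b$x [^] length bs+.eval bs x)-.1."
 by (simp add: eval_Cons)
 have "eval (b # ?m) x = b$(x [^] length bs$x)+.eval ?m x"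
 using lm by (simp add: eval_Cons)
 also have "... = (x-.a)$(b$x [^] length bs+.eval bs x)-.1."
 unfolding em by (reify rsimps, rule ring_id, simp add: x bk ac, simp, code_simp)
 also have "... = 0." using h Cons(3) by (simp add: eval_Cons minus_eq r_neg)
 finally have e: "eval (b # ?m) x = 0." .
 have "set (b # ?m) <= k" using m bk(1) by (simp only: list.set insert_subset)
 from T[OF this e] have "b : {0.}" by (simp only: list.set insert_subset)
 then show False using False by simp
 qed
 qed
 then show False using w polys_iff[OF kf(1) x(1)] by blast
qed

text \<open>By division with remainder, a nonzero element of \<open>P\<close> of least length
  divides all of \<open>P\<close>. As long as numerator and denominator both lie in \<open>P\<close>
  it can be cancelled, and each time the denominator gets shorter.\<close>

lemma poly_localization_reduced:
 assumes k: "subfield k R" and x: "x : carrier R"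
 and P: "prime_in R (simple_extension k x) P"
 and u: "u : simple_extension k x" and w: "w : simple_extension k x" "w ~= 0."
 shows "\<exists>u'\<in>simple_extension k x. \<exists>w'\<in>simple_extension k x. w' ~= 0. & u$inv w = u'$inv w' &
 ~ (u' : P & w' : P)"
proof (cases "P <= {0.}")
 case True then show ?thesis using u w by blast
next
 case False
 note kf = sf_facts[OF k] note A = polys_subring[OF kf(1) x]
 note ac = subcarr[OF A(1)] note cl = subcl[OF A(1)]
 note pi = polys_iff[OF kf(1) x]
 let ?A = "simple_extension k x"
 have pr: "P <= ?A" "1. ~: P" "!!a b. a : P ==> b : P ==> a+.b : P" "!!a b. a : ?A ==> b : P ==> a$b : P"
 using P by (auto simp: prime_in_def)
 define Q where "Q p \<longleftrightarrow> set p <= k & eval p x : P & eval p x ~= 0." for p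
 obtain z where "z : P" "z ~= 0." using False by blast
 then obtain p0 where "Q p0" using pi[of z] pr(1) unfolding Q_def by blast
 then obtain p where p: "Q p" "!!p'. Q p' ==> length p <= length p'"
 using ex_has_least_nat[of Q p0 length] by blast
 obtain b bs where pb: "p = b # bs" using p(1) by (cases p) (auto simp: Q_def)
 have bk: "b : k" "set bs <= k" "b : carrier R" "set bs <= carrier R"
 using p(1) pb kf(2) by (auto simp: Q_def)
 have b0: "b ~= 0."
 proof
 assume "b = 0."
 then have "Q bs" using p(1) pb eval_zero_prefix[OF bk(4) x] bk by (auto simp: Q_def)
 then show False using p(2) pb by fastforce
 qed
 let ?\<pi> = "eval p x"
 have piP: "?\<pi> : P" "?\<pi> ~= 0." "?\<pi> : carrier R" using p(1) pr(1) ac by (auto simp: Q_def)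
 \<comment> \<open>The generator is not constant since \<open>1.\<close> is outside
   \<open>P\<close>; this makes the cancellation below strictly shorten the denominator.\<close>
 have bs: "length bs > 0"
 proof (rule ccontr)
 assume "~ length bs > 0"
 then have "?\<pi> = b" using pb bk x by (simp add: eval_Cons)
 then have "inv b$b : P" using pr(4)[of "inv b" b] piP(1) kf(3)[OF bk(1) b0] A(2) by auto
 then show False using pr(2) bk b0 by simp
 qed
 have div: "\<exists>q. set q <= k & length q <= length l - length bs & eval l x = ?\<pi>$eval q x"
 if l: "set l <= k" "eval l x : P" for l
 proof -
 obtain q r where q: "set q <= k" "set r <= k" "length r = length bs" "length q <= length l - length bs"
 "eval l x = eval q x$?\<pi>+.eval r x"
 using poly_division[OF k x bk(1) b0 bk(2) l(1)] unfolding pb by blast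
 have qA: "eval q x : ?A" "eval r x : ?A" using pi q by blast+
 have qc: "eval q x : carrier R" "eval r x : carrier R" using qA ac by blast+
 have "eval r x = eval l x+.( -. eval q x)$?\<pi>"
 unfolding q(5) by (reify rsimps, rule ring_id, simp add: qc piP, simp, code_simp)
 moreover have "... : P" using pr(3)[OF l(2) pr(4)[OF cl(3)[OF qA(1)] piP(1)]] .
 ultimately have "eval r x : P" by simp
 then have "eval r x = 0." using p(2)[of r] q(2,3) pb by (fastforce simp: Q_def)
 then show ?thesis using q qc piP by (intro exI[of _ q]) (simp add: m_comm)
 qed
 obtain lw where lw: "set lw <= k" "w = eval lw x" using w pi by blast
 show ?thesis using u w lw
 proof (induct "length lw" arbitrary: lw u w rule: less_induct)
 case less
 note IH = less(1) and hu = less(2) and hw = less(3,4) and hl = less(5,6)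
 show ?case
 proof (cases "u : P & w : P")
 case False then show ?thesis using hu hw by blast
 next
 case True
 obtain lu where lu: "set lu <= k" "u = eval lu x" using hu pi by blast
 obtain q where q: "set q <= k" "u = ?\<pi>$eval q x" using div[OF lu(1)] True lu by auto
 obtain q' where q': "set q' <= k" "w = ?\<pi>$eval q' x" "length q' <= length lw - length bs"
 using div[OF hl(1)] True hl by auto
 have qA: "eval q x : ?A" "eval q' x : ?A" using pi q(1) q'(1) by blast+
 have qc: "eval q x : carrier R" "eval q' x : carrier R" using qA ac by blast+
 have q0: "eval q' x ~= 0." using hw q'(2) piP by auto
 have "0 < length lw" using hw hl by auto
 then have "length q' < length lw" using q'(3) bs by arith
 from IH[OF this qA(1) qA(2) q0 q'(1) refl]
 obtain u' w' where uw: "u' : ?A" "w' : ?A" "w' ~= 0." "eval q x$inv (eval q' x) = u'$inv w'"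
 "~ (u' : P & w' : P)" by blast
 have "u$inv w = eval q x$inv (eval q' x)"
 unfolding q(2) q'(2) using piP qc q0
 by (subst fraction_eq_iff) (auto simp: m_ac)
 then show ?thesis using uw by auto
 qed
 qed
qed

text \<open>A reduced fraction has its numerator or its denominator outside
  \<open>P\<close>.\<close>

lemma poly_localization_valuation_ring:
 assumes k: "subfield k R" and x: "x : carrier R"
 and P: "prime_in R (simple_extension k x) P"
 shows "valuation_ring R (funfield k x) (localization R (simple_extension k x) P)"
proof -
 note kf = sf_facts[OF k] note A = polys_subring[OF kf(1) x] note ff = funfield_facts[OF kf(1) x]
 let ?A = "simple_extension k x"
 have z: "0. : P" using P by (simp add: prime_in_def)
 have 1: "localization R ?A P <= funfield k x"
 using z unfolding funfield_def localization_def by blast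
 have "z : localization R ?A P \<or> inv z : localization R ?A P" if zE: "z : funfield k x" "z ~= 0." for z
 proof -
 obtain u0 w0 where u0: "u0 : ?A" "w0 : ?A" "w0 ~= 0." "z = u0$inv w0"
 using ff(5)[OF zE(1)] by blast
 obtain u w where u: "u : ?A" "w : ?A" "w ~= 0." "z = u$inv w" "~ (u : P & w : P)"
 using poly_localization_reduced[OF k x P u0(1-3)] unfolding u0(4) by blast
 have c: "u : carrier R" "w : carrier R" using u subcarr[OF A(1)] by blast+
 have "u ~= 0." using zE(2) u c by auto
 then have "inv z = w$inv u" using fraction_inv[OF c u(3)] u(4) by simp
 moreover have "u$inv w : localization R ?A P" if "w ~: P"
 using that u(1,2) unfolding localization_def by blast
 moreover have "w$inv u : localization R ?A P" if "u ~: P"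
 using that u(1,2) unfolding localization_def by blast
 ultimately show ?thesis using u(4,5) by auto
 qed
 moreover have "funfield k x <= carrier R" using sf_facts(2)[OF ff(1)] by blast
 ultimately show ?thesis
 unfolding valuation_ring_def
 using 1 lsubD(1)[OF localization_facts(1)[OF A(1) P]] by simp
qed

end

section \<open>Constants, points of the line and quadratic extensions\<close>

context field

begin

lemma nonunits_localizationD:
 assumes "subring A R" "prime_in R A I" "z : nonunits R (localization R A I)"
 shows "\<exists>a\<in>I. \<exists>s\<in>A. s ~: I & z = a$inv s"
 using localization_facts(2)[OF assms(1,2)] assms(3) by blast

lemma localizationI: "a : A ==> s : A ==> s ~: I ==> a$inv s : localization R A I"
 unfolding localization_def by blast

lemma algebraics_subfield:
 assumes "subfield k R"
 shows "subfield {z : carrier R. ~ transcendental k z} R" "k <= {z : carrier R. ~ transcendental k z}"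
proof -
 show "subfield {z : carrier R. ~ transcendental k z} R"
 using subfield_of_algebraics[OF assms] by (simp add: over_def)
 show "k <= {z : carrier R. ~ transcendental k z}"
 using algebraic_self[OF sf_facts(1)[OF assms]] sf_facts(2)[OF assms]
 by (auto simp: over_def)
qed

lemma transcendental_inv:
 assumes k: "subfield k R" and x: "x : carrier R" "transcendental k x"
 shows "x ~= 0." "transcendental k (inv x)"
proof -
 note a = algebraics_subfield[OF k] note af = sf_facts[OF a(1)]
 have "0. : {z : carrier R. ~ transcendental k z}" using subcl(1)[OF af(1)] .
 then show x0: "x ~= 0." using x by auto
 show "transcendental k (inv x)"
 using af(3)[of "inv x"] x x0 by auto
qed

text \<open>At a pole of \<open>z\<close> the top term dominates: a nonzero polynomial in
  \<open>z\<close> over \<open>k\<close> is a power of \<open>z\<close> times a unit, hence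
  nonzero.\<close>

lemma transcendental_if_pole:
 assumes k: "subfield k R" and V: "local_subring R V" "k <= V"
 and z: "z : carrier R" "z ~= 0." "inv z : nonunits R V"
 shows "transcendental k z"
proof -
 note v = lsubD[OF V(1)] note kf = sf_facts[OF k]
 have *: "set p <= {0.} \<or> (\<exists>d u. u : V & u ~: nonunits R V & eval p z = z [^] (d::nat)$u)"
 if "set p <= k" for p
 using that
 proof (induct p rule: rev_induct)
 case (snoc c p)
 then have c: "c : k" "set p <= k" by auto
 then have cc: "c : carrier R" "set p <= carrier R" "c : V" using kf(2) V(2) by auto
 show ?case
 proof (cases "set p <= {0.}")
 case True
 then have e: "eval (p @ [c]) z = c" using cc z by (simp add: eval_snoc eval_zeros)
 show ?thesis
 proof (cases "c = 0.")
 case False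
 then have "c ~: nonunits R V" using subfield_unit(2)[OF k V(2) v(1) c(1)] by simp
 then show ?thesis using e cc z by (intro disjI2 exI[of _ 0] exI[of _ c]) simp
 qed (use True in auto)
 next
 case False
 with snoc(1)[OF c(2)] obtain d u where u: "u : V" "u ~: nonunits R V" "eval p z = z [^] (d::nat)$u"
 by blast
 have uc: "u : carrier R" using u subcarr[OF v(1)] by blast
 let ?m = "inv z$(inv z [^] d$c)"
 have iz: "inv z : V" "inv z : carrier R" using z nonunits_iff[OF v(1)] by auto
 have m: "?m : nonunits R V"
 using nonunits_mult[OF v(1) z(3)] subcl(4)[OF v(1) subcl(7)[OF v(1) iz(1)] cc(3)] by blast
 have zz: "z [^] d$inv z [^] d = 1." using z by (simp flip: nat_pow_distrib)
 have "z [^] Suc d$(u+.?m) = z [^] d$u$z+.c$(z$inv z)$(z [^] d$inv z [^] d)"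
 unfolding nat_pow_Suc by (reify rsimps, rule ring_id, simp add: z iz uc cc, simp, code_simp)
 then have "z [^] Suc d$(u+.?m) = z [^] d$u$z+.c" using z cc zz by simp
 then have "eval (p @ [c]) z = z [^] Suc d$(u+.?m)" using eval_snoc[OF cc(2,1) z(1)] u(3) by simp
 then show ?thesis using unit_add_nonunit[OF V(1) u(1,2) m] by blast
 qed
 qed simp
 have "set p <= {0.}" if p: "set p <= k" "eval p z = 0." for p
 proof (rule ccontr)
 assume "~ set p <= {0.}"
 then obtain d u where u: "u : V" "u ~: nonunits R V" "eval p z = z [^] (d::nat)$u" using *[OF p(1)] by blast
 then have "u ~= 0." "u : carrier R" using unit_inv(1)[OF v(1)] subcarr[OF v(1)] by blast+
 then have "z [^] d$u ~= 0." using mult_nonzero[of "z [^] d" u] pow_nonzero[OF z(1,2)] z(1) by blast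
 then show False using u(3) p(2) by simp
 qed
 then show ?thesis using transcendental_iff[OF kf(1) z(1)] by blast
qed

text \<open>A valuation ring with residue field \<open>k\<close> forces \<open>k\<close> to be
  algebraically closed in the field. An algebraic \<open>z\<close> has no pole, so it is congruent
  to a constant \<open>c\<close>; if \<open>z\<close> differed from \<open>c\<close>, the inverse of
  \<open>z-.c\<close> would be algebraic with a pole.\<close>

lemma algebraic_constants:
 assumes k: "subfield k R" and V: "valuation_ring R (carrier R) V" "rational_over R k V"
 and z: "z : carrier R" "~ transcendental k z"
 shows "z : k"
proof (rule ccontr)
 assume zk: "z ~: k"
 note v = valuation_ringD[OF V(1)] note kf = sf_facts[OF k]
 note a = algebraics_subfield[OF k] note af = sf_facts[OF a(1)]
 have L: "local_subring R V" by (rule valuation_ring_local[OF V(1) carrier_is_subfield])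
 have kV: "k <= V" using V(2) by (simp add: rational_over_def)
 show False
 proof (cases "z : V")
 case False
 then have "inv z : nonunits R V" "z ~= 0." using v(3)[OF z(1)] subcl(1)[OF v(1)] by auto
 then show False using transcendental_if_pole[OF k L kV z(1)] z(2) by blast
 next
 case True
 then obtain c where c: "c : k" "z-.c : nonunits R V" using V(2) unfolding rational_over_def by blast
 have cc: "c : carrier R" using kf(2) c by blast
 have zc: "z-.c ~= 0." using zk c(1) r_right_minus_eq[OF z(1) cc] by auto
 have zcc: "z-.c : carrier R" using z cc by simp
 have "z : {z : carrier R. ~ transcendental k z}" "c : {z : carrier R. ~ transcendental k z}"
 using z c(1) a(2) by auto
 then have "z-.c : {z : carrier R. ~ transcendental k z}" using subcl(6)[OF af(1)] by blast
 then have "inv (z-.c) : {z : carrier R. ~ transcendental k z}" using af(3) zc by blast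
 moreover have "transcendental k (inv (z-.c))"
 using transcendental_if_pole[OF k L kV, of "inv (z-.c)"] zc zcc c(2) by simp
 ultimately show False by blast
 qed
qed

text \<open>The local ring of the line at x = a, with uniformizer \<open>x-.a\<close>. The clause
  about \<open>T\<close> is a universal property: this ring lies below every local ring over
  \<open>k\<close> centered at that point. Later arguments use this clause and never the
  localization itself.\<close>

lemma point_valuation_ring:
 assumes k: "subfield k R" and x: "x : carrier R" "transcendental k x" and a: "a : k"
 shows "\<exists>V. valuation_ring R (funfield k x) V & rational_over R k V & x-.a : nonunits R V &
 (\<forall>v\<in>nonunits R V. \<exists>w\<in>V. v = (x-.a)$w) &
 (\<forall>T. local_subring R T --> k <= T --> x-.a : nonunits R T -->
 V <= T & nonunits R V <= nonunits R T) &
 simple_extension k x <= V"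
proof -
 note kf = sf_facts[OF k] note A = polys_subring[OF kf(1) x(1)]
 note cl = subcl[OF A(1)] note ac = subcarr[OF A(1)]
 let ?A = "simple_extension k x"
 let ?I = "{(x-.a)$w | w. w : ?A}"
 have aA: "a : ?A" "a : carrier R" "x-.a : ?A" "x-.a : carrier R"
 using a A(2) cl(6)[OF A(3)] x kf(2) by auto
 \<comment> \<open>Division by \<open>x-.a\<close>, by Horner's scheme along the inductive
   construction of k[x].\<close>
 have rep: "\<exists>c\<in>k. \<exists>w\<in>?A. z = (x-.a)$w+.c" if z: "z : ?A" for z
 using z
 proof induct
 case zero
 then show ?case using cl(1) subcl(1)[OF kf(1)] x aA by (intro bexI[of _ \<zero>]) auto
 next
 case (lin k1 k2)
 then obtain c w where c: "c : k" "w : ?A" "k1 = (x-.a)$w+.c" by blast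
 have cc: "c : carrier R" "w : carrier R" "k2 : carrier R" using c kf(2) ac lin(3) by blast+
 have "k1$x+.k2 = (x-.a)$(w$x+.c)+.(c$a+.k2)"
 unfolding c(3) by (reify rsimps, rule ring_id, simp add: cc x aA, simp, code_simp)
 moreover have "w$x+.c : ?A" using cl(5)[OF cl(4)[OF c(2) A(3)]] A(2) c(1) by blast
 moreover have "c$a+.k2 : k"
 using subcl(5)[OF kf(1) subcl(4)[OF kf(1) c(1) a] lin(3)] .
 ultimately show ?case by blast
 qed
 have I1: "?I <= ?A" using cl(4)[OF aA(3)] by blast
 have I2: "0. : ?I" using cl(1) aA by (auto intro!: exI[of _ \<zero>])
 have I3: "1. ~: ?I"
 proof
 assume "1. : ?I"
 then obtain w where w: "1. = (x-.a)$w" "w : ?A" by blast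
 show False using transcendental_poly_nonconstant[OF k x a w(2)] w(1)[symmetric] by blast
 qed
 have I4: "z+.w : ?I" if zw: "z : ?I" "w : ?I" for z w
 proof -
 obtain z' w' where *: "z = (x-.a)$z'" "w = (x-.a)$w'" "z' : ?A" "w' : ?A" using zw by blast
 then have "z+.w = (x-.a)$(z'+.w')" using ac aA by (simp add: r_distr)
 then show ?thesis using cl(5)[OF *(3,4)] by blast
 qed
 have I5: "z$w : ?I" if zw: "z : ?A" "w : ?I" for z w
 proof -
 obtain w' where *: "w = (x-.a)$w'" "w' : ?A" using zw(2) by blast
 then have "z$w = (x-.a)$(z$w')" using ac aA zw(1) by (simp add: m_lcomm)
 then show ?thesis using cl(4)[OF zw(1) *(2)] by blast
 qed
 have r: "\<exists>c\<in>k. z-.c : ?I" if z: "z : ?A" for z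
 proof -
 obtain c w where c: "c : k" "w : ?A" "z = (x-.a)$w+.c" using rep[OF z] by blast
 then have "c : carrier R" "w : carrier R" using kf(2) ac by blast+
 then have "z-.c = (x-.a)$w" using c(3) aA by (simp add: minus_eq a_assoc r_neg)
 then show ?thesis using c by blast
 qed
 note p = rational_prime[OF A(1) k A(2) I1 I2 I3 I4 I5 r]
 note L = localization_facts[OF A(1) p(1)]
 note Ls = lsubD(1)[OF L(1)]
 let ?V = "localization R ?A ?I"
 have xI: "x-.a : ?I" using cl(2) aA by (intro CollectI exI[of _ \<one>]) auto
 show ?thesis
 proof (rule exI[of _ ?V], intro conjI ballI allI impI)
 show "valuation_ring R (funfield k x) ?V" by (rule poly_localization_valuation_ring[OF k x(1) p(1)])
 show "rational_over R k ?V" by (rule p(2))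
 show "x-.a : nonunits R ?V" using xI L(3) by blast
 show "\<exists>w\<in>?V. v = (x-.a)$w" if v: "v : nonunits R ?V" for v
 proof -
 obtain z s where z: "z : ?I" "s : ?A" "s ~: ?I" "v = z$inv s"
 using nonunits_localizationD[OF A(1) p(1) v] by blast
 obtain w where w: "z = (x-.a)$w" "w : ?A" using z(1) by blast
 have "w$inv s : ?V" using localizationI[OF w(2) z(2,3)] .
 moreover have "s ~= 0." using z(3) I2 by metis
 then have "v = (x-.a)$(w$inv s)" using z w ac aA by (simp add: m_assoc)
 ultimately show ?thesis by blast
 qed
 fix T assume T: "local_subring R T" "k <= T" "x-.a : nonunits R T"
 have "?V <= T & nonunits R ?V <= nonunits R T"
 proof -
 note t = lsubD[OF T(1)]
 have "x-.a : T" "a : T" using T nonunits_iff[OF t(1)] a by auto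
 moreover have "(x-.a)+.a = x" using x aA by (simp add: minus_eq a_assoc l_neg)
 ultimately have "x : T" using subcl(5)[OF t(1), of "x-.a" a] by simp
 then have AT: "?A <= T" using simple_extension_subring_incl[OF t(1) T(2)] by blast
 have IT: "?I <= nonunits R T" using nonunits_mult[OF t(1) T(3)] AT by blast
 \<comment> \<open>The constant congruent to \<open>z\<close> modulo \<open>?I\<close> becomes a
   nonunit of \<open>T\<close>, hence is zero: the center of \<open>T\<close> on k[x] is not larger
   than \<open>?I\<close>.\<close>
 have "z : ?I" if z: "z : ?A" "z : nonunits R T" for z
 proof -
 obtain c where c: "c : k" "z-.c : ?I" using r[OF z(1)] by blast
 have cz: "c : carrier R" "z : carrier R" using kf(2) c ac z by blast+
 have "z-.(z-.c) : nonunits R T" using t(3)[OF z(2)] c(2) IT by blast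
 moreover have "z-.(z-.c) = c" by (reify rsimps, rule ring_id, simp add: cz, simp, code_simp)
 ultimately have "c = 0." using subfield_unit(2)[OF k T(2) t(1) c(1)] by auto
 then show ?thesis using c(2) cz by (simp add: minus_eq)
 qed
 then show ?thesis using localization_least[OF A(1) p(1) T(1) AT] IT by blast
 qed
 then show "?V <= T" "nonunits R ?V <= nonunits R T" by blast+
 next
 show "simple_extension k x <= ?V" using subset_localization[OF A(1) p(1)] by blast
 qed
qed

lemma valuation_ring_scale:
 assumes V: "valuation_ring R E V" and E: "subfield E R" and u: "u : E" "w : E" "u ~= 0. \<or> w ~= 0."
 shows "\<exists>e\<in>E. e ~= 0. & e$u : V & e$w : V & (e$u = 1. \<or> e$w = 1.)"
proof -
 note v = valuation_ringD[OF V] note ef = sf_facts[OF E]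
 have *: "\<exists>e\<in>E. e ~= 0. & e$u : V & e$w : V & (e$u = 1. \<or> e$w = 1.)"
 if u: "u : E" "w : E" "u ~= 0." for u w
 proof -
 have c: "u : carrier R" "w : carrier R" using u ef(2) by blast+
 show ?thesis
 proof (cases "inv u$w : V")
 case True
 then show ?thesis using ef(3)[OF u(1,3)] c u subcl(2)[OF v(1)] by (intro bexI[of _ "inv u"]) auto
 next
 case False
 have E: "inv u$w : E" using ef(3)[OF u(1,3)] u subcl(4)[OF ef(1)] by blast
 have w0: "w ~= 0." using False c u(3) subcl(1)[OF v(1)] by auto
 then have "inv (inv u$w) : V" using v(4)[OF E] False c u by auto
 moreover have "inv (inv u$w) = inv w$u" using c u w0 by (simp add: inv_mult_distrib m_comm)
 ultimately show ?thesis using ef(3)[OF u(2) w0] c w0 subcl(2)[OF v(1)] by (intro bexI[of _ "inv w"]) auto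
 qed
 qed
 show ?thesis using *[OF u(1,2)] *[OF u(2,1)] u(3) by blast
qed

lemma quadratic_unique:
 assumes E: "subfield E R" and Y: "Y : carrier R" "Y ~: E"
 and u: "u : E" "v : E" "u' : E" "v' : E" "u+.v$Y = u'+.v'$Y"
 shows "u = u'" "v = v'"
proof -
 note ef = sf_facts[OF E] note cl = subcl[OF ef(1)]
 have c: "u : carrier R" "v : carrier R" "u' : carrier R" "v' : carrier R" using u ef(2) by blast+
 have e: "(v-.v')$Y = u'-.u"
 proof -
 have "(v-.v')$Y = (u+.v$Y)-.u-.v'$Y"
 by (reify rsimps, rule ring_id, simp add: c Y, simp, code_simp)
 also have "... = u'-.u" unfolding u(5) by (reify rsimps, rule ring_id, simp add: c Y, simp, code_simp)
 finally show ?thesis .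
 qed
 show "v = v'"
 proof (rule ccontr)
 assume "v ~= v'"
 then have n: "v-.v' ~= 0." "v-.v' : E" "v-.v' : carrier R" using c cl(6)[OF u(2,4)] by auto
 have "inv (v-.v')$((v-.v')$Y) = Y" using mult_inv_cancel(2)[OF n(3,1) Y(1)] .
 then have "Y = inv (v-.v')$(u'-.u)" unfolding e by simp
 then show False using Y(2) cl(4)[OF ef(3)[OF n(2,1)] cl(6)[OF u(3,1)]] by simp
 qed
 then have "(v-.v')$Y = 0." using c Y by (simp add: minus_eq r_neg)
 then have "u'-.u = 0." using e by metis
 then show "u = u'" using r_right_minus_eq[of u' u] c by blast
qed

lemma quadratic_extension_subring:
 assumes A: "subring A R" and Y: "Y : carrier R" "Y$Y : A"
 shows "subring {u+.v$Y | u v. u : A & v : A} R" (is "subring ?B R")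
proof (rule subringI)
 note cl = subcl[OF A] note c = subcarr[OF A]
 show "?B <= carrier R" using c Y by auto
 show "1. : ?B" using cl(1,2) Y by (intro CollectI exI[of _ \<one>] exI[of _ \<zero>]) simp
 fix z assume "z : ?B"
 then obtain u v where z: "z = u+.v$Y" "u : A" "v : A" by blast
 have zc: "u : carrier R" "v : carrier R" using z c by blast+
 have "-. z = ( -. u)+.( -. v)$Y"
 unfolding z(1) by (reify rsimps, rule ring_id, simp add: zc Y, simp, code_simp)
 then show "-. z : ?B" using cl(3) z by blast
 fix w assume "w : ?B"
 then obtain u' v' where w: "w = u'+.v'$Y" "u' : A" "v' : A" by blast
 have wc: "u' : carrier R" "v' : carrier R" using w c by blast+
 have "z+.w = (u+.u')+.(v+.v')$Y"
 unfolding z(1) w(1) by (reify rsimps, rule ring_id, simp add: zc wc Y, simp, code_simp)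
 then show "z+.w : ?B" using cl(5)[OF z(2) w(2)] cl(5)[OF z(3) w(3)] by blast
 have "z$w = (u$u'+.v$v'$(Y$Y))+.(u$v'+.v$u')$Y"
 unfolding z(1) w(1) by (reify rsimps, rule ring_id, simp add: zc wc Y, simp, code_simp)
 moreover have "u$u'+.v$v'$(Y$Y) : A" "u$v'+.v$u' : A"
 using cl(5)[OF cl(4)[OF z(2) w(2)] cl(4)[OF cl(4)[OF z(3) w(3)] Y(2)]]
 cl(5)[OF cl(4)[OF z(2) w(3)] cl(4)[OF z(3) w(2)]] .
 ultimately show "z$w : ?B" by blast
qed

lemma quadratic_extension_subfield:
 assumes E: "subfield E R" and Y: "Y : carrier R" "Y$Y : E"
 shows "subfield {u+.v$Y | u v. u : E & v : E} R" (is "subfield ?B R")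
proof (rule subfieldI_inv)
 note ef = sf_facts[OF E] note cl = subcl[OF ef(1)]
 show "subring ?B R" by (rule quadratic_extension_subring[OF ef(1) Y])
 fix z assume "z : ?B" and z0: "z ~= 0."
 then obtain u v where z: "z = u+.v$Y" "u : E" "v : E" by blast
 have zc: "u : carrier R" "v : carrier R" using z ef(2) by blast+
 let ?n = "u$u-.v$v$(Y$Y)"
 have n: "?n : E" using cl(6)[OF cl(4)[OF z(2,2)] cl(4)[OF cl(4)[OF z(3,3)] Y(2)]] .
 have nz: "z$(u-.v$Y) = ?n"
 unfolding z(1) by (reify rsimps, rule ring_id, simp add: zc Y, simp, code_simp)
 show "inv z : ?B"
 proof (cases "?n = 0.")
 case False
 have i: "inv ?n : E" "inv ?n : carrier R" "?n : carrier R" using ef(3)[OF n False] ef(2) n by auto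
 have "z$(u$inv ?n+.( -. v$inv ?n)$Y) = z$(u-.v$Y)$inv ?n"
 unfolding z(1) by (reify rsimps, rule ring_id, simp add: zc Y i, simp, code_simp)
 also have "... = 1." unfolding nz using inv_mult(1)[OF i(3) False] .
 finally have "inv z = u$inv ?n+.( -. v$inv ?n)$Y"
 using zc Y i z(1) by (intro inv_unique_field) auto
 then show ?thesis using cl(4)[OF z(2) i(1)] cl(4)[OF cl(3)[OF z(3)] i(1)] by blast
 next
 \<comment> \<open>\<open>Y\<close> may lie in \<open>E\<close>, so the norm of a nonzero element
   can vanish. Then the conjugate vanishes, and \<open>z = u+.u\<close> lies in \<open>E\<close>
   already.\<close>
 case True
 have "z : carrier R" "u-.v$Y : carrier R" using zc Y z(1) by auto
 then have h: "u-.v$Y = 0." using nz True z0 by auto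
 then have "u = v$Y" using zc Y by simp
 then have z2: "z = u+.u" using z(1) by simp
 have iz: "inv z : E" using ef(3)[of z] cl(5)[OF z(2,2)] z2 z0 by simp
 then have "inv z = inv z+.0.$Y" using ef(2) Y by simp
 then show ?thesis using iz cl(1) by blast
 qed
qed

end

section \<open>Rational places and double covers\<close>

definition place :: "('a, 'b) ring_scheme => 'a set => 'a set => bool" where
 "place F k V \<longleftrightarrow> valuation_ring F (carrier F) V & rational_over F k V"

context field

begin

lemma placeD:
 assumes "place R k V"
 shows "valuation_ring R (carrier R) V" "rational_over R k V" "local_subring R V" "k <= V" "subring V R"
 using assms valuation_ring_local[OF _ carrier_is_subfield] valuation_ringD(1)
 by (auto simp: place_def rational_over_def)

text \<open>A common residue field turns inclusion into domination, for which valuation rings are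
  maximal.\<close>

lemma place_eq:
 assumes k: "subfield k R" and V: "place R k V" and T: "local_subring R T" "rational_over R k T" "V <= T"
 shows "T = V"
proof (rule dominating_eq[OF placeD(1)[OF V]])
 show "nonunits R V <= nonunits R T"
 by (rule rational_over_nonunits[OF k placeD(3,2)[OF V] T])
qed (use T lsubD(1)[OF T(1)] subringE(1) in auto)

text \<open>
 A double cover \<open>Y\<^sup>2 = g\<close> of a valuation ring with residue field \<open>k\<close> has a valuation ring above
 each residue class \<open>Y \<mapsto> c\<close> with \<open>c\<^sup>2 = g\<close>, provided that it is unramified there (\<open>c \<noteq> 0\<close>) or that
 \<open>g\<close> is a uniformizer.
\<close>

lemma double_cover_valuation_ring:
 assumes k: "subfield k R" and E: "subfield E R" and Q: "valuation_ring R E Q" "rational_over R k Q"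
 and Y: "Y : carrier R" "Y ~: E" "Y$Y : Q" and c: "c : k" "c$c-.Y$Y : nonunits R Q"
 and two: "1.+.1. ~= 0."
 and smooth: "c ~= 0. \<or> (\<forall>v\<in>nonunits R Q. \<exists>w\<in>Q. v = (Y$Y)$w)"
 and gen: "carrier R = {u+.v$Y | u v. u : E & v : E}"
 shows "\<exists>S. place R k S & Q <= S & nonunits R Q <= nonunits R S & Y-.c : nonunits R S &
 (\<forall>T. local_subring R T --> Q <= T --> nonunits R Q <= nonunits R T --> Y-.c : nonunits R T -->
 S <= T & nonunits R S <= nonunits R T) &
 (c = 0. --> (\<forall>v\<in>nonunits R S. \<exists>w\<in>S. v = Y$w))"
proof -
 note o = valuation_ringD[OF Q(1)] note ocl = subcl[OF o(1)] note oc = subcarr[OF o(1)]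
 note ef = sf_facts[OF E] note ecl = subcl[OF ef(1)] note kf = sf_facts[OF k]
 have OL: "local_subring R Q" by (rule valuation_ring_local[OF Q(1) E])
 note om = lsubD[OF OL] note ni = nonunits_iff[OF o(1)]
 have kO: "k <= Q" using Q(2) by (simp add: rational_over_def)
 let ?g = "Y$Y"
 have cc: "c : carrier R" "c : Q" "?g : carrier R" using kf(2) c kO Y by auto
 \<comment> \<open>\<open>A\<close> is Q[Y]; \<open>I\<close> is the kernel of the substitution of
   \<open>c\<close> for \<open>Y\<close> followed by reduction, an ideal because \<open>c$c\<close>
   and \<open>Y$Y\<close> agree modulo nonunits.\<close>
 define A where "A = {u+.v$Y | u v. u : Q & v : Q}"
 define I where "I = {u+.v$Y | u v. u : Q & v : Q & u+.v$c : nonunits R Q}"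
 have AE: "\<exists>u v. z = u+.v$Y & u : Q & v : Q" if "z : A" for z
 using that unfolding A_def by blast
 have AI: "u+.v$Y : A" if "u : Q" "v : Q" for u v using that unfolding A_def by blast
 have IE: "\<exists>u v. z = u+.v$Y & u : Q & v : Q & u+.v$c : nonunits R Q" if "z : I" for z
 using that unfolding I_def by blast
 have A: "subring A R" unfolding A_def by (rule quadratic_extension_subring[OF o(1) Y(1,3)])
 note acl = subcl[OF A] note acc = subcarr[OF A]
 have OE: "u : E" if "u : Q" for u using that o(2) by blast
 have uniq: "u = u' & v = v'" if "u : Q" "v : Q" "u' : Q" "v' : Q" "u+.v$Y = u'+.v'$Y" for u v u' v'
 using quadratic_unique[OF E Y(1,2) OE OE OE OE that(5)] that by blast
 have inI: "u+.v$Y : I \<longleftrightarrow> u+.v$c : nonunits R Q" if "u : Q" "v : Q" for u v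
 using uniq that unfolding I_def by blast
 have kA: "k <= A" "Q <= A"
 proof -
 show "Q <= A"
 proof
 fix u assume u: "u : Q"
 then have "u = u+.0.$Y" using oc Y by simp
 then show "u : A" using AI[OF u ocl(1)] by simp
 qed
 then show "k <= A" using kO by blast
 qed
 have I1: "I <= A" unfolding I_def A_def by blast
 have I2: "0. : I"
 using inI[OF ocl(1) ocl(1)] Y cc zero_nonunit[OF o(1)] by simp
 have I3: "1. ~: I" using inI[OF ocl(2) ocl(1)] Y cc one_unit[OF o(1)] by simp
 have I4: "z+.w : I" if zw: "z : I" "w : I" for z w
 proof -
 obtain u v u' v' where *: "z = u+.v$Y" "w = u'+.v'$Y" "u : Q" "v : Q" "u' : Q" "v' : Q"
 "u+.v$c : nonunits R Q" "u'+.v'$c : nonunits R Q" using IE[OF zw(1)] IE[OF zw(2)] by blast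
 have **: "u : carrier R" "v : carrier R" "u' : carrier R" "v' : carrier R" using * oc by blast+
 have "z+.w = (u+.u')+.(v+.v')$Y"
 unfolding * by (reify rsimps, rule ring_id, simp add: ** Y, simp, code_simp)
 moreover have "(u+.v$c)+.(u'+.v'$c) = (u+.u')+.(v+.v')$c"
 by (reify rsimps, rule ring_id, simp add: ** cc, simp, code_simp)
 ultimately show ?thesis
 using inI[OF ocl(5)[OF *(3,5)] ocl(5)[OF *(4,6)]] om(2)[OF *(7,8)] by simp
 qed
 have I5: "z$w : I" if zw: "z : A" "w : I" for z w
 proof -
 obtain u v u' v' where *: "z = u+.v$Y" "w = u'+.v'$Y" "u : Q" "v : Q" "u' : Q" "v' : Q"
 "u'+.v'$c : nonunits R Q" using AE[OF zw(1)] IE[OF zw(2)] by blast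
 have **: "u : carrier R" "v : carrier R" "u' : carrier R" "v' : carrier R" using * oc by blast+
 let ?s = "u$u'+.v$v'$?g" and ?t = "u$v'+.v$u'"
 have Q: "?s : Q" "?t : Q"
 using ocl(5)[OF ocl(4)[OF *(3,5)] ocl(4)[OF ocl(4)[OF *(4,6)] Y(3)]]
 ocl(5)[OF ocl(4)[OF *(3,6)] ocl(4)[OF *(4,5)]] .
 have "z$w = ?s+.?t$Y"
 unfolding * by (reify rsimps, rule ring_id, simp add: ** Y, simp, code_simp)
 moreover have "(u'+.v'$c)$(u+.v$c)-.(c$c-.?g)$(v$v') = ?s+.?t$c"
 by (reify rsimps, rule ring_id, simp add: ** cc Y, simp, code_simp)
 moreover have "(u'+.v'$c)$(u+.v$c)-.(c$c-.?g)$(v$v') : nonunits R Q"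
 using om(3)[OF nonunits_mult[OF o(1) *(7) ocl(5)[OF *(3) ocl(4)[OF *(4) cc(2)]]]
 nonunits_mult[OF o(1) c(2) ocl(4)[OF *(4,6)]]] .
 ultimately show ?thesis using inI[OF Q] by simp
 qed
 have r: "\<exists>d\<in>k. z-.d : I" if z: "z : A" for z
 proof -
 obtain u v where *: "z = u+.v$Y" "u : Q" "v : Q" using AE[OF z] by blast
 obtain d where d: "d : k" "(u+.v$c)-.d : nonunits R Q"
 using Q(2) ocl(5)[OF *(2) ocl(4)[OF *(3) cc(2)]] unfolding rational_over_def by blast
 have **: "u : carrier R" "v : carrier R" "d : carrier R" "d : Q" using * oc d(1) kO by blast+
 have "z-.d = (u-.d)+.v$Y"
 unfolding * by (reify rsimps, rule ring_id, simp add: ** Y, simp, code_simp)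
 moreover have "(u+.v$c)-.d = (u-.d)+.v$c"
 by (reify rsimps, rule ring_id, simp add: ** cc, simp, code_simp)
 ultimately have "z-.d : I" using inI[OF ocl(6)[OF *(2) **(4)] *(3)] d(2) by simp
 then show ?thesis using d(1) by blast
 qed
 have p: "prime_in R A I" "rational_over R k (localization R A I)"
 using rational_prime[OF A k kA(1) I1 I2 I3] I4 I5 r by blast+
 note L = localization_facts[OF A p(1)] note Ls = lsubD(1)[OF L(1)]
 note lcl = subcl[OF Ls] note lc = subcarr[OF Ls]
 define S where "S = localization R A I"
 note L = L[folded S_def] and Ls = Ls[folded S_def] and lcl = lcl[folded S_def] and lc = lc[folded S_def]
 and p = p(1) p(2)[folded S_def]
 have AS: "A <= S" using subset_localization[OF A p(1)] unfolding S_def by blast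
 have unit: "inv n : S & n : S & n ~= 0. & n : carrier R" if n: "n : A" "n ~: I" for n
 proof -
 have "1.$inv n : S" unfolding S_def by (rule localizationI[OF acl(2) n])
 moreover have "n ~= 0." using n I2 by metis
 ultimately show ?thesis using n AS acc by auto
 qed
 \<comment> \<open>An element of \<open>E\<close> times a unit of \<open>S\<close>: integrality is
   decided in the valuation ring \<open>Q\<close>.\<close>
 have val: "f : S \<or> inv f : S" if f: "f = e$n" "e : E" "e ~= 0." "n : S" "inv n : S" "n ~= 0." for f e n
 proof -
 have fc: "e : carrier R" "n : carrier R" using f ef(2) lc by blast+
 consider "e : Q" | "inv e : Q" using o(4) f by blast
 then show ?thesis
 proof cases
 case 1 then show ?thesis using lcl(4)[of e n] kA(2) AS f by blast
 next
 case 2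
 then have "inv e$inv n : S" using lcl(4)[of "inv e" "inv n"] kA(2) AS f by blast
 then show ?thesis using f(1) fc f(3,6) by (simp add: inv_mult_distrib)
 qed
 qed
 have V: "f : S \<or> inv f : S" if f: "f : carrier R" "f ~= 0." for f
 proof -
 obtain u0 v0 where f0: "f = u0+.v0$Y" "u0 : E" "v0 : E" using f gen by blast
 have f0c: "u0 : carrier R" "v0 : carrier R" using f0 ef(2) by blast+
 have "u0 ~= 0. \<or> v0 ~= 0." using f(2) f0 Y by auto
 then obtain e where e: "e : E" "e ~= 0." "e$u0 : Q" "e$v0 : Q" "e$u0 = 1. \<or> e$v0 = 1."
 using valuation_ring_scale[OF Q(1) E f0(2,3)] by blast
 let ?u = "e$u0" and ?v = "e$v0" and ?e = "inv e"
 have ec: "e : carrier R" "?e : carrier R" "?e : E" "?e ~= 0." using e ef by auto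
 have uc: "?u : carrier R" "?v : carrier R" using oc e by blast+
 let ?n = "?u+.?v$Y"
 have nA: "?n : A" by (rule AI[OF e(3,4)])
 have nc: "?n : carrier R" using uc Y by simp
 have "?e$?n = (?e$e)$u0+.(?e$e)$v0$Y"
 by (reify rsimps, rule ring_id, simp add: ec f0c Y, simp, code_simp)
 then have fe: "f = ?e$?n" using ec e f0c Y f0 by simp
 have n0: "?n ~= 0." using fe f(2) ec by auto
 show ?thesis
 proof (cases "?u+.?v$c : nonunits R Q")
 case False
 then have "?n ~: I" using inI[OF e(3,4)] by simp
 then show ?thesis using val[OF fe ec(3,4)] unit[OF nA] by blast
 next
 case True
 \<comment> \<open>If \<open>?v\<close> were a nonunit, then so would be \<open>?u\<close>, but one
   of the two has been scaled to \<open>1.\<close>.\<close>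
 have vu: "?v : Q" "?v ~: nonunits R Q"
 proof -
 show "?v : Q" by fact
 show "?v ~: nonunits R Q"
 proof
 assume v: "?v : nonunits R Q"
 have "(?u+.?v$c)-.?v$c : nonunits R Q"
 using om(3)[OF True nonunits_mult[OF o(1) v cc(2)]] .
 moreover have "(?u+.?v$c)-.?v$c = ?u"
 by (reify rsimps, rule ring_id, simp add: ec f0c cc, simp, code_simp)
 ultimately have "?u : nonunits R Q" by simp
 then show False using v e(5) one_unit[OF o(1)] by auto
 qed
 qed
 show ?thesis
 proof (cases "c = 0.")
 case False
 \<comment> \<open>The conjugate. Its value at \<open>c\<close> is congruent to -2vc, a unit, so
   \<open>?n\<close> equals its norm, an element of \<open>E\<close>, divided by a unit of
   \<open>S\<close>.\<close>
 let ?nb = "?u+.( -. ?v)$Y"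
 have "1.+.1. : k" using subcl(2,5)[OF kf(1)] by blast
 then have t: "( 1.+.1.)$c : k" "( 1.+.1.)$c ~= 0."
 using subcl(4)[OF kf(1) _ c(1)] two False cc by auto
 have tu: "( 1.+.1.)$c : Q" "( 1.+.1.)$c ~: nonunits R Q"
 using subfield_unit[OF k kO o(1) t] .
 have w: "-. (?v$(( 1.+.1.)$c)) : Q" "-. (?v$(( 1.+.1.)$c)) ~: nonunits R Q"
 using unit_mult[OF o(1) vu tu] ocl(3) nonunits_neg[OF o(1), of "-. (?v$(( 1.+.1.)$c))"] uc cc
 by auto
 have "-. (?v$(( 1.+.1.)$c))+.(?u+.?v$c) ~: nonunits R Q"
 using unit_add_nonunit(2)[OF OL w True] .
 moreover have "-. (?v$(( 1.+.1.)$c))+.(?u+.?v$c) = ?u+.( -. ?v)$c"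
 by (reify rsimps, rule ring_id, simp add: ec f0c cc, simp, code_simp)
 ultimately have nbI: "?nb ~: I" using inI[OF e(3) ocl(3)[OF e(4)]] by simp
 have nbA: "?nb : A" by (rule AI[OF e(3) ocl(3)[OF e(4)]])
 note nb = unit[OF nbA nbI]
 let ?N = "?u$?u-.?v$?v$?g"
 have N: "?n$?nb = ?N"
 by (reify rsimps, rule ring_id, simp add: ec f0c Y, simp, code_simp)
 have NO: "?N : Q" using ocl(6)[OF ocl(4)[OF e(3,3)] ocl(4)[OF ocl(4)[OF e(4,4)] Y(3)]] .
 have N0: "?N ~= 0." using N n0 nb nc by (metis mult_nonzero)
 have "?n = ?N$inv ?nb" unfolding N[symmetric] using nb nc by (simp add: m_assoc)
 then have "f = (?e$?N)$inv ?nb" using fe ec oc[OF NO] nb by (simp add: m_assoc)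
 moreover have "?e$?N : E" "?e$?N ~= 0."
 using ecl(4)[OF ec(3) OE[OF NO]] ec N0 oc[OF NO] by auto
 ultimately show ?thesis using val[of f "?e$?N" "inv ?nb"] nb by auto
 next
 \<comment> \<open>The ramified case: \<open>?u\<close> is a nonunit, hence a multiple of
   \<open>Y$Y\<close>, and one factor \<open>Y\<close> splits off from \<open>?n\<close>, leaving a
   unit.\<close>
 case c0: True
 then have um: "?u : nonunits R Q" using True uc by simp
 obtain w where w: "w : Q" "?u = ?g$w" using smooth c0 um by blast
 have wc: "w : carrier R" using w oc by blast
 let ?m = "?v+.w$Y"
 have mA: "?m : A" by (rule AI[OF e(4) w(1)])
 have mI: "?m ~: I" using inI[OF e(4) w(1)] c0 wc uc vu by simp
 note m = unit[OF mA mI]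
 have "?n = ?g$w+.?v$Y" using w(2) by simp
 also have "... = Y$?m" by (reify rsimps, rule ring_id, simp add: ec f0c Y wc, simp, code_simp)
 finally have nY: "?n = Y$?m" .
 have Y0: "Y ~= 0." using Y(2) ecl(1) by auto
 have YS: "Y : S"
 proof -
 have "Y = 0.+.1.$Y" using Y by simp
 then have "Y : A" using AI[OF ocl(1,2)] by simp
 then show ?thesis using AS by blast
 qed
 have fY: "f = (?e$Y)$?m" using fe nY ec Y m by (simp add: m_assoc)
 show ?thesis
 proof (cases "?e : Q")
 case True
 then have "?e : S" using kA(2) AS by blast
 then have "f : S" unfolding fY using lcl(4)[OF lcl(4)[OF _ YS]] m by blast
 then show ?thesis ..
 next
 case False
 \<comment> \<open>A pole in the base has order at least that of 1/Y^2, so the single extra factor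
   \<open>Y\<close> cannot cancel it: the inverse of \<open>?e$Y\<close> is
   \<open>Y$w'\<close>.\<close>
 then have "inv ?e : nonunits R Q" using o(3)[OF ec(3)] by blast
 then obtain w' where w': "w' : Q" "inv ?e = ?g$w'" using smooth c0 by blast
 have w'c: "w' : carrier R" using w' oc by blast
 have "inv (?e$Y) = inv ?e$inv Y" using ec Y Y0 by (intro inv_mult_distrib) auto
 also have "... = (Y$inv Y)$(Y$w')"
 unfolding w'(2) by (reify rsimps, rule ring_id, simp add: Y Y0 w'c, simp, code_simp)
 also have "... = Y$w'" using Y Y0 w'c by simp
 finally have i: "inv (?e$Y) = Y$w'" .
 have "w' : S" using w'(1) kA(2) AS by blast
 then have "inv (?e$Y) : S" unfolding i by (rule lcl(4)[OF YS])
 then have "inv (?e$Y)$inv ?m : S" using lcl(4) m by blast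
 moreover have "inv f = inv (?e$Y)$inv ?m"
 unfolding fY using ec Y Y0 m by (intro inv_mult_distrib) auto
 ultimately show ?thesis by simp
 qed
 qed
 qed
 qed
 have pl: "place R k S"
 unfolding place_def valuation_ring_def using p(2) Ls V lc by auto
 have YcI: "Y-.c : I"
 proof -
 have "Y-.c = ( -. c)+.1.$Y" using Y cc by (simp add: minus_eq a_comm)
 moreover have "( -. c)+.1.$c = 0." using cc by (simp add: l_neg)
 ultimately show ?thesis using inI[OF ocl(3)[OF cc(2)] ocl(2)] zero_nonunit[OF o(1)] by simp
 qed
 have OI: "nonunits R Q <= I"
 proof
 fix v assume v: "v : nonunits R Q"
 then have "v : Q" "v : carrier R" using ni oc by blast+
 then show "v : I" using inI[OF _ ocl(1), of v] Y cc v by simp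
 qed
 show ?thesis
 proof (rule exI[of _ S], intro conjI ballI allI impI)
 show "place R k S" by (rule pl)
 show "Q <= S" using kA AS by blast
 show "nonunits R Q <= nonunits R S" "Y-.c : nonunits R S" using OI YcI L(3) by blast+
 fix T assume T: "local_subring R T" "Q <= T" "nonunits R Q <= nonunits R T" "Y-.c : nonunits R T"
 have "S <= T & nonunits R S <= nonunits R T"
 proof -
 note t = lsubD[OF T(1)] note tcl = subcl[OF t(1)]
 have YT: "Y : T"
 proof -
 have "(Y-.c)+.c = Y" using Y cc by (simp add: minus_eq a_assoc l_neg)
 moreover have "Y-.c : T" using T(4) nonunits_iff[OF t(1)] by blast
 ultimately show ?thesis using tcl(5)[of "Y-.c" c] cc T by auto
 qed
 have AT: "A <= T"
 proof
 fix z assume "z : A"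
 then obtain u v where "z = u+.v$Y" "u : T" "v : T" using AE T(2) by blast
 then show "z : T" using tcl(5)[OF _ tcl(4)[OF _ YT]] by blast
 qed
 \<comment> \<open>Modulo the nonunit \<open>Y-.c\<close> of \<open>T\<close>, the element u + vY
   may be replaced by u + vc from \<open>Q\<close>, where being a unit persists in
   \<open>T\<close>.\<close>
 have key: "u+.v$Y : nonunits R T \<longleftrightarrow> u+.v$c : nonunits R Q" if uv: "u : Q" "v : Q" for u v
 proof -
 have uvc: "u : carrier R" "v : carrier R" using uv oc by blast+
 have vm: "(Y-.c)$v : nonunits R T" using nonunits_mult[OF t(1) T(4)] uv T by blast
 have e: "u+.v$Y = (u+.v$c)+.(Y-.c)$v"
 by (reify rsimps, rule ring_id, simp add: uvc Y cc, simp, code_simp)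
 have sO: "u+.v$c : Q" using ocl(5)[OF uv(1) ocl(4)[OF uv(2) cc(2)]] .
 show ?thesis
 proof
 assume "u+.v$c : nonunits R Q"
 then show "u+.v$Y : nonunits R T" unfolding e using t(2)[OF _ vm] T(3) by blast
 next
 assume h: "u+.v$Y : nonunits R T"
 show "u+.v$c : nonunits R Q"
 proof (rule ccontr)
 assume n: "u+.v$c ~: nonunits R Q"
 have "u+.v$c : T" "u+.v$c ~: nonunits R T"
 using unit_inv[OF o(1) sO n] sO T(2) nonunits_iff[OF t(1)] by blast+
 then show False using unit_add_nonunit(2)[OF T(1) _ _ vm] h e by simp
 qed
 qed
 qed
 have "I <= nonunits R T" using key unfolding I_def by blast
 moreover have "A \<inter> nonunits R T <= I" using key unfolding I_def A_def by blast
 ultimately show ?thesis using localization_least[OF A p(1) T(1) AT] unfolding S_def by blast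
 qed
 then show "S <= T" "nonunits R S <= nonunits R T" by blast+
 next
 show "\<exists>w\<in>S. v = Y$w" if c0: "c = 0." and v: "v : nonunits R S" for v
 proof -
 obtain z s where z: "z : I" "s : A" "s ~: I" "v = z$inv s"
 using nonunits_localizationD[OF A p(1)] v unfolding S_def by blast
 obtain u t where u: "z = u+.t$Y" "u : Q" "t : Q" "u+.t$c : nonunits R Q" using IE[OF z(1)] by blast
 have uc: "u : carrier R" "t : carrier R" using u oc by blast+
 then have "u : nonunits R Q" using u(4) c0 by simp
 then obtain w where w: "w : Q" "u = ?g$w" using smooth c0 by blast
 have wc: "w : carrier R" using w oc by blast
 have "z = Y$(t+.w$Y)"
 unfolding u(1) w(2) by (reify rsimps, rule ring_id, simp add: uc Y wc, simp, code_simp)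
 moreover have tA: "t+.w$Y : A" by (rule AI[OF u(3) w(1)])
 ultimately have "v = Y$((t+.w$Y)$inv s)" using z(4) unit[OF z(2,3)] lc uc wc Y
 by (simp add: m_assoc)
 moreover have "(t+.w$Y)$inv s : S"
 unfolding S_def by (rule localizationI[OF tA z(2,3)])
 ultimately show ?thesis by blast
 qed
 qed
qed

end

section \<open>Integral closedness of k[T] in terms of valuation rings\<close>

context field

begin

text \<open>Zorn's lemma for ideals avoiding 1. A maximal one is prime: if a is outside, then 1 = m
  + ra, and b = bm + r(ab) lies in it whenever ab does.\<close>

lemma proper_ideal_in_prime:
 assumes A: "subring A R" and J: "J <= A" "0. : J" "1. ~: J"
 "!!a b. a : J ==> b : J ==> a+.b : J" "!!a b. a : A ==> b : J ==> a$b : J"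
 shows "\<exists>P. prime_in R A P & J <= P"
proof -
 note cl = subcl[OF A] note c = subcarr[OF A]
 define S where "S = {I. J <= I & I <= A & 1. ~: I & (\<forall>a\<in>I. \<forall>b\<in>I. a+.b : I) & (\<forall>a\<in>A. \<forall>b\<in>I. a$b : I)}"
 have "\<exists>M\<in>S. \<forall>U\<in>S. M <= U --> U = M"
 proof (rule subset_Zorn_nonempty)
 have "J : S" unfolding S_def using J by blast
 then show "S ~= {}" by blast
 fix C assume C: "C ~= {}" "subset.chain S C"
 then have CS: "C <= S" "!!U Y. U : C ==> Y : C ==> U <= Y \<or> Y <= U"
 by (auto simp: subset.chain_def)
 have "a+.b : \<Union>C" if ab: "a : \<Union>C" "b : \<Union>C" for a b
 proof -
 obtain U Y where UY: "U : C" "Y : C" "a : U" "b : Y" using ab by blast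
 then obtain Z where "Z : C" "a : Z" "b : Z" using CS(2)[OF UY(1,2)] by blast
 then show ?thesis using CS(1) unfolding S_def by blast
 qed
 moreover have "J <= \<Union>C" "\<Union>C <= A" "1. ~: \<Union>C" "!!a b. a : A ==> b : \<Union>C ==> a$b : \<Union>C"
 using C(1) CS(1) unfolding S_def by blast+
 ultimately show "\<Union>C \<in> S" unfolding S_def by blast
 qed
 then obtain M where M: "M : S" "!!U. U : S ==> M <= U ==> U = M" by blast
 have m: "J <= M" "M <= A" "1. ~: M" "!!a b. a : M ==> b : M ==> a+.b : M"
 "!!a b. a : A ==> b : M ==> a$b : M" using M(1) unfolding S_def by blast+
 have z: "0. : M" using m(1) J(2) by blast
 have one: "\<exists>m\<in>M. \<exists>r\<in>A. 1. = m+.r$a" if a: "a : A" "a ~: M" for a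
 proof (rule ccontr)
 assume n: "~ ?thesis"
 let ?N = "{m+.r$a | m r. m : M & r : A}"
 have MN: "M <= ?N"
 proof
 fix m assume "m : M"
 moreover from this have "m = m+.0.$a" using c m(2) a by auto
 ultimately show "m : ?N" using cl(1) by blast
 qed
 have aN: "a : ?N"
 proof -
 have "a = 0.+.1.$a" using c a by simp
 then show ?thesis using z cl(2) by blast
 qed
 have NA: "?N <= A" using cl(5)[OF _ cl(4)[OF _ a(1)]] m(2) by blast
 have N4: "u+.v : ?N" if uv: "u : ?N" "v : ?N" for u v
 proof -
 obtain m1 r1 m2 r2 where *: "u = m1+.r1$a" "v = m2+.r2$a" "m1 : M" "m2 : M" "r1 : A" "r2 : A"
 using uv by blast
 have **: "m1 : carrier R" "m2 : carrier R" "r1 : carrier R" "r2 : carrier R" "a : carrier R"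
 using * m(2) c a by blast+
 have "u+.v = (m1+.m2)+.(r1+.r2)$a"
 unfolding * by (reify rsimps, rule ring_id, simp add: **, simp, code_simp)
 then show ?thesis using m(4)[OF *(3,4)] cl(5)[OF *(5,6)] by blast
 qed
 have N5: "u$v : ?N" if uv: "u : A" "v : ?N" for u v
 proof -
 obtain m1 r1 where *: "v = m1+.r1$a" "m1 : M" "r1 : A" using uv by blast
 have **: "m1 : carrier R" "r1 : carrier R" "u : carrier R" "a : carrier R" using * m(2) c a uv by blast+
 have "u$v = (u$m1)+.(u$r1)$a"
 unfolding * by (reify rsimps, rule ring_id, simp add: **, simp, code_simp)
 then show ?thesis using m(5)[OF uv(1) *(2)] cl(4)[OF uv(1) *(3)] by blast
 qed
 have "1. ~: ?N" using n by blast
 moreover have "J <= ?N" using MN m(1) by blast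
 ultimately have "?N : S" unfolding S_def using NA N4 N5 by blast
 then have "?N = M" using M(2) MN by blast
 then show False using aN a(2) by blast
 qed
 have "a : M \<or> b : M" if ab: "a : A" "b : A" "a$b : M" for a b
 proof (rule ccontr)
 assume n: "~ (a : M \<or> b : M)"
 obtain m1 r1 where 1: "m1 : M" "r1 : A" "1. = m1+.r1$a" using one[OF ab(1)] n by blast
 have cc: "m1 : carrier R" "r1 : carrier R" "a : carrier R" "b : carrier R" using 1 m(2) c ab by blast+
 have "b = (m1+.r1$a)$b" using 1(3)[symmetric] cc by simp
 also have "... = b$m1+.r1$(a$b)" by (reify rsimps, rule ring_id, simp add: cc, simp, code_simp)
 finally show False using m(4)[OF m(5)[OF ab(2) 1(1)] m(5)[OF 1(2) ab(3)]] n by simp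
 qed
 then have "prime_in R A M" unfolding prime_in_def using m z by blast
 then show ?thesis using m(1) by blast
qed

text \<open>The denominators of \<open>z\<close> form a proper ideal of k[T]; localizing at a prime
  above it gives a valuation ring that misses \<open>z\<close>.\<close>

lemma poly_ring_integrally_closed_valuative:
 assumes k: "subfield k R" and T: "T : carrier R" and z: "z : funfield k T" "z ~: simple_extension k T"
 obtains V where "valuation_ring R (funfield k T) V" "simple_extension k T <= V" "z ~: V"
proof -
 let ?A = "simple_extension k T"
 note kf = sf_facts[OF k] note A = polys_subring[OF kf(1) T]
 note cl = subcl[OF A(1)] note c = subcarr[OF A(1)]
 note ff = funfield_facts[OF kf(1) T]
 have zc: "z : carrier R" using sf_facts(2)[OF ff(1) z(1)] .
 define J where "J = {w : ?A. w$z : ?A}"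
 have JD: "w : J \<longleftrightarrow> w : ?A & w$z : ?A" for w unfolding J_def by blast
 have "\<exists>P. prime_in R ?A P & J <= P"
 proof (rule proper_ideal_in_prime[OF A(1)])
 show "J <= ?A" unfolding J_def by blast
 show "0. : J" "1. ~: J" using JD cl(1) zc z(2) by auto
 show "a+.b : J" if "a : J" "b : J" for a b
 using that cl(5)[of a b] cl(5)[of "a$z" "b$z"] l_distr[OF c c zc, of a b] by (simp add: JD)
 show "a$b : J" if "a : ?A" "b : J" for a b
 using that cl(4)[of a b] cl(4)[of a "b$z"] m_assoc[OF c c zc, of a b] by (simp add: JD)
 qed
 then obtain P where P: "prime_in R ?A P" "J <= P" by blast
 have "z ~: localization R ?A P"
 proof
 assume "z : localization R ?A P"
 then obtain u w where u: "z = u$inv w" "u : ?A" "w : ?A" "w ~: P" unfolding localization_def by blast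
 have uc: "u : carrier R" "w : carrier R" using u c by blast+
 have "w ~= 0." using u(4) P(1) by (auto simp: prime_in_def)
 then have "w$z = u" using u(1) uc by (simp add: m_lcomm)
 then have "w : J" using JD u by simp
 then show False using P(2) u(4) by blast
 qed
 moreover have "?A <= localization R ?A P" using subset_localization[OF A(1) P(1)] by blast
 ultimately show ?thesis using that poly_localization_valuation_ring[OF k T P(1)] by blast
qed

end

section \<open>The function field of a short Weierstrass equation\<close>

locale weierstrass_function_field = field R for R (structure) +
 fixes k x y a b
 assumes k: "subfield k R" and xc: "x : carrier R" and yc: "y : carrier R"
 and tr: "transcendental k x" and ab: "a : k" "b : k"
 and eq: "y$y = x$x$x+.a$x+.b"
 and disc: "[(4::nat)] #. (a$a$a)+.[(27::nat)] #. (b$b) ~= 0."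
 and two: "1.+.1. ~= 0."
 and gen: "generate_field R (k \<union> {x, y}) = carrier R"

begin

abbreviation "E \<equiv> funfield k x"

abbreviation "x1 \<equiv> inv x"

text \<open>The coordinate at infinity. \<open>Y$Y\<close> is \<open>x1\<close> times a unit there,
  so \<open>Y\<close> is a uniformizer, and the field is quadratic over k(x) by \<open>Y\<close> as
  well as by \<open>y\<close>, since y = x^2 Y.\<close>

abbreviation "Y \<equiv> y$x1$x1"

lemmas kf = sf_facts[OF k]

lemmas ff = funfield_facts[OF kf(1) xc]

lemmas ef = sf_facts[OF ff(1)]

lemmas ecl = subcl[OF ef(1)]

lemma abc: "a : carrier R" "b : carrier R"
 using ab kf(2) by blast+

lemma x0: "x ~= 0." and tr1: "transcendental k x1"
 using transcendental_inv[OF k xc tr] by blast+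

lemma x1c: "x1 : carrier R" "x1 ~= 0." "x1 : E"
 using xc x0 ef(3)[OF ff(4)] by auto

lemma Yc: "Y : carrier R"
 using yc x1c by simp

lemma E_x1: "funfield k x1 = E"
proof
 note f1 = funfield_facts[OF kf(1) x1c(1)]
 show "funfield k x1 <= E" using f1(6)[OF ff(1) ff(3) x1c(3)] .
 have "inv x1 : funfield k x1" using sf_facts(3)[OF f1(1) f1(4)] x1c by blast
 then show "E <= funfield k x1" using ff(6)[OF f1(1) f1(3)] xc x0 by simp
qed

lemma Y_square: "Y$Y = x1$( 1.+.(a$x1+.b$x1$x1)$x1)"
proof -
 have "Y$Y = (y$y)$(x1$x1$x1$x1)"
 by (reify rsimps, rule ring_id, simp add: yc x1c, simp, code_simp)
 also have "... = (x$x1)$(x$x1)$(x$x1)$x1+.a$(x$x1)$x1$x1$x1+.b$x1$x1$x1$x1"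
 unfolding eq by (reify rsimps, rule ring_id, simp add: xc x1c abc, simp, code_simp)
 also have "... = x1+.a$x1$x1$x1+.b$x1$x1$x1$x1"
 using xc x0 x1c abc by simp
 also have "... = x1$( 1.+.(a$x1+.b$x1$x1)$x1)"
 by (reify rsimps, rule ring_id, simp add: xc x1c abc, simp, code_simp)
 finally show ?thesis .
qed

lemma Y_square_unit:
 assumes T: "local_subring R T" "k <= T" "x1 : nonunits R T"
 obtains u where "Y$Y = x1$u" "u : T" "u ~: nonunits R T"
proof -
 note t = lsubD[OF T(1)] note tcl = subcl[OF t(1)]
 have xT: "x1 : T" using T(3) nonunits_iff[OF t(1)] by blast
 have abT: "a : T" "b : T" using ab T(2) by blast+
 let ?m = "(a$x1+.b$x1$x1)$x1"
 have s: "a$x1+.b$x1$x1 : T"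
 using tcl(5)[OF tcl(4)[OF abT(1) xT] tcl(4)[OF tcl(4)[OF abT(2) xT] xT]] .
 have "x1$(a$x1+.b$x1$x1) : nonunits R T" using nonunits_mult[OF t(1) T(3) s] .
 moreover have "x1$(a$x1+.b$x1$x1) = ?m"
 by (reify rsimps, rule ring_id, simp add: x1c abc, simp, code_simp)
 ultimately have "?m : nonunits R T" by simp
 then have "1.+.?m : T" "1.+.?m ~: nonunits R T"
 using unit_add_nonunit[OF T(1) tcl(2) one_unit[OF t(1)]] by blast+
 then show ?thesis using that Y_square by blast
qed

text \<open>The point x1 = 0 of the line. Since \<open>Y$Y\<close> is \<open>x1\<close> times a
  unit, it may serve as the uniformizer, as the ramified case of the double cover demands.\<close>

lemma infinity_base:
 "\<exists>Q. valuation_ring R E Q & rational_over R k Q & x1 : nonunits R Q &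
 Y$Y : nonunits R Q & (\<forall>v\<in>nonunits R Q. \<exists>w\<in>Q. v = (Y$Y)$w) &
 (\<forall>T. local_subring R T --> k <= T --> x1 : nonunits R T --> Q <= T & nonunits R Q <= nonunits R T)"
proof -
 have z: "x1-.0. = x1" using x1c by (simp add: minus_eq)
 obtain Q where Q: "valuation_ring R (funfield k x1) Q" "rational_over R k Q" "x1-.0. : nonunits R Q"
 "\<forall>v\<in>nonunits R Q. \<exists>w\<in>Q. v = (x1-.0.)$w"
 "\<forall>T. local_subring R T --> k <= T --> x1-.0. : nonunits R T --> Q <= T & nonunits R Q <= nonunits R T"
 using point_valuation_ring[OF k x1c(1) tr1 subcl(1)[OF kf(1)]] by blast
 note Q = Q[unfolded z E_x1, rule_format]
 note q = valuation_ringD[OF Q(1)] note qcl = subcl[OF q(1)]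
 have L: "local_subring R Q" by (rule valuation_ring_local[OF Q(1) ff(1)])
 have kQ: "k <= Q" using Q(2) by (simp add: rational_over_def)
 obtain u where u: "Y$Y = x1$u" "u : Q" "u ~: nonunits R Q" using Y_square_unit[OF L kQ Q(3)] by blast
 note iu = unit_inv[OF q(1) u(2,3)]
 have uc: "u : carrier R" using u subcarr[OF q(1)] by blast
 have g: "Y$Y : nonunits R Q" unfolding u(1) by (rule nonunits_mult[OF q(1) Q(3) u(2)])
 have "\<exists>w\<in>Q. v = (Y$Y)$w" if v: "v : nonunits R Q" for v
 proof -
 obtain w where w: "w : Q" "v = x1$w" using Q(4)[OF v] by blast
 have wc: "w : carrier R" using w subcarr[OF q(1)] by blast
 have "v = (x1$u)$(inv u$w)" using w x1c uc wc iu(1) by (simp add: m_assoc)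
 then show ?thesis using u(1) qcl(4)[OF iu(2) w(1)] by auto
 qed
 then show ?thesis using Q(1,2,3,5) g by blast
qed

text \<open>Ramification at infinity: if \<open>Y\<close> were in k(x), it would be a nonunit and
  thus a multiple of the uniformizer \<open>Y$Y\<close>, which would make it invertible.\<close>

lemma Y_notin: "Y ~: E"
proof
 assume YE: "Y : E"
 obtain Q where Q: "valuation_ring R E Q" "rational_over R k Q" "x1 : nonunits R Q"
 "Y$Y : nonunits R Q" "\<forall>v\<in>nonunits R Q. \<exists>w\<in>Q. v = (Y$Y)$w"
 "\<forall>T. local_subring R T --> k <= T --> x1 : nonunits R T --> Q <= T & nonunits R Q <= nonunits R T"
 using infinity_base by blast
 note Q = Q[rule_format]
 note q = valuation_ringD[OF Q(1)] note qcl = subcl[OF q(1)]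
 have gn: "Y$Y : Q" using Q(4) nonunits_iff[OF q(1)] by blast
 have Y0: "Y ~= 0."
 proof
 assume "Y = 0."
 moreover obtain w where "w : Q" "x1 = (Y$Y)$w" using Q(5)[OF Q(3)] by blast
 ultimately show False using x1c subcarr[OF q(1)] by simp
 qed
 have YQ: "Y : Q"
 proof (rule ccontr)
 assume "Y ~: Q"
 then have "inv Y : Q" using q(4)[OF YE Y0] by blast
 then have "inv Y$(Y$Y) : Q" using qcl(4) gn by blast
 then show False using \<open>Y \<notin> Q\<close> Yc Y0 by simp
 qed
 have "Y : nonunits R Q" using unit_mult(2)[OF q(1) YQ _ YQ] Q(4) by blast
 then obtain h where h: "h : Q" "Y = (Y$Y)$h" using Q(5) by blast
 have hc: "h : carrier R" using h subcarr[OF q(1)] by blast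
 have "inv Y$Y = inv Y$((Y$Y)$h)" using h(2) by simp
 then have "1. = Y$h" using Yc Y0 hc by (simp add: m_assoc)
 then have "1. : nonunits R Q" using nonunits_mult[OF q(1) \<open>Y \<in> nonunits R Q\<close> h(1)] by simp
 then show False using one_unit[OF q(1)] by blast
qed

lemma y_Y: "y = x$x$Y"
proof -
 have "x$x$Y = (x$x1)$(x$x1)$y"
 by (reify rsimps, rule ring_id, simp add: xc x1c yc, simp, code_simp)
 then show ?thesis using xc x0 yc by simp
qed

lemma xx: "x$x : E"
 using ecl(4)[OF ff(4) ff(4)] .

lemma y_notin: "y ~: E"
 using Y_notin ecl(4)[OF ecl(4)[OF _ x1c(3)] x1c(3)] by blast

lemma carrier_quadratic:
 assumes Z: "Z : carrier R" "Z$Z : E" and e: "e : E" "y = e$Z"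
 shows "carrier R = {u+.v$Z | u v. u : E & v : E}" (is "_ = ?B")
proof
 have B: "subfield ?B R" by (rule quadratic_extension_subfield[OF ff(1) Z])
 have EB: "E <= ?B"
 proof
 fix u assume "u : E"
 moreover from this have "u = u+.0.$Z" using ef(2) Z by simp
 ultimately show "u : ?B" using ecl(1) by blast
 qed
 have "y = 0.+.e$Z" using e ef(2) Z by simp
 then have "y : ?B" using ecl(1) e(1) by blast
 then have "k \<union> {x, y} <= ?B" using EB ff(3,4) by blast
 moreover have "k \<union> {x, y} <= carrier R" using kf(2) xc yc by blast
 ultimately show "carrier R <= ?B" using generate_field_min_subfield1[OF _ B] gen by blast
 show "?B <= carrier R" using sf_facts(2)[OF B] by blast
qed

text \<open>The ramified double cover over x1 = 0, at the residue class \<open>Y\<close> = 0.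
  Besides the universal property it yields that \<open>Y\<close> is a uniformizer, on which the
  comparison of pole orders rests.\<close>

lemma infinity_place:
 "\<exists>S. place R k S & x1 : nonunits R S & Y : nonunits R S &
 (\<forall>T. local_subring R T --> k <= T --> x1 : nonunits R T --> Y : nonunits R T -->
 S <= T & nonunits R S <= nonunits R T) &
 (\<forall>v\<in>nonunits R S. \<exists>w\<in>S. v = Y$w)"
proof -
 obtain Q where Q: "valuation_ring R E Q" "rational_over R k Q" "x1 : nonunits R Q"
 "Y$Y : nonunits R Q" "\<forall>v\<in>nonunits R Q. \<exists>w\<in>Q. v = (Y$Y)$w"
 "\<forall>T. local_subring R T --> k <= T --> x1 : nonunits R T --> Q <= T & nonunits R Q <= nonunits R T"
 using infinity_base by blast
 note Q = Q[rule_format]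
 note q = valuation_ringD[OF Q(1)]
 have gQ: "Y$Y : Q" using Q(4) nonunits_iff[OF q(1)] by blast
 have z: "0. : k" "Y-.0. = Y" using subcl(1)[OF kf(1)] Yc by (auto simp: minus_eq)
 have cg: "0.$0.-.Y$Y : nonunits R Q"
 using nonunits_neg[OF q(1) Q(4)] Yc by (simp add: minus_eq)
 have C: "carrier R = {u+.v$Y | u v. u : E & v : E}"
 using gQ q(2) by (intro carrier_quadratic[OF Yc _ xx y_Y]) blast
 have sm: "0. ~= 0. \<or> (\<forall>v\<in>nonunits R Q. \<exists>w\<in>Q. v = (Y$Y)$w)" using Q(5) by blast
 obtain S where S: "place R k S" "Q <= S" "nonunits R Q <= nonunits R S" "Y-.0. : nonunits R S"
 "\<forall>T. local_subring R T --> Q <= T --> nonunits R Q <= nonunits R T --> Y-.0. : nonunits R T -->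
 S <= T & nonunits R S <= nonunits R T"
 "0. = 0. --> (\<forall>v\<in>nonunits R S. \<exists>w\<in>S. v = Y$w)"
 using double_cover_valuation_ring[OF k ff(1) Q(1,2) Yc Y_notin gQ z(1) cg two sm C]
 by (elim exE conjE) (rule that)
 note S = S(1-4) S(5)[rule_format] S(6)[rule_format, OF refl]
 show ?thesis
 proof (rule exI[of _ S], intro conjI ballI allI impI)
 show "place R k S" by (rule S(1))
 show "x1 : nonunits R S" using S(3) Q(3) by blast
 show "Y : nonunits R S" using S(4) unfolding z(2) .
 show "\<exists>w\<in>S. v = Y$w" if "v : nonunits R S" for v using S(6)[OF that] .
 fix T assume T: "local_subring R T" "k <= T" "x1 : nonunits R T" "Y : nonunits R T"
 have "S <= T & nonunits R S <= nonunits R T"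
 using S(5)[OF T(1)] Q(6)[OF T(1-3)] T(4) unfolding z(2) by blast
 then show "S <= T" "nonunits R S <= nonunits R T" by blast+
 qed
qed

text \<open>For nonzero \<open>h\<close> the cover is unramified over x = e. For \<open>h\<close> =
  0 the right hand side is \<open>x-.e\<close> times a cofactor with value 3e^2 + a at
  \<open>e\<close>, the derivative; as the discriminant is nonzero this is a unit, so
  \<open>y$y\<close> is a uniformizer of the base.\<close>

lemma point_place:
 assumes e: "e : k" "h : k" "h$h = e$e$e+.a$e+.b"
 shows "\<exists>S. place R k S & x-.e : nonunits R S & y-.h : nonunits R S &
 (\<forall>T. local_subring R T --> k <= T --> x-.e : nonunits R T --> y-.h : nonunits R T -->
 S <= T & nonunits R S <= nonunits R T)"
proof -
 have ec: "e : carrier R" "h : carrier R" using e kf(2) by blast+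
 obtain Q where Q: "valuation_ring R E Q" "rational_over R k Q" "x-.e : nonunits R Q"
 "\<forall>v\<in>nonunits R Q. \<exists>w\<in>Q. v = (x-.e)$w"
 "\<forall>T. local_subring R T --> k <= T --> x-.e : nonunits R T --> Q <= T & nonunits R Q <= nonunits R T"
 "simple_extension k x <= Q"
 using point_valuation_ring[OF k xc tr e(1)] by blast
 note Q = Q[rule_format]
 note q = valuation_ringD[OF Q(1)] note qcl = subcl[OF q(1)]
 have L: "local_subring R Q" by (rule valuation_ring_local[OF Q(1) ff(1)])
 have kQ: "k <= Q" using Q(2) by (simp add: rational_over_def)
 have xQ: "x : Q" "e : Q" "a : Q" "b : Q" using Q(6) polys_subring(3)[OF kf(1) xc] kQ e ab by blast+
 have yQ: "y$y : Q"
 unfolding eq using qcl(5)[OF qcl(5)[OF qcl(4)[OF qcl(4)[OF xQ(1,1)] xQ(1)] qcl(4)[OF xQ(3,1)]] xQ(4)] .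
 let ?q = "x$x+.x$e+.e$e+.a"
 have qQ: "?q : Q"
 using qcl(5)[OF qcl(5)[OF qcl(5)[OF qcl(4)[OF xQ(1,1)] qcl(4)[OF xQ(1,2)]] qcl(4)[OF xQ(2,2)]] xQ(3)] .
 have f: "y$y = h$h+.(x-.e)$?q"
 unfolding e(3) eq by (reify rsimps, rule ring_id, simp add: ec xc abc, simp, code_simp)
 have cg: "h$h-.y$y : nonunits R Q"
 proof -
 have "h$h-.y$y = (x-.e)$( -. ?q)"
 unfolding f by (reify rsimps, rule ring_id, simp add: ec xc abc, simp, code_simp)
 then show ?thesis using nonunits_mult[OF q(1) Q(3) qcl(3)[OF qQ]] by simp
 qed
 have sm: "h ~= 0. \<or> (\<forall>v\<in>nonunits R Q. \<exists>w\<in>Q. v = (y$y)$w)"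
 proof (cases "h = 0.")
 case True
 have fe: "e$e$e+.a$e+.b = 0." using e(3) True by simp
 let ?d = "[(3::nat)] #. (e$e)+.a"
 have dk: "?d : k"
 using subcl(5)[OF kf(1) subcl(8)[OF kf(1) subcl(4)[OF kf(1) e(1,1)]] ab(1)] .
 have d0: "?d ~= 0."
 proof
 assume d: "?d = 0."
 \<comment> \<open>The discriminant as a combination of the cubic and its derivative at
   \<open>e\<close>.\<close>
 have "[(4::nat)] #. (a$a$a)+.[(27::nat)] #. (b$b) =
 ([(27::nat)] #. b-.[(18::nat)] #. (a$e))$(e$e$e+.a$e+.b) +.
 ([(6::nat)] #. (a$e$e)-.[(9::nat)] #. (b$e)+.[(4::nat)] #. (a$a))$?d"
 by (reify rsimps, rule ring_id, simp add: ec abc, simp, code_simp)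
 then show False using disc unfolding fe d using ec abc by simp
 qed
 let ?m = "(x-.e)$(x+.[(2::nat)] #. e)"
 have m: "?m : nonunits R Q" using nonunits_mult[OF q(1) Q(3) qcl(5)[OF xQ(1) qcl(8)[OF xQ(2)]]] .
 have qm: "?q = ?d+.?m" by (reify rsimps, rule ring_id, simp add: ec xc abc, simp, code_simp)
 have qu: "?q ~: nonunits R Q"
 unfolding qm using unit_add_nonunit(2)[OF L subfield_unit[OF k kQ q(1) dk d0] m] .
 note iq = unit_inv[OF q(1) qQ qu]
 have qc: "?q : carrier R" using qQ subcarr[OF q(1)] by blast
 have yy: "y$y = (x-.e)$?q" using f True xc ec abc by simp
 have "\<exists>w\<in>Q. v = (y$y)$w" if v: "v : nonunits R Q" for v
 proof -
 obtain w where w: "w : Q" "v = (x-.e)$w" using Q(4)[OF v] by blast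
 have wc: "w : carrier R" using w subcarr[OF q(1)] by blast
 have "(y$y)$(inv ?q$w) = (x-.e)$(?q$(inv ?q$w))"
 unfolding yy using qc iq(1) wc xc ec by (intro m_assoc) auto
 also have "... = v" unfolding w(2) mult_inv_cancel(1)[OF qc iq(1) wc] ..
 finally have "v = (y$y)$(inv ?q$w)" by simp
 then show ?thesis using qcl(4)[OF iq(2) w(1)] by blast
 qed
 then show ?thesis by blast
 qed simp
 have C: "carrier R = {u+.v$y | u v. u : E & v : E}"
 using yQ q(2) ecl(2) yc by (intro carrier_quadratic[OF yc, of \<one>]) auto
 obtain S where S: "place R k S" "Q <= S" "nonunits R Q <= nonunits R S" "y-.h : nonunits R S"
 "\<forall>T. local_subring R T --> Q <= T --> nonunits R Q <= nonunits R T --> y-.h : nonunits R T -->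
 S <= T & nonunits R S <= nonunits R T"
 using double_cover_valuation_ring[OF k ff(1) Q(1,2) yc y_notin yQ e(2) cg two sm C]
 by (elim exE conjE) (rule that)
 note S = S[rule_format]
 show ?thesis
 proof (rule exI[of _ S], intro conjI ballI allI impI)
 show "place R k S" by (rule S(1))
 show "x-.e : nonunits R S" using S(3) Q(3) by blast
 show "y-.h : nonunits R S" by (rule S(4))
 fix T assume T: "local_subring R T" "k <= T" "x-.e : nonunits R T" "y-.h : nonunits R T"
 have "S <= T & nonunits R S <= nonunits R T"
 using S(5)[OF T(1)] Q(5)[OF T(1-3)] T(4) by blast
 then show "S <= T" "nonunits R S <= nonunits R T" by blast+
 qed
qed

end

section \<open>Points of the equation and places of the field\<close>

context weierstrass_function_field

begin

lemma curve_equation_in_residue: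
 assumes T: "local_subring R T" "k <= T" "x : T" "y : T"
 and e: "e : k" "h : k" "x-.e : nonunits R T" "y-.h : nonunits R T"
 shows "h$h = e$e$e+.a$e+.b"
proof -
 note t = lsubD[OF T(1)] note tcl = subcl[OF t(1)] note kcl = subcl[OF kf(1)]
 have ec: "e : carrier R" "h : carrier R" "e : T" "h : T" "a : T" using e kf(2) T ab by blast+
 let ?d = "h$h-.(e$e$e+.a$e+.b)"
 have "?d = (x-.e)$(x$x+.x$e+.e$e+.a)-.(y-.h)$(y+.h) +.
 (y$y-.(x$x$x+.a$x+.b))"
 by (reify rsimps, rule ring_id, simp add: ec xc yc abc, simp, code_simp)
 also have "... = (x-.e)$(x$x+.x$e+.e$e+.a)-.(y-.h)$(y+.h)"
 unfolding eq using ec xc yc abc by (simp add: r_neg minus_eq)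
 also have "... : nonunits R T"
 proof (rule t(3))
 have "x$x+.x$e+.e$e+.a : T"
 using tcl(5)[OF tcl(5)[OF tcl(5)[OF tcl(4)[OF T(3,3)] tcl(4)[OF T(3) ec(3)]] tcl(4)[OF ec(3,3)]] ec(5)] .
 then show "(x-.e)$(x$x+.x$e+.e$e+.a) : nonunits R T"
 by (rule nonunits_mult[OF t(1) e(3)])
 show "(y-.h)$(y+.h) : nonunits R T" by (rule nonunits_mult[OF t(1) e(4) tcl(5)[OF T(4) ec(4)]])
 qed
 finally have n: "?d : nonunits R T" .
 have "?d : k"
 using kcl(6)[OF kcl(4)[OF e(2,2)] kcl(5)[OF kcl(5)[OF kcl(4)[OF kcl(4)[OF e(1,1)] e(1)] kcl(4)[OF ab(1) e(1)]] ab(2)]] .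
 then have "?d = 0." using subfield_unit(2)[OF k T(2) t(1)] n by blast
 then show ?thesis using r_right_minus_eq[of "h$h" "e$e$e+.a$e+.b"] ec abc by auto
qed

lemma local_point:
 assumes T: "local_subring R T" "rational_over R k T" "x : T" "y : T"
 shows "\<exists>e\<in>k. \<exists>h\<in>k. h$h = e$e$e+.a$e+.b & x-.e : nonunits R T & y-.h : nonunits R T"
proof -
 have kT: "k <= T" using T(2) by (simp add: rational_over_def)
 obtain e h where e: "e : k" "h : k" "x-.e : nonunits R T" "y-.h : nonunits R T"
 using T(2-4) unfolding rational_over_def by blast
 then show ?thesis using curve_equation_in_residue[OF T(1) kT T(3,4) e] by blast
qed

text \<open>\<open>y$y\<close> is integral, and a valuation ring contains the square roots of its
  elements.\<close>

lemma pole_of_y: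
 assumes V: "valuation_ring R (carrier R) V" "k <= V" and x: "x : V"
 shows "y : V"
proof (rule ccontr)
 assume n: "y ~: V"
 note v = valuation_ringD[OF V(1)] note vcl = subcl[OF v(1)]
 have abV: "a : V" "b : V" using ab V(2) by blast+
 have yy: "y$y : V"
 unfolding eq using vcl(5)[OF vcl(5)[OF vcl(4)[OF vcl(4)[OF x x] x] vcl(4)[OF abV(1) x]] abV(2)] .
 have y0: "y ~= 0." using n vcl(1) by auto
 then have "inv y : V" using v(4)[OF yc y0] n by blast
 then have "inv y$(y$y) : V" using vcl(4) yy by blast
 then show False using n yc y0 by simp
qed

lemma infinity_Y:
 assumes V: "valuation_ring R (carrier R) V" "k <= V" and x1: "x1 : nonunits R V"
 shows "Y : nonunits R V"
proof -
 note v = valuation_ringD[OF V(1)] note vcl = subcl[OF v(1)]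
 have L: "local_subring R V" by (rule valuation_ring_local[OF V(1) carrier_is_subfield])
 obtain u where u: "Y$Y = x1$u" "u : V" "u ~: nonunits R V" by (rule Y_square_unit[OF L V(2) x1])
 have yy: "Y$Y : nonunits R V" unfolding u(1) by (rule nonunits_mult[OF v(1) x1 u(2)])
 then have yV: "Y$Y : V" using nonunits_iff[OF v(1)] by blast
 have "Y : V"
 proof (rule ccontr)
 assume n: "Y ~: V"
 have y0: "Y ~= 0." using n vcl(1) by metis
 then have "inv Y : V" using v(4)[OF Yc y0] n by blast
 then have "inv Y$(Y$Y) : V" using vcl(4) yV by blast
 then show False using n mult_inv_cancel(2)[OF Yc y0 Yc] by simp
 qed
 then show ?thesis using unit_mult(2)[OF v(1), of Y Y] yy by blast
qed

text \<open>Change from the projective chart at the origin to \<open>x1\<close> and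
  \<open>Y\<close>. With w = x/y and s = 1/y the equation reads s u = w^3 for the unit u = 1 - s(aw
  + bs); hence 1/x = w^2/u and Y = w/u.\<close>

lemma infinity_coordinates:
 assumes T: "local_subring R T" "k <= T" and w: "x$inv y : nonunits R T" "inv y : nonunits R T"
 shows "x1 : nonunits R T" "Y : nonunits R T"
proof -
 note t = lsubD[OF T(1)] note tcl = subcl[OF t(1)]
 have y0: "y ~= 0." using y_notin ecl(1) by auto
 have iyc: "inv y : carrier R" using yc y0 by simp
 define w s where ws: "w = x$inv y" "s = inv y"
 have c: "w : carrier R" "s : carrier R" "y$s = 1." using ws xc yc y0 iyc by auto
 have wT: "w : T" "s : T" "a : T" "b : T" using w ws nonunits_iff[OF t(1)] ab T(2) by auto
 let ?n = "s$(a$w+.b$s)"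
 have n: "?n : nonunits R T"
 using nonunits_mult[OF t(1), of s] w(2) ws tcl(5)[OF tcl(4)[OF wT(3,1)] tcl(4)[OF wT(4,2)]] by blast
 let ?u = "1.+.-. ?n"
 have u: "?u : T" "?u ~: nonunits R T"
 using unit_add_nonunit[OF T(1) tcl(2) one_unit[OF t(1)] nonunits_neg[OF t(1) n]] .
 note iu = unit_inv[OF t(1) u]
 have uc: "?u : carrier R" "inv ?u : carrier R" using u(1) iu(2) subcarr[OF t(1)] by blast+
 have x: "x = w$y" using ws xc yc y0 by (simp add: m_assoc)
 have su: "s$?u = w$w$w"
 proof -
 have "w$w$w = (x$x$x)$(s$s$s)"
 unfolding ws by (reify rsimps, rule ring_id, simp add: xc iyc, simp, code_simp)
 also have "x$x$x = y$y-.(a$x+.b)"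
 unfolding eq by (reify rsimps, rule ring_id, simp add: xc abc, simp, code_simp)
 also have "(y$y-.(a$x+.b))$(s$s$s) =
 (y$s)$(y$s)$s-.a$(w$(y$s))$s$s-.b$s$s$s"
 unfolding x by (reify rsimps, rule ring_id, simp add: c yc abc, simp, code_simp)
 also have "... = s-.a$w$s$s-.b$s$s$s" unfolding c(3) using c by simp
 also have "... = s$?u" by (reify rsimps, rule ring_id, simp add: c abc, simp, code_simp)
 finally show ?thesis by simp
 qed
 have uu: "?u$inv ?u = 1." using inv_mult(1)[OF uc(1) iu(1)] .
 define u' where "u' = ?u"
 define v' where "v' = inv ?u"
 have uv: "u' : carrier R" "v' : carrier R" "u'$v' = 1." "s$u' = w$w$w" "v' : T"
 using uc uu su iu(2) unfolding u'_def v'_def by blast+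
 have "x$(w$w$v') = (w$w$w)$(y$v')"
 unfolding x by (reify rsimps, rule ring_id, simp add: c yc uv(2), simp, code_simp)
 also have "... = (y$s)$(u'$v')"
 unfolding uv(4)[symmetric] by (reify rsimps, rule ring_id, simp add: c yc uv(1,2), simp, code_simp)
 also have "... = 1." unfolding c(3) uv(3) by simp
 finally have x1: "x1 = w$w$v'" using xc c uv by (intro inv_unique_field) auto
 have wn: "w : nonunits R T" using w ws by simp
 show "x1 : nonunits R T"
 unfolding x1 using nonunits_mult[OF t(1) nonunits_mult[OF t(1) wn wT(1)] uv(5)] .
 have "Y = (w$w$w)$(y$w$v'$v')"
 unfolding x1 by (reify rsimps, rule ring_id, simp add: c yc uv(2), simp, code_simp)
 also have "... = (y$s)$(u'$v')$(w$v')"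
 unfolding uv(4)[symmetric] by (reify rsimps, rule ring_id, simp add: c yc uv(1,2), simp, code_simp)
 also have "... = w$v'" unfolding c(3) uv(3) using c uv by simp
 finally show "Y : nonunits R T" using nonunits_mult[OF t(1) wn uv(5)] by simp
qed

text \<open>Nonsingularity: a local ring with residue field \<open>k\<close> centered on the curve
  contains the place at its center by the universal property, and then equals it.\<close>

lemma local_place:
 assumes T: "local_subring R T" "rational_over R k T"
 and "x : T & y : T \<or> x1 : nonunits R T & Y : nonunits R T"
 shows "place R k T"
proof -
 have kT: "k <= T" using T(2) by (simp add: rational_over_def)
 have "\<exists>S. place R k S & S <= T"
 using assms(3)
 proof
 assume xy: "x : T & y : T"
 then obtain e h where e: "e : k" "h : k" "h$h = e$e$e+.a$e+.b"
 "x-.e : nonunits R T" "y-.h : nonunits R T" using local_point[OF T] by blast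
 show ?thesis using point_place[OF e(1-3)] T(1) kT e(4,5) by blast
 next
 assume h: "x1 : nonunits R T & Y : nonunits R T"
 obtain S where S: "place R k S"
 "\<forall>T. local_subring R T --> k <= T --> x1 : nonunits R T --> Y : nonunits R T -->
 S <= T & nonunits R S <= nonunits R T"
 using infinity_place by (elim exE conjE) (rule that)
 have "S <= T" using S(2)[rule_format, OF T(1) kT] h by blast
 then show ?thesis using S(1) by blast
 qed
 then obtain S where S: "place R k S" "S <= T" by blast
 show ?thesis using place_eq[OF k S(1) T S(2)] S(1) by simp
qed

definition centered :: "'a set => ('a \<times> 'a) option => bool" where
 "centered V P \<longleftrightarrow> (case P of None => x1 : nonunits R V & Y : nonunits R V
 | Some (e, h) => x-.e : nonunits R V & y-.h : nonunits R V)"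

lemma weierstrass_points_short:
 "weierstrass_points (R(|carrier := k|)) (Weierstrass 0. 0. 0. a b) =
 insert None (Some ` {(e, h). e : k & h : k & h$h = e$e$e+.a$e+.b})"
proof -
 have "weierstrass_eq (R(|carrier := k|)) (Weierstrass 0. 0. 0. a b) e h \<longleftrightarrow>
 h$h = e$e$e+.a$e+.b" if "e : k" "h : k" for e h
 using kf(2)[OF that(1)] kf(2)[OF that(2)] abc by (simp add: numeral_eq_Suc nat_pow_def)
 then show ?thesis by (auto simp: weierstrass_points_def)
qed

text \<open>The universal property leaves only one place above each point. Conversely a place has an
  affine center if \<open>x\<close> is integral and is centered at infinity otherwise, and the
  residues of \<open>x\<close> and \<open>y\<close> determine the center.\<close>

lemma bij_points_places:
 "\<exists>f. bij_betw f (weierstrass_points (R(|carrier := k|)) (Weierstrass 0. 0. 0. a b)) {V. place R k V}"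
proof -
 define Pts where "Pts = weierstrass_points (R(|carrier := k|)) (Weierstrass 0. 0. 0. a b)"
 have PtsD: "P = None \<or> (\<exists>e h. P = Some (e, h) & e : k & h : k & h$h = e$e$e+.a$e+.b)"
 if "P : Pts" for P
 using that unfolding Pts_def weierstrass_points_short by blast
 have PtsI: "None : Pts"
 "!!e h. e : k ==> h : k ==> h$h = e$e$e+.a$e+.b ==> Some (e, h) : Pts"
 unfolding Pts_def weierstrass_points_short by blast+
 have cN: "centered V None \<longleftrightarrow> x1 : nonunits R V & Y : nonunits R V" for V
 by (simp add: centered_def)
 have cS: "centered V (Some (e, h)) \<longleftrightarrow> x-.e : nonunits R V & y-.h : nonunits R V" for V e h
 by (simp add: centered_def)
 have ex: "\<exists>S. place R k S & centered S P & (\<forall>V. place R k V --> centered V P --> V = S)"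
 if P: "P : Pts" for P
 using PtsD[OF P]
 proof
 assume N: "P = None"
 obtain S where S: "place R k S" "x1 : nonunits R S" "Y : nonunits R S"
 "\<forall>T. local_subring R T --> k <= T --> x1 : nonunits R T --> Y : nonunits R T -->
 S <= T & nonunits R S <= nonunits R T"
 using infinity_place by (elim exE conjE) (rule that)
 have "V = S" if V: "place R k V" "centered V P" for V
 proof -
 have "S <= V" using S(4)[rule_format, OF placeD(3,4)[OF V(1)]] V(2) unfolding N cN by blast
 then show ?thesis by (rule place_eq[OF k S(1) placeD(3,2)[OF V(1)]])
 qed
 then show ?thesis using S(1-3) unfolding N cN by blast
 next
 assume "\<exists>e h. P = Some (e, h) & e : k & h : k & h$h = e$e$e+.a$e+.b"
 then obtain e h where e: "P = Some (e, h)" "e : k" "h : k" "h$h = e$e$e+.a$e+.b" by blast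
 obtain S where S: "place R k S" "x-.e : nonunits R S" "y-.h : nonunits R S"
 "\<forall>T. local_subring R T --> k <= T --> x-.e : nonunits R T --> y-.h : nonunits R T -->
 S <= T & nonunits R S <= nonunits R T"
 using point_place[OF e(2-4)] by blast
 have "V = S" if V: "place R k V" "centered V P" for V
 proof -
 have "S <= V" using S(4)[rule_format, OF placeD(3,4)[OF V(1)]] V(2) unfolding e(1) cS by blast
 then show ?thesis by (rule place_eq[OF k S(1) placeD(3,2)[OF V(1)]])
 qed
 then show ?thesis using S(1-3) unfolding e(1) cS by blast
 qed
 define f where "f P = (SOME S. place R k S & centered S P & (\<forall>V. place R k V --> centered V P --> V = S))" for P
 have f: "place R k (f P)" "centered (f P) P" "!!V. place R k V ==> centered V P ==> V = f P"
 if "P : Pts" for P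
 using someI_ex[OF ex[OF that]] unfolding f_def[symmetric] by blast+
 have cover: "\<exists>P\<in>Pts. centered V P" if V: "place R k V" for V
 proof (cases "x : V")
 case True
 note p = placeD[OF V]
 obtain e h where e: "e : k" "h : k" "h$h = e$e$e+.a$e+.b"
 "x-.e : nonunits R V" "y-.h : nonunits R V"
 using local_point[OF p(3,2) True pole_of_y[OF p(1,4) True]] by blast
 show ?thesis using PtsI(2)[OF e(1-3)] cS e(4,5) by blast
 next
 case False
 note p = placeD[OF V]
 have "x1 : nonunits R V" using valuation_ringD(3)[OF p(1) xc False] .
 then show ?thesis using infinity_Y[OF p(1,4)] PtsI(1) cN by blast
 qed
 have same: "P = Q" if V: "place R k V" and PQ: "P : Pts" "Q : Pts" "centered V P" "centered V Q" for V P Q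
 proof -
 note p = placeD[OF V] note l = lsubD[OF p(3)]
 have no: False if h: "x1 : nonunits R V" "e : k" "x-.e : nonunits R V" for e
 proof -
 have ec: "e : carrier R" "e : V" using h kf(2) p(4) by blast+
 have "x-.e : V" using h nonunits_iff[OF l(1)] by blast
 then have "(x-.e)+.e : V" using subcl(5)[OF l(1)] ec by blast
 moreover have "(x-.e)+.e = x" using xc ec by (simp add: minus_eq a_assoc l_neg)
 ultimately have "x1$x : nonunits R V" using nonunits_mult[OF l(1) h(1)] by simp
 then show False using one_unit[OF l(1)] xc x0 by simp
 qed
 have diff: "c = d" if h: "z : carrier R" "c : k" "d : k" "z-.c : nonunits R V" "z-.d : nonunits R V" for z c d
 proof -
 have cc: "c : carrier R" "d : carrier R" using h kf(2) by blast+
 have "(z-.d)-.(z-.c) : nonunits R V" using l(3) h by blast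
 moreover have "(z-.d)-.(z-.c) = c-.d"
 by (reify rsimps, rule ring_id, simp add: cc h(1), simp, code_simp)
 ultimately have n: "c-.d : nonunits R V" by simp
 have "c-.d : k" using subcl(6)[OF kf(1) h(2,3)] .
 then have "c-.d = 0." using subfield_unit(2)[OF k p(4) l(1)] n by blast
 then show ?thesis using cc r_right_minus_eq by blast
 qed
 consider "P = None" "Q = None" | e h where "P = None" "Q = Some (e, h)" "e : k"
 | e h where "P = Some (e, h)" "Q = None" "e : k"
 | e h e' h' where "P = Some (e, h)" "Q = Some (e', h')" "e : k" "h : k" "e' : k" "h' : k"
 using PtsD[OF PQ(1)] PtsD[OF PQ(2)] by blast
 then show ?thesis
 proof cases
 case (4 e h e' h')
 then show ?thesis using PQ(3,4) diff[OF xc, of e e'] diff[OF yc, of h h'] cS by blast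
 qed (use PQ(3,4) no cN cS in blast)+
 qed
 have "bij_betw f Pts {V. place R k V}"
 unfolding bij_betw_def
 proof
 show "inj_on f Pts"
 proof (rule inj_onI)
 fix P Q assume "P : Pts" "Q : Pts" "f P = f Q"
 then show "P = Q" using same[OF f(1)[of P], of P Q] f(2)[of P] f(2)[of Q] by auto
 qed
 show "f ` Pts = {V. place R k V}"
 proof
 show "f ` Pts <= {V. place R k V}" using f(1) by blast
 show "{V. place R k V} <= f ` Pts"
 proof
 fix V assume "V : {V. place R k V}"
 then obtain P where "P : Pts" "V = f P" using cover f(3) by blast
 then show "V : f ` Pts" by blast
 qed
 qed
 qed
 then show ?thesis unfolding Pts_def by blast
qed

lemma algebraic_in_constants:
 assumes "z : carrier R" "~ transcendental k z"
 shows "z : k"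
proof -
 obtain S where "place R k S" using infinity_place by (elim exE conjE) (rule that)
 then show ?thesis using placeD(1,2) algebraic_constants[OF k _ _ assms] by blast
qed

lemma x_notin_k: "x ~: k"
 using algebraic_self[OF kf(1)] tr by (auto simp: over_def)

text \<open>If the generator has a finite value \<open>c\<close> at \<open>S\<close>, the generator
  1/(T - c) has a pole there.\<close>

lemma funfield_generator_at_infinity:
 assumes T: "T : carrier R" "funfield k T = carrier R" and S: "place R k S"
 shows "\<exists>T'\<in>carrier R. funfield k T' = carrier R & T' ~: S"
proof (cases "T : S")
 case True
 note s = placeD[OF S]
 obtain c where c: "c : k" "T-.c : nonunits R S" using s(2) True unfolding rational_over_def by blast
 have cc: "c : carrier R" using c kf(2) by blast
 have "T ~: k"
 proof
 assume "T : k"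
 then have "funfield k T <= k" using funfield_facts(6)[OF kf(1) T(1) k] by blast
 then show False using T(2) xc x_notin_k by blast
 qed
 then have "T ~= c" using c(1) by blast
 then have d: "T-.c ~= 0." "T-.c : carrier R" using cc T(1) r_right_minus_eq[OF T(1) cc] by auto
 let ?T = "inv (T-.c)"
 have Tc: "?T : carrier R" "?T ~= 0." using d by simp_all
 note f = funfield_facts[OF kf(1) Tc(1)] note fs = sf_facts[OF f(1)]
 have "inv ?T : funfield k ?T" using fs(3)[OF f(4) Tc(2)] .
 then have "T-.c : funfield k ?T" using inv_inv_field[OF d(2,1)] by simp
 then have "(T-.c)+.c : funfield k ?T" using subcl(5)[OF fs(1)] c(1) f(3) by blast
 moreover have "(T-.c)+.c = T" using T cc by (simp add: minus_eq a_assoc l_neg)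
 ultimately have "carrier R <= funfield k ?T" using funfield_facts(6)[OF kf(1) T(1) f(1) f(3)] T(2) by simp
 moreover have "funfield k ?T <= carrier R" using fs(2) by blast
 moreover have "?T ~: S" using c(2) d nonunits_iff[OF s(5)] by blast
 ultimately show ?thesis using Tc by blast
qed (use T in blast)

end

section \<open>Pole orders measured by powers of one element\<close>

context field

begin

lemma polys_leading:
 assumes k: "subring k R" and T: "T : carrier R" and z: "z : simple_extension k T" "z ~= 0."
 shows "\<exists>c cs. c : k & c ~= 0. & set cs <= k & z = eval (c # cs) T"
proof -
 obtain p where p: "set p <= k" "z = eval p T" using z polys_iff[OF k T] by blast
 show ?thesis using p
 proof (induct p)
 case Nil then show ?case using z by simp
 next
 case (Cons c cs)
 show ?case
 proof (cases "c = 0.")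
 case True
 have "set cs <= carrier R" using Cons(2) subringE(1)[OF k] by auto
 then have "z = eval cs T" using Cons(3) True T by (simp add: eval_zero_prefix)
 then show ?thesis using Cons by auto
 next
 case False then show ?thesis using Cons(2,3) by auto
 qed
 qed
qed

text \<open>The leading term dominates at a pole of \<open>T\<close>, so the degree of a polynomial
  in \<open>T\<close> becomes an exact exponent.\<close>

lemma eval_at_pole:
 assumes k: "subfield k R" and V: "local_subring R V" "k <= V"
 and T: "T : carrier R" "T ~= 0." "inv T : nonunits R V"
 and c: "c : k" "c ~= 0." "set cs <= k"
 shows "\<exists>u\<in>V. u ~: nonunits R V & eval (c # cs) T = T [^] length cs$u"
proof -
 note v = lsubD[OF V(1)] note vcl = subcl[OF v(1)] note kf = sf_facts[OF k]
 have t: "inv T : carrier R" "inv T : V" using T nonunits_iff[OF v(1)] by auto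
 have TT: "T [^] n$inv T [^] n = 1." for n :: nat using T t by (simp flip: nat_pow_distrib)
 have *: "eval cs T$inv T [^] length cs : nonunits R V" if "set cs <= k" for cs
 using that
 proof (induct cs)
 case Nil then show ?case using zero_nonunit[OF v(1)] by simp
 next
 case (Cons d cs)
 let ?n = "length cs"
 have d: "d : carrier R" "d : V" "set cs <= carrier R" using Cons(2) kf(2) V(2) by auto
 have m: "inv T$(eval cs T$inv T [^] ?n) : nonunits R V" "inv T$d : nonunits R V"
 using nonunits_mult[OF v(1) T(3)] d(2) Cons nonunits_iff[OF v(1)] by auto
 have "eval (d # cs) T$inv T [^] Suc ?n =
 inv T$(eval cs T$inv T [^] ?n)+.inv T$d$(T [^] ?n$inv T [^] ?n)"
 unfolding eval_Cons nat_pow_Suc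
 by (reify rsimps, rule ring_id, simp add: d T t, simp, code_simp)
 then show ?case using v(2)[OF m] TT d t by simp
 qed
 have cc: "c : carrier R" "c : V" "set cs <= carrier R" using c kf(2) V(2) by auto
 let ?m = "eval cs T$inv T [^] length cs"
 have "T [^] length cs$(c+.?m) = c$T [^] length cs+.eval cs T$(T [^] length cs$inv T [^] length cs)"
 by (reify rsimps, rule ring_id, simp add: cc T t, simp, code_simp)
 then have "eval (c # cs) T = T [^] length cs$(c+.?m)" using cc T by (simp add: eval_Cons TT)
 then show ?thesis
 using unit_add_nonunit[OF V(1) cc(2) subfield_unit(2)[OF k V(2) v(1) c(1,2)] *[OF c(3)]] by blast
qed

text \<open>Comparison of pole orders: a surplus power of \<open>T\<close> on the left would make
  the unit \<open>u\<close> a multiple of the nonunit \<open>inv T\<close>.\<close>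

lemma pole_power:
 assumes V: "subring V R" and T: "T : carrier R" "T ~= 0." "inv T : nonunits R V"
 and u: "u : V" "u ~: nonunits R V" and w: "w : V" and e: "T [^] (i::nat)$u = T [^] (j::nat)$w"
 shows "i <= j"
proof (rule ccontr)
 assume "~ i <= j"
 then obtain d where d: "i = Suc d + j" using less_imp_Suc_add[of j i] by auto
 have c: "u : carrier R" "w : carrier R" using u w subcarr[OF V] by blast+
 have t: "inv T : carrier R" "inv T : V" using T nonunits_iff[OF V] by auto
 have "T [^] j$(T [^] Suc d$u) = T [^] j$w"
 using e T(1) c d by (simp add: m_ac flip: nat_pow_mult)
 then have "T [^] Suc d$u = w" using m_lcancel[of "T [^] j"] T c by simp
 then have w': "w = T [^] Suc d$u" by simp
 have "inv T [^] Suc d$w = (T [^] Suc d$inv T [^] Suc d)$u"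
 unfolding w' by (reify rsimps, rule ring_id, simp add: T t c, simp, code_simp)
 also have "T [^] Suc d$inv T [^] Suc d = 1."
 using nat_pow_distrib[OF T(1) t(1), of "Suc d"] inv_mult(1)[OF T(1,2)] by (simp only: nat_pow_one)
 finally have "u = (inv T [^] d$inv T)$w" using c by simp
 also have "... = inv T$(inv T [^] d$w)"
 by (reify rsimps, rule ring_id, simp add: T t c, simp, code_simp)
 finally have "u = inv T$(inv T [^] d$w)" .
 then show False using u(2) nonunits_mult[OF V T(3) subcl(4)[OF V subcl(7)[OF V t(2)] w]] by simp
qed

end

section \<open>An elliptic function field is not rational\<close>

context weierstrass_function_field

begin

text \<open>Comparing coefficients removes the even terms of \<open>y\<close>, so y = U(qU^2 + c1)
  while U^2 = (x - r)/p. The cubic in \<open>x\<close> is then (x - r)/p times a square, so its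
  discriminant vanishes.\<close>

lemma no_parametrization:
 assumes U: "U : carrier R" "transcendental k U"
 and p: "p : k" "p ~= 0." "r : k" "x = p$U$U+.r"
 and q: "q : k" "q ~= 0." "c2 : k" "c1 : k" "c0 : k"
 "y = q$U$U$U+.c2$U$U+.c1$U+.c0"
 shows False
proof -
 note kcl = subcl[OF kf(1)]
 have c: "p : carrier R" "r : carrier R" "q : carrier R" "c2 : carrier R" "c1 : carrier R" "c0 : carrier R"
 using p q kf(2) by blast+
 let ?t = "1.+.1."
 \<comment> \<open>Coefficients of y^2 - (x^3 + ax + b) as a polynomial in \<open>U\<close>, from
   degree 6 down to 0.\<close>
 let ?l = "[q$q-.p$p$p, ?t$q$c2, c2$c2+.?t$q$c1-.[(3::nat)] #. (p$p$r),
 ?t$(q$c0+.c2$c1), c1$c1+.?t$c2$c0-.[(3::nat)] #. (p$r$r)-.a$p, ?t$c1$c0,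
 c0$c0-.(r$r$r+.a$r+.b)]"
 have l: "set ?l <= k"
 using kcl p(1,3) q(1,3-5) ab by simp
 have "eval ?l U = y$y-.(x$x$x+.a$x+.b)"
 unfolding p(4) q(6) eval_Cons list.size One_nat_def add_0 add_0_right add_Suc_right nat_pow_Suc
 eval.simps(1) nat_pow_0
 by (reify rsimps, rule ring_id, simp add: c U abc, simp, code_simp)
 also have "y$y-.(x$x$x+.a$x+.b) = 0."
 unfolding eq using xc abc by (simp add: minus_eq r_neg)
 finally have "set ?l <= {0.}" using transcendental_iff[OF kf(1) U(1)] U(2) l by blast
 then have z0: "d = 0." if "d : set ?l" for d using that by blast
 have z: "q$q-.p$p$p = 0." "?t$q$c2 = 0."
 "c2$c2+.?t$q$c1-.[(3::nat)] #. (p$p$r) = 0." "?t$(q$c0+.c2$c1) = 0."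
 "c1$c1+.?t$c2$c0-.[(3::nat)] #. (p$r$r)-.a$p = 0."
 "c0$c0-.(r$r$r+.a$r+.b) = 0."
 by (rule z0, simp only: list.set insert_iff simp_thms)+
 have c2: "c2 = 0." using z(2) two q(2) c by simp
 have c0: "c0 = 0." using z(4) two q(2) c c2 by simp
 let ?A = "q$q-.p$p$p" and ?B = "?t$q$c1-.[(3::nat)] #. (p$p$r)"
 and ?C = "c1$c1-.[(3::nat)] #. (p$r$r)-.a$p" and ?D = "r$r$r+.a$r+.b"
 have A: "?A = 0." by (rule z(1))
 have B: "?B = 0." using z(3) c2 c by simp
 have C: "?C = 0." using z(5) c2 c0 c abc by simp
 have D: "?D = 0." using z(6) c0 c abc by (simp add: minus_eq)
 \<comment> \<open>-(4a + 3r^2) is the discriminant of the quadratic cofactor of the root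
   \<open>r\<close>; it vanishes because that cofactor is proportional to a square.\<close>
 have "p$p$p$p$([(4::nat)] #. a+.[(3::nat)] #. (r$r)) =
 ?B$(?t$q$c1+.[(3::nat)] #. (p$p$r))-.[(4::nat)] #. (?A$(c1$c1)) -.
 [(4::nat)] #. (?C$(p$p$p))"
 by (reify rsimps, rule ring_id, simp add: c abc, simp, code_simp)
 also have "... = 0." unfolding A B C using c abc by (simp add: minus_eq)
 finally have h: "[(4::nat)] #. a+.[(3::nat)] #. (r$r) = 0." using p(2) c abc by simp
 \<comment> \<open>The factor 16 clears denominators, so that the discriminant becomes a combination
   of 4a + 3r^2 and the value of the cubic at \<open>r\<close>.\<close>
 have "?t$?t$?t$?t$([(4::nat)] #. (a$a$a)+.[(27::nat)] #. (b$b)) =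
 ([(4::nat)] #. a+.[(3::nat)] #. (r$r)) $
 ([(16::nat)] #. (a$a)+.[(96::nat)] #. (r$r$a)+.[(144::nat)] #. (r$r$r$r)) +.
 [(432::nat)] #. (?D$(b-.(r$r$r+.a$r)))"
 by (reify rsimps, rule ring_id, simp add: c abc, simp, code_simp)
 also have "... = 0." unfolding h D using c abc by simp
 finally show False using two disc c abc by simp
qed

text \<open>A generator \<open>T\<close> may be taken with a pole at the place \<open>S\<close> at
  infinity. Then \<open>x\<close> and \<open>y\<close> have no poles outside \<open>S\<close> and
  are polynomials in \<open>T\<close>; the equation and the uniformizer \<open>Y\<close> force
  degrees 2 and 3, and completing the square leads to \<open>no_parametrization\<close>.\<close>

theorem not_rational:
 assumes T0: "T0 : carrier R"
 shows "funfield k T0 ~= carrier R"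
proof
 assume "funfield k T0 = carrier R"
 obtain S where S: "place R k S" "x1 : nonunits R S" "Y : nonunits R S"
 "\<forall>T. local_subring R T --> k <= T --> x1 : nonunits R T --> Y : nonunits R T -->
 S <= T & nonunits R S <= nonunits R T"
 "\<forall>v\<in>nonunits R S. \<exists>w\<in>S. v = Y$w"
 using infinity_place by (elim exE conjE) (rule that)
 note s = placeD[OF S(1)] note scl = subcl[OF s(5)] note kcl = subcl[OF kf(1)]
 obtain T where T: "T : carrier R" "funfield k T = carrier R" "T ~: S"
 using funfield_generator_at_infinity[OF T0 \<open>funfield k T0 = carrier R\<close> S(1)] by blast
 have T0: "T ~= 0." using T(3) scl(1) by blast
 have t: "inv T : nonunits R S" using valuation_ringD(3)[OF s(1) T(1,3)] .
 let ?A = "simple_extension k T"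
 note A = polys_subring[OF kf(1) T(1)]
 \<comment> \<open>If \<open>x\<close> had a pole at \<open>V\<close>, the universal property of the
   place at infinity would give V = S, but \<open>T\<close> is integral at \<open>V\<close> and not
   at \<open>S\<close>.\<close>
 have int: "x : V & y : V" if V: "valuation_ring R (carrier R) V" "?A <= V" for V
 proof -
 have kV: "k <= V" "T : V" using A(2,3) V(2) by blast+
 have L: "local_subring R V" by (rule valuation_ring_local[OF V(1) carrier_is_subfield])
 note v = valuation_ringD[OF V(1)]
 have "x : V"
 proof (rule ccontr)
 assume "x ~: V"
 then have x1: "x1 : nonunits R V" using v(3)[OF xc] by blast
 have "S <= V" "nonunits R S <= nonunits R V"
 using S(4)[rule_format, OF L kV(1) x1 infinity_Y[OF V(1) kV(1) x1]] by blast+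
 then have "V = S" by (intro dominating_eq[OF s(1) v(1,2)])
 then show False using kV T(3) by blast
 qed
 then show ?thesis using pole_of_y[OF V(1) kV(1)] by blast
 qed
 have xyA: "x : ?A" "y : ?A"
 using poly_ring_integrally_closed_valuative[OF k T(1), unfolded T(2)] int xc yc by blast+
 have y0: "y ~= 0." using y_notin ecl(1) by auto
 obtain p ps where p: "p : k" "p ~= 0." "set ps <= k" "x = eval (p # ps) T"
 using polys_leading[OF kf(1) T(1) xyA(1) x0] by blast
 obtain q qs where q: "q : k" "q ~= 0." "set qs <= k" "y = eval (q # qs) T"
 using polys_leading[OF kf(1) T(1) xyA(2) y0] by blast
 obtain u where u: "u : S" "u ~: nonunits R S" "x = T [^] length ps$u"
 using eval_at_pole[OF k s(3,4) T(1) T0 t p(1-3)] p(4) by blast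
 obtain w where w: "w : S" "w ~: nonunits R S" "y = T [^] length qs$w"
 using eval_at_pole[OF k s(3,4) T(1) T0 t q(1-3)] q(4) by blast
 define m n where mn: "m = length ps" "n = length qs"
 have uw: "u : carrier R" "w : carrier R" using u w subcarr[OF s(5)] by blast+
 obtain v where v: "Y$Y = x1$v" "v : S" "v ~: nonunits R S"
 by (rule Y_square_unit[OF s(3,4) S(2)])
 have vc: "v : carrier R" using v subcarr[OF s(5)] by blast
 note um = unit_mult[OF s(5)]
 have uu: "u$u : S" "u$u ~: nonunits R S" and ww: "w$w : S" "w$w ~: nonunits R S"
 using um[OF u(1,2) u(1,2)] um[OF w(1,2) w(1,2)] by blast+
 have uuuv: "u$u$u$v : S" "u$u$u$v ~: nonunits R S"
 using um[OF um[OF uu u(1,2)] v(2,3)] by blast+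
 have pc: "T [^] i : carrier R" for i :: nat using T(1) by simp
 have "y$y = (x$x$Y)$(x$x$Y)" by (simp only: y_Y[symmetric])
 also have "... = x$x$x$(x$(Y$Y))"
 by (reify rsimps, rule ring_id, simp add: xc yc x1c, simp, code_simp)
 also have "x$(Y$Y) = v" unfolding v(1) using xc x0 vc by simp
 finally have "(T [^] n$T [^] n)$(w$w) = (T [^] m$T [^] m$T [^] m)$(u$u$u$v)"
 unfolding u(3) w(3) mn[symmetric]
 proof -
 assume h: "T [^] n$w$(T [^] n$w) =
 T [^] m$u$(T [^] m$u)$(T [^] m$u)$v"
 have "(T [^] n$T [^] n)$(w$w) = T [^] n$w$(T [^] n$w)"
 by (reify rsimps, rule ring_id, simp add: pc uw vc, simp, code_simp)
 also have "... = (T [^] m$T [^] m$T [^] m)$(u$u$u$v)"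
 unfolding h by (reify rsimps, rule ring_id, simp add: pc uw vc, simp, code_simp)
 finally show ?thesis .
 qed
 then have e1: "T [^] (n + n)$(w$w) = T [^] (m + m + m)$(u$u$u$v)"
 using T(1) by (simp add: nat_pow_mult)
 \<comment> \<open>Degrees are pole orders in units of that of \<open>T\<close>; y^2 is x^3 times a
   unit at infinity.\<close>
 have nm: "n + n = m + m + m"
 using pole_power[OF s(5) T(1) T0 t ww uuuv(1) e1] pole_power[OF s(5) T(1) T0 t uuuv ww(1) e1[symmetric]]
 by simp
 have m0: "m ~= 0"
 proof
 assume "m = 0"
 then have "x : S" using u uw mn by simp
 then have "x1$x : nonunits R S" using nonunits_mult[OF s(5) S(2)] by blast
 then show False using one_unit[OF s(5)] xc x0 by simp
 qed
 \<comment> \<open>\<open>inv T\<close> is a multiple of the uniformizer \<open>Y\<close>. Hence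
   T^(2m-1) u^2 = x^2 Y z = y z has pole order at most n, that is 2m - 1 <= n. With 2n = 3m and
   nonzero m only m = 2, n = 3 remains.\<close>
 obtain z where z: "z : S" "inv T = Y$z" using S(5) t by blast
 have zc: "z : carrier R" using z subcarr[OF s(5)] by blast
 obtain m' where m': "m + m = Suc m'" using m0 by (cases m) auto
 have iT: "inv T : carrier R" "T$inv T = 1." using T T0 by auto
 have "T [^] m'$(u$u) = T [^] m'$(u$u)$(T$inv T)" unfolding iT(2) using pc uw by simp
 also have "... = (T [^] Suc m')$(u$u)$inv T"
 unfolding nat_pow_Suc by (reify rsimps, rule ring_id, simp add: pc uw T(1) iT(1), simp, code_simp)
 also have "T [^] Suc m' = T [^] m$T [^] m" using T(1) m' by (simp add: nat_pow_mult del: nat_pow_Suc)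
 also have "T [^] m$T [^] m$(u$u)$inv T = ((T [^] m$u)$(T [^] m$u)$Y)$z"
 unfolding z(2) by (reify rsimps, rule ring_id, simp add: pc uw zc yc x1c, simp, code_simp)
 also have "(T [^] m$u)$(T [^] m$u)$Y = T [^] n$w"
 unfolding mn u(3)[symmetric] w(3)[symmetric] by (simp only: y_Y[symmetric])
 also have "T [^] n$w$z = T [^] n$(w$z)" using pc uw zc by (simp add: m_assoc)
 finally have "m' <= n" using pole_power[OF s(5) T(1) T0 t uu scl(4)[OF w(1) z(1)]] by blast
 then have "m = 2" "n = 3" using nm m' m0 by presburger+
 then have len: "length ps = 2" "length qs = 3" using mn by auto
 obtain p1 p0 where ps: "ps = [p1, p0]" using len(1) by (auto simp: numeral_eq_Suc length_Suc_conv)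
 obtain q2 q1 q0 where qs: "qs = [q2, q1, q0]" using len(2) by (auto simp: numeral_eq_Suc length_Suc_conv)
 have pk: "p1 : k" "p0 : k" "q2 : k" "q1 : k" "q0 : k" using p(3) q(3) ps qs by auto
 have c: "p : carrier R" "p1 : carrier R" "p0 : carrier R" "q : carrier R" "q2 : carrier R" "q1 : carrier R"
 "q0 : carrier R" using pk p q kf(2) by blast+
 have tp: "( 1.+.1.)$p : k" "( 1.+.1.)$p ~= 0." using kcl(4)[OF kcl(5)[OF kcl(2,2)] p(1)] two p c by auto
 \<comment> \<open>Completing the square: the shift by p1/(2p) removes the linear term of
   \<open>x\<close>.\<close>
 define s' where "s' = p1$inv (( 1.+.1.)$p)"
 have sk: "s' : k" unfolding s'_def using kcl(4)[OF pk(1) kf(3)[OF tp]] .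
 have sc: "s' : carrier R" using sk kf(2) by blast
 have p1: "p1 = s'$(( 1.+.1.)$p)" unfolding s'_def using kf(2)[OF tp(1)] tp(2) c by (simp add: m_assoc)
 define U where "U = T+.s'"
 have Uc: "U : carrier R" using U_def T sc by simp
 have TU: "T = U-.s'" unfolding U_def using T sc by (simp add: minus_eq a_assoc r_neg)
 have "transcendental k U"
 proof (rule ccontr)
 assume "~ transcendental k U"
 then have "U : k" using algebraic_in_constants[OF Uc] by blast
 then have "T : k" unfolding TU using kcl(6) sk by blast
 then show False using T(3) s(4) by blast
 qed
 have x': "x = p$T$T+.p1$T+.p0" unfolding p(4) ps eval_Cons using T c by (simp add: m_assoc a_assoc)
 have y': "y = q$T$T$T+.q2$T$T+.q1$T+.q0"
 unfolding q(4) qs eval_Cons using T c by (simp add: m_assoc a_assoc)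
 have "x = p$U$U+.(p0-.p$s'$s')"
 unfolding x' p1 TU by (reify rsimps, rule ring_id, simp add: c Uc sc, simp, code_simp)
 moreover have "y = q$U$U$U+.(q2-.[(3::nat)] #. (q$s'))$U$U +.
 (q1-.[(2::nat)] #. (q2$s')+.[(3::nat)] #. (q$s'$s'))$U +.
 (q0-.q1$s'+.q2$s'$s'-.q$s'$s'$s')"
 unfolding y' TU by (reify rsimps, rule ring_id, simp add: c Uc sc, simp, code_simp)
 moreover have "p0-.p$s'$s' : k" "q2-.[(3::nat)] #. (q$s') : k"
 "q1-.[(2::nat)] #. (q2$s')+.[(3::nat)] #. (q$s'$s') : k"
 "q0-.q1$s'+.q2$s'$s'-.q$s'$s'$s' : k"
 using kcl p(1) q(1) pk sk by simp_all
 ultimately show False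
 using no_parametrization[OF Uc \<open>transcendental k U\<close> p(1,2) _ _ q(1,2)] by blast
qed

end

section \<open>Parametrizing conics and singular cubics over a finite field\<close>

lemma card_two_to_one_image:
 assumes k: "finite k" and g: "\<forall>u\<in>k. \<forall>v\<in>k. g u = g v --> v = u \<or> v = s u" and w: "w : k" "s w = w"
 shows "card k < 2 * card (g ` k)"
proof -
 define D where "D = inv_into k g ` (g ` k)"
 have D: "finite D" "card D <= card (g ` k)" unfolding D_def using k by (simp_all add: card_image_le)
 have d: "inv_into k g (g u) : D" "u = inv_into k g (g u) \<or> u = s (inv_into k g (g u))" if u: "u : k" for u
 proof -
 show "inv_into k g (g u) : D" unfolding D_def using u by blast
 have "inv_into k g (g u) : k" "g (inv_into k g (g u)) = g u"
 using inv_into_into[of "g u" g k] f_inv_into_f[of "g u" g k] u by simp_all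
 then show "u = inv_into k g (g u) \<or> u = s (inv_into k g (g u))" using g u by blast
 qed
 have "inv_into k g (g w) : k" "g (inv_into k g (g w)) = g w"
 using inv_into_into[of "g w" g k] f_inv_into_f[of "g w" g k] w(1) by simp_all
 then have "inv_into k g (g w) = w" using g w by metis
 then have wD: "w : D" using d(1)[OF w(1)] by simp
 \<comment> \<open>\<open>D\<close> holds one member of each fibre. The fixed point \<open>w\<close>
   is its own partner, so it can be omitted on the right; this makes the final inequality
   strict.\<close>
 have "k <= D \<union> s ` (D - {w})"
 proof
 fix u assume u: "u : k"
 show "u : D \<union> s ` (D - {w})"
 proof (cases "inv_into k g (g u) = w")
 case True
 then have "u = w" using d(2)[OF u] w(2) by auto
 then show ?thesis using wD by simp
 next
 case False
 then show ?thesis using d[OF u] by auto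
 qed
 qed
 then have "card k <= card (D \<union> s ` (D - {w}))" using D(1) by (intro card_mono) auto
 also have "... <= card D + card (s ` (D - {w}))" by (rule card_Un_le)
 also have "card (s ` (D - {w})) <= card (D - {w})" using D(1) by (intro card_image_le) auto
 also have "card (D - {w}) < card D" using D(1) wD by (intro card_Diff1_less)
 finally show ?thesis using D(2) by simp
qed

context weierstrass_function_field

begin

lemma square_root_of_constant:
 assumes Z: "Z : carrier R" "Z$Z : k"
 shows "Z : k"
proof (rule algebraic_in_constants[OF Z(1)])
 let ?l = "[1., 0.,-.(Z$Z)]"
 have "set ?l <= k" using subcl[OF kf(1)] Z(2) by simp
 moreover have "eval ?l Z = 0." using Z(1) by (simp add: eval_Cons r_neg)
 moreover have "~ set ?l <= {0.}" by simp
 ultimately show "~ transcendental k Z" using transcendental_iff[OF kf(1) Z(1)] by blast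
qed

lemma no_joint_parameter:
 assumes T: "T : carrier R" and W: "W : funfield k T" and Z: "Z : funfield k T"
 and C: "carrier R = {u+.v$Z | u v. u : funfield k W & v : funfield k W}"
 shows False
proof -
 note f = funfield_facts[OF kf(1) T] note fs = sf_facts[OF f(1)] note fcl = subcl[OF fs(1)]
 have WE: "funfield k W <= funfield k T"
 using funfield_facts(6)[OF kf(1) fs(2)[OF W] f(1) f(3) W] .
 have "z : funfield k T" if zz: "z : carrier R" for z
 proof -
 have "z : {u+.v$Z | u v. u : funfield k W & v : funfield k W}" using zz unfolding C .
 then obtain u v where uv: "z = u+.v$Z" "u : funfield k W" "v : funfield k W"
 unfolding mem_Collect_eq by (elim exE conjE) (rule that)
 show ?thesis unfolding uv(1) by (rule fcl(5)[OF subsetD[OF WE uv(2)] fcl(4)[OF subsetD[OF WE uv(3)] Z]])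
 qed
 moreover have "funfield k T <= carrier R" using fs(2) by blast
 ultimately show False using not_rational[OF T] by blast
qed

text \<open>Pigeonhole: the values of the quadratic polynomial and the squares each fill more than
  half of \<open>k\<close>, so they meet.\<close>

lemma conic_point:
 assumes fin: "finite k" and h: "h2 : k" "h2 ~= 0." "h1 : k" "h0 : k"
 shows "\<exists>u\<in>k. \<exists>v\<in>k. v$v = h2$u$u+.h1$u+.h0"
proof (rule ccontr)
 assume n: "~ ?thesis"
 note kcl = subcl[OF kf(1)]
 have hc: "h2 : carrier R" "h1 : carrier R" "h0 : carrier R" using h kf(2) by blast+
 let ?f = "%u. h2$u$u+.h1$u+.h0" and ?s = "%u.-.(u+.h1$inv h2)" and ?q = "%v. v$v"
 have i: "inv h2 : k" "inv h2 : carrier R" "h2$inv h2 = 1." using kf(3)[OF h(1,2)] hc h(2) by auto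
 have fk: "?f ` k <= k" using kcl h by auto
 have qk: "?q ` k <= k" using kcl by auto
 have t: "1.+.1. : k" using kcl by simp
 have it: "inv ( 1.+.1.) : k" "inv ( 1.+.1.) : carrier R" "( 1.+.1.)$inv ( 1.+.1.) = 1."
 using kf(3)[OF t two] two by auto
 have 1: "card k < 2 * card (?f ` k)"
 \<comment> \<open>The reflection exchanges two arguments with equal value; its fixed point is the
   vertex -h1/(2 h2).\<close>
 proof (rule card_two_to_one_image[OF fin, where s = ?s and w = "-. (inv ( 1.+.1.)$(h1$inv h2))"], intro ballI impI)
 fix u v assume uv: "u : k" "v : k" "?f u = ?f v"
 have c: "u : carrier R" "v : carrier R" using uv kf(2) by blast+
 have "(v-.u)$(h2$(v+.(u+.h1$inv h2))) = ?f v-.?f u+.(v-.u)$h1$((h2$inv h2)-.1.)"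
 by (reify rsimps, rule ring_id, simp add: c hc i(2), simp, code_simp)
 also have "... = 0." unfolding uv(3) i(3) using c hc by (simp add: minus_eq r_neg)
 finally have "v-.u = 0. \<or> v+.(u+.h1$inv h2) = 0." using c hc i h(2) by auto
 then show "v = u \<or> v = ?s u"
 using c hc i r_right_minus_eq[of v u] minus_equality[of v "u+.h1$inv h2"] by auto
 next
 show "-. (inv ( 1.+.1.)$(h1$inv h2)) : k" using kcl it(1) i(1) h(3) by simp
 let ?c = "h1$inv h2" and ?i = "inv ( 1.+.1.)"
 have "-. ( -. (?i$?c)+.?c) =-.(?i$?c)+.(( 1.+.1.)$?i-.1.)$?c"
 by (reify rsimps, rule ring_id, simp add: it(2) hc i(2), simp, code_simp)
 then show "-. ( -. (?i$?c)+.?c) =-.(?i$?c)" unfolding it(3) using it(2) hc i(2) by (simp add: minus_eq r_neg)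
 qed
 have 2: "card k < 2 * card (?q ` k)"
 proof (rule card_two_to_one_image[OF fin, where s = "%u.-.u" and w = \<zero>], intro ballI impI)
 fix u v assume uv: "u : k" "v : k" "u$u = v$v"
 have c: "u : carrier R" "v : carrier R" using uv kf(2) by blast+
 have "(v-.u)$(v+.u) = v$v-.u$u"
 by (reify rsimps, rule ring_id, simp add: c, simp, code_simp)
 also have "... = 0." unfolding uv(3) using c by (simp add: minus_eq r_neg)
 finally show "v = u \<or> v =-.u" using c r_right_minus_eq[of v u] minus_equality[of v u] by auto
 qed (use kcl in simp_all)
 have "?f ` k \<inter> ?q ` k = {}" using n by (auto, metis)
 then have "card (?f ` k) + card (?q ` k) = card (?f ` k \<union> ?q ` k)" using fin by (simp add: card_Un_disjoint)
 also have "... <= card k" using fk qk fin by (intro card_mono) auto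
 finally show False using 1 2 by simp
qed

text \<open>Projection from a rational point parametrizes the conic, so the field would be rational.
  In the degenerate cases \<open>Z\<close> is a constant, or \<open>W\<close> is a polynomial in
  \<open>Z\<close>.\<close>

lemma no_conic:
 assumes fin: "finite k" and W: "W : carrier R" "W ~: k" and Z: "Z : carrier R" "Z ~: funfield k W"
 and C: "carrier R = {u+.v$Z | u v. u : funfield k W & v : funfield k W}"
 and h: "h2 : k" "h1 : k" "h0 : k" "Z$Z = h2$W$W+.h1$W+.h0"
 shows False
proof -
 note kcl = subcl[OF kf(1)]
 have hc: "h2 : carrier R" "h1 : carrier R" "h0 : carrier R" using h kf(2) by blast+
 note fW = funfield_facts[OF kf(1) W(1)]
 consider "h2 = 0." "h1 = 0." | "h2 = 0." "h1 ~= 0." | "h2 ~= 0." by blast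
 then show False
 proof cases
 case 1
 then have "Z$Z = h0" using h(4) hc W by simp
 then have "Z : k" using square_root_of_constant[OF Z(1)] h(3) by simp
 then show False using Z(2) fW(3) by blast
 next
 case 2
 note f = funfield_facts[OF kf(1) Z(1)] note fs = sf_facts[OF f(1)] note fcl = subcl[OF fs(1)]
 have e: "Z$Z-.h0 = h1$W" using h(4) 2 hc W by (simp add: minus_eq a_assoc r_neg)
 have "W = inv h1$(Z$Z-.h0)" unfolding e using 2 hc W by simp
 also have "... : funfield k Z"
 using fcl(4)[OF _ fcl(6)[OF fcl(4)[OF f(4,4)]]] kf(3)[OF h(2) 2(2)] f(3) h(3) by blast
 finally show False using no_joint_parameter[OF Z(1) _ f(4) C] by blast
 next
 case 3
 obtain u v where uv: "u : k" "v : k" "v$v = h2$u$u+.h1$u+.h0"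
 using conic_point[OF fin h(1) 3 h(2,3)] by blast
 have c: "u : carrier R" "v : carrier R" using uv kf(2) by blast+
 define \<xi> where "\<xi> = W-.u"
 have "W ~= u" using W(2) uv(1) by blast
 then have \<xi>: "\<xi> : carrier R" "\<xi> ~= 0." unfolding \<xi>_def using W(1) c r_right_minus_eq[OF W(1) c(1)] by auto
 have W\<xi>: "W = \<xi>+.u" unfolding \<xi>_def using W c by (simp add: minus_eq a_assoc l_neg)
 \<comment> \<open>The slope of the line through the rational point (u, v).\<close>
 define T where "T = (Z-.v)$inv \<xi>"
 have T: "T : carrier R" unfolding T_def using Z c \<xi> by simp
 have T\<xi>: "T$\<xi> = Z-.v" unfolding T_def using Z c \<xi> by (simp add: m_assoc)
 have ZT: "Z = v+.T$\<xi>" unfolding T\<xi> using Z c by (simp add: minus_eq a_lcomm r_neg)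
 \<comment> \<open>Substituting Z = v + T\<xi> and W = \<xi> + u into the conic, the constant terms
   cancel and one factor \<xi> divides out; what remains is linear in \<xi>.\<close>
 have "\<xi>$(\<xi>$(T$T-.h2)) = \<xi>$(( 1.+.1.)$h2$u+.h1-.( 1.+.1.)$v$T) +.
 ((v+.T$\<xi>)$(v+.T$\<xi>)-.(h2$(\<xi>+.u)$(\<xi>+.u)+.h1$(\<xi>+.u)+.h0)) -.
 (v$v-.(h2$u$u+.h1$u+.h0))"
 by (reify rsimps, rule ring_id, simp add: c hc \<xi> T, simp, code_simp)
 also have "... = \<xi>$(( 1.+.1.)$h2$u+.h1-.( 1.+.1.)$v$T)"
 unfolding ZT[symmetric] W\<xi>[symmetric] h(4) uv(3) using c hc \<xi> T W Z by (simp add: minus_eq r_neg)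
 finally have e: "\<xi>$(T$T-.h2) = ( 1.+.1.)$h2$u+.h1-.( 1.+.1.)$v$T"
 using m_lcancel[of \<xi>] \<xi> T c hc by simp
 show False
 \<comment> \<open>If the coefficient of \<xi> vanishes, the slope is a constant, and
   \<open>Z\<close> would lie in k(W).\<close>
 proof (cases "T$T-.h2 = 0.")
 case True
 then have "T$T = h2" using T hc by simp
 then have Tk: "T : k" using square_root_of_constant[OF T] h(1) by simp
 note fs = sf_facts[OF fW(1)] note fcl = subcl[OF fs(1)]
 have "T : funfield k W" "u : funfield k W" "v : funfield k W" using fW(3) Tk uv by blast+
 then have "Z : funfield k W"
 using ZT fcl(5)[OF _ fcl(4)[OF _ fcl(6)[OF fW(4)]], of v T u] unfolding \<xi>_def by simp
 then show False using Z(2) by blast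
 next
 case False
 note f = funfield_facts[OF kf(1) T] note fs = sf_facts[OF f(1)] note fcl = subcl[OF fs(1)]
 have kk: "u : funfield k T" "v : funfield k T" "h1 : funfield k T" "h2 : funfield k T" "1.+.1. : funfield k T"
 using f(3) uv h fcl(5)[OF fcl(2,2)] by blast+
 have d: "T$T-.h2 : funfield k T" using fcl(6)[OF fcl(4)[OF f(4,4)] kk(4)] .
 have nf: "( 1.+.1.)$h2$u+.h1-.( 1.+.1.)$v$T : funfield k T"
 using fcl(6)[OF fcl(5)[OF fcl(4)[OF fcl(4)[OF kk(5,4)] kk(1)] kk(3)] fcl(4)[OF fcl(4)[OF kk(5,2)] f(4)]] .
 have "\<xi> = (\<xi>$(T$T-.h2))$inv (T$T-.h2)" using \<xi> T hc False by (simp add: m_assoc)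
 then have x: "\<xi> : funfield k T" unfolding e using fcl(4)[OF nf fs(3)[OF d False]] by simp
 have "W : funfield k T" "Z : funfield k T"
 using W\<xi> ZT fcl(5)[OF x kk(1)] fcl(5)[OF kk(2) fcl(4)[OF f(4) x]] by simp_all
 then show False using no_joint_parameter[OF T _ _ C] by blast
 qed
 qed
qed

text \<open>A vanishing discriminant gives a double root \<open>e\<close> in \<open>k\<close>, and
  the slope Z/(W - e) at the singular point, node or cusp, parametrizes the curve.\<close>

lemma no_nodal_cubic:
 assumes three: "1.+.1.+.1. ~= 0." and W: "W : carrier R" "W ~: k" and Z: "Z : carrier R"
 and C: "carrier R = {u+.v$Z | u v. u : funfield k W & v : funfield k W}"
 and h: "A : k" "B : k" "Z$Z = W$W$W+.A$W+.B"
 shows "[(4::nat)] #. (A$A$A)+.[(27::nat)] #. (B$B) ~= 0."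
proof
 assume D: "[(4::nat)] #. (A$A$A)+.[(27::nat)] #. (B$B) = 0."
 note kcl = subcl[OF kf(1)]
 have hc: "A : carrier R" "B : carrier R" using h kf(2) by blast+
 have "\<exists>e\<in>k. A =-.(( 1.+.1.+.1.)$e$e) & B = ( 1.+.1.)$e$e$e"
 proof (cases "A = 0.")
 case True
 have "( 1.+.1.+.1.)$( 1.+.1.+.1.)$( 1.+.1.+.1.)$(B$B) = [(27::nat)] #. (B$B)"
 by (reify rsimps, rule ring_id, simp add: hc, simp, code_simp)
 also have "... = 0." using D True hc by simp
 finally have "B = 0." using three hc by simp
 then show ?thesis using True kcl(1) by (intro bexI[of _ \<zero>]) auto
 next
 case False
 have d: "( 1.+.1.)$A : k" "( 1.+.1.)$A ~= 0." using kcl(4)[OF kcl(5)[OF kcl(2,2)] h(1)] two False hc by auto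
 define i where "i = inv (( 1.+.1.)$A)"
 have i: "i : k" "i : carrier R" "( 1.+.1.)$A$i = 1."
 unfolding i_def using kf(3)[OF d] kf(2)[OF d(1)] kf(2)[OF kf(3)[OF d]] d(2) by auto
 \<comment> \<open>The double root -3B/(2A): the cubic must be (W - e)^2 (W + 2e), so A = -3e^2 and
   B = 2e^3.\<close>
 let ?e = "-. (( 1.+.1.+.1.)$B$i)" and ?j = "( 1.+.1.)$A$i" and ?D = "[(4::nat)] #. (A$A$A)+.[(27::nat)] #. (B$B)"
 have "?e : k" using kcl(3)[OF kcl(4)[OF kcl(4)[OF kcl(5)[OF kcl(5)[OF kcl(2,2)] kcl(2)] h(2)] i(1)]] .
 moreover have "A$?j$?j+.( 1.+.1.+.1.)$?e$?e = ?D$i$i"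
 by (reify rsimps, rule ring_id, simp add: hc i(2), simp, code_simp)
 then have "A+.( 1.+.1.+.1.)$?e$?e = 0." unfolding D i(3) using hc i(2) by simp
 then have "A =-.(( 1.+.1.+.1.)$?e$?e)" using minus_equality[of A] hc i(2) by (simp del: minus_equality)
 moreover have "B$?j$?j$?j-.( 1.+.1.)$?e$?e$?e = ( 1.+.1.)$B$?D$i$i$i"
 by (reify rsimps, rule ring_id, simp add: hc i(2), simp, code_simp)
 then have "B-.( 1.+.1.)$?e$?e$?e = 0." unfolding D i(3) using hc i(2) by simp
 then have "B = ( 1.+.1.)$?e$?e$?e"
 using r_right_minus_eq[of B "( 1.+.1.)$?e$?e$?e"] hc i(2) by blast
 ultimately show ?thesis by blast
 qed
 then obtain e where e: "e : k" "A =-.(( 1.+.1.+.1.)$e$e)" "B = ( 1.+.1.)$e$e$e" by blast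
 have ec: "e : carrier R" using e kf(2) by blast
 have "W ~= e" using W(2) e(1) by blast
 then have n: "W-.e : carrier R" "W-.e ~= 0." using W(1) ec r_right_minus_eq[OF W(1) ec] by auto
 define T where "T = Z$inv (W-.e)"
 have T: "T : carrier R" unfolding T_def using Z n by simp
 have ZT: "Z = T$(W-.e)" unfolding T_def using Z n by (simp add: m_assoc)
 have "(W-.e)$(W-.e)$(T$T) = Z$Z"
 unfolding ZT by (reify rsimps, rule ring_id, simp add: W ec T, simp, code_simp)
 also have "... = (W-.e)$(W-.e)$(W+.e+.e)"
 unfolding h(3) e(2,3) by (reify rsimps, rule ring_id, simp add: W ec, simp, code_simp)
 finally have "T$T = W+.e+.e" using m_lcancel[of "(W-.e)$(W-.e)"] n T W ec by simp
 moreover have "W = (W+.e+.e)-.e-.e"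
 by (reify rsimps, rule ring_id, simp add: W ec, simp, code_simp)
 ultimately have We: "W = T$T-.e-.e" by simp
 note f = funfield_facts[OF kf(1) T] note fcl = subcl[OF sf_facts(1)[OF f(1)]]
 have ef: "e : funfield k T" using f(3) e(1) by blast
 have Wf: "W : funfield k T" using We fcl(6)[OF fcl(6)[OF fcl(4)[OF f(4,4)] ef] ef] by simp
 have "Z : funfield k T" using ZT fcl(4)[OF f(4) fcl(6)[OF Wf ef]] by simp
 then show False using no_joint_parameter[OF T Wf _ C] by blast
qed

end

section \<open>Reduction modulo the generic point of a fibre\<close>

locale curve_reduction = weierstrass_function_field R K x y a b +
 L: weierstrass_function_field L \<kappa> x' y' a' b'
 for R (structure) and K x y a b and L :: "('c, 'd) ring_scheme" and \<kappa> x' y' a' b' +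
 fixes V \<rho> \<pi>
 assumes V: "valuation_ring R (carrier R) V"
 and hom: "\<rho> : ring_hom (R(|carrier := V|)) L" and surj: "\<rho> ` V = carrier L"
 and ker: "!!v. v : V ==> \<rho> v = 0.\<^bsub>L\<^esub> \<longleftrightarrow> v : nonunits R V"
 and base: "\<kappa> = \<rho> ` (K \<inter> V)" and fin: "finite \<kappa>"
 and uniformizer: "\<pi> : K" "\<pi> : nonunits R V" "\<pi> ~= 0." "!!v. v : nonunits R V ==> \<exists>w\<in>V. v = \<pi>$w"
 and separated: "!!v. v : V ==> v ~= 0. ==> \<exists>n::nat. \<forall>w\<in>V. v ~= \<pi> [^] n$w"
 and three: "1.\<^bsub>L\<^esub> +.\<^bsub>L\<^esub> 1.\<^bsub>L\<^esub> +.\<^bsub>L\<^esub> 1.\<^bsub>L\<^esub> ~= 0.\<^bsub>L\<^esub>"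

begin

lemmas VD = valuation_ringD[OF V]

lemmas vcl = subcl[OF VD(1)]

lemma vc: "v : V ==> v : carrier R" by (rule subcarr[OF VD(1)])

lemmas kcl = subcl[OF kf(1)]

lemma \<rho>_closed: "v : V ==> \<rho> v : carrier L" and \<rho>_one: "\<rho> 1. = 1.\<^bsub>L\<^esub>"
 and \<rho>_mult: "u : V ==> v : V ==> \<rho> (u$v) = \<rho> u $\<^bsub>L\<^esub> \<rho> v"
 and \<rho>_add: "u : V ==> v : V ==> \<rho> (u+.v) = \<rho> u +.\<^bsub>L\<^esub> \<rho> v"
 using ring_hom_closed[OF hom] ring_hom_one[OF hom] ring_hom_mult[OF hom] ring_hom_add[OF hom] by simp_all

lemma \<rho>_zero: "\<rho> 0. = 0.\<^bsub>L\<^esub>" using ker[OF vcl(1)] zero_nonunit[OF VD(1)] by simp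

lemma \<rho>_neg: assumes v: "v : V" shows "\<rho> ( -. v) = -.\<^bsub>L\<^esub> \<rho> v"
proof -
 have "\<rho> ( -. v) +.\<^bsub>L\<^esub> \<rho> v = 0.\<^bsub>L\<^esub>"
 unfolding \<rho>_add[OF vcl(3)[OF v] v, symmetric] using \<rho>_zero vc[OF v] by (simp add: l_neg)
 then show ?thesis using L.minus_equality[of "\<rho> ( -. v)" "\<rho> v"] \<rho>_closed[OF v] \<rho>_closed[OF vcl(3)[OF v]] by simp
qed

lemma \<rho>_minus: assumes "u : V" "v : V" shows "\<rho> (u-.v) = \<rho> u -.\<^bsub>L\<^esub> \<rho> v"
 unfolding a_minus_def using \<rho>_add[OF assms(1) vcl(3)[OF assms(2)]] \<rho>_neg[OF assms(2)] by simp

lemma \<rho>_inv: assumes v: "v : V" "v ~: nonunits R V"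
 shows "\<rho> (inv v) = inv\<^bsub>L\<^esub> \<rho> v" "\<rho> v ~= 0.\<^bsub>L\<^esub>" "inv v : V"
proof -
 note u = unit_inv[OF VD(1) v]
 have "\<rho> v $\<^bsub>L\<^esub> \<rho> (inv v) = 1.\<^bsub>L\<^esub>"
 unfolding \<rho>_mult[OF v(1) u(2), symmetric] using \<rho>_one vc[OF v(1)] u(1) by simp
 then show "\<rho> (inv v) = inv\<^bsub>L\<^esub> \<rho> v"
 using L.inv_unique_field[OF \<rho>_closed[OF v(1)] \<rho>_closed[OF u(2)]] by simp
 show "\<rho> v ~= 0.\<^bsub>L\<^esub>" using ker[OF v(1)] v(2) by simp
qed (rule unit_inv(2)[OF VD(1) v])

lemma \<rho>_eq: assumes "u : V" "v : V" shows "\<rho> u = \<rho> v \<longleftrightarrow> u-.v : nonunits R V"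
 using ker[OF vcl(6)[OF assms]] \<rho>_minus[OF assms] L.r_right_minus_eq[OF \<rho>_closed[OF assms(1)] \<rho>_closed[OF assms(2)]]
 by simp

lemma \<rho>_eval: assumes z: "z : V" and p: "set p <= V"
 shows "\<rho> (eval p z) = L.eval (map \<rho> p) (\<rho> z)"
 using p
proof (induction p)
 case (Cons c p)
 have pw: "\<rho> (z [^] n) = \<rho> z [^]\<^bsub>L\<^esub> n" for n :: nat
 proof (induction n)
 case (Suc n)
 then show ?case using \<rho>_mult[OF vcl(7)[OF z] z, of n] by simp
 qed (simp add: \<rho>_one)
 have c: "c : V" and p: "set p <= V" using Cons.prems by simp_all
 have "\<rho> (eval (c # p) z) = \<rho> (c$z [^] length p) +.\<^bsub>L\<^esub> \<rho> (eval p z)"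
 unfolding eval_Cons by (rule \<rho>_add[OF vcl(4)[OF c vcl(7)[OF z]] eval_in_subring[OF VD(1) z p]])
 then show ?case using Cons.IH[OF p] \<rho>_mult[OF c vcl(7)[OF z]] by (simp add: L.eval_Cons pw)
qed (simp add: \<rho>_zero)

lemma inv_integral: assumes "c : carrier R" "c ~= 0." "c ~: nonunits R V" shows "inv c : V"
 using VD(4)[OF assms(1,2)] assms(2,3) nonunits_iff[OF VD(1), of c] by blast

lemma \<pi>c: "\<pi> : carrier R" "\<pi> : V" "inv \<pi> : K" "inv \<pi> : carrier R"
proof -
 show "\<pi> : carrier R" "\<pi> : V" using kf(2)[OF uniformizer(1)] uniformizer(2) nonunits_iff[OF VD(1)] by auto
 then show "inv \<pi> : K" "inv \<pi> : carrier R" using kf(3)[OF uniformizer(1,3)] uniformizer(3) by auto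
qed

lemma unit_times_power:
 assumes v: "v : V" "v ~= 0."
 shows "\<exists>n::nat. \<exists>u\<in>V. u ~: nonunits R V & v = \<pi> [^] n$u"
proof -
 define n where "n = (LEAST n::nat. \<forall>w\<in>V. v ~= \<pi> [^] n$w)"
 have n: "\<forall>w\<in>V. v ~= \<pi> [^] n$w" unfolding n_def by (rule LeastI_ex[OF separated[OF v]])
 have "n ~= 0" using n v vc[OF v(1)] by (metis l_one nat_pow_0)
 then obtain m where m: "n = Suc m" by (cases n) auto
 have "~ (\<forall>w\<in>V. v ~= \<pi> [^] m$w)"
 using not_less_Least[of m "%n. \<forall>w\<in>V. v ~= \<pi> [^] n$w"] m unfolding n_def by simp
 then obtain w where w: "w : V" "v = \<pi> [^] m$w" by blast
 have "w ~: nonunits R V"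
 proof
 assume "w : nonunits R V"
 then obtain z where z: "z : V" "w = \<pi>$z" using uniformizer(4) by blast
 have "v = \<pi> [^] n$z" using w(2) z(2) \<pi>c(1) vc[OF z(1)] by (simp add: m m_assoc)
 then show False using n z(1) by blast
 qed
 then show ?thesis using w by blast
qed

lemma power_K: "\<pi> [^] (n::nat) : K" "inv (\<pi> [^] (n::nat)) : K" "\<pi> [^] (n::nat) ~= 0." "inv (\<pi> [^] (n::nat)) ~= 0."
 "\<pi> [^] (n::nat) : carrier R" "inv (\<pi> [^] (n::nat)) : carrier R"
proof -
 show 1: "\<pi> [^] n : K" by (rule kcl(7)[OF uniformizer(1)])
 show 2: "\<pi> [^] n ~= 0." using \<pi>c(1) uniformizer(3) by simp
 show "inv (\<pi> [^] n) : K" by (rule kf(3)[OF 1 2])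
 show 3: "\<pi> [^] n : carrier R" using \<pi>c(1) by simp
 show "inv (\<pi> [^] n) ~= 0." "inv (\<pi> [^] n) : carrier R" using 2 3 by simp_all
qed

text \<open>Constants of \<open>K\<close> suffice for the scaling because the uniformizer of
  \<open>V\<close> already lies in \<open>K\<close>.\<close>

lemma scale_unit:
 assumes f: "f : carrier R" "f ~= 0."
 shows "\<exists>c\<in>K. c ~= 0. & c$f : V & c$f ~: nonunits R V"
proof (cases "f : V")
 case True
 obtain n u where u: "u : V" "u ~: nonunits R V" "f = \<pi> [^] (n::nat)$u"
 using unit_times_power[OF True f(2)] by blast
 have "inv (\<pi> [^] n)$f = u" unfolding u(3) using power_K(3,5)[of n] vc[OF u(1)] by simp
 then show ?thesis using power_K(2,4)[of n] u(1,2) by (intro bexI[of _ "inv (\<pi> [^] n)"]) simp_all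
next
 case False
 have i: "inv f : V" "inv f ~= 0." "inv f : carrier R" using VD(4)[OF f] False f by auto
 obtain n u where u: "u : V" "u ~: nonunits R V" "inv f = \<pi> [^] (n::nat)$u"
 using unit_times_power[OF i(1,2)] by blast
 note ui = unit_inv[OF VD(1) u(1,2)]
 have "f = inv (\<pi> [^] n$u)" using f u(3) inv_inv_field[OF f] by simp
 also have "... = inv (\<pi> [^] n)$inv u" using inv_mult_distrib power_K(3,5)[of n] vc[OF u(1)] ui(1) by simp
 finally have "\<pi> [^] n$f = inv u" using power_K(3,5)[of n] vc[OF ui(2)] by simp
 then show ?thesis using power_K(1,3)[of n] ui by (intro bexI[of _ "\<pi> [^] n"]) simp_all
qed

lemma scale_list:
 assumes "set ps <= carrier R" "~ set ps <= {0.}"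
 shows "\<exists>c\<in>K. c ~= 0. & (\<forall>q\<in>set ps. c$q : V) & (\<exists>q\<in>set ps. c$q ~: nonunits R V)"
 using assms
proof (induction ps)
 case (Cons q ps)
 have qc: "q : carrier R" and psc: "set ps <= carrier R" using Cons.prems(1) by simp_all
 show ?case
 proof (cases "set ps <= {0.}")
 case True
 then have "q ~= 0." using Cons.prems(2) by simp
 then obtain c where c: "c : K" "c ~= 0." "c$q : V" "c$q ~: nonunits R V" using scale_unit[OF qc] by blast
 have "c$r : V" if r: "r : set (q # ps)" for r
 using r True c(3) vcl(1) kf(2)[OF c(1)] by auto
 then show ?thesis using c by auto
 next
 case False
 obtain c where c: "c : K" "c ~= 0." "\<forall>q\<in>set ps. c$q : V" "\<exists>q\<in>set ps. c$q ~: nonunits R V"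
 using Cons.IH[OF psc False] by blast
 have cc: "c : carrier R" by (rule kf(2)[OF c(1)])
 show ?thesis
 proof (cases "c$q : V")
 case True
 then show ?thesis using c by auto
 next
 case F: False
 have z: "c$q : carrier R" "c$q ~= 0." using F vcl(1) cc qc by auto
 obtain e where e: "e : K" "e ~= 0." "e$(c$q) : V" "e$(c$q) ~: nonunits R V"
 using scale_unit[OF z] by blast
 have ec: "e : carrier R" by (rule kf(2)[OF e(1)])
 have "e = (inv (c$q))$(e$(c$q))" using ec z by (simp add: m_lcomm)
 also have "... : nonunits R V" by (rule nonunits_mult[OF VD(1) VD(3)[OF z(1) F] e(3)])
 finally have eV: "e : V" using nonunits_iff[OF VD(1)] by blast
 have "e$c$r : V" if r: "r : set (q # ps)" for r
 proof (cases "r = q")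
 case True
 then show ?thesis using e(3) m_assoc[OF ec cc qc] by simp
 next
 case False
 then have "c$r : V" "r : carrier R" using r c(3) psc by auto
 then show ?thesis using vcl(4)[OF eV] m_assoc[OF ec cc] by simp
 qed
 moreover have "e$c$q ~: nonunits R V" using e(4) m_assoc[OF ec cc qc] by simp
 moreover have "e$c : K" "e$c ~= 0." using kcl(4)[OF e(1) c(1)] ec cc e(2) c(2) by simp_all
 ultimately show ?thesis by (intro bexI[of _ "e$c"]) auto
 qed
 qed
qed simp

lemma residue_transcendental:
 assumes z: "z : V" "\<rho> z ~: \<kappa>" and p: "set p <= K" "set p <= V" "\<rho> (eval p z) = 0.\<^bsub>L\<^esub>"
 shows "set p <= nonunits R V"
proof -
 have t: "ring.transcendental L \<kappa> (\<rho> z)" using L.algebraic_in_constants[OF \<rho>_closed[OF z(1)]] z(2) by blast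
 have "set (map \<rho> p) <= \<kappa>" unfolding base using p(1,2) by auto
 moreover have "L.eval (map \<rho> p) (\<rho> z) = 0.\<^bsub>L\<^esub>" using \<rho>_eval[OF z(1) p(2)] p(3) by simp
 ultimately have "set (map \<rho> p) <= {0.\<^bsub>L\<^esub>}" using t L.transcendental_iff[OF L.kf(1) \<rho>_closed[OF z(1)]] by blast
 then show ?thesis using p(2) ker by auto
qed

text \<open>Gauss's lemma. After scaling, all coefficients are integral and one of them is a unit;
  since the residue of \<open>z\<close> is transcendental over \<kappa>, the reduced polynomial does
  not vanish there, so the value is a unit as well.\<close>

lemma gauss_scale:
 assumes z: "z : V" "\<rho> z ~: \<kappa>" and p: "set p <= K" "~ set p <= {0.}"
 shows "\<exists>c\<in>K. c ~= 0. & (\<forall>q\<in>set p. c$q : V) & c$eval p z : V & c$eval p z ~: nonunits R V &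
 \<rho> (c$eval p z) : L.simple_extension \<kappa> (\<rho> z)"
proof -
 have pc: "set p <= carrier R" using p(1) kf(2) by blast
 obtain c where c: "c : K" "c ~= 0." "\<forall>q\<in>set p. c$q : V" "\<exists>q\<in>set p. c$q ~: nonunits R V"
 using scale_list[OF pc p(2)] by blast
 let ?p = "map (%q. c$q) p"
 have e: "eval ?p z = c$eval p z" by (rule eval_map_mult[OF kf(2)[OF c(1)] vc[OF z(1)] pc])
 have pV: "set ?p <= V" using c(3) by auto
 have pK: "set ?p <= K" using p(1) kcl(4)[OF c(1)] by auto
 have eV: "c$eval p z : V" unfolding e[symmetric] by (rule eval_in_subring[OF VD(1) z(1) pV])
 have "~ set ?p <= nonunits R V" using c(4) by auto
 then have "\<rho> (eval ?p z) ~= 0.\<^bsub>L\<^esub>" using residue_transcendental[OF z pK pV] by blast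
 then have n: "c$eval p z ~: nonunits R V" unfolding e using ker[OF eV] by blast
 have "set (map \<rho> ?p) <= \<kappa>" unfolding base using pV pK by auto
 then have "\<rho> (c$eval p z) : L.simple_extension \<kappa> (\<rho> z)"
 unfolding e[symmetric] \<rho>_eval[OF z(1) pV] L.polys_iff[OF L.kf(1) \<rho>_closed[OF z(1)]] by blast
 then show ?thesis using c(1,2,3) eV n by blast
qed

text \<open>The scaling factor of \<open>gauss_scale\<close> cannot be a nonunit when the value is
  integral, so undoing it preserves integrality of the coefficients.\<close>

lemma gauss:
 assumes z: "z : V" "\<rho> z ~: \<kappa>" and p: "set p <= K" "eval p z : V"
 shows "set p <= V"
proof (cases "set p <= {0.}")
 case True
 then show ?thesis using vcl(1) by auto
next
 case False
 obtain c where c: "c : K" "c ~= 0." "\<forall>q\<in>set p. c$q : V" "c$eval p z ~: nonunits R V"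
 using gauss_scale[OF z p(1) False] by blast
 have cc: "c : carrier R" by (rule kf(2)[OF c(1)])
 have "c ~: nonunits R V" using nonunits_mult[OF VD(1) _ p(2), of c] c(4) by blast
 then have i: "inv c : V" by (rule inv_integral[OF cc c(2)])
 show ?thesis
 proof
 fix q assume q: "q : set p"
 then have "q = inv c$(c$q)" using cc c(2) p(1) kf(2) by auto
 also have "... : V" by (rule vcl(4)[OF i]) (use c(3) q in blast)
 finally show "q : V" .
 qed
qed

text \<open>Residues of k(x)-type elements are controlled by those of polynomials. For e = u/w with
  cu and dw units, the leftover factor f = d/c is integral and lies in \<open>K\<close>, so its
  residue is in \<kappa>, and e = (cu) f/(dw).\<close>

lemma base_residue:
 assumes k': "subfield \<kappa>' L" "\<kappa> <= \<kappa>'"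
 and s: "\<forall>z\<in>simple_extension K x. z ~= 0. -->
 (\<exists>c\<in>K. c ~= 0. & c$z : V & c$z ~: nonunits R V & \<rho> (c$z) : \<kappa>')"
 and e: "e : E" "e : V"
 shows "\<rho> e : \<kappa>'"
proof (cases "e = 0.")
 case True
 then show ?thesis using \<rho>_zero L.subcl(1)[OF L.sf_facts(1)[OF k'(1)]] by simp
next
 case False
 obtain u w where uw: "u : simple_extension K x" "w : simple_extension K x" "w ~= 0." "e = u$inv w"
 using ff(5)[OF e(1)] by blast
 note sc = subcarr[OF polys_subring(1)[OF kf(1) xc]]
 have cc: "u : carrier R" "w : carrier R" using sc[OF uw(1)] sc[OF uw(2)] by simp_all
 have u0: "u ~= 0." using False uw(3,4) cc by auto
 obtain c where c: "c : K" "c ~= 0." "c$u : V" "c$u ~: nonunits R V" "\<rho> (c$u) : \<kappa>'"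
 using s uw(1) u0 by blast
 obtain d where d: "d : K" "d ~= 0." "d$w : V" "d$w ~: nonunits R V" "\<rho> (d$w) : \<kappa>'"
 using s uw(2,3) by blast
 have dc: "c : carrier R" "d : carrier R" by (rule kf(2)[OF c(1)], rule kf(2)[OF d(1)])
 note ui = \<rho>_inv[OF c(3,4)] and wi = \<rho>_inv[OF d(3,4)]
 define f where "f = d$inv c"
 have fc: "f : carrier R" and fK: "f : K"
 unfolding f_def using dc c(2) kcl(4)[OF d(1) kf(3)[OF c(1,2)]] by simp_all
 have i: "inv c : carrier R" "inv w : carrier R" "inv u : carrier R" "inv d : carrier R"
 using dc cc c(2) u0 uw(3) d(2) by simp_all
 have fe: "f = e$(d$w)$inv (c$u)"
 proof -
 have "e$(d$w)$inv (c$u) = (u$inv w)$(d$w)$(inv c$inv u)"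
 using inv_mult_distrib[OF dc(1) c(2) cc(1) u0] uw(4) by simp
 also have "... = (u$inv u)$(w$inv w)$(d$inv c)"
 by (reify rsimps, rule ring_id, simp add: cc dc i, simp, code_simp)
 finally show ?thesis unfolding f_def using cc dc u0 uw(3) i by simp
 qed
 then have fV: "f : V" using vcl(4)[OF vcl(4)[OF e(2) d(3)] ui(3)] by simp
 have "e = (c$u)$f$inv (d$w)"
 proof -
 have "(c$u)$f$inv (d$w) = (c$u)$(d$inv c)$(inv d$inv w)"
 unfolding f_def using inv_mult_distrib[OF dc(2) d(2) cc(2) uw(3)] by simp
 also have "... = (c$inv c)$(d$inv d)$(u$inv w)"
 by (reify rsimps, rule ring_id, simp add: cc dc i, simp, code_simp)
 finally show ?thesis unfolding uw(4) using cc dc c(2) d(2) i by simp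
 qed
 then have re: "\<rho> e = \<rho> (c$u) $\<^bsub>L\<^esub> \<rho> f $\<^bsub>L\<^esub> inv\<^bsub>L\<^esub> \<rho> (d$w)"
 using \<rho>_mult[OF vcl(4)[OF c(3) fV] wi(3)] \<rho>_mult[OF c(3) fV] wi(1) by simp
 have "\<rho> f : \<kappa>'" using k'(2) base fK fV by blast
 note cl = L.subcl[OF L.sf_facts(1)[OF k'(1)]]
 show ?thesis unfolding re
 by (rule cl(4)[OF cl(4)[OF c(5) \<open>\<rho> f \<in> \<kappa>'\<close>] L.sf_facts(3)[OF k'(1) d(5) wi(2)]])
qed

lemma y_square: "y$y : E"
 unfolding eq using ecl(5)[OF ecl(5)[OF ecl(4)[OF xx ff(4)] ecl(4)[OF _ ff(4)]]] ff(3) ab by blast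

lemma carrier_y: "carrier R = {u+.v$y | u v. u : E & v : E}"
 by (rule carrier_quadratic[OF yc y_square ecl(2)]) (use yc in simp)

text \<open>Otherwise a lift of \<open>x'\<close>, being quadratic over \<open>E\<close>, would
  satisfy a scaled equation whose reduction is a nontrivial relation over \<kappa>, while
  \<open>x'\<close> is transcendental.\<close>

lemma base_residue_not_constant: "\<exists>e\<in>E \<inter> V. \<rho> e ~: \<kappa>"
proof (rule ccontr)
 assume n: "~ ?thesis"
 have xL: "x' : carrier L" by (rule L.xc)
 have "x' : \<rho> ` V" unfolding surj by (rule xL)
 then obtain z where z: "z : V" "x' = \<rho> z" by blast
 have zc: "z : carrier R" by (rule vc[OF z(1)])
 then have "z : {u+.v$y | u v. u : E & v : E}" unfolding carrier_y[symmetric] .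
 then obtain u v where uv: "z = u+.v$y" "u : E" "v : E"
 unfolding mem_Collect_eq by (elim exE conjE) (rule that)
 have c: "u : carrier R" "v : carrier R" by (rule ef(2)[OF uv(2)], rule ef(2)[OF uv(3)])
 \<comment> \<open>Norm and negative trace of \<open>z\<close> over \<open>E\<close>, the
   coefficients of its quadratic equation.\<close>
 let ?N = "u$u-.v$v$(y$y)" and ?T = "-. (u+.u)"
 have T: "?T : E" by (rule ecl(3)[OF ecl(5)[OF uv(2,2)]])
 have N: "?N : E" by (rule ecl(6)[OF ecl(4)[OF uv(2,2)] ecl(4)[OF ecl(4)[OF uv(3,3)] y_square]])
 let ?p = "[1., ?T, ?N]"
 have pc: "set ?p <= carrier R" using ef(2)[OF T] ef(2)[OF N] by simp
 have "eval ?p z = z$z+.?T$z+.?N" using zc c yc by (simp add: eval_Cons a_assoc numeral_2_eq_2)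
 also have "... = 0." unfolding uv(1) by (reify rsimps, rule ring_id, simp add: c yc, simp, code_simp)
 finally have ev: "eval ?p z = 0." .
 have "~ set ?p <= {0.}" by simp
 then obtain d where d: "d : K" "d ~= 0." "\<forall>q\<in>set ?p. d$q : V" "\<exists>q\<in>set ?p. d$q ~: nonunits R V"
 using scale_list[OF pc] by blast
 let ?q = "map (%q. d$q) ?p"
 have dE: "d : E" using ff(3) d(1) by blast
 have qV: "set ?q <= V" using d(3) by auto
 have qE: "set ?q <= E" using ecl(4)[OF dE ecl(2)] ecl(4)[OF dE T] ecl(4)[OF dE N] by simp
 have "eval ?q z = 0." unfolding eval_map_mult[OF kf(2)[OF d(1)] zc pc] ev using kf(2)[OF d(1)] by simp
 then have e0: "L.eval (map \<rho> ?q) (\<rho> z) = 0.\<^bsub>L\<^esub>" using \<rho>_eval[OF z(1) qV] \<rho>_zero by simp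
 have qk: "set (map \<rho> ?q) <= \<kappa>"
 proof
 fix w assume "w : set (map \<rho> ?q)"
 then obtain r where "r : set ?q" "w = \<rho> r" unfolding set_map by blast
 then show "w : \<kappa>" using n qV qE by blast
 qed
 have "set (map \<rho> ?q) <= {0.\<^bsub>L\<^esub>}"
 using L.tr L.transcendental_iff[OF L.kf(1) xL] e0 qk z(2) by blast
 then have "\<forall>r\<in>set ?q. \<rho> r = 0.\<^bsub>L\<^esub>" unfolding set_map by blast
 then have "\<forall>r\<in>set ?q. r : nonunits R V" using ker qV by blast
 then show False using d(4) by auto
qed

lemma eval_congruent:
 assumes z: "z : V" "w : V" and p: "set p <= V"
 shows "\<exists>v\<in>V. eval p z = eval p w+.(z-.w)$v"
 using p
proof (induction p rule: rev_induct)
 case Nil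
 show ?case using vcl(1) vc[OF z(1)] vc[OF z(2)] by (intro bexI[of _ \<zero>]) simp_all
next
 case (snoc c p)
 have p: "set p <= V" "c : V" using snoc.prems by simp_all
 obtain v where v: "v : V" "eval p z = eval p w+.(z-.w)$v" using snoc.IH[OF p(1)] by blast
 have pc: "set p <= carrier R" using p(1) vc by blast
 note cc = vc[OF z(1)] vc[OF z(2)] vc[OF p(2)] vc[OF v(1)]
 have wV: "eval p w : V" by (rule eval_in_subring[OF VD(1) z(2) p(1)])
 note ec = vc[OF wV]
 have "eval (p @ [c]) z = eval (p @ [c]) w+.(z-.w)$(v$z+.eval p w)"
 unfolding eval_snoc[OF pc cc(3) cc(1)] eval_snoc[OF pc cc(3) cc(2)] v(2)
 by (reify rsimps, rule ring_id, simp add: cc ec, simp, code_simp)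
 then show ?case using vcl(5)[OF vcl(4)[OF v(1) z(1)] wV] by blast
qed

lemma polys_substitute:
 assumes c: "c : K" "c ~= 0." "a0 : K" and z: "z : simple_extension K x"
 shows "z : simple_extension K (c$(x-.a0))"
proof -
 have cc: "c : carrier R" "a0 : carrier R" using kf(2) c by blast+
 have Xc: "c$(x-.a0) : carrier R" using cc xc by simp
 note ps = polys_subring[OF kf(1) Xc] note pcl = subcl[OF ps(1)]
 have "x = inv c$(c$(x-.a0))+.a0" using cc c(2) xc by (simp add: minus_eq a_assoc l_neg)
 also have "... : simple_extension K (c$(x-.a0))"
 using pcl(5)[OF pcl(4)[OF _ ps(3)]] ps(2) kf(3)[OF c(1,2)] c(3) by blast
 finally have x: "x : simple_extension K (c$(x-.a0))" .
 obtain p where p: "set p <= K" "z = eval p x" using z polys_iff[OF kf(1) xc] by blast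
 show ?thesis unfolding p(2) by (rule eval_in_subring[OF ps(1) x]) (use p(1) ps(2) in blast)
qed

text \<open>If every integral c(x - a0) had its residue in \<kappa>, a scaled \<open>x\<close> could
  be approximated by elements of \<open>K\<close> modulo every power of \<pi>. All polynomials in
  \<open>x\<close>, scaled to units, would then have residues in \<kappa>, and so would all of
  \<open>E\<close>, against \<open>base_residue_not_constant\<close>.\<close>

lemma transcendental_residue_coordinate:
 "\<exists>c\<in>K. \<exists>a0\<in>K. c ~= 0. & c$(x-.a0) : V & \<rho> (c$(x-.a0)) ~: \<kappa>"
proof (rule ccontr)
 assume n: "~ ?thesis"
 obtain c where c: "c : K" "c ~= 0." "c$x : V" using scale_unit[OF xc x0] by blast
 have cc: "c : carrier R" "inv c : carrier R" "inv c : K" using kf(2)[OF c(1)] c(2) kf(3)[OF c(1,2)] by simp_all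
 define X0 where "X0 = c$(x-.0.)"
 have Xx: "X0 = c$x" unfolding X0_def using xc by (simp add: minus_eq)
 have XV: "X0 : V" unfolding Xx by (rule c(3))
 note Xc = vc[OF XV]
 \<comment> \<open>One more digit at each stage: the error divided by the power of \<pi> is again of
   the form c(x - a0), so its residue lifts to \<open>K\<close>.\<close>
 have approx: "\<exists>a0\<in>K \<inter> V. \<exists>w\<in>V. X0-.a0 = \<pi> [^] n$w" for n :: nat
 proof (induction n)
 case 0
 have "X0-.0. = \<pi> [^] (0::nat)$X0" using Xc by (simp add: minus_eq)
 then show ?case using kcl(1) vcl(1) XV by blast
 next
 case (Suc n)
 obtain a0 w where a0: "a0 : K" "a0 : V" "w : V" "X0-.a0 = \<pi> [^] n$w" using Suc.IH by blast
 note ac = vc[OF a0(2)] vc[OF a0(3)] note pk = power_K[of n]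
 have "(inv (\<pi> [^] n)$c)$(x-.inv c$a0) = inv (\<pi> [^] n)$(c$x-.(c$inv c)$a0)"
 by (reify rsimps, rule ring_id, simp add: cc ac pk xc, simp, code_simp)
 also have "... = inv (\<pi> [^] n)$(X0-.a0)" using Xx cc c(2) ac by simp
 also have "... = w" unfolding a0(4) using pk ac by simp
 finally have w: "(inv (\<pi> [^] n)$c)$(x-.inv c$a0) = w" .
 have "inv (\<pi> [^] n)$c : K" "inv (\<pi> [^] n)$c ~= 0." "inv c$a0 : K"
 using kcl(4)[OF pk(2) c(1)] kcl(4)[OF cc(3) a0(1)] pk cc c(2) by simp_all
 then have "\<rho> w : \<kappa>" using n w a0(3) by metis
 then obtain b0 where b0: "b0 : K" "b0 : V" "\<rho> w = \<rho> b0" unfolding base by blast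
 have "w-.b0 : nonunits R V" using \<rho>_eq[OF a0(3) b0(2)] b0(3) by blast
 then obtain v where v: "v : V" "w-.b0 = \<pi>$v" using uniformizer(4) by blast
 note bc = vc[OF b0(2)] vc[OF v(1)]
 have "X0-.(a0+.\<pi> [^] n$b0) = (X0-.a0)-.\<pi> [^] n$b0"
 by (reify rsimps, rule ring_id, simp add: Xc ac bc pk, simp, code_simp)
 also have "... = \<pi> [^] n$(w-.b0)" unfolding a0(4)
 by (reify rsimps, rule ring_id, simp add: ac bc pk, simp, code_simp)
 also have "... = \<pi> [^] Suc n$v" unfolding v(2) using pk \<pi>c(1) bc by (simp add: m_assoc)
 finally have "X0-.(a0+.\<pi> [^] n$b0) = \<pi> [^] Suc n$v" .
 moreover have "a0+.\<pi> [^] n$b0 : K" by (rule kcl(5)[OF a0(1) kcl(4)[OF pk(1) b0(1)]])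
 moreover have "a0+.\<pi> [^] n$b0 : V" by (rule vcl(5)[OF a0(2) vcl(4)[OF vcl(7)[OF \<pi>c(2)] b0(2)]])
 ultimately show ?case using v(1) by blast
 qed
 have "\<rho> e : \<kappa>" if e: "e : E" "e : V" for e
 proof (rule base_residue[OF L.k subset_refl _ e], intro ballI impI)
 fix z assume z: "z : simple_extension K x" "z ~= 0."
 have "z : simple_extension K X0" unfolding X0_def by (rule polys_substitute[OF c(1,2) kcl(1) z(1)])
 then obtain p where p: "set p <= K" "z = eval p X0" using polys_iff[OF kf(1) Xc] by blast
 have pc: "set p <= carrier R" using p(1) kf(2) by blast
 have "~ set p <= {0.}" using eval_zeros[OF _ Xc] p(2) z(2) by blast
 then obtain d where d: "d : K" "d ~= 0." "\<forall>q\<in>set p. d$q : V" using scale_list[OF pc] by blast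
 note dc = kf(2)[OF d(1)]
 let ?q = "map (%q. d$q) p"
 have qV: "set ?q <= V" using d(3) by auto
 have qK: "set ?q <= K" using p(1) kcl(4)[OF d(1)] by auto
 have ez: "eval ?q X0 = d$z" unfolding p(2) by (rule eval_map_mult[OF dc Xc pc])
 have zc: "z : carrier R" unfolding p(2) using pc Xc by simp
 have dzV: "d$z : V" unfolding ez[symmetric] by (rule eval_in_subring[OF VD(1) XV qV])
 have dz0: "d$z ~= 0." using d(2) z(2) zc dc by simp
 obtain m u where u: "u : V" "u ~: nonunits R V" "d$z = \<pi> [^] (m::nat)$u"
 using unit_times_power[OF dzV dz0] by blast
 \<comment> \<open>Precision m + 1 exceeds the order m of the value, so replacing \<open>X0\<close>
   by its approximation \<open>a0\<close> preserves the residue of the unit part.\<close>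
 obtain a0 w where a0: "a0 : K" "a0 : V" "w : V" "X0-.a0 = \<pi> [^] Suc m$w" using approx[of "Suc m"] by blast
 obtain v where v: "v : V" "eval ?q X0 = eval ?q a0+.(X0-.a0)$v" using eval_congruent[OF XV a0(2) qV] by blast
 have g: "eval ?q a0 : K" "eval ?q a0 : V"
 by (rule eval_in_subring[OF kf(1) a0(1) qK], rule eval_in_subring[OF VD(1) a0(2) qV])
 define h where "h = inv (\<pi> [^] m)$eval ?q a0"
 note pk = power_K[of m] note gc = vc[OF g(2)] vc[OF u(1)] vc[OF v(1)] vc[OF a0(3)]
 have hK: "h : K" unfolding h_def by (rule kcl(4)[OF pk(2) g(1)])
 note hc = kf(2)[OF hK]
 have "eval ?q a0 = \<pi> [^] m$h" unfolding h_def using pk gc by simp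
 then have "\<pi> [^] m$u = \<pi> [^] m$h+.\<pi> [^] Suc m$w$v" using v(2) a0(4) ez u(3) by simp
 also have "... = \<pi> [^] m$(h+.\<pi>$(w$v))"
 unfolding nat_pow_Suc by (reify rsimps, rule ring_id, simp add: gc pk hc \<pi>c, simp, code_simp)
 finally have uh: "u = h+.\<pi>$(w$v)" using m_lcancel[of "\<pi> [^] m"] pk gc hc \<pi>c by simp
 have wv: "\<pi>$(w$v) : nonunits R V" "\<pi>$(w$v) : V"
 using nonunits_mult[OF VD(1) uniformizer(2) vcl(4)[OF a0(3) v(1)]] nonunits_iff[OF VD(1)] by blast+
 have "h = u-.\<pi>$(w$v)" unfolding uh
 by (reify rsimps, rule ring_id, simp add: gc hc \<pi>c, simp, code_simp)
 then have hV: "h : V" using vcl(6)[OF u(1) wv(2)] by simp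
 have "u-.h = \<pi>$(w$v)" unfolding uh
 by (reify rsimps, rule ring_id, simp add: gc hc \<pi>c, simp, code_simp)
 then have "\<rho> u = \<rho> h" using \<rho>_eq[OF u(1) hV] wv(1) by simp
 then have ru: "\<rho> u : \<kappa>" unfolding base using hK hV by blast
 have "inv (\<pi> [^] m)$d$z = u" using u(3) pk gc dc zc by (simp add: m_assoc)
 moreover have "inv (\<pi> [^] m)$d : K" "inv (\<pi> [^] m)$d ~= 0." using kcl(4)[OF pk(2) d(1)] pk dc d(2) by simp_all
 ultimately show "\<exists>c\<in>K. c ~= 0. & c$z : V & c$z ~: nonunits R V & \<rho> (c$z) : \<kappa>"
 using u(1,2) ru by (intro bexI[of _ "inv (\<pi> [^] m)$d"]) simp_all
 qed
 then show False using base_residue_not_constant by blast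
qed

end

section \<open>Nonsingularity of the reduced equation\<close>

context curve_reduction

begin

text \<open>1 and the residue of \<open>t\<close> are linearly independent over \<kappa>'. A factor
  that makes \<open>g\<close> and \<open>h\<close> integral and one of them a unit cannot be a
  nonunit, since reduction would then give a nontrivial relation.\<close>

lemma residue_quadratic_independent:
 assumes \<kappa>': "subfield \<kappa>' L" "\<forall>e\<in>E \<inter> V. \<rho> e : \<kappa>'" and t: "t : V" "\<rho> t ~: \<kappa>'"
 and g: "g : E" "h : E" "g+.h$t : V"
 shows "g : V & h : V"
proof (cases "g = 0. & h = 0.")
 case True
 then show ?thesis using vcl(1) by simp
next
 case False
 have c: "g : carrier R" "h : carrier R" "t : carrier R" using ef(2)[OF g(1)] ef(2)[OF g(2)] vc[OF t(1)] by simp_all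
 have "~ set [g, h] <= {0.}" "set [g, h] <= carrier R" using False c by auto
 then obtain e where e: "e : K" "e ~= 0." "\<forall>q\<in>set [g, h]. e$q : V" "\<exists>q\<in>set [g, h]. e$q ~: nonunits R V"
 using scale_list by blast
 have eV: "e$g : V" "e$h : V" using e(3) by simp_all
 have ec: "e : carrier R" "e : E" using kf(2)[OF e(1)] ff(3) e(1) by auto
 have "e ~: nonunits R V"
 proof
 assume "e : nonunits R V"
 then have "e$(g+.h$t) : nonunits R V" by (rule nonunits_mult[OF VD(1) _ g(3)])
 moreover have ee: "e$(g+.h$t) = e$g+.e$h$t"
 by (reify rsimps, rule ring_id, simp add: c ec, simp, code_simp)
 moreover have sV: "e$g+.e$h$t : V" by (rule vcl(5)[OF eV(1) vcl(4)[OF eV(2) t(1)]])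
 ultimately have "\<rho> (e$g+.e$h$t) = 0.\<^bsub>L\<^esub>" using ker[OF sV] by simp
 then have z: "\<rho> (e$g) +.\<^bsub>L\<^esub> \<rho> (e$h) $\<^bsub>L\<^esub> \<rho> t = 0.\<^bsub>L\<^esub>"
 using \<rho>_add[OF eV(1) vcl(4)[OF eV(2) t(1)]] \<rho>_mult[OF eV(2) t(1)] by simp
 have k: "\<rho> (e$g) : \<kappa>'" "\<rho> (e$h) : \<kappa>'"
 using \<kappa>'(2) eV ecl(4)[OF ec(2) g(1)] ecl(4)[OF ec(2) g(2)] by blast+
 note kc = \<rho>_closed[OF eV(1)] \<rho>_closed[OF eV(2)] \<rho>_closed[OF t(1)]
 show False
 proof (cases "\<rho> (e$h) = 0.\<^bsub>L\<^esub>")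
 case True
 then have "\<rho> (e$g) = 0.\<^bsub>L\<^esub>" using z kc by simp
 then show False using True e(4) ker eV by auto
 next
 case False
 have "\<rho> (e$h) $\<^bsub>L\<^esub> \<rho> t = -.\<^bsub>L\<^esub> \<rho> (e$g)"
 using L.minus_equality[of "\<rho> (e$h) $\<^bsub>L\<^esub> \<rho> t" "\<rho> (e$g)"] z kc L.a_comm by simp
 then have "\<rho> t = inv\<^bsub>L\<^esub> \<rho> (e$h) $\<^bsub>L\<^esub> ( -.\<^bsub>L\<^esub> \<rho> (e$g))"
 using L.mult_inv_cancel(2)[OF kc(2) False kc(3)] by simp
 note cl = L.subcl[OF L.sf_facts(1)[OF \<kappa>'(1)]]
 have "\<rho> t : \<kappa>'" unfolding \<open>\<rho> t = _\<close>
 by (rule cl(4)[OF L.sf_facts(3)[OF \<kappa>'(1) k(2) False] cl(3)[OF k(1)]])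
 then show False using t(2) by blast
 qed
 qed
 then have i: "inv e : V" by (rule inv_integral[OF ec(1) e(2)])
 have "g = inv e$(e$g)" "h = inv e$(e$h)" using ec c e(2) by simp_all
 then show ?thesis using vcl(4)[OF i eV(1)] vcl(4)[OF i eV(2)] by simp
qed

lemma two_unit: "1.+.1. : V" "1.+.1. ~: nonunits R V"
 and three_unit: "1.+.1.+.1. : V" "1.+.1.+.1. ~: nonunits R V"
proof -
 show 1: "1.+.1. : V" by (rule vcl(5)[OF vcl(2,2)])
 show 2: "1.+.1.+.1. : V" by (rule vcl(5)[OF 1 vcl(2)])
 have r: "\<rho> ( 1.+.1.) = 1.\<^bsub>L\<^esub> +.\<^bsub>L\<^esub> 1.\<^bsub>L\<^esub>" using \<rho>_add[OF vcl(2,2)] \<rho>_one by simp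
 then show "1.+.1. ~: nonunits R V" using ker[OF 1] L.two by simp
 have "\<rho> ( 1.+.1.+.1.) = 1.\<^bsub>L\<^esub> +.\<^bsub>L\<^esub> 1.\<^bsub>L\<^esub> +.\<^bsub>L\<^esub> 1.\<^bsub>L\<^esub>" using \<rho>_add[OF 1 vcl(2)] r \<rho>_one by simp
 then show "1.+.1.+.1. ~: nonunits R V" using ker[OF 2] three by simp
qed

text \<open>With a coordinate Z = c(x - a0) of nonconstant residue and U = dy scaled to a unit, the
  equation has integral coefficients, and the residues of \<open>Z\<close> and \<open>U\<close>
  generate the residue field. As this field is not rational, the cubic coefficient cannot vanish in
  the reduction (a conic) and the reduced cubic cannot be singular. Making the cubic monic and
  removing its square term turns (Z, U) into (\<mu>^2 x, \<mu>^3 y) with \<mu> = d/c.\<close>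

theorem reduced_weierstrass:
 "\<exists>\<mu>\<in>K. \<mu> ~= 0. & \<mu>$\<mu>$\<mu>$\<mu>$a : V & \<mu>$\<mu>$\<mu>$\<mu>$\<mu>$\<mu>$b : V &
 (\<exists>u v. weierstrass_function_field L \<kappa> u v (\<rho> (\<mu>$\<mu>$\<mu>$\<mu>$a)) (\<rho> (\<mu>$\<mu>$\<mu>$\<mu>$\<mu>$\<mu>$b)))"
proof -
 obtain c a0 where c: "c : K" "c ~= 0." "a0 : K" and Xk: "c$(x-.a0) : V" "\<rho> (c$(x-.a0)) ~: \<kappa>"
 using transcendental_residue_coordinate by blast
 have y0: "y ~= 0." using y_notin ecl(1) by auto
 obtain d where d: "d : K" "d ~= 0." "d$y : V" "d$y ~: nonunits R V" using scale_unit[OF yc y0] by blast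
 have cc: "c : carrier R" "a0 : carrier R" "d : carrier R" "inv c : carrier R" "c$inv c = 1." "d$inv d = 1." "inv d : carrier R"
 using kf(2)[OF c(1)] kf(2)[OF c(3)] kf(2)[OF d(1)] c(2) d(2) by simp_all
 have iK: "inv c : K" "inv d : K" by (rule kf(3)[OF c(1,2)], rule kf(3)[OF d(1,2)])
 define Z where "Z = c$(x-.a0)"
 define U where "U = d$y"
 have XV: "Z : V" "\<rho> Z ~: \<kappa>" unfolding Z_def by (rule Xk(1), rule Xk(2))
 have UV: "U : V" "U ~: nonunits R V" unfolding U_def by (rule d(3), rule d(4))
 note Xc = vc[OF XV(1)] and Uc = vc[OF UV(1)]
 note rX = \<rho>_closed[OF XV(1)] and rU = \<rho>_closed[OF UV(1)]
 define \<kappa>1 where "\<kappa>1 = L.funfield \<kappa> (\<rho> Z)"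
 note f1 = L.funfield_facts[OF L.kf(1) rX, folded \<kappa>1_def]
 note fs1 = L.sf_facts[OF f1(1)]
 note cl1 = L.subcl[OF fs1(1)]
 have E1: "\<rho> e : \<kappa>1" if e: "e : E" "e : V" for e
 proof (rule base_residue[OF f1(1,3) _ e], intro ballI impI)
 fix z assume z: "z : simple_extension K x" "z ~= 0."
 have "z : simple_extension K Z" unfolding Z_def by (rule polys_substitute[OF c z(1)])
 then obtain p where p: "set p <= K" "z = eval p Z" using polys_iff[OF kf(1) Xc] by blast
 have "~ set p <= {0.}" using eval_zeros[OF _ Xc] p(2) z(2) by blast
 then show "\<exists>c\<in>K. c ~= 0. & c$z : V & c$z ~: nonunits R V & \<rho> (c$z) : \<kappa>1"
 using gauss_scale[OF XV p(1)] f1(2) unfolding p(2) by blast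
 qed
 have E1': "\<forall>e\<in>E \<inter> V. \<rho> e : \<kappa>1" using E1 by blast
 have dE: "d : E" "inv d : E" "Z : E" using ff(3) d(1) iK(2) c(1,3) ecl(4)[of c "x-.a0"] ecl(6)[OF ff(4), of a0]
 unfolding Z_def by blast+
 have UU: "U$U = d$d$(y$y)" unfolding U_def
 by (reify rsimps, rule ring_id, simp add: cc yc, simp, code_simp)
 have UE: "U$U : E" unfolding UU by (rule ecl(4)[OF ecl(4)[OF dE(1,1)] y_square])
 have "y = inv d$U" unfolding U_def using cc d(2) yc by simp
 then have CU: "carrier R = {u+.v$U | u v. u : E & v : E}" by (rule carrier_quadratic[OF Uc UE dE(2)])
 have split: "\<exists>u v. z = u+.v$U & u : E & v : E" if z: "z : V" for z
 proof -
 have "z : {u+.v$U | u v. u : E & v : E}" using vc[OF z] unfolding CU .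
 then show ?thesis unfolding mem_Collect_eq .
 qed
 \<comment> \<open>By \<open>not_rational\<close> some \<open>t\<close> has a residue outside
   \<kappa>1. Its quadratic equation over \<open>E\<close> shows 2u, and then u and v, to be
   integral; if the residue of \<open>U\<close> were in \<kappa>1, that of t = u + vU would be
   too.\<close>
 have Un: "\<rho> U ~: \<kappa>1"
 proof
 assume U1: "\<rho> U : \<kappa>1"
 have "\<kappa>1 <= carrier L" using fs1(2) by blast
 then obtain t' where t': "t' : carrier L" "t' ~: \<kappa>1" using L.not_rational[OF rX] unfolding \<kappa>1_def by blast
 have "t' : \<rho> ` V" unfolding surj by (rule t'(1))
 then obtain t where t: "t : V" "t' = \<rho> t" by blast
 note tc = vc[OF t(1)]
 obtain u v where uv: "t = u+.v$U" "u : E" "v : E" using split[OF t(1)] by blast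
 have c: "u : carrier R" "v : carrier R" by (rule ef(2)[OF uv(2)], rule ef(2)[OF uv(3)])
 have tk: "\<rho> t ~: \<kappa>1" using t'(2) t(2) by simp
 let ?N = "v$v$(U$U)-.u$u"
 have "?N+.(u+.u)$t = t$t" unfolding uv(1)
 by (reify rsimps, rule ring_id, simp add: c Uc, simp, code_simp)
 then have "?N+.(u+.u)$t : V" using vcl(4)[OF t(1,1)] by simp
 moreover have "?N : E" by (rule ecl(6)[OF ecl(4)[OF ecl(4)[OF uv(3,3)] UE] ecl(4)[OF uv(2,2)]])
 moreover have "u+.u : E" by (rule ecl(5)[OF uv(2,2)])
 ultimately have uu: "u+.u : V" using residue_quadratic_independent[OF f1(1) E1' t(1) tk] by blast
 have i2: "inv ( 1.+.1.) : V" "1.+.1. ~= 0." using \<rho>_inv(3)[OF two_unit] two by simp_all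
 have "u+.u = ( 1.+.1.)$u" by (reify rsimps, rule ring_id, simp add: c, simp, code_simp)
 then have "u = inv ( 1.+.1.)$(u+.u)" using i2(2) c by simp
 then have uV: "u : V" using vcl(4)[OF i2(1) uu] by simp
 have iU: "inv U : V" "U ~= 0." using unit_inv[OF VD(1) UV] by simp_all
 have "v = (t-.u)$inv U" unfolding uv(1) using c Uc iU(2)
 by (simp add: minus_eq a_comm[of u] a_assoc r_neg m_assoc)
 then have vV: "v : V" using vcl(4)[OF vcl(6)[OF t(1) uV] iU(1)] by simp
 have "\<rho> t = \<rho> u +.\<^bsub>L\<^esub> \<rho> v $\<^bsub>L\<^esub> \<rho> U"
 unfolding uv(1) using \<rho>_add[OF uV vcl(4)[OF vV UV(1)]] \<rho>_mult[OF vV UV(1)] by simp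
 then have "\<rho> t : \<kappa>1" using cl1(5)[OF E1[OF uv(2) uV] cl1(4)[OF E1[OF uv(3) vV] U1]] by simp
 then show False using tk by blast
 qed
 have CL: "z' : {u +.\<^bsub>L\<^esub> v $\<^bsub>L\<^esub> \<rho> U | u v. u : \<kappa>1 & v : \<kappa>1}" if z': "z' : carrier L" for z'
 proof -
 have "z' : \<rho> ` V" unfolding surj by (rule z')
 then obtain z where z: "z : V" "z' = \<rho> z" by blast
 obtain u v where uv: "z = u+.v$U" "u : E" "v : E" using split[OF z(1)] by blast
 have uvV: "u : V" "v : V"
 using residue_quadratic_independent[OF f1(1) E1' UV(1) Un uv(2,3)] z(1) uv(1) by simp_all
 have "z' = \<rho> u +.\<^bsub>L\<^esub> \<rho> v $\<^bsub>L\<^esub> \<rho> U"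
 unfolding z(2) uv(1) using \<rho>_add[OF uvV(1) vcl(4)[OF uvV(2) UV(1)]] \<rho>_mult[OF uvV(2) UV(1)] by simp
 then show ?thesis using E1[OF uv(2) uvV(1)] E1[OF uv(3) uvV(2)] by blast
 qed
 \<comment> \<open>Coefficients of U^2 = d^2 (x^3 + ax + b) as a cubic in \<open>Z\<close>, by x =
   Z/c + a0.\<close>
 define h3 h2 h1 h0 where "h3 = d$d$inv c$inv c$inv c"
 and "h2 = d$d$inv c$inv c$(( 1.+.1.+.1.)$a0)"
 and "h1 = d$d$inv c$(( 1.+.1.+.1.)$a0$a0+.a)"
 and "h0 = d$d$(a0$a0$a0+.a$a0+.b)"
 note hd = h3_def h2_def h1_def h0_def
 have th: "1.+.1.+.1. : K" by (rule kcl(5)[OF kcl(5)[OF kcl(2,2)] kcl(2)])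
 have dd: "d$d : K" by (rule kcl(4)[OF d(1,1)])
 have hK: "h3 : K" "h2 : K" "h1 : K" "h0 : K"
 proof -
 show "h3 : K" unfolding hd by (rule kcl(4)[OF kcl(4)[OF kcl(4)[OF dd iK(1)] iK(1)] iK(1)])
 show "h2 : K" unfolding hd by (rule kcl(4)[OF kcl(4)[OF kcl(4)[OF dd iK(1)] iK(1)] kcl(4)[OF th c(3)]])
 show "h1 : K" unfolding hd
 by (rule kcl(4)[OF kcl(4)[OF dd iK(1)] kcl(5)[OF kcl(4)[OF kcl(4)[OF th c(3)] c(3)] ab(1)]])
 show "h0 : K" unfolding hd
 by (rule kcl(4)[OF dd kcl(5)[OF kcl(5)[OF kcl(4)[OF kcl(4)[OF c(3,3)] c(3)] kcl(4)[OF ab(1) c(3)]] ab(2)]])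
 qed
 have hc: "h3 : carrier R" "h2 : carrier R" "h1 : carrier R" "h0 : carrier R" using hK kf(2) by blast+
 define w where "w = x-.a0"
 have wc: "w : carrier R" unfolding w_def using xc cc by simp
 have xw: "x = w+.a0" unfolding w_def using xc cc by (simp add: minus_eq a_assoc l_neg)
 have ev: "eval [h3, h2, h1, h0] Z = h3$Z$Z$Z+.h2$Z$Z+.h1$Z+.h0"
 using Xc hc by (simp add: eval_Cons a_assoc m_assoc numeral_3_eq_3 numeral_2_eq_2)
 have "h3$Z$Z$Z+.h2$Z$Z+.h1$Z+.h0 =
 d$d$((c$inv c)$(c$inv c)$(c$inv c)$w$w$w +.
 (c$inv c)$(c$inv c)$( 1.+.1.+.1.)$a0$w$w +.
 (c$inv c)$(( 1.+.1.+.1.)$a0$a0+.a)$w+.(a0$a0$a0+.a$a0+.b))"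
 unfolding hd Z_def w_def[symmetric]
 by (reify rsimps, rule ring_id, simp add: cc wc abc, simp, code_simp)
 also have "... = d$d$( 1.$1.$1.$w$w$w+.1.$1.$( 1.+.1.+.1.)$a0$w$w +.
 1.$(( 1.+.1.+.1.)$a0$a0+.a)$w+.(a0$a0$a0+.a$a0+.b))"
 unfolding cc(5) ..
 also have "... = d$d$(y$y)" unfolding eq xw
 by (reify rsimps, rule ring_id, simp add: cc wc abc, simp, code_simp)
 finally have N: "U$U = h3$Z$Z$Z+.h2$Z$Z+.h1$Z+.h0" using UU by simp
 \<comment> \<open>The value is \<open>U$U\<close>, which is integral, so Gauss's lemma makes all
   coefficients integral.\<close>
 have "eval [h3, h2, h1, h0] Z : V" unfolding ev N[symmetric] by (rule vcl(4)[OF UV(1,1)])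
 moreover have "set [h3, h2, h1, h0] <= K" using hK by simp
 ultimately have "set [h3, h2, h1, h0] <= V" using gauss[OF XV] by blast
 then have hV: "h3 : V" "h2 : V" "h1 : V" "h0 : V" by simp_all
 note rh = \<rho>_closed[OF hV(1)] \<rho>_closed[OF hV(2)] \<rho>_closed[OF hV(3)] \<rho>_closed[OF hV(4)]
 have hk: "\<rho> h3 : \<kappa>" "\<rho> h2 : \<kappa>" "\<rho> h1 : \<kappa>" "\<rho> h0 : \<kappa>" unfolding base using hV hK by blast+
 have XX: "Z$Z : V" by (rule vcl(4)[OF XV(1,1)])
 have rN: "\<rho> U $\<^bsub>L\<^esub> \<rho> U = \<rho> h3 $\<^bsub>L\<^esub> \<rho> Z $\<^bsub>L\<^esub> \<rho> Z $\<^bsub>L\<^esub> \<rho> Z +.\<^bsub>L\<^esub> \<rho> h2 $\<^bsub>L\<^esub> \<rho> Z $\<^bsub>L\<^esub> \<rho> Z +.\<^bsub>L\<^esub> \<rho> h1 $\<^bsub>L\<^esub> \<rho> Z +.\<^bsub>L\<^esub> \<rho> h0"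
 proof -
 have m: "h3$Z : V" "h3$Z$Z : V" "h3$Z$Z$Z : V" "h2$Z : V" "h2$Z$Z : V" "h1$Z : V"
 by (rule vcl(4) hV XV(1))+
 have s: "h3$Z$Z$Z+.h2$Z$Z : V" "h3$Z$Z$Z+.h2$Z$Z+.h1$Z : V"
 by (rule vcl(5) m)+
 have "\<rho> (U$U) = \<rho> (h3$Z$Z$Z+.h2$Z$Z+.h1$Z+.h0)" unfolding N ..
 then show ?thesis
 unfolding \<rho>_mult[OF UV(1,1)] \<rho>_add[OF s(2) hV(4)] \<rho>_add[OF s(1) m(6)] \<rho>_add[OF m(3,5)]
 \<rho>_mult[OF m(2) XV(1)] \<rho>_mult[OF m(1) XV(1)] \<rho>_mult[OF hV(1) XV(1)] \<rho>_mult[OF m(4) XV(1)]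
 \<rho>_mult[OF hV(2) XV(1)] \<rho>_mult[OF hV(3) XV(1)] .
 qed
 have fs1U: "carrier L = {u +.\<^bsub>L\<^esub> v $\<^bsub>L\<^esub> \<rho> U | u v. u : \<kappa>1 & v : \<kappa>1}"
 proof
 show "carrier L <= {u +.\<^bsub>L\<^esub> v $\<^bsub>L\<^esub> \<rho> U | u v. u : \<kappa>1 & v : \<kappa>1}" using CL by blast
 show "{u +.\<^bsub>L\<^esub> v $\<^bsub>L\<^esub> \<rho> U | u v. u : \<kappa>1 & v : \<kappa>1} <= carrier L"
 proof
 fix z assume "z : {u +.\<^bsub>L\<^esub> v $\<^bsub>L\<^esub> \<rho> U | u v. u : \<kappa>1 & v : \<kappa>1}"
 then obtain u v where "z = u +.\<^bsub>L\<^esub> v $\<^bsub>L\<^esub> \<rho> U" "u : \<kappa>1" "v : \<kappa>1" unfolding mem_Collect_eq by (elim exE conjE) (rule that)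
 then show "z : carrier L" using L.a_closed[OF fs1(2) L.m_closed[OF fs1(2) rU]] by simp
 qed
 qed
 \<comment> \<open>If the cubic term disappeared, the residue field would be the function field of a
   conic.\<close>
 have h3n: "\<rho> h3 ~= 0.\<^bsub>L\<^esub>"
 proof
 assume z: "\<rho> h3 = 0.\<^bsub>L\<^esub>"
 have "\<rho> U $\<^bsub>L\<^esub> \<rho> U = \<rho> h2 $\<^bsub>L\<^esub> \<rho> Z $\<^bsub>L\<^esub> \<rho> Z +.\<^bsub>L\<^esub> \<rho> h1 $\<^bsub>L\<^esub> \<rho> Z +.\<^bsub>L\<^esub> \<rho> h0"
 unfolding rN z using rh rX by simp
 then show False
 using L.no_conic[OF fin rX XV(2) rU, folded \<kappa>1_def, OF Un fs1U hk(2,3,4)] by blast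
 qed
 \<comment> \<open>Since h3 = d^2/c^3 = \<mu>^2/c, the substitution h3 Z + s yields \<mu>^2 x and h3
   U yields \<mu>^3 y.\<close>
 define \<mu> where "\<mu> = d$inv c"
 have \<mu>: "\<mu> : K" "\<mu> ~= 0." "\<mu> : carrier R" unfolding \<mu>_def using kcl(4)[OF d(1) iK(1)] cc d(2) c(2) by simp_all
 define a1 b1 s where "a1 = \<mu>$\<mu>$\<mu>$\<mu>$a" and "b1 = \<mu>$\<mu>$\<mu>$\<mu>$\<mu>$\<mu>$b" and "s = \<mu>$\<mu>$a0"
 have sK: "s : K" unfolding s_def by (rule kcl(4)[OF kcl(4)[OF \<mu>(1,1)] c(3)])
 note sc = kf(2)[OF sK]
 have a1K: "a1 : K" unfolding a1_def by (rule kcl(4)[OF kcl(4)[OF kcl(4)[OF kcl(4)[OF \<mu>(1,1)] \<mu>(1)] \<mu>(1)] ab(1)])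
 have b1K: "b1 : K" unfolding b1_def
 by (rule kcl(4)[OF kcl(4)[OF kcl(4)[OF kcl(4)[OF kcl(4)[OF kcl(4)[OF \<mu>(1,1)] \<mu>(1)] \<mu>(1)] \<mu>(1)] \<mu>(1)] ab(2)])
 note a1c = kf(2)[OF a1K] and b1c = kf(2)[OF b1K]
 \<comment> \<open>The shift \<open>s\<close> is integral because 3 is a unit; this is what makes
   the short coefficients integral.\<close>
 have "h2 = ( 1.+.1.+.1.)$s" unfolding hd s_def \<mu>_def
 by (reify rsimps, rule ring_id, simp add: cc, simp, code_simp)
 moreover have i3: "inv ( 1.+.1.+.1.) : V" "1.+.1.+.1. ~= 0." using unit_inv[OF VD(1) three_unit] by simp_all
 ultimately have "s = inv ( 1.+.1.+.1.)$h2" using sc by simp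
 then have sV: "s : V" using vcl(4)[OF i3(1) hV(2)] by simp
 have "a1 = h1$h3-.( 1.+.1.+.1.)$s$s" unfolding hd s_def \<mu>_def a1_def
 by (reify rsimps, rule ring_id, simp add: cc abc, simp, code_simp)
 then have a1V: "a1 : V" using vcl(6)[OF vcl(4)[OF hV(3,1)] vcl(4)[OF vcl(4)[OF three_unit(1) sV] sV]] by simp
 have "b1 = h0$h3$h3-.s$s$s-.a1$s" unfolding hd s_def \<mu>_def a1_def b1_def
 by (reify rsimps, rule ring_id, simp add: cc abc, simp, code_simp)
 then have b1V: "b1 : V"
 using vcl(6)[OF vcl(6)[OF vcl(4)[OF vcl(4)[OF hV(4,1)] hV(1)] vcl(4)[OF vcl(4)[OF sV sV] sV]] vcl(4)[OF a1V sV]] by simp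
 define X1 Y1 where "X1 = h3$Z+.s" and "Y1 = h3$U"
 have h3Z: "h3$Z : V" by (rule vcl(4)[OF hV(1) XV(1)])
 have XYV: "X1 : V" "Y1 : V" unfolding X1_def Y1_def by (rule vcl(5)[OF h3Z sV], rule vcl(4)[OF hV(1) UV(1)])
 note XYc = vc[OF XYV(1)] vc[OF XYV(2)]
 have "X1 = d$d$inv c$inv c$(c$inv c)$w+.s" unfolding X1_def Z_def hd w_def[symmetric]
 by (reify rsimps, rule ring_id, simp add: cc wc sc, simp, code_simp)
 also have "... = \<mu>$\<mu>$x" unfolding cc(5) s_def \<mu>_def xw
 by (reify rsimps, rule ring_id, simp add: cc wc, simp, code_simp)
 finally have X1: "X1 = \<mu>$\<mu>$x" .
 have Y1: "Y1 = \<mu>$\<mu>$\<mu>$y" unfolding Y1_def U_def hd \<mu>_def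
 by (reify rsimps, rule ring_id, simp add: cc yc, simp, code_simp)
 have "Y1$Y1 = \<mu>$\<mu>$\<mu>$\<mu>$\<mu>$\<mu>$(y$y)" unfolding Y1
 by (reify rsimps, rule ring_id, simp add: \<mu> yc, simp, code_simp)
 also have "... = X1$X1$X1+.a1$X1+.b1" unfolding eq X1 a1_def b1_def
 by (reify rsimps, rule ring_id, simp add: \<mu> xc abc, simp, code_simp)
 finally have e1: "Y1$Y1 = X1$X1$X1+.a1$X1+.b1" .
 have re: "\<rho> Y1 $\<^bsub>L\<^esub> \<rho> Y1 = \<rho> X1 $\<^bsub>L\<^esub> \<rho> X1 $\<^bsub>L\<^esub> \<rho> X1 +.\<^bsub>L\<^esub> \<rho> a1 $\<^bsub>L\<^esub> \<rho> X1 +.\<^bsub>L\<^esub> \<rho> b1"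
 proof -
 have m: "X1$X1 : V" "X1$X1$X1 : V" "a1$X1 : V" by (rule vcl(4) XYV(1) a1V)+
 have s: "X1$X1$X1+.a1$X1 : V" by (rule vcl(5) m)+
 have "\<rho> (Y1$Y1) = \<rho> (X1$X1$X1+.a1$X1+.b1)" unfolding e1 ..
 then show ?thesis unfolding \<rho>_mult[OF XYV(2,2)] \<rho>_add[OF s b1V] \<rho>_add[OF m(2,3)]
 \<rho>_mult[OF m(1) XYV(1)] \<rho>_mult[OF XYV(1,1)] \<rho>_mult[OF a1V XYV(1)] .
 qed
 note rXY = \<rho>_closed[OF XYV(1)] \<rho>_closed[OF XYV(2)]
 have rX1: "\<rho> X1 = \<rho> h3 $\<^bsub>L\<^esub> \<rho> Z +.\<^bsub>L\<^esub> \<rho> s" and rY1: "\<rho> Y1 = \<rho> h3 $\<^bsub>L\<^esub> \<rho> U"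
 unfolding X1_def Y1_def \<rho>_add[OF h3Z sV] \<rho>_mult[OF hV(1) XV(1)] \<rho>_mult[OF hV(1) UV(1)] by simp_all
 have sk: "\<rho> s : \<kappa>" "\<rho> a1 : \<kappa>" "\<rho> b1 : \<kappa>" unfolding base using sV sK a1V a1K b1V b1K by blast+
 note rs = \<rho>_closed[OF sV]
 have ih: "inv\<^bsub>L\<^esub> \<rho> h3 : \<kappa>" by (rule L.kf(3)[OF hk(1) h3n])
 have rXe: "\<rho> Z = inv\<^bsub>L\<^esub> \<rho> h3 $\<^bsub>L\<^esub> (\<rho> X1 -.\<^bsub>L\<^esub> \<rho> s)" and rUe: "\<rho> U = inv\<^bsub>L\<^esub> \<rho> h3 $\<^bsub>L\<^esub> \<rho> Y1"
 unfolding rX1 rY1 using rh(1) h3n rX rU rs by (simp_all add: L.minus_eq L.a_assoc L.r_neg)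
 note lcl = L.subcl[OF L.kf(1)]
 have X1k: "\<rho> X1 ~: \<kappa>"
 proof
 assume "\<rho> X1 : \<kappa>"
 then have "\<rho> Z : \<kappa>" unfolding rXe by (rule lcl(4)[OF ih lcl(6)[OF _ sk(1)]])
 then show False using XV(2) by blast
 qed
 have sub: "\<rho> Z : D & \<kappa>1 <= D" if D: "subfield D L" "\<kappa> <= D" "\<rho> X1 : D" for D
 proof -
 note dcl = L.subcl[OF L.sf_facts(1)[OF D(1)]]
 have 1: "\<rho> Z : D" unfolding rXe by (rule dcl(4)[OF subsetD[OF D(2) ih] dcl(6)[OF D(3) subsetD[OF D(2) sk(1)]]])
 show ?thesis using 1 f1(6)[OF D(1,2) 1] by blast
 qed
 note f2 = L.funfield_facts[OF L.kf(1) rXY(1)]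
 have "\<kappa>1 <= L.funfield \<kappa> (\<rho> X1)" using sub[OF f2(1,3,4)] by blast
 moreover have "L.funfield \<kappa> (\<rho> X1) <= \<kappa>1"
 by (rule f2(6)[OF f1(1,3)])
 (unfold rX1, rule cl1(5)[OF cl1(4)[OF subsetD[OF f1(3) hk(1)] f1(4)] subsetD[OF f1(3) sk(1)]])
 ultimately have k12: "L.funfield \<kappa> (\<rho> X1) = \<kappa>1" by blast
 have C1: "carrier L = {u +.\<^bsub>L\<^esub> v $\<^bsub>L\<^esub> \<rho> Y1 | u v. u : \<kappa>1 & v : \<kappa>1}" (is "_ = ?D")
 proof
 show "carrier L <= ?D"
 proof
 fix z assume "z : carrier L"
 then have "z : {u +.\<^bsub>L\<^esub> v $\<^bsub>L\<^esub> \<rho> U | u v. u : \<kappa>1 & v : \<kappa>1}" using fs1U by blast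
 then obtain u v where z: "z = u +.\<^bsub>L\<^esub> v $\<^bsub>L\<^esub> \<rho> U" "u : \<kappa>1" "v : \<kappa>1" unfolding mem_Collect_eq by (elim exE conjE) (rule that)
 have "z = u +.\<^bsub>L\<^esub> (v $\<^bsub>L\<^esub> inv\<^bsub>L\<^esub> \<rho> h3) $\<^bsub>L\<^esub> \<rho> Y1"
 unfolding z(1) rUe using fs1(2)[OF z(3)] rXY(2) rh(1) h3n by (simp add: L.m_assoc)
 then show "z : ?D" using z(2) cl1(4)[OF z(3) subsetD[OF f1(3) ih]] by blast
 qed
 show "?D <= carrier L"
 proof
 fix z assume "z : ?D"
 then obtain u v where "z = u +.\<^bsub>L\<^esub> v $\<^bsub>L\<^esub> \<rho> Y1" "u : \<kappa>1" "v : \<kappa>1" unfolding mem_Collect_eq by (elim exE conjE) (rule that)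
 then show "z : carrier L" using L.a_closed[OF fs1(2) L.m_closed[OF fs1(2) rXY(2)]] by simp
 qed
 qed
 have "weierstrass_function_field L \<kappa> (\<rho> X1) (\<rho> Y1) (\<rho> a1) (\<rho> b1)"
 proof (intro weierstrass_function_field.intro weierstrass_function_field_axioms.intro)
 show "field L" by (rule L.field_axioms)
 show "subfield \<kappa> L" by (rule L.k)
 show "\<rho> X1 : carrier L" "\<rho> Y1 : carrier L" by (rule rXY(1), rule rXY(2))
 show "ring.transcendental L \<kappa> (\<rho> X1)" using L.algebraic_in_constants[OF rXY(1)] X1k by blast
 show "\<rho> a1 : \<kappa>" "\<rho> b1 : \<kappa>" by (rule sk(2), rule sk(3))
 show "\<rho> Y1 $\<^bsub>L\<^esub> \<rho> Y1 = \<rho> X1 $\<^bsub>L\<^esub> \<rho> X1 $\<^bsub>L\<^esub> \<rho> X1 +.\<^bsub>L\<^esub> \<rho> a1 $\<^bsub>L\<^esub> \<rho> X1 +.\<^bsub>L\<^esub> \<rho> b1" by (rule re)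
 show "[(4::nat)] #.\<^bsub>L\<^esub> (\<rho> a1 $\<^bsub>L\<^esub> \<rho> a1 $\<^bsub>L\<^esub> \<rho> a1) +.\<^bsub>L\<^esub> [(27::nat)] #.\<^bsub>L\<^esub> (\<rho> b1 $\<^bsub>L\<^esub> \<rho> b1) ~= 0.\<^bsub>L\<^esub>"
 by (rule L.no_nodal_cubic[OF three rXY(1) X1k rXY(2) _ sk(2,3) re]) (unfold k12, rule C1)
 show "1.\<^bsub>L\<^esub> +.\<^bsub>L\<^esub> 1.\<^bsub>L\<^esub> ~= 0.\<^bsub>L\<^esub>" by (rule L.two)
 have s: "\<kappa> \<union> {\<rho> X1, \<rho> Y1} <= carrier L" using L.kf(2) rXY by blast
 note g = L.generate_field_is_subfield[OF s]
 note gcl = L.subcl[OF L.sf_facts(1)[OF g]]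
 have gi: "\<kappa> <= generate_field L (\<kappa> \<union> {\<rho> X1, \<rho> Y1})" "\<rho> X1 : generate_field L (\<kappa> \<union> {\<rho> X1, \<rho> Y1})"
 "\<rho> Y1 : generate_field L (\<kappa> \<union> {\<rho> X1, \<rho> Y1})" using generate_field.incl by (blast intro: generate_field.incl)+
 have k1g: "\<kappa>1 <= generate_field L (\<kappa> \<union> {\<rho> X1, \<rho> Y1})" using sub[OF g gi(1,2)] by blast
 show "generate_field L (\<kappa> \<union> {\<rho> X1, \<rho> Y1}) = carrier L"
 proof
 show "generate_field L (\<kappa> \<union> {\<rho> X1, \<rho> Y1}) <= carrier L" using L.sf_facts(2)[OF g] by blast
 show "carrier L <= generate_field L (\<kappa> \<union> {\<rho> X1, \<rho> Y1})"
 proof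
 fix z assume "z : carrier L"
 then have "z : {u +.\<^bsub>L\<^esub> v $\<^bsub>L\<^esub> \<rho> Y1 | u v. u : \<kappa>1 & v : \<kappa>1}" using C1 by blast
 then obtain u v where z: "z = u +.\<^bsub>L\<^esub> v $\<^bsub>L\<^esub> \<rho> Y1" "u : \<kappa>1" "v : \<kappa>1" unfolding mem_Collect_eq by (elim exE conjE) (rule that)
 show "z : generate_field L (\<kappa> \<union> {\<rho> X1, \<rho> Y1})" unfolding z(1)
 by (rule gcl(5)[OF subsetD[OF k1g z(2)] gcl(4)[OF subsetD[OF k1g z(3)] gi(3)]])
 qed
 qed
 qed
 then show ?thesis using \<mu>(1,2) a1V b1V unfolding a1_def b1_def by blast
qed

end

section \<open>Discrete valuation rings and weak approximation\<close>

definition uniformizer :: "('a, 'b) ring_scheme => 'a set => 'a => bool" where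
 "uniformizer F P \<pi> \<longleftrightarrow> \<pi> : nonunits F P & \<pi> ~= 0.\<^bsub>F\<^esub> &
 (\<forall>v\<in>nonunits F P. \<exists>w\<in>P. v = \<pi> $\<^bsub>F\<^esub> w) &
 (\<forall>v\<in>P. v ~= 0.\<^bsub>F\<^esub> --> (\<exists>n::nat. \<forall>w\<in>P. v ~= \<pi> [^]\<^bsub>F\<^esub> n $\<^bsub>F\<^esub> w))"

definition discrete_valuation_ring :: "('a, 'b) ring_scheme => 'a set => 'a set => bool" where
 "discrete_valuation_ring F K P \<longleftrightarrow> valuation_ring F K P & (\<exists>\<pi>. uniformizer F P \<pi>)"

context field

begin

lemma uniformizer_facts:
 assumes P: "subring P R" and u: "uniformizer R P \<pi>"
 shows "\<pi> : P" "\<pi> : carrier R" "\<pi> ~= 0." "\<pi> : nonunits R P" "inv \<pi> : carrier R" "inv \<pi> ~: P"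
 "!!n::nat. \<pi> [^] n : carrier R" "!!n::nat. \<pi> [^] n ~= 0." "!!n::nat. inv (\<pi> [^] n) : carrier R"
proof -
 show 1: "\<pi> : nonunits R P" "\<pi> ~= 0." using u unfolding uniformizer_def by blast+
 show 2: "\<pi> : P" "inv \<pi> ~: P" using 1 nonunits_iff[OF P] by blast+
 show 3: "\<pi> : carrier R" by (rule subcarr[OF P 2(1)])
 show "inv \<pi> : carrier R" "!!n::nat. \<pi> [^] n : carrier R" "!!n::nat. \<pi> [^] n ~= 0." "!!n::nat. inv (\<pi> [^] n) : carrier R"
 using 3 1(2) by simp_all
qed

text \<open>The last clause of \<open>uniformizer\<close> says that no nonzero element is divisible
  by all powers of \<pi>; the least failing exponent yields the factorization.\<close>

lemma unit_times_uniformizer_power: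
 assumes P: "subring P R" and u: "uniformizer R P \<pi>" and v: "v : P" "v ~= 0."
 shows "\<exists>n::nat. \<exists>u\<in>P. u ~: nonunits R P & v = \<pi> [^] n$u"
proof -
 note uf = uniformizer_facts[OF P u]
 define n where "n = (LEAST n::nat. \<forall>w\<in>P. v ~= \<pi> [^] n$w)"
 have "\<exists>n::nat. \<forall>w\<in>P. v ~= \<pi> [^] n$w" using u v unfolding uniformizer_def by blast
 then have n: "\<forall>w\<in>P. v ~= \<pi> [^] n$w" unfolding n_def by (rule LeastI_ex)
 have "n ~= 0" using n v subcarr[OF P v(1)] by (metis l_one nat_pow_0)
 then obtain m where m: "n = Suc m" by (cases n) auto
 have "~ (\<forall>w\<in>P. v ~= \<pi> [^] m$w)"
 using not_less_Least[of m "%n. \<forall>w\<in>P. v ~= \<pi> [^] n$w"] m unfolding n_def by simp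
 then obtain w where w: "w : P" "v = \<pi> [^] m$w" by blast
 have "w ~: nonunits R P"
 proof
 assume "w : nonunits R P"
 then obtain z where z: "z : P" "w = \<pi>$z" using u unfolding uniformizer_def by blast
 have "v = \<pi> [^] n$z" using w(2) z(2) uf(2) subcarr[OF P z(1)] by (simp add: m m_assoc)
 then show False using n z(1) by blast
 qed
 then show ?thesis using w by blast
qed

lemma uniformizer_valuation_ring:
 assumes P: "subring P R" "P <= K" and u: "uniformizer R P \<pi>" and K: "subfield K R"
 and frac: "\<forall>z\<in>K. \<exists>a\<in>P. \<exists>b\<in>P. b ~= 0. & z = a$inv b"
 shows "valuation_ring R K P"
 unfolding valuation_ring_def
proof (intro conjI ballI P)
 show "K <= carrier R" using sf_facts(2)[OF K] by blast
 fix z assume z: "z : K - {0.}"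
 note uf = uniformizer_facts[OF P(1) u] and pcl = subcl[OF P(1)] and pc = subcarr[OF P(1)]
 obtain a b where ab: "a : P" "b : P" "b ~= 0." "z = a$inv b" using frac z by blast
 have a0: "a ~= 0." using z ab pc[OF ab(2)] by auto
 obtain n s where s: "s : P" "s ~: nonunits R P" "a = \<pi> [^] (n::nat)$s"
 using unit_times_uniformizer_power[OF P(1) u ab(1) a0] by blast
 obtain m t where t: "t : P" "t ~: nonunits R P" "b = \<pi> [^] (m::nat)$t"
 using unit_times_uniformizer_power[OF P(1) u ab(2,3)] by blast
 note si = unit_inv[OF P(1) s(1,2)] and ti = unit_inv[OF P(1) t(1,2)]
 note c = pc[OF s(1)] pc[OF t(1)] pc[OF si(2)] pc[OF ti(2)] pc[OF ab(1)] pc[OF ab(2)] uf(2) uf(7)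
 show "z : P \<or> inv z : P"
 proof (cases "m <= n")
 case True
 then obtain d where d: "n = m + d" using le_Suc_ex by blast
 have "z = (\<pi> [^] m$inv (\<pi> [^] m))$(\<pi> [^] d$s$inv t)"
 proof -
 have "z = (\<pi> [^] m$\<pi> [^] d$s)$(inv (\<pi> [^] m)$inv t)"
 unfolding ab(4) s(3) t(3) d using inv_mult_distrib[OF uf(7,8) c(2) ti(1)] nat_pow_mult[OF uf(2)] by simp
 also have "... = (\<pi> [^] m$inv (\<pi> [^] m))$(\<pi> [^] d$s$inv t)"
 by (reify rsimps, rule ring_id, simp add: c uf, simp, code_simp)
 finally show ?thesis .
 qed
 then have "z = \<pi> [^] d$s$inv t" using uf c by simp
 then show ?thesis using pcl(4)[OF pcl(4)[OF pcl(7)[OF uf(1)] s(1)] ti(2)] by simp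
 next
 case False
 then obtain d where d: "m = n + d" using le_Suc_ex[of n m] by auto
 have "inv z = b$inv a" unfolding ab(4) by (rule fraction_inv[OF c(5,6) ab(3) a0])
 also have "... = (\<pi> [^] n$\<pi> [^] d$t)$(inv (\<pi> [^] n)$inv s)"
 unfolding s(3) t(3) d using inv_mult_distrib[OF uf(7,8) c(1) si(1)] nat_pow_mult[OF uf(2)] by simp
 also have "... = (\<pi> [^] n$inv (\<pi> [^] n))$(\<pi> [^] d$t$inv s)"
 by (reify rsimps, rule ring_id, simp add: c uf, simp, code_simp)
 finally have "inv z = \<pi> [^] d$t$inv s" using uf c by simp
 then show ?thesis using pcl(4)[OF pcl(4)[OF pcl(7)[OF uf(1)] t(1)] si(2)] by simp
 qed
qed

lemma pole_uniformizer_power: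
 assumes P: "valuation_ring R K P" and u: "uniformizer R P \<pi>" and K: "subfield K R" and f: "f : K" "f ~: P"
 shows "\<exists>n::nat. \<exists>u\<in>P. u ~: nonunits R P & f = inv (\<pi> [^] n)$u"
proof -
 note PD = valuation_ringD[OF P] and uf = uniformizer_facts[OF valuation_ringD(1)[OF P] u]
 have f0: "f ~= 0." using f(2) subcl(1)[OF PD(1)] by blast
 have fc: "f : carrier R" by (rule sf_facts(2)[OF K f(1)])
 have i: "inv f : P" "inv f ~= 0." using PD(4)[OF f(1) f0] f(2) f0 fc by simp_all
 obtain n s where s: "s : P" "s ~: nonunits R P" "inv f = \<pi> [^] (n::nat)$s"
 using unit_times_uniformizer_power[OF PD(1) u i] by blast
 note si = unit_inv[OF PD(1) s(1,2)]
 have "f = inv (\<pi> [^] n$s)" using s(3) inv_inv_field[OF fc f0] by simp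
 then have "f = inv (\<pi> [^] n)$inv s" using inv_mult_distrib[OF uf(7,8) _ si(1)] subcarr[OF PD(1) s(1)] by simp
 then show ?thesis using si by blast
qed

text \<open>If 1/\<pi> were in \<open>Q\<close>, then \<open>P\<close> and the powers of 1/\<pi>
  would exhaust \<open>K\<close> inside \<open>Q\<close>, which has a nonunit of its own. So \<pi>
  stays a nonunit, and \<open>Q\<close> dominates \<open>P\<close>.\<close>

lemma discrete_valuation_ring_maximal:
 assumes K: "subfield K R" and P: "discrete_valuation_ring R K P" and Q: "discrete_valuation_ring R K Q" and PQ: "P <= Q"
 shows "P = Q"
proof -
 obtain \<pi> where P': "valuation_ring R K P" and u: "uniformizer R P \<pi>" using P unfolding discrete_valuation_ring_def by blast
 obtain \<pi>' where Q': "valuation_ring R K Q" and u': "uniformizer R Q \<pi>'" using Q unfolding discrete_valuation_ring_def by blast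
 note PD = valuation_ringD[OF P'] and QD = valuation_ringD[OF Q']
 note uf = uniformizer_facts[OF PD(1) u] and uf' = uniformizer_facts[OF QD(1) u'] and qcl = subcl[OF QD(1)]
 have ni: "inv \<pi> ~: Q"
 proof
 assume i: "inv \<pi> : Q"
 have pw: "inv (\<pi> [^] n) : Q" for n :: nat
 proof (induction n)
 case 0
 then show ?case using qcl(2) inv_one by simp
 next
 case (Suc n)
 have "inv (\<pi> [^] Suc n) = inv (\<pi> [^] n)$inv \<pi>" using inv_mult_distrib[OF uf(7,8) uf(2,3)] by simp
 then show ?case using qcl(4)[OF Suc.IH i] by simp
 qed
 have "f : Q" if f: "f : K" for f
 proof (cases "f : P")
 case False
 obtain n s where "s : P" "f = inv (\<pi> [^] (n::nat))$s" using pole_uniformizer_power[OF P' u K f False] by blast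
 then show ?thesis using qcl(4)[OF pw] PQ by blast
 qed (use PQ in blast)
 moreover have "inv \<pi>' : K" using sf_facts(3)[OF K _ uf'(3)] QD(2) uf'(1) by blast
 ultimately show False using uf'(6) by blast
 qed
 have "nonunits R P <= nonunits R Q"
 proof
 fix v assume "v : nonunits R P"
 then obtain w where w: "w : P" "v = \<pi>$w" using u unfolding uniformizer_def by blast
 have "\<pi> : nonunits R Q" using nonunits_iff[OF QD(1)] ni uf(1) PQ by blast
 then show "v : nonunits R Q" unfolding w(2) by (rule nonunits_mult[OF QD(1)]) (use w(1) PQ in blast)
 qed
 then show ?thesis using dominating_eq[OF P' QD(1,2) PQ] by simp
qed

text \<open>A nonunit carries at least one factor \<pi>, so its power beyond the pole order of
  \<open>f\<close> cancels the pole.\<close>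

lemma power_absorbs_pole:
 assumes P: "valuation_ring R K P" and u: "uniformizer R P \<pi>" and K: "subfield K R"
 and w: "w : nonunits R P" and f: "f : K"
 shows "\<exists>M::nat. \<forall>m\<ge>M. w [^] m$f : nonunits R P"
proof -
 note PD = valuation_ringD[OF P] and uf = uniformizer_facts[OF valuation_ringD(1)[OF P] u] and pcl = subcl[OF valuation_ringD(1)[OF P]]
 have wP: "w : P" and wc: "w : carrier R" using w nonunits_iff[OF PD(1)] subcarr[OF PD(1)] by blast+
 have pw: "w [^] Suc m : nonunits R P" for m
 using nonunits_mult[OF PD(1) w pcl(7)[OF wP, of m]] wc by (simp add: m_comm)
 show ?thesis
 proof (cases "f : P")
 case True
 have "w [^] m$f : nonunits R P" if m: "m \<ge> Suc 0" for m
 proof -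
 obtain m' where "m = Suc m'" using m by (cases m) auto
 then show ?thesis using nonunits_mult[OF PD(1) pw True] by blast
 qed
 then show ?thesis by blast
 next
 case False
 obtain n s where s: "s : P" "f = inv (\<pi> [^] (n::nat))$s" using pole_uniformizer_power[OF P u K f False] by blast
 obtain v where v: "v : P" "w = \<pi>$v" using u w unfolding uniformizer_def by blast
 have c: "s : carrier R" "v : carrier R" using s v subcarr[OF PD(1)] by blast+
 have "w [^] m$f : nonunits R P" if m: "m \<ge> Suc n" for m
 proof -
 obtain d where d: "m = Suc (d + n)" using m by (metis add.commute add_Suc_right le_Suc_ex)
 have wn: "w [^] n = \<pi> [^] n$v [^] n" unfolding v(2) by (rule nat_pow_distrib[OF uf(2) c(2)])
 have wm: "w [^] m = w [^] d$(\<pi> [^] n$v [^] n)$w"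
 unfolding d wn[symmetric] nat_pow_mult[OF wc] by simp
 have "w [^] m$f = (\<pi> [^] n$inv (\<pi> [^] n))$(w$(w [^] d$v [^] n$s))"
 unfolding wm s(2) by (reify rsimps, rule ring_id, simp add: c uf wc, simp, code_simp)
 then have "w [^] m$f = w$(w [^] d$v [^] n$s)" using uf wc c by simp
 then show ?thesis
 using nonunits_mult[OF PD(1) w pcl(4)[OF pcl(4)[OF pcl(7)[OF wP, of d] pcl(7)[OF v(1), of n]] s(1)]] by simp
 qed
 then show ?thesis by blast
 qed
qed

lemma valuation_mult_unit_notin:
 assumes V: "subring P R" and z: "z : P" "z ~: nonunits R P" and f: "f : carrier R" "f ~: P"
 shows "z$f ~: P"
proof
 assume "z$f : P"
 then have "inv z$(z$f) : P" by (rule subcl(4)[OF V unit_inv(2)[OF V z]])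
 then show False using f subcarr[OF V z(1)] unit_inv(1)[OF V z] by simp
qed

lemma valuation_mult_notin:
 assumes V: "valuation_ring R K P" and K: "subfield K R" and z: "z : K" "z ~: P" and f: "f : K" "f ~: P"
 shows "z$f ~: P"
proof
 note PD = valuation_ringD[OF V]
 assume "z$f : P"
 have c: "z : carrier R" "f : carrier R" "z ~= 0." using sf_facts(2)[OF K] z f subcl(1)[OF PD(1)] by blast+
 have "inv z : P" using PD(3)[OF z] nonunits_iff[OF PD(1)] by blast
 then have "inv z$(z$f) : P" by (rule subcl(4)[OF PD(1) _ \<open>z \<otimes> f \<in> P\<close>])
 then show False using c f by simp
qed

text \<open>Induction over the avoided rings. Given \<open>w\<close> for the earlier ones, a
  function \<open>h\<close> with a pole at \<open>P\<close> and a zero at the new ring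
  \<open>S\<close> is multiplied by a high power of \<open>w\<close>, or, if \<open>w\<close> has a
  pole at \<open>S\<close>, of w/(1 + w).\<close>

lemma valuation_rings_separation:
 assumes K: "subfield K R" and P: "discrete_valuation_ring R K P"
 and Q: "finite \<Q>" "\<forall>Q\<in>\<Q>. discrete_valuation_ring R K Q" "P ~: \<Q>"
 shows "\<exists>w\<in>K. w ~: P & (\<forall>Q\<in>\<Q>. w : nonunits R Q)"
 using Q
proof (induction \<Q> rule: finite_induct)
 case empty
 obtain \<pi> where P': "valuation_ring R K P" and u: "uniformizer R P \<pi>" using P unfolding discrete_valuation_ring_def by blast
 note PD = valuation_ringD[OF P'] and uf = uniformizer_facts[OF valuation_ringD(1)[OF P'] u]
 have "inv \<pi> : K" using sf_facts(3)[OF K _ uf(3)] PD(2) uf(1) by blast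
 then show ?case using uf(6) by blast
next
 case (insert S \<Q>)
 note Kf = sf_facts[OF K] and kcl = subcl[OF sf_facts(1)[OF K]]
 have dS: "discrete_valuation_ring R K S" and dQ: "\<forall>Q\<in>\<Q>. discrete_valuation_ring R K Q" and PS: "P ~= S" "P ~: \<Q>"
 using insert.prems by auto
 obtain w where w: "w : K" "w ~: P" "\<forall>Q\<in>\<Q>. w : nonunits R Q" using insert.IH[OF dQ PS(2)] by blast
 have P': "valuation_ring R K P" and S': "valuation_ring R K S" using P dS unfolding discrete_valuation_ring_def by blast+
 note PD = valuation_ringD[OF P'] and SD = valuation_ringD[OF S']
 have SL: "local_subring R S" and PL: "local_subring R P"
 by (rule valuation_ring_local[OF S' K], rule valuation_ring_local[OF P' K])
 obtain f where f: "f : S" "f ~: P" using discrete_valuation_ring_maximal[OF K dS P] PS(1) by blast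
 obtain g where g: "g : P" "g ~: S" using discrete_valuation_ring_maximal[OF K P dS] PS(1) by blast
 have fg: "f : K" "g : K" "g ~= 0." using f g SD(2) PD(2) subcl(1)[OF SD(1)] by blast+
 have fgc: "f : carrier R" "g : carrier R" "f ~= 0." using Kf(2) fg f(2) subcl(1)[OF PD(1)] by blast+
 \<comment> \<open>\<open>f\<close> is integral at \<open>S\<close> but not at \<open>P\<close>, and
   \<open>g\<close> conversely, so f/g vanishes at \<open>S\<close> and has a pole at
   \<open>P\<close>.\<close>
 define h where "h = inv g$f"
 have hK: "h : K" unfolding h_def by (rule kcl(4)[OF Kf(3)[OF fg(2,3)] fg(1)])
 note hc = Kf(2)[OF hK]
 have hS: "h : nonunits R S" unfolding h_def by (rule nonunits_mult[OF SD(1) SD(3)[OF fg(2) g(2)] f(1)])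
 have hP: "h ~: P"
 proof
 assume "h : P"
 then have "g$h : P" by (rule subcl(4)[OF PD(1) g(1)])
 then show False unfolding h_def using fgc fg(3) f(2) by simp
 qed
 have pow: "z [^] m$h ~: P" if z: "z : K" "z ~: P \<or> (z : P & z ~: nonunits R P)" for z and m :: nat
 proof (induction m)
 case 0
 then show ?case using hP hc by simp
 next
 case (Suc m)
 have zc: "z : carrier R" by (rule Kf(2)[OF z(1)])
 have e: "z [^] Suc m$h = z$(z [^] m$h)"
 unfolding nat_pow_Suc by (reify rsimps, rule ring_id, simp add: zc hc, simp, code_simp)
 have pK: "z [^] m$h : K" by (rule kcl(4)[OF kcl(7)[OF z(1)] hK])
 show ?case unfolding e
 using z(2) valuation_mult_notin[OF P' K z(1) _ pK Suc.IH] valuation_mult_unit_notin[OF PD(1) _ _ Kf(2)[OF pK] Suc.IH] by blast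
 qed
 have absorb: "\<exists>m. \<forall>Q\<in>\<Q>. z [^] (m::nat)$h : nonunits R Q" if z: "\<forall>Q\<in>\<Q>. z : nonunits R Q" for z
 proof -
 have "\<forall>Q\<in>\<Q>. \<exists>M::nat. \<forall>m\<ge>M. z [^] m$h : nonunits R Q"
 proof
 fix Q assume q: "Q : \<Q>"
 then obtain \<pi> where "valuation_ring R K Q" "uniformizer R Q \<pi>" using dQ unfolding discrete_valuation_ring_def by blast
 then show "\<exists>M::nat. \<forall>m\<ge>M. z [^] m$h : nonunits R Q" using power_absorbs_pole[OF _ _ K _ hK] z q by blast
 qed
 then obtain M where M: "\<forall>Q\<in>\<Q>. \<forall>m\<ge>M Q. z [^] (m::nat)$h : nonunits R Q" by (rule bchoice[THEN exE])
 have "M Q <= Max (M ` \<Q>)" if "Q : \<Q>" for Q using insert.hyps(1) that by simp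
 then show ?thesis using M by (intro exI[of _ "Max (M ` \<Q>)"]) blast
 qed
 show ?case
 proof (cases "w : S")
 case True
 obtain m where m: "\<forall>Q\<in>\<Q>. w [^] (m::nat)$h : nonunits R Q" using absorb[OF w(3)] by blast
 have "h$w [^] m : nonunits R S" by (rule nonunits_mult[OF SD(1) hS subcl(7)[OF SD(1) True]])
 then have "w [^] m$h : nonunits R S" using m_comm[OF hc, of "w [^] m"] Kf(2)[OF w(1)] by simp
 moreover have "w [^] m$h ~: P" using pow[OF w(1)] w(2) by blast
 moreover have "w [^] m$h : K" by (rule kcl(4)[OF kcl(7)[OF w(1)] hK])
 ultimately show ?thesis using m by blast
 next
 case False
 \<comment> \<open>This is w/(1 + w): a unit wherever \<open>w\<close> has a pole, in particular at
   \<open>P\<close> and \<open>S\<close>, and a nonunit wherever \<open>w\<close> is one.\<close>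
 define z where "z = inv (inv w+.1.)"
 have w0: "w ~= 0." using w(2) subcl(1)[OF PD(1)] by blast
 have wc: "w : carrier R" "inv w : carrier R" using Kf(2)[OF w(1)] w0 by simp_all
 have unit: "inv w+.1. : T & inv w+.1. ~: nonunits R T & z : T & z ~: nonunits R T"
 if T: "valuation_ring R K T" "w ~: T" for T
 proof -
 note TD = valuation_ringD[OF T(1)] and TL = valuation_ring_local[OF T(1) K]
 have n: "inv w : nonunits R T" by (rule TD(3)[OF w(1) T(2)])
 have "1.+.inv w : T" "1.+.inv w ~: nonunits R T"
 using unit_add_nonunit[OF TL subcl(2)[OF TD(1)] one_unit[OF TD(1)] n] by blast+
 then have 1: "inv w+.1. : T" "inv w+.1. ~: nonunits R T" using a_comm[OF wc(2) one_closed] by simp_all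
 then show ?thesis unfolding z_def using unit_inv[OF TD(1) 1] by blast
 qed
 have uP: "z : P" "z ~: nonunits R P" "inv w+.1. : P" "inv w+.1. ~: nonunits R P" using unit[OF P' w(2)] by blast+
 have uS: "z : S" "z ~: nonunits R S" using unit[OF S' False] by blast+
 have d0: "inv w+.1. ~= 0." using unit_inv(1)[OF PD(1) uP(3,4)] .
 have zK: "z : K" using uP(1) PD(2) by blast
 note zc = Kf(2)[OF zK]
 have zQ: "\<forall>Q\<in>\<Q>. z : nonunits R Q"
 proof
 fix Q assume q: "Q : \<Q>"
 then have Q': "valuation_ring R K Q" using dQ unfolding discrete_valuation_ring_def by blast
 note QD = valuation_ringD[OF Q'] and QL = valuation_ring_local[OF Q' K]
 have n: "w : nonunits R Q" using w(3) q by blast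
 have 1: "1.+.w : Q" "1.+.w ~: nonunits R Q"
 using unit_add_nonunit[OF QL subcl(2)[OF QD(1)] one_unit[OF QD(1)] n] by blast+
 note i = unit_inv[OF QD(1) 1]
 have "(inv w+.1.) = inv w$( 1.+.w)" using wc w0 by (simp add: r_distr)
 then have "z = w$inv ( 1.+.w)" unfolding z_def
 using inv_mult_distrib[OF wc(2) _ _ i(1)] wc w0 by simp
 then show "z : nonunits R Q" using nonunits_mult[OF QD(1) n i(2)] by simp
 qed
 obtain m where m: "\<forall>Q\<in>\<Q>. z [^] (m::nat)$h : nonunits R Q" using absorb[OF zQ] by blast
 have "h$z [^] m : nonunits R S" by (rule nonunits_mult[OF SD(1) hS subcl(7)[OF SD(1) uS(1)]])
 then have "z [^] m$h : nonunits R S" using m_comm[OF hc, of "z [^] m"] zc by simp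
 moreover have "z [^] m$h ~: P" using pow[OF zK] uP by blast
 moreover have "z [^] m$h : K" by (rule kcl(4)[OF kcl(7)[OF zK] hK])
 ultimately show ?thesis using m by blast
 qed
qed

text \<open>w/(1 + w) turns the pole at \<open>P\<close> into a unit and keeps the zeros.\<close>

lemma valuation_rings_approximation:
 assumes K: "subfield K R" and P: "discrete_valuation_ring R K P"
 and Q: "finite \<Q>" "\<forall>Q\<in>\<Q>. discrete_valuation_ring R K Q" "P ~: \<Q>"
 shows "\<exists>z\<in>P. z ~: nonunits R P & (\<forall>Q\<in>\<Q>. z : nonunits R Q)"
proof -
 note Kf = sf_facts[OF K]
 obtain w where w: "w : K" "w ~: P" "\<forall>Q\<in>\<Q>. w : nonunits R Q" using valuation_rings_separation[OF assms] by blast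
 have P': "valuation_ring R K P" using P unfolding discrete_valuation_ring_def by blast
 note PD = valuation_ringD[OF P'] and PL = valuation_ring_local[OF P' K]
 have w0: "w ~= 0." using w(2) subcl(1)[OF PD(1)] by blast
 have wc: "w : carrier R" "inv w : carrier R" using Kf(2)[OF w(1)] w0 by simp_all
 have 1: "1.+.inv w : P" "1.+.inv w ~: nonunits R P"
 using unit_add_nonunit[OF PL subcl(2)[OF PD(1)] one_unit[OF PD(1)] PD(3)[OF w(1,2)]] by blast+
 note i = unit_inv[OF PD(1) 1]
 have "inv ( 1.+.inv w) : nonunits R Q" if q: "Q : \<Q>" for Q
 proof -
 have Q': "valuation_ring R K Q" using Q(2) q unfolding discrete_valuation_ring_def by blast
 note QD = valuation_ringD[OF Q'] and QL = valuation_ring_local[OF Q' K]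
 have n: "w : nonunits R Q" using w(3) q by blast
 have 1: "1.+.w : Q" "1.+.w ~: nonunits R Q"
 using unit_add_nonunit[OF QL subcl(2)[OF QD(1)] one_unit[OF QD(1)] n] by blast+
 note j = unit_inv[OF QD(1) 1]
 have "1.+.inv w = inv w$( 1.+.w)" using wc w0 by (simp add: r_distr a_comm)
 then have "inv ( 1.+.inv w) = w$inv ( 1.+.w)" using inv_mult_distrib[OF wc(2) _ _ j(1)] wc w0 by simp
 then show ?thesis using nonunits_mult[OF QD(1) n j(2)] by simp
 qed
 then show ?thesis using i by blast
qed

text \<open>The successive quotients of \<open>v\<close> by powers of \<pi> generate an ascending
  chain of principal ideals. Where it becomes stationary, \<pi> divides 1.\<close>

lemma noetherian_separated:
 assumes T: "subring T R" and N: "noetherian_ring (R(|carrier := T|))" and p: "\<pi> : nonunits R T" "\<pi> ~= 0."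
 and v: "v : T" "v ~= 0."
 shows "\<exists>n::nat. \<forall>w\<in>T. v ~= \<pi> [^] n$w"
proof (rule ccontr)
 assume "~ ?thesis"
 then have "\<forall>n::nat. \<exists>w. w : T & v = \<pi> [^] n$w" by blast
 then obtain w where w: "\<forall>n::nat. w n : T & v = \<pi> [^] n$w n" by (rule choice[THEN exE])
 interpret T: noetherian_ring "R(|carrier := T|)" by (rule N)
 interpret T: cring "R(|carrier := T|)" using subring_is_domain[OF T] unfolding domain_def by blast
 note tc = subcarr[OF T] and tcl = subcl[OF T]
 have pT: "\<pi> : T" "\<pi> : carrier R" using p nonunits_iff[OF T] tc by blast+
 have pw: "\<pi> [^] n : carrier R" "\<pi> [^] n ~= 0." for n :: nat using pT p by simp_all
 have wT: "w n : T" "w n : carrier R" for n using w tc by blast+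
 have step: "w n = \<pi>$w (Suc n)" for n
 proof -
 have "v = \<pi> [^] n$w n" "v = \<pi> [^] Suc n$w (Suc n)" using w by blast+
 then have "\<pi> [^] n$w n = \<pi> [^] n$(\<pi>$w (Suc n))" using pT wT pw by (simp add: m_assoc)
 then show ?thesis using m_lcancel[OF pw(2)[of n] pw(1)[of n] wT(2)[of n]] pT(2) wT(2)[of "Suc n"] by simp
 qed
 define I where "I n = PIdl\<^bsub>R(|carrier := T|)\<^esub> (w n)" for n
 have I_iff: "z : I n \<longleftrightarrow> (\<exists>c\<in>T. z = c$w n)" for z n unfolding I_def cgenideal_def by auto
 have ideal: "ideal (I n) (R(|carrier := T|))" for n unfolding I_def using T.cgenideal_ideal[of "w n"] wT by simp
 have mono1: "I n <= I (Suc n)" for n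
 proof
 fix z assume "z : I n"
 then obtain c where c: "c : T" "z = c$w n" unfolding I_iff by blast
 then have "z = (c$\<pi>)$w (Suc n)" unfolding c(2) using step[of n] tc[OF c(1)] pT(2) wT(2) by (simp add: m_assoc)
 then show "z : I (Suc n)" unfolding I_iff using tcl(4)[OF c(1) pT(1)] by blast
 qed
 have mono: "I n <= I m" if "n <= m" for n m using that by (induction rule: dec_induct) (use mono1 in blast)+
 have "subset.chain {I. ideal I (R(|carrier := T|))} (range I)"
 unfolding subset_chain_def
 proof (intro conjI ballI)
 show "range I <= {I. ideal I (R(|carrier := T|))}" using ideal by blast
 fix J J' assume "J : range I" "J' : range I"
 then obtain n m where nm: "J = I n" "J' = I m" by blast
 show "J <= J' \<or> J' <= J" unfolding nm using mono[of n m] mono[of m n] nat_le_linear[of n m] by (elim disjE) simp_all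
 qed
 then have "\<Union> (range I) \<in> range I" using T.ideal_chain_is_trivial[of "range I"] by blast
 then obtain N where N: "\<Union> (range I) = I N" by blast
 have "w (Suc N) : I (Suc N)" unfolding I_iff using tcl(2) wT(2) by (intro bexI[of _ \<one>]) simp_all
 then have "w (Suc N) : I N" using N by blast
 then obtain c where c: "c : T" "w (Suc N) = c$w N" unfolding I_iff by blast
 have cc: "c : carrier R" by (rule tc[OF c(1)])
 have w0: "w (Suc N) ~= 0." using w v(2) pw(1)[of "Suc N"] r_null by metis
 have "1.$w (Suc N) = (\<pi>$c)$w (Suc N)"
 using c(2) step[of N] cc pT(2) wT(2)[of "Suc N"] by (simp add: m_assoc m_comm m_lcomm)
 then have "1. = \<pi>$c" using m_rcancel[OF w0 wT(2)] cc pT(2) by simp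
 then show False using nonunits_mult[OF T p(1) c(1)] one_unit[OF T] by simp
qed

end

section \<open>Linear independence and the exchange of transcendental elements\<close>

lemma (in ring) bounded_independent_finite_dimension:
 assumes K: "subfield K R" and N: "\<forall>Us. independent K Us --> length Us <= N"
 shows "finite_dimension K (carrier R)"
proof -
 define S where "S = {n. \<exists>Us. independent K Us & length Us = n}"
 have S: "finite S" "S ~= {}"
 proof -
 have "S <= {..N}" unfolding S_def using N by auto
 then show "finite S" using finite_subset by blast
 have "0 : S" unfolding S_def by (auto intro!: exI[of _ "[]"])
 then show "S ~= {}" by blast
 qed
 then obtain Us where Us: "independent K Us" "length Us = Max S" using Max_in[OF S] unfolding S_def by blast
 note Uc = independent_in_carrier[OF Us(1)]
 have "Span K Us = carrier R"
 proof (rule ccontr)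
 assume "Span K Us ~= carrier R"
 moreover have "Span K Us <= carrier R" using Span_in_carrier[OF subfieldE(3)[OF K] Uc] .
 ultimately obtain v where v: "v : carrier R" "v ~: Span K Us" by blast
 have "independent K (v # Us)" by (rule independent.li_Cons[OF v(1,2) Us(1)])
 then have "length (v # Us) : S" unfolding S_def by blast
 then have "length (v # Us) <= Max S" using S(1) by simp
 then show False using Us(2) by simp
 qed
 then show ?thesis using finite_dimensionI[OF dimension_independent[OF Us(1)]] by simp
qed

context field

begin

lemma valuation_ring_scale_list:
 assumes V: "valuation_ring R E V" and E: "subfield E R" and ps: "set ps <= E" "~ set ps <= {0.}"
 shows "\<exists>e\<in>E. e ~= 0. & (\<forall>q\<in>set ps. e$q : V) & (\<exists>q\<in>set ps. e$q = 1.)"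
 using ps
proof (induction ps)
 case (Cons q ps)
 note Ef = sf_facts[OF E] and Ecl = subcl[OF sf_facts(1)[OF E]]
 note VD = valuation_ringD[OF V] and vcl = subcl[OF valuation_ringD(1)[OF V]]
 have q: "q : E" "q : carrier R" and ps: "set ps <= E" using Cons.prems(1) Ef(2) by auto
 show ?case
 proof (cases "set ps <= {0.}")
 case True
 then have q0: "q ~= 0." using Cons.prems(2) by simp
 have i: "inv q : E" "inv q : carrier R" "inv q ~= 0." "inv q$q = 1." using Ef(3)[OF q(1) q0] q(2) q0 by simp_all
 have "inv q$r : V" if r: "r : set (q # ps)" for r
 proof (cases "r = q")
 case False
 then have "r = 0." using r True by auto
 then show ?thesis using i(2) vcl(1) by simp
 qed (use i(4) vcl(2) in simp)
 then show ?thesis using i by (intro bexI[of _ "inv q"]) auto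
 next
 case False
 obtain e where e: "e : E" "e ~= 0." "\<forall>q\<in>set ps. e$q : V" "\<exists>q\<in>set ps. e$q = 1."
 using Cons.IH[OF ps False] by blast
 have ec: "e : carrier R" by (rule Ef(2)[OF e(1)])
 show ?thesis
 proof (cases "e$q : V")
 case True
 then show ?thesis using e by auto
 next
 case F: False
 define f where "f = inv (e$q)"
 have z: "e$q : E" "e$q ~= 0." "e$q : carrier R" using Ecl(4)[OF e(1) q(1)] F vcl(1) ec q(2) by auto
 have f: "f : V" "f : E" "f : carrier R" "f ~= 0." "f$(e$q) = 1."
 unfolding f_def using VD(4)[OF z(1,2)] F Ef(3)[OF z(1,2)] z by simp_all
 have "f$e$r : V" if r: "r : set (q # ps)" for r
 proof (cases "r = q")
 case True
 then show ?thesis using f(5) m_assoc[OF f(3) ec q(2)] vcl(2) by simp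
 next
 case False
 then have "e$r : V" "r : carrier R" using r e(3) ps Ef(2) by auto
 then show ?thesis using vcl(4)[OF f(1)] m_assoc[OF f(3) ec] by simp
 qed
 moreover have "f$e$q = 1." using f(5) m_assoc[OF f(3) ec q(2)] by simp
 moreover have "f$e : E" "f$e ~= 0." using Ecl(4)[OF f(2) e(1)] f ec e(2) by simp_all
 ultimately show ?thesis by (intro bexI[of _ "f$e"]) auto
 qed
 qed
qed simp

text \<open>A nontrivial relation over \<open>E\<close> can be scaled to have integral coefficients
  with one of them equal to 1, so only such relations have to be excluded; these survive
  reduction.\<close>

lemma valuation_independent:
 assumes V: "valuation_ring R E V" and E: "subfield E R" and us: "set us \<subseteq> carrier R"
 and n: "\<forall>fs. set fs \<subseteq> V \<and> length fs = length us \<and> combine fs us = \<zero> \<longrightarrow> \<one> \<notin> set fs"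
 shows "independent E us"
proof (rule ccontr)
 assume "dependent E us"
 then obtain fs where fs: "length fs = length us" "combine fs us = \<zero>" "set fs \<subseteq> E" "set fs \<noteq> {\<zero>}"
 using dependent_imp_non_trivial_combine[OF E us] by blast
 have "us \<noteq> []" using \<open>dependent E us\<close> by auto
 then have "set fs \<noteq> {}" using fs(1) by auto
 then have "\<not> set fs \<subseteq> {\<zero>}" using fs(4) subset_singleton_iff by metis
 then obtain e where e: "e \<in> E" "e \<noteq> \<zero>" "\<forall>q\<in>set fs. e \<otimes> q \<in> V" "\<exists>q\<in>set fs. e \<otimes> q = \<one>"
 using valuation_ring_scale_list[OF V E fs(3)] by blast
 note ec = sf_facts(2)[OF E e(1)]
 have fc: "set fs \<subseteq> carrier R" using fs(3) sf_facts(2)[OF E] by blast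
 have "combine (map ((\<otimes>) e) fs) us = \<zero>" using combine_r_distr[OF fc us ec] fs(2) ec by simp
 moreover have "set (map ((\<otimes>) e) fs) \<subseteq> V" "\<one> \<in> set (map ((\<otimes>) e) fs)" using e(3,4) by force+
 ultimately show False using n fs(1) by (metis length_map)
qed

lemma eval_replicate_zero: "set p <= carrier R ==> x : carrier R ==> eval (replicate m 0. @ p) x = eval p x"
proof (induction m)
 case (Suc m)
 have "set (replicate m 0. @ p) <= carrier R"
 proof
 fix z assume "z : set (replicate m 0. @ p)"
 then have "z = 0. \<or> z : set p" by auto
 then show "z : carrier R" using Suc.prems(1) zero_closed by blast
 qed
 then show ?case using eval_zero_prefix[of "replicate m 0. @ p" x] Suc by simp
qed simp

text \<open>A polynomial in two variables, evaluated by rows or by columns of its coefficient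
  matrix.\<close>

lemma eval_exchange:
 assumes t: "t : carrier R" and s: "s : carrier R"
 and ps: "\<forall>p\<in>set ps. set p <= carrier R & length p = n"
 shows "eval (map (%p. eval p t) ps) s = eval (map (%i. eval (map (%p. p ! i) ps) s) [0 ..<n]) t"
 using ps
proof (induction ps)
 case Nil
 have "set (map (%i. 0.) [0 ..<n]) <= {0.}" by auto
 from eval_zeros[OF this t] show ?case by simp
next
 case (Cons p ps)
 let ?q = "map (%i. eval (map (%p. p ! i) ps) s) [0 ..<n]" and ?A = "s [^] length ps"
 have p: "set p <= carrier R" "length p = n" and ps: "\<forall>p\<in>set ps. set p <= carrier R & length p = n"
 using Cons.prems by simp_all
 have pi: "p ! i : carrier R" if "i < n" for i using p that nth_mem[of i p] by blast
 have psi: "set (map (%p. p ! i) ps) <= carrier R" if i: "i < n" for i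
 proof
 fix z assume "z : set (map (%p. p ! i) ps)"
 then obtain q where q: "q : set ps" "z = q ! i" by auto
 have "set q <= carrier R" "length q = n" using ps q(1) by simp_all
 then show "z : carrier R" unfolding q(2) using nth_mem[of i q] i by blast
 qed
 have qc: "set ?q <= carrier R"
 proof
 fix z assume "z : set ?q"
 then obtain i where i: "i < n" "z = eval (map (%p. p ! i) ps) s" by auto
 show "z : carrier R" unfolding i(2) by (rule eval_closed[OF psi[OF i(1)] s])
 qed
 have A: "?A : carrier R" using s by simp
 \<comment> \<open>The sum is written as the subtraction of a negative multiple, so that
   \<open>eval_map2_minus\<close> applies.\<close>
 have swap: "u$v+.w = w-.-. v$u" if c: "u : carrier R" "v : carrier R" "w : carrier R" for u v w
 by (reify rsimps, rule ring_id, simp add: c, simp, code_simp)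
 have "map (%i. eval (map (%p. p ! i) (p # ps)) s) [0 ..<n] = map2 (%u v. u-.-. ?A$v) ?q p"
 proof (rule nth_equalityI)
 fix i assume "i < length (map (%i. eval (map (%p. p ! i) (p # ps)) s) [0 ..<n])"
 then have i: "i < n" by simp
 note c = pi[OF i] eval_closed[OF psi[OF i] s]
 have "p ! i$?A+.eval (map (%p. p ! i) ps) s = eval (map (%p. p ! i) ps) s-.-. ?A$p ! i"
 by (rule swap[OF c(1) A c(2)])
 then show "map (%i. eval (map (%p. p ! i) (p # ps)) s) [0 ..<n] ! i = map2 (%u v. u-.-. ?A$v) ?q p ! i"
 using i p(2) by (simp add: eval_Cons)
 qed (use p(2) in simp)
 then have "eval (map (%i. eval (map (%p. p ! i) (p # ps)) s) [0 ..<n]) t = eval ?q t-.-. ?A$eval p t"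
 using eval_map2_minus[of "-. ?A" t ?q p] A t qc p by simp
 also have "... = eval p t$?A+.eval (map (%p. eval p t) ps) s"
 unfolding Cons.IH[OF ps] using swap[OF eval_closed[OF p(1) t] A eval_closed[OF qc t]] by (rule sym)
 also have "... = eval (map (%p. eval p t) (p # ps)) s" by (simp add: eval_Cons)
 finally show ?case by simp
qed

lemma common_denominator:
 assumes k: "subring k R" and t: "t : carrier R" and cs: "set cs <= funfield k t"
 shows "\<exists>w\<in>simple_extension k t. w ~= 0. & (\<forall>c\<in>set cs. w$c : simple_extension k t)"
 using cs
proof (induction cs)
 case Nil
 then show ?case using subcl(2)[OF polys_subring(1)[OF k t]] by (intro bexI[of _ \<one>]) simp_all
next
 case (Cons c cs)
 note f = funfield_facts[OF k t] and pcl = subcl[OF polys_subring(1)[OF k t]] and pc = subcarr[OF polys_subring(1)[OF k t]]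
 obtain w where w: "w : simple_extension k t" "w ~= 0." "\<forall>c\<in>set cs. w$c : simple_extension k t"
 using Cons.IH Cons.prems by auto
 obtain u v where uv: "u : simple_extension k t" "v : simple_extension k t" "v ~= 0." "c = u$inv v"
 using f(5)[of c] Cons.prems by auto
 note cc = pc[OF w(1)] pc[OF uv(1)] pc[OF uv(2)]
 have ic: "inv v : carrier R" "v$inv v = 1." using cc uv(3) by simp_all
 have "v$w$c = (v$inv v)$(w$u)"
 unfolding uv(4) by (reify rsimps, rule ring_id, simp add: cc ic(1), simp, code_simp)
 then have "v$w$c = w$u" unfolding ic(2) using cc by simp
 then have 1: "v$w$c : simple_extension k t" using pcl(4)[OF w(1) uv(1)] by simp
 have 2: "v$w$d : simple_extension k t" if d: "d : set cs" for d
 proof -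
 have dc: "d : carrier R" using d Cons.prems sf_facts(2)[OF f(1)] by auto
 have "w$d : simple_extension k t" using w(3) d by blast
 then show ?thesis using pcl(4)[OF uv(2)] m_assoc[OF cc(3) cc(1) dc] by simp
 qed
 have "v$w ~= 0." using cc uv(3) w(2) by simp
 then show ?case using 1 2 pcl(4)[OF uv(2) w(1)] by (intro bexI[of _ "v$w"]) auto
qed

text \<open>Steinitz exchange. Clearing denominators in a relation for \<open>s\<close> over k(t)
  and transposing its coefficient matrix gives a relation for \<open>t\<close> over k(s). If that
  were trivial, every column would vanish because \<open>s\<close> is transcendental over
  \<open>k\<close>, and so would the given relation.\<close>

lemma transcendence_exchange:
 assumes k: "subfield k R" and t: "t : carrier R" and s: "s : carrier R" "transcendental k s"
 and alg: "~ transcendental (funfield k t) s"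
 shows "~ transcendental (funfield k s) t"
proof
 assume tt: "transcendental (funfield k s) t"
 note kf = sf_facts[OF k]
 note f = funfield_facts[OF kf(1) t] and fs = sf_facts[OF funfield_facts(1)[OF kf(1) t]]
 note g = funfield_facts[OF kf(1) s(1)] and gs = sf_facts[OF funfield_facts(1)[OF kf(1) s(1)]]
 note pc = subcarr[OF polys_subring(1)[OF kf(1) t]]
 obtain cs where cs: "set cs <= funfield k t" "eval cs s = 0." "~ set cs <= {0.}"
 using alg transcendental_iff[OF fs(1) s(1)] by blast
 obtain w where w: "w : simple_extension k t" "w ~= 0." "\<forall>c\<in>set cs. w$c : simple_extension k t"
 using common_denominator[OF kf(1) t cs(1)] by blast
 have csc: "set cs <= carrier R" using cs(1) fs(2) by blast
 have "\<forall>c\<in>set cs. \<exists>p. set p <= k & w$c = eval p t" using w(3) unfolding polys_iff[OF kf(1) t] .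
 then obtain F where F: "\<forall>c\<in>set cs. set (F c) <= k & w$c = eval (F c) t" by (rule bchoice[THEN exE])
 define n where "n = Max (length ` F ` set cs)"
 \<comment> \<open>Padding to a common length makes the coefficient lists a rectangular
   matrix.\<close>
 define G where "G c = replicate (n - length (F c)) 0. @ F c" for c
 have len: "length (F c) <= n" if "c : set cs" for c unfolding n_def using that by (intro Max_ge) auto
 have G: "set (G c) <= k" "length (G c) = n" "eval (G c) t = w$c" if c: "c : set cs" for c
 proof -
 have Fk: "set (F c) <= k" "set (F c) <= carrier R" using F c kf(2) by blast+
 show "set (G c) <= k" unfolding G_def using Fk(1) subcl(1)[OF kf(1)] by auto
 show "length (G c) = n" unfolding G_def using len[OF c] by simp
 show "eval (G c) t = w$c" unfolding G_def using eval_replicate_zero[OF Fk(2) t] F c by simp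
 qed
 let ?ps = "map G cs"
 have psc: "\<forall>p\<in>set ?ps. set p <= carrier R & length p = n"
 proof
 fix p assume "p : set ?ps"
 then obtain c where c: "c : set cs" "p = G c" by auto
 have "k <= carrier R" using kf(2) by blast
 then show "set p <= carrier R & length p = n" unfolding c(2) using G(1,2)[OF c(1)] by blast
 qed
 have e1: "map (%p. eval p t) ?ps = map (%c. w$c) cs" using G(3) by simp
 let ?q = "map (%i. eval (map (%p. p ! i) ?ps) s) [0 ..<n]"
 have "eval ?q t = eval (map (%c. w$c) cs) s" using eval_exchange[OF t s(1) psc] unfolding e1 by simp
 also have "... = 0." using eval_map_mult[OF pc[OF w(1)] s(1) csc] cs(2) pc[OF w(1)] by simp
 finally have q0: "eval ?q t = 0." .
 have col: "set (map (%p. p ! i) ?ps) <= k" if i: "i < n" for i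
 proof
 fix z assume "z : set (map (%p. p ! i) ?ps)"
 then obtain c where c: "c : set cs" "z = G c ! i" by auto
 show "z : k" unfolding c(2) using G(1,2)[OF c(1)] i nth_mem[of i "G c"] by blast
 qed
 have "set ?q <= funfield k s"
 proof
 fix z assume "z : set ?q"
 then obtain i where i: "i < n" "z = eval (map (%p. p ! i) ?ps) s" by auto
 have "z : simple_extension k s" unfolding polys_iff[OF kf(1) s(1)] i(2) using col[OF i(1)] by blast
 then show "z : funfield k s" using g(2) by blast
 qed
 then have z: "set ?q <= {0.}" using tt transcendental_iff[OF gs(1) t] q0 by blast
 have trans: "\<forall>p. set p <= k --> eval p s = 0. --> set p <= {0.}"
 using s(2) unfolding transcendental_iff[OF kf(1) s(1)] .
 have "c = 0." if c: "c : set cs" for c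
 proof -
 have "G c ! i = 0." if i: "i < n" for i
 proof -
 have "eval (map (%p. p ! i) ?ps) s : set ?q" unfolding set_map by (rule imageI) (use i in simp)
 then have e: "eval (map (%p. p ! i) ?ps) s = 0." using z by blast
 have "G c ! i : set (map (%p. p ! i) ?ps)" unfolding set_map using c by blast
 then show ?thesis using trans[rule_format, OF col[OF i] e] by blast
 qed
 then have "set (G c) <= {0.}" unfolding set_conv_nth G(2)[OF c] by blast
 then have "w$c = 0." using eval_zeros[OF _ t, of "G c"] G(3)[OF c] by simp
 moreover have "c : carrier R" using csc c by blast
 ultimately show ?thesis using w(2) pc[OF w(1)] by simp
 qed
 then show False using cs(3) by blast
qed

text \<open>By exchange \<open>t\<close> is algebraic over k(s), so k(s)[t] is a finite extension of
  k(s). It is a field containing k(t), so a basis of \<open>K\<close> over k(t) also spans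
  \<open>K\<close> over it.\<close>

lemma finite_over_transcendental:
 assumes k: "subfield k R" and K: "subfield K R" "k <= K" and t: "t : K" and fin: "finite_dimension (funfield k t) K"
 and s: "s : K" "transcendental k s"
 shows "finite_dimension (funfield k s) K"
proof -
 note kf = sf_facts[OF k] and Kf = sf_facts[OF K(1)]
 have c: "t : carrier R" "s : carrier R" using Kf(2) t s(1) by blast+
 note f = funfield_facts[OF kf(1) c(1)] and g = funfield_facts[OF kf(1) c(2)]
 have "~ transcendental (funfield k t) s"
 using finite_dimension_imp_algebraic[OF f(1) Kf(1) fin s(1)] by (simp add: over_def)
 then have ta: "~ transcendental (funfield k s) t" by (rule transcendence_exchange[OF k c s(2)])
 define L where "L = simple_extension (funfield k s) t"
 have L: "subfield L R" unfolding L_def using simple_extension_is_subfield[OF g(1) c(1)] ta by (simp add: over_def)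
 have Lfin: "finite_dimension (funfield k s) L"
 unfolding L_def using finite_dimension_simple_extension[OF g(1) c(1)] ta by (simp add: over_def)
 have gL: "funfield k s <= L" "t : L" unfolding L_def using polys_subring[OF sf_facts(1)[OF g(1)] c(1)] by blast+
 have fL: "funfield k t <= L" using f(6)[OF L _ gL(2)] g(3) gL(1) by blast
 have "funfield k s <= K" by (rule g(6)[OF K s(1)])
 then have LK: "L <= K" unfolding L_def using simple_extension_subring_incl[OF Kf(1) _ t] by blast
 obtain n where n: "dimension n (funfield k t) K" using fin unfolding finite_dimension_def by blast
 obtain Vs where Vs: "set Vs <= carrier R" "Span (funfield k t) Vs = K" using exists_base[OF f(1) n] by blast
 have VsK: "set Vs <= K" using Span_base_incl[OF f(1) Vs(1)] Vs(2) by simp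
 have 1: "K <= Span L Vs"
 proof
 fix z assume "z : K"
 then have "z : Span (funfield k t) Vs" using Vs(2) by simp
 then obtain Ks where "set Ks <= funfield k t" "z = combine Ks Vs" unfolding Span_eq_combine_set[OF f(1) Vs(1)] by blast
 then show "z : Span L Vs" unfolding Span_eq_combine_set[OF L Vs(1)] using fL by blast
 qed
 have 2: "Span L Vs <= K"
 proof
 fix z assume "z : Span L Vs"
 then obtain Ks where Ks: "set Ks <= L" "z = combine Ks Vs" unfolding Span_eq_combine_set[OF L Vs(1)] by blast
 have "set Ks <= K" using Ks(1) LK by blast
 then have "combine Ks Vs : K" using VsK
 proof (induction Ks Vs rule: combine.induct)
 case (1 q Ks u Us)
 then show ?case using subcl(4,5)[OF Kf(1)] by simp
 qed (use subcl(1)[OF Kf(1)] in simp_all)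
 then show "z : K" unfolding Ks(2) .
 qed
 have "finite_dimension L K" using Span_finite_dimension[OF L Vs(1)] 1 2 by simp
 then show ?thesis by (rule telescopic_base_dim(1)[OF g(1) L Lfin])
qed

end

section \<open>Function fields of one variable have dimension one\<close>

locale function_field = field R for R (structure) +
 fixes k K
 assumes kR: "subfield k R" and KR: "subfield K R" and kK: "k <= K" and one_var: "function_field_one_var R k K"

begin

lemmas kF = sf_facts[OF kR]

lemmas KF = sf_facts[OF KR]

lemma finite_over:
 assumes s: "s : K" "transcendental k s"
 shows "finite_dimension (funfield k s) K"
proof -
 obtain t n where t: "t : K" "dimension n (generate_field R (insert t k)) K"
 using one_var unfolding function_field_one_var_def by blast
 have "finite_dimension (funfield k t) K"
 using t(2) finite_dimensionI unfolding generate_field_insert[OF kF(1) KF(2)[OF t(1)]] by blast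
 then show ?thesis by (rule finite_over_transcendental[OF kR KR kK t(1) _ s])
qed

text \<open>The relation is scaled rather than made monic: one coefficient equal to 1 is enough for
  its reduction to be nontrivial.\<close>

lemma integral_relation:
 assumes s: "s : K" "transcendental k s" and V: "valuation_ring R (funfield k s) V" and b: "b : K"
 shows "\<exists>cs. set cs <= V & 1. : set cs & eval cs b = 0."
proof -
 note f = funfield_facts[OF kF(1) KF(2)[OF s(1)]]
 have "~ transcendental (funfield k s) b"
 using finite_dimension_imp_algebraic[OF f(1) KF(1) finite_over[OF s] b] by (simp add: over_def)
 then obtain cs where cs: "set cs <= funfield k s" "eval cs b = 0." "~ set cs <= {0.}"
 using transcendental_iff[OF sf_facts(1)[OF f(1)] KF(2)[OF b]] by blast
 obtain e where e: "e : funfield k s" "e ~= 0." "\<forall>q\<in>set cs. e$q : V" "\<exists>q\<in>set cs. e$q = 1."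
 using valuation_ring_scale_list[OF V f(1) cs(1,3)] by blast
 note ec = sf_facts(2)[OF f(1) e(1)]
 have "set cs <= carrier R" using cs(1) sf_facts(2)[OF f(1)] by blast
 then have "eval (map (%q. e$q) cs) b = 0." using eval_map_mult[OF ec KF(2)[OF b]] cs(2) ec by simp
 moreover have "set (map (%q. e$q) cs) <= V" "1. : set (map (%q. e$q) cs)" using e(3,4) by force+
 ultimately show ?thesis by blast
qed

lemma nonunit_transcendental:
 assumes T: "local_subring R T" "k <= T" and s: "s : nonunits R T" "s ~= 0."
 shows "transcendental k s"
proof -
 have c: "s : carrier R" using s(1) nonunits_iff[OF lsubD(1)[OF T(1)]] subcarr[OF lsubD(1)[OF T(1)]] by blast
 have "transcendental k (inv s)" using transcendental_if_pole[OF kR T inv_closed[OF c s(2)] inv_nonzero[OF c s(2)]] s c by simp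
 then show ?thesis using transcendental_inv(2)[OF kR inv_closed[OF c s(2)]] c s(2) by simp
qed

text \<open>A nonzero polynomial over \<open>k\<close> takes at the nonunit \<open>b\<close> a value
  that is a power of \<open>b\<close> times a unit, given by its lowest term. If the value lies in
  the prime, so does \<open>b\<close>.\<close>

lemma constant_relation_in_prime:
 assumes T: "local_subring R T" "k <= T" and q: "prime_in R T \<qq>" and b: "b : nonunits R T"
 and cs: "set cs <= k" "~ set cs <= {0.}" "eval cs b : \<qq>"
 shows "b : \<qq>"
 using cs
proof (induction cs rule: rev_induct)
 case (snoc c cs)
 note TD = lsubD[OF T(1)] and tcl = subcl[OF lsubD(1)[OF T(1)]] and tc = subcarr[OF lsubD(1)[OF T(1)]]
 have bT: "b : T" using b nonunits_iff[OF TD(1)] by blast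
 have cs: "set cs <= k" "c : k" "set cs <= T" "c : T" using snoc.prems(1) T(2) by auto
 have csc: "set cs <= carrier R" using cs(3) tc by blast
 have eT: "eval cs b : T" by (rule eval_in_subring[OF TD(1) bT cs(3)])
 have e: "eval (cs @ [c]) b = eval cs b$b+.c" by (rule eval_snoc[OF csc tc[OF cs(4)] tc[OF bT]])
 show ?case
 proof (cases "c = 0.")
 case True
 then have "eval cs b$b : \<qq>" using snoc.prems(3) e tc[OF eT] tc[OF bT] by simp
 then have "eval cs b : \<qq> \<or> b : \<qq>" using q eT bT unfolding prime_in_def by blast
 then show ?thesis using snoc.IH[OF cs(1)] True snoc.prems(2) by auto
 next
 case False
 have "c ~: nonunits R T" using subfield_unit(2)[OF kR T(2) TD(1) cs(2) False] .
 moreover have "b$eval cs b : nonunits R T" by (rule nonunits_mult[OF TD(1) b eT])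
 then have "eval cs b$b : nonunits R T" using m_comm tc[OF eT] tc[OF bT] by simp
 ultimately have "c+.eval cs b$b : T" "c+.eval cs b$b ~: nonunits R T"
 using unit_add_nonunit[OF T(1) cs(4)] by blast+
 moreover have e': "c+.eval cs b$b = eval (cs @ [c]) b" unfolding e using a_comm tc[OF cs(4)] tc[OF eT] tc[OF bT] by simp
 ultimately have u: "eval (cs @ [c]) b : T" "eval (cs @ [c]) b ~: nonunits R T" by simp_all
 have "inv (eval (cs @ [c]) b)$eval (cs @ [c]) b : \<qq>"
 using q unit_inv(2)[OF TD(1) u] snoc.prems(3) unfolding prime_in_def by blast
 then have "1. : \<qq>" using tc[OF u(1)] unit_inv(1)[OF TD(1) u] by simp
 then show ?thesis using q unfolding prime_in_def by blast
 qed
qed simp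

text \<open>A nonzero \<open>s\<close> in the prime is transcendental, and every nonunit
  \<open>b\<close> is algebraic over k(s). Its relation has coefficients in the local ring of the
  line at s = 0; modulo the prime, which contains \<open>s\<close>, they may be replaced by
  constants.\<close>

lemma nonzero_prime_maximal:
 assumes T: "local_subring R T" "k <= T" "T <= K" and q: "prime_in R T \<qq>" and s: "s : \<qq>" "s ~= 0."
 shows "\<qq> = nonunits R T"
proof
 note TD = lsubD[OF T(1)] and tcl = subcl[OF lsubD(1)[OF T(1)]] and tc = subcarr[OF lsubD(1)[OF T(1)]]
 have qT: "\<qq> <= T" using q unfolding prime_in_def by blast
 show sub: "\<qq> <= nonunits R T"
 proof
 fix u assume u: "u : \<qq>"
 show "u : nonunits R T"
 proof (rule ccontr)
 assume n: "u ~: nonunits R T"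
 have uT: "u : T" using qT u by blast
 note i = unit_inv[OF TD(1) uT n]
 have "inv u$u : \<qq>" using q i(2) u unfolding prime_in_def by blast
 then have "1. : \<qq>" using i(1) tc[OF uT] by simp
 then show False using q unfolding prime_in_def by blast
 qed
 qed
 have sn: "s : nonunits R T" using sub s(1) by blast
 have sT: "s : T" using qT s(1) by blast
 have tr: "transcendental k s" by (rule nonunit_transcendental[OF T(1,2) sn s(2)])
 have sK: "s : K" using sT T(3) by blast
 note sc = tc[OF sT]
 have s0: "s-.0. = s" using sc by (simp add: minus_eq)
 from point_valuation_ring[OF kR sc tr subcl(1)[OF kF(1)], unfolded s0]
 obtain V where V: "valuation_ring R (funfield k s) V" "rational_over R k V"
 "\<forall>v\<in>nonunits R V. \<exists>w\<in>V. v = s$w"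
 and VT: "\<forall>T. local_subring R T --> k <= T --> s : nonunits R T --> V <= T & nonunits R V <= nonunits R T"
 by (elim exE conjE) (rule that, assumption+)
 have V4: "V <= T" using VT T(1,2) sn by blast
 show "nonunits R T <= \<qq>"
 proof
 fix b assume b: "b : nonunits R T"
 have bT: "b : T" using b nonunits_iff[OF TD(1)] by blast
 obtain cs where cs: "set cs <= V" "1. : set cs" "eval cs b = 0."
 using integral_relation[OF sK tr V(1)] bT T(3) by blast
 have "\<forall>c\<in>V. \<exists>d. d : k & c-.d : nonunits R V" using V(2) unfolding rational_over_def by blast
 then obtain d where d: "\<forall>c\<in>V. d c : k & c-.d c : nonunits R V" by (rule bchoice[THEN exE])
 have VT: "subring V R" using valuation_ringD(1)[OF V(1)] .
 have dq: "c-.d c : \<qq>" if c: "c : V" for c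
 proof -
 obtain w where w: "w : V" "c-.d c = s$w" using d V(3) c by blast
 have wT: "w : T" using w(1) V4 by blast
 have "w$s : \<qq>" using q s(1) wT unfolding prime_in_def by blast
 then show ?thesis using w(2) m_comm sc tc[OF wT] by simp
 qed
 \<comment> \<open>Replacing each coefficient by its residue \<open>d c\<close> changes the value by
   a multiple of \<open>s\<close>, hence by an element of the prime.\<close>
 have diff: "eval p b-.eval (map d p) b : \<qq>" if p: "set p <= V" for p
 using p
 proof (induction p)
 case Nil
 then show ?case using q unfolding prime_in_def by simp
 next
 case (Cons c p)
 have c: "c : V" "c : T" "set p <= V" "set p <= T" using Cons.prems V4 by auto
 have dk: "d c : k" "set (map d p) <= k" using d c by auto
 have dT: "d c : T" "set (map d p) <= T" using dk T(2) by blast+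
 note ev = eval_in_subring[OF TD(1) bT c(4)] eval_in_subring[OF TD(1) bT dT(2)]
 have P: "b [^] length p : T" by (rule tcl(7)[OF bT])
 note cc = tc[OF c(2)] tc[OF dT(1)] tc[OF ev(1)] tc[OF ev(2)] tc[OF P]
 have IH: "eval p b-.eval (map d p) b : \<qq>" by (rule Cons.IH[OF c(3)])
 have "b [^] length p$(c-.d c) : \<qq>" using q P dq[OF c(1)] unfolding prime_in_def by blast
 then have "b [^] length p$(c-.d c)+.(eval p b-.eval (map d p) b) : \<qq>"
 using q IH unfolding prime_in_def by blast
 moreover have "eval (c # p) b-.eval (map d (c # p)) b = b [^] length p$(c-.d c)+.(eval p b-.eval (map d p) b)"
 unfolding list.map eval_Cons length_map by (reify rsimps, rule ring_id, simp add: cc, simp, code_simp)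
 ultimately show ?case by simp
 qed
 have dk: "set (map d cs) <= k" using d cs(1) by auto
 have dT: "set (map d cs) <= T" using dk T(2) by blast
 note evd = tc[OF eval_in_subring[OF TD(1) bT dT]]
 have "-. eval (map d cs) b : \<qq>" using diff[OF cs(1)] cs(3) evd by (simp add: minus_eq)
 then have "( -. 1.)$( -. eval (map d cs) b) : \<qq>" using q tcl(3)[OF tcl(2)] unfolding prime_in_def by blast
 then have e: "eval (map d cs) b : \<qq>" using evd by (simp add: l_minus)
 have "d 1. ~= 0."
 proof
 assume z: "d 1. = 0."
 have "1.-.d 1. : nonunits R V" using d cs(1,2) by blast
 then show False using one_unit[OF VT] z by (simp add: minus_eq)
 qed
 then have "~ set (map d cs) <= {0.}" using cs(2) by force
 then show "b : \<qq>" by (rule constant_relation_in_prime[OF T(1,2) q b dk _ e])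
 qed
qed

end

section \<open>Regular local rings, residue fields and points over a prime\<close>

context field

begin

lemma uniformizerI:
 assumes "subring P R" "noetherian_ring (R(|carrier := P|))" "\<pi> : nonunits R P" "\<pi> ~= 0."
 "\<forall>v\<in>nonunits R P. \<exists>w\<in>P. v = \<pi>$w"
 shows "uniformizer R P \<pi>"
 unfolding uniformizer_def using assms(3,4,5) noetherian_separated[OF assms(1-4)] by blast

lemma nonunits_prime:
 assumes P: "local_subring R P" shows "prime_in R P (nonunits R P)"
proof -
 have "P \<inter> nonunits R P = nonunits R P" using nonunits_iff[OF lsubD(1)[OF P]] by blast
 then show ?thesis using prime_in_center[OF lsubD(1)[OF P] P subset_refl] by simp
qed

lemma residue_field_facts:
 assumes P: "local_subring R P"
 shows "field (residue_field R P)" "residue R P : ring_hom (R(|carrier := P|)) (residue_field R P)"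
 "residue R P ` P = carrier (residue_field R P)"
 "!!v. v : P ==> residue R P v = 0.\<^bsub>residue_field R P\<^esub> \<longleftrightarrow> v : nonunits R P"
proof -
 let ?P = "R(|carrier := P|)" and ?m = "nonunits R P"
 note PD = lsubD[OF P]
 interpret P: domain ?P by (rule subring_is_domain[OF PD(1)])
 have pr: "primeideal ?m ?P" using prime_in_iff[OF PD(1)] nonunits_prime[OF P] by blast
 then have id: "ideal ?m ?P" by (rule primeideal.axioms(1))
 interpret I: ideal ?m ?P by (rule id)
 have co: "?m +>\<^bsub>?P\<^esub> v = residue R P v" for v
 unfolding residue_def a_r_coset_def r_coset_def by simp
 have max: "maximalideal ?m ?P"
 proof (rule maximalidealI[OF id])
 show "carrier ?P ~= ?m"
 proof
 assume "carrier ?P = ?m"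
 then have "1. : ?m" using subcl(2)[OF PD(1)] by simp
 then show False using one_unit[OF PD(1)] by blast
 qed
 fix J assume J: "ideal J ?P" "?m <= J" "J <= carrier ?P"
 show "J = ?m \<or> J = carrier ?P"
 proof (cases "J <= ?m")
 case False
 then obtain u where u: "u : J" "u ~: ?m" by blast
 have uP: "u : P" using J(3) u(1) by auto
 note i = unit_inv[OF PD(1) uP u(2)]
 have "inv u$u : J" using ideal.I_l_closed[OF J(1) u(1), of "inv u"] i(2) by simp
 then have "1.\<^bsub>?P\<^esub> : J" using i(1) subcarr[OF PD(1) uP] by simp
 then show ?thesis using ideal.one_imp_carrier[OF J(1)] by simp
 qed (use J(2) in blast)
 qed
 show "field (residue_field R P)" unfolding residue_field_def by (rule maximalideal.quotient_is_field[OF max P.is_cring])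
 have "(+>\<^bsub>?P\<^esub>) ?m = residue R P" using co by blast
 then show "residue R P : ring_hom ?P (residue_field R P)" unfolding residue_field_def using I.rcos_ring_hom by simp
 show "residue R P ` P = carrier (residue_field R P)"
 unfolding residue_field_def FactRing_def using co by (auto simp: A_RCOSETS_def')
 fix v assume v: "v : P"
 have z: "0.\<^bsub>residue_field R P\<^esub> = ?m" unfolding residue_field_def FactRing_def by simp
 show "residue R P v = 0.\<^bsub>residue_field R P\<^esub> \<longleftrightarrow> v : nonunits R P"
 unfolding z co[symmetric] using I.rcos_const_imp_mem[of v] P.a_rcos_zero[OF id, of v] v by auto
qed

lemma combine_nonunits:
 assumes P: "local_subring R P" and l: "length fs = length us"
 and n: "\<forall>i<length us. fs ! i$us ! i : nonunits R P"
 shows "combine fs us : nonunits R P"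
 using l n
proof (induction fs us rule: list_induct2)
 case Nil
 then show ?case using zero_nonunit[OF lsubD(1)[OF P]] by simp
next
 case (Cons f fs u us)
 have 1: "f$u : nonunits R P" using Cons.prems[rule_format, of 0] by simp
 have "\<forall>i<length us. fs ! i$us ! i : nonunits R P"
 proof (intro allI impI)
 fix i assume "i < length us"
 then show "fs ! i$us ! i : nonunits R P" using Cons.prems[rule_format, of "Suc i"] by simp
 qed
 then show ?case using lsubD(2)[OF P 1 Cons.IH] by simp
qed

lemma combine_unit:
 assumes P: "local_subring R P" and l: "length fs = length us"
 and i: "i < length us" "fs ! i$us ! i : P" "fs ! i$us ! i ~: nonunits R P"
 and n: "\<forall>j<length us. j ~= i --> fs ! j$us ! j : nonunits R P"
 shows "combine fs us : P & combine fs us ~: nonunits R P"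
 using l i n
proof (induction fs us arbitrary: i rule: list_induct2)
 case (Cons f fs u us)
 note PD = lsubD[OF P] and pc = subcarr[OF lsubD(1)[OF P]]
 show ?case
 proof (cases i)
 case 0
 have "\<forall>j<length us. fs ! j$us ! j : nonunits R P"
 proof (intro allI impI)
 fix j assume "j < length us"
 then show "fs ! j$us ! j : nonunits R P" using Cons.prems(4)[rule_format, of "Suc j"] 0 by simp
 qed
 then have "combine fs us : nonunits R P" by (rule combine_nonunits[OF P Cons.hyps])
 moreover have "f$u : P" "f$u ~: nonunits R P" using Cons.prems(2,3) 0 by simp_all
 ultimately show ?thesis using unit_add_nonunit[OF P] by simp
 next
 case (Suc m)
 have "\<forall>j<length us. j ~= m --> fs ! j$us ! j : nonunits R P"
 proof (intro allI impI)
 fix j assume "j < length us" "j ~= m"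
 then show "fs ! j$us ! j : nonunits R P" using Cons.prems(4)[rule_format, of "Suc j"] Suc by simp
 qed
 then have c: "combine fs us : P" "combine fs us ~: nonunits R P" using Cons.IH[of m] Cons.prems Suc by simp_all
 have f: "f$u : nonunits R P" using Cons.prems(4)[rule_format, of 0] Suc by simp
 then have fP: "f$u : P" using nonunits_iff[OF PD(1)] by blast
 have "f$u+.combine fs us = combine fs us+.f$u" using a_comm pc[OF fP] pc[OF c(1)] by simp
 then show ?thesis using unit_add_nonunit[OF P c f] by simp
 qed
qed simp

end

context function_field

begin

text \<open>The only primes are 0 and the maximal ideal, so the Krull dimension is at most 1 and
  regularity provides at most one generator. Without a generator the ring would be its fraction
  field \<open>K\<close>.\<close>

lemma regular_uniformizer:
 assumes P: "local_subring R P" "k <= P" "P <= K" "P ~= K"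
 and frac: "\<forall>z\<in>K. \<exists>a\<in>P. \<exists>b\<in>P. b ~= 0. & z = a$inv b"
 and reg: "regular_local_ring (R(|carrier := P|))"
 shows "\<exists>\<pi>. uniformizer R P \<pi>"
proof -
 let ?P = "R(|carrier := P|)" and ?m = "nonunits R P"
 note PD = lsubD[OF P(1)] and pc = subcarr[OF lsubD(1)[OF P(1)]] and pcl = subcl[OF lsubD(1)[OF P(1)]]
 interpret P: domain ?P by (rule subring_is_domain[OF PD(1)])
 have pr: "primeideal ?m ?P" using prime_in_iff[OF PD(1)] nonunits_prime[OF P(1)] by blast
 have primes: "I = {0.} \<or> I = ?m" if "primeideal I ?P" for I
 proof -
 have I: "prime_in R P I" using prime_in_iff[OF PD(1)] that by blast
 show ?thesis
 proof (cases "I <= {0.}")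
 case True
 then show ?thesis using I unfolding prime_in_def by blast
 next
 case False
 then show ?thesis using nonzero_prime_maximal[OF P(1-3) I] by blast
 qed
 qed
 have kd: "krull_dim ?P <= 1"
 unfolding krull_dim_def
 proof (rule SUP_least)
 fix ps assume "ps : {ps. ps ~= [] & (\<forall>\<pp>\<in>set ps. primeideal \<pp> ?P) & sorted_wrt (\<subset>) ps}"
 then have ps: "\<forall>\<pp>\<in>set ps. primeideal \<pp> ?P" "sorted_wrt (\<subset>) ps" by simp_all
 have "length ps <= 2"
 proof (rule ccontr)
 assume "~ length ps <= 2"
 then have l: "2 < length ps" by simp
 have "ps ! 0 \<subset> ps ! 1" "ps ! 1 \<subset> ps ! 2" "ps ! 0 \<subset> ps ! 2"
 using sorted_wrt_nth_less[OF ps(2), of 0 1] sorted_wrt_nth_less[OF ps(2), of 1 2] sorted_wrt_nth_less[OF ps(2), of 0 2] l by simp_all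
 moreover have "ps ! i = {0.} \<or> ps ! i = ?m" if "i < 3" for i using primes ps(1) nth_mem[of i ps] that l by simp
 then have "ps ! 0 = {0.} \<or> ps ! 0 = ?m" "ps ! 1 = {0.} \<or> ps ! 1 = ?m" "ps ! 2 = {0.} \<or> ps ! 2 = ?m" by simp_all
 ultimately show False by (metis psubsetE)
 qed
 then have "length ps - 1 <= 1" by simp
 then show "enat (length ps - 1) <= 1" by (simp add: one_enat_def)
 qed
 obtain m G where m: "{I. maximalideal I ?P} = {m}" and G: "finite G" "G <= P" "m = genideal ?P G" "enat (card G) = krull_dim ?P"
 and N: "noetherian_ring ?P"
 using reg unfolding regular_local_ring_def by auto
 have mm: "maximalideal m ?P" using m by blast
 have mi: "ideal m ?P" by (rule maximalideal.axioms(1)[OF mm])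
 have mn: "carrier ?P ~= m" by (rule maximalideal.I_notcarr[OF mm])
 have id: "ideal ?m ?P" by (rule primeideal.axioms(1)[OF pr])
 have "m <= ?m"
 proof
 fix u assume u: "u : m"
 then have uP: "u : P" using additive_subgroup.a_subset[OF ideal.axioms(1)[OF mi]] by auto
 show "u : ?m"
 proof (rule ccontr)
 assume n: "u ~: ?m"
 note i = unit_inv[OF PD(1) uP n]
 have "inv u$u : m" using ideal.I_l_closed[OF mi u, of "inv u"] i(2) by simp
 then have "1.\<^bsub>?P\<^esub> : m" using i(1) pc[OF uP] by simp
 then have "m = carrier ?P" by (rule ideal.one_imp_carrier[OF mi])
 then show False using mn by simp
 qed
 qed
 moreover have "?m <= P" using nonunits_iff[OF PD(1)] by blast
 then have "?m <= carrier ?P" by simp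
 moreover have "?m ~= carrier ?P"
 proof
 assume "?m = carrier ?P"
 then have "1. : ?m" using pcl(2) by simp
 then show False using one_unit[OF PD(1)] by blast
 qed
 ultimately have "?m = m" using maximalideal.I_maximal[OF mm id] by metis
 then have me: "?m = genideal ?P G" unfolding G(3) .
 have nz: "~ ?m <= {0.}"
 proof
 assume z: "?m <= {0.}"
 have "K <= P"
 proof
 fix f assume "f : K"
 then obtain u v where uv: "u : P" "v : P" "v ~= 0." "f = u$inv v" using frac by blast
 have "v ~: ?m" using z uv(3) by blast
 then show "f : P" unfolding uv(4) using pcl(4)[OF uv(1) unit_inv(2)[OF PD(1) uv(2)]] by blast
 qed
 then show False using P(3,4) by blast
 qed
 have "card G <= 1" using kd unfolding G(4)[symmetric] by (simp add: one_enat_def)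
 moreover have "G ~= {}"
 proof
 assume "G = {}"
 then have "?m <= {0.\<^bsub>?P\<^esub>}" unfolding me using P.genideal_minimal[OF P.zeroideal, of "{}"] by simp
 then show False using nz by simp
 qed
 ultimately have "card G = 1" using G(1) card_gt_0_iff[of G] by linarith
 then obtain \<pi> where pi: "G = {\<pi>}" using card_1_singletonE by blast
 have pP: "\<pi> : P" using G(2) pi by simp
 have "?m = PIdl\<^bsub>?P\<^esub> \<pi>" unfolding me pi using P.cgenideal_eq_genideal[of \<pi>] pP by simp
 then have mform: "v : ?m \<longleftrightarrow> (\<exists>w\<in>P. v = w$\<pi>)" for v unfolding cgenideal_def by auto
 have "\<pi> : ?m" unfolding mform using pcl(2) pc[OF pP] by (intro bexI[of _ \<one>]) simp_all
 moreover have "\<pi> ~= 0."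
 proof
 assume z: "\<pi> = 0."
 have "v = 0." if v: "v : ?m" for v
 proof -
 obtain w where "w : P" "v = w$\<pi>" using v unfolding mform by blast
 then show ?thesis using z pc by simp
 qed
 then show False using nz by blast
 qed
 moreover have "\<forall>v\<in>?m. \<exists>w\<in>P. v = \<pi>$w"
 proof
 fix v assume "v : ?m"
 then obtain w where w: "w : P" "v = w$\<pi>" unfolding mform by blast
 then show "\<exists>w\<in>P. v = \<pi>$w" using m_comm[OF pc[OF w(1)] pc[OF pP]] by blast
 qed
 ultimately show ?thesis using uniformizerI[OF PD(1) N] by blast
qed

text \<open>Lifts of residues that are independent over \<open>k\<close> are independent over
  k(\<pi>): a scaled relation reduces to one over \<open>k\<close>, as the local ring at \<pi> = 0
  has residue field \<open>k\<close>. So the residue degree is bounded by the degree of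
  \<open>K\<close> over k(\<pi>).\<close>

lemma residue_field_finite:
 assumes P: "discrete_valuation_ring R K P" "k <= P"
 shows "ring.finite_dimension (residue_field R P) (residue R P ` k) (carrier (residue_field R P))"
 and "subfield (residue R P ` k) (residue_field R P)" and "inj_on (residue R P) k"
proof -
 obtain \<pi> where V: "valuation_ring R K P" and u: "uniformizer R P \<pi>" using P(1) unfolding discrete_valuation_ring_def by blast
 note VD = valuation_ringD[OF V] and uf = uniformizer_facts[OF valuation_ringD(1)[OF V] u]
 have L: "local_subring R P" by (rule valuation_ring_local[OF V KR])
 note pc = subcarr[OF VD(1)] and pcl = subcl[OF VD(1)]
 let ?L = "residue_field R P" and ?h = "residue R P"
 note rf = residue_field_facts[OF L]
 interpret L: field ?L by (rule rf(1))
 interpret H: ring_hom_ring "R(|carrier := P|)" ?L ?h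
 by (rule ring_hom_ringI2[OF subring_is_ring[OF VD(1)] L.ring_axioms rf(2)])
 have ks: "subfield k (R(|carrier := P|))" using ring.subfield_iff(1)[OF subring_is_ring[OF VD(1)], of k] subfield_iff(2)[OF kR] P(2) by simp
 show sk: "subfield (?h ` k) ?L" using H.img_is_subfield(2)[OF ks L.one_not_zero] .
 show inj: "inj_on ?h k" using H.img_is_subfield(1)[OF ks L.one_not_zero] .
 have tr: "transcendental k \<pi>" by (rule nonunit_transcendental[OF L P(2) uf(4,3)])
 have pK: "\<pi> : K" using uf(1) VD(2) by blast
 have s0: "\<pi>-.0. = \<pi>" using uf(2) by (simp add: minus_eq)
 from point_valuation_ring[OF kR uf(2) tr subcl(1)[OF kF(1)], unfolded s0]
 obtain S where S: "valuation_ring R (funfield k \<pi>) S" "rational_over R k S"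
 and SP: "\<forall>T. local_subring R T --> k <= T --> \<pi> : nonunits R T --> S <= T & nonunits R S <= nonunits R T"
 by (elim exE conjE) (rule that, assumption+)
 have SP: "S <= P" "nonunits R S <= nonunits R P" using SP L P(2) uf(4) by blast+
 note f = funfield_facts[OF kF(1) uf(2)]
 obtain N where N: "dimension N (funfield k \<pi>) K" using finite_over[OF pK tr] unfolding finite_dimension_def by blast
 have hc: "?h (combine fs us) = L.combine (map ?h fs) (map ?h us)" if "set fs <= P" "set us <= P" for fs us
 using that
 proof (induction fs us rule: combine.induct)
 case (1 q fs v us)
 have c: "q : P" "v : P" "set fs <= P" "set us <= P" using 1(2,3) by simp_all
 have cP: "combine fs us : P" using c(3,4)
 by (induction fs us rule: combine.induct) (use pcl(1,4,5) in simp_all)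
 show ?case using 1(1)[OF c(3,4)] H.hom_add[of "q$v" "combine fs us"] H.hom_mult[of q v] c(1,2) cP pcl(4)[OF c(1,2)] by simp
 qed (use H.hom_zero in simp_all)
 have "length vs <= N" if vs: "L.independent (?h ` k) vs" for vs
 proof -
 have "set vs <= ?h ` P" using L.independent_in_carrier[OF vs] rf(3) by simp
 then obtain us where us: "set us <= P" "vs = map ?h us"
 proof (induction vs arbitrary: thesis)
 case (Cons v vs)
 then obtain us where us: "set us <= P" "vs = map ?h us" by auto
 obtain w where w: "w : P" "v = ?h w" using Cons.prems(2) by auto
 show ?case by (rule Cons.prems(1)[of "w # us"]) (use us w in simp_all)
 qed simp
 have "independent (funfield k \<pi>) us"
 proof (rule valuation_independent[OF S(1) f(1)])
 show "set us <= carrier R" using us(1) pc by blast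
 show "\<forall>fs. set fs <= S & length fs = length us & combine fs us = 0. --> 1. ~: set fs"
 proof (intro allI impI notI)
 fix fs assume fs: "set fs <= S & length fs = length us & combine fs us = 0." and one: "1. : set fs"
 have fP: "set fs <= P" using fs SP(1) by blast
 have fk: "set (map ?h fs) <= ?h ` k"
 proof
 fix z assume "z : set (map ?h fs)"
 then obtain g where g: "g : S" "g : P" "z = ?h g" using fs SP(1) by auto
 obtain c where c: "c : k" "g-.c : nonunits R S" using S(2) g(1) unfolding rational_over_def by blast
 have cP: "c : P" using c(1) P(2) by blast
 have n: "g-.c : nonunits R P" "g-.c : P" using c(2) SP(2) pcl(6)[OF g(2) cP] by blast+
 have "g = (g-.c)+.c" using pc[OF g(2)] pc[OF cP] by (simp add: minus_eq a_assoc l_neg)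
 then have "?h g = ?h (g-.c) +.\<^bsub>?L\<^esub> ?h c" using H.hom_add[of "g-.c" c] n(2) cP by simp
 also have "... = ?h c" using rf(4)[OF n(2)] n(1) H.hom_closed[of c] cP by simp
 finally show "z : ?h ` k" using g(3) c(1) by blast
 qed
 have "L.combine (map ?h fs) vs = 0.\<^bsub>?L\<^esub>" using hc[OF fP us(1)] fs H.hom_zero us(2) by simp
 then have "set (take (length vs) (map ?h fs)) <= {0.\<^bsub>?L\<^esub>}" by (rule L.independent_imp_trivial_combine[OF sk vs fk])
 moreover have "take (length vs) (map ?h fs) = map ?h fs" using fs us(2) by simp
 ultimately have "?h 1. = 0.\<^bsub>?L\<^esub>" using one by auto
 then show False using rf(4)[OF pcl(2)] one_unit[OF VD(1)] by blast
 qed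
 qed
 moreover have "set us <= K" using us(1) VD(2) by blast
 ultimately have "length us <= N" by (rule independent_length_le_dimension[OF f(1) N])
 then show ?thesis using us(2) by simp
 qed
 then have "\<forall>vs. L.independent (?h ` k) vs --> length vs <= N" by blast
 then show "L.finite_dimension (?h ` k) (carrier ?L)" by (rule L.bounded_independent_finite_dimension[OF sk])
qed

text \<open>Weak approximation attaches to each point a function that is a unit there and a nonunit
  at the other points. In a relation over the local ring of the common prime with coefficient 1 at
  one of them, the sum is a unit at that point; so these functions are independent over
  k(s).\<close>

lemma card_points_over_prime:
 assumes s: "s : K" "transcendental k s" and n: "dimension n (funfield k s) K" and fin: "finite \<P>"
 and P: "\<forall>P\<in>\<P>. discrete_valuation_ring R K P & k <= P & s : P & simple_extension k s \<inter> nonunits R P = \<pp>"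
 shows "card \<P> <= n"
proof (cases "\<P> = {}")
 case False
 let ?A = "simple_extension k s"
 note sc = KF(2)[OF s(1)]
 note f = funfield_facts[OF kF(1) sc] and As = polys_subring[OF kF(1) sc]
 have loc: "valuation_ring R K P" "local_subring R P" "?A <= P" if p: "P : \<P>" for P
 proof -
 show 1: "valuation_ring R K P" using P p unfolding discrete_valuation_ring_def by blast
 show "local_subring R P" by (rule valuation_ring_local[OF 1 KR])
 show "?A <= P" using simple_extension_subring_incl[OF valuation_ringD(1)[OF 1]] P p by blast
 qed
 obtain P0 where P0: "P0 : \<P>" using False by blast
 have pp: "prime_in R ?A \<pp>"
 proof -
 have "?A \<inter> nonunits R P0 = \<pp>" using P P0 by blast
 then show ?thesis using prime_in_center[OF As(1) loc(2,3)[OF P0]] by simp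
 qed
 let ?O = "localization R ?A \<pp>"
 have V: "valuation_ring R (funfield k s) ?O" by (rule poly_localization_valuation_ring[OF kR sc pp])
 have OP: "?O <= P & nonunits R ?O <= nonunits R P" if p: "P : \<P>" for P
 proof -
 have e: "?A \<inter> nonunits R P = \<pp>" using P p by blast
 have "?A \<inter> nonunits R P <= \<pp>" "\<pp> <= nonunits R P" using e by blast+
 then show ?thesis using localization_least[OF As(1) pp loc(2,3)[OF p]] by blast
 qed
 have "\<forall>P\<in>\<P>. \<exists>z. z : P & z ~: nonunits R P & (\<forall>Q\<in>\<P> - {P}. z : nonunits R Q)"
 proof
 fix P' assume p: "P' : \<P>"
 show "\<exists>z. z : P' & z ~: nonunits R P' & (\<forall>Q\<in>\<P> - {P'}. z : nonunits R Q)"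
 using valuation_rings_approximation[OF KR, of P' "\<P> - {P'}"] P p fin by blast
 qed
 then obtain z where z: "\<forall>P\<in>\<P>. z P : P & z P ~: nonunits R P & (\<forall>Q\<in>\<P> - {P}. z P : nonunits R Q)"
 by (rule bchoice[THEN exE])
 obtain ps where ps: "set ps = \<P>" "distinct ps" using finite_distinct_list[OF fin] by blast
 let ?us = "map z ps"
 have usK: "set ?us <= K"
 proof
 fix v assume "v : set ?us"
 then obtain P where p: "P : \<P>" "v = z P" using ps(1) by auto
 then show "v : K" using z valuation_ringD(2)[OF loc(1)[OF p(1)]] by blast
 qed
 have usc: "set ?us <= carrier R" using usK KF(2) by blast
 have "independent (funfield k s) ?us"
 proof (rule valuation_independent[OF V f(1) usc], intro allI impI notI)
 fix fs assume fs: "set fs <= ?O & length fs = length ?us & combine fs ?us = 0." and one: "1. : set fs"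
 obtain i where i: "i < length fs" "fs ! i = 1." using one by (metis in_set_conv_nth)
 have il: "i < length ps" using i(1) fs by simp
 let ?P = "ps ! i"
 have pi: "?P : \<P>" using ps(1) il nth_mem by blast
 note PL = loc(2)[OF pi] note PD = lsubD[OF PL]
 have zi: "z ?P : ?P" "z ?P ~: nonunits R ?P" using z pi by blast+
 note zc = subcarr[OF PD(1) zi(1)]
 have "fs ! i$?us ! i : ?P" "fs ! i$?us ! i ~: nonunits R ?P" using i(2) il zi zc by simp_all
 moreover have "\<forall>j<length ?us. j ~= i --> fs ! j$?us ! j : nonunits R ?P"
 proof (intro allI impI)
 fix j assume j: "j < length ?us" "j ~= i"
 have jl: "j < length ps" using j(1) by simp
 have "ps ! j : \<P>" using ps(1) jl nth_mem by blast
 moreover have "ps ! j ~= ?P" using ps(2) jl il j(2) nth_eq_iff_index_eq by blast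
 ultimately have n: "z (ps ! j) : nonunits R ?P" using z pi by blast
 have "fs ! j : ?O" using fs j(1) nth_mem[of j fs] by auto
 then have fj: "fs ! j : ?P" using OP[OF pi] by blast
 have "z (ps ! j) : ?P" using n nonunits_iff[OF PD(1)] by blast
 then have "fs ! j$z (ps ! j) = z (ps ! j)$fs ! j" using m_comm subcarr[OF PD(1)] fj by simp
 then show "fs ! j$?us ! j : nonunits R ?P" using nonunits_mult[OF PD(1) n fj] jl by simp
 qed
 ultimately have "combine fs ?us ~: nonunits R ?P"
 using combine_unit[OF PL, of fs ?us i] fs il by simp
 then show False using fs zero_nonunit[OF PD(1)] by simp
 qed
 then have "length ?us <= n" by (rule independent_length_le_dimension[OF f(1) n _ usK])
 then show ?thesis using ps distinct_card[of ps] by simp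
qed simp

end

section \<open>Finite fields: cardinality, roots and division\<close>

context field

begin

lemma card_dimension:
 assumes K: "subfield K R" "finite K" and n: "dimension n K E"
 shows "finite E" "card E = card K ^ n"
proof -
 obtain Us where Us: "set Us <= carrier R" "independent K Us" "length Us = n" "Span K Us = E"
 using exists_base[OF K(1) n] by blast
 let ?L = "{Ks. set Ks <= K & length Ks = n}"
 have "bij_betw (%Ks. combine Ks Us) ?L E"
 unfolding bij_betw_def
 proof
 show "inj_on (%Ks. combine Ks Us) ?L"
 proof (rule inj_onI)
 fix Ks Ks' assume h: "Ks : ?L" "Ks' : ?L" "combine Ks Us = combine Ks' Us"
 have "combine Ks Us : Span K Us" unfolding Span_eq_combine_set[OF K(1) Us(1)] using h(1) by blast
 then have "\<exists>!Ks'. set Ks' <= K & length Ks' = length Us & combine Ks Us = combine Ks' Us"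
 by (rule unique_decomposition[OF K(1) Us(2)])
 then obtain M where M: "\<forall>N. set N <= K & length N = length Us & combine Ks Us = combine N Us --> N = M"
 by (elim ex1E) (rule that)
 have "Ks = M" by (rule M[rule_format]) (use h(1) Us(3) in simp)
 moreover have "Ks' = M" by (rule M[rule_format]) (use h(2,3) Us(3) in simp)
 ultimately show "Ks = Ks'" by simp
 qed
 show "(%Ks. combine Ks Us) ` ?L = E"
 unfolding Us(4)[symmetric] Span_eq_combine_set_length_version[OF K(1) Us(1)] Us(3) by blast
 qed
 from bij_betw_finite[OF this] bij_betw_same_card[OF this] show "finite E" "card E = card K ^ n"
 using finite_lists_length_eq[OF K(2), of n] card_lists_length_eq[OF K(2), of n] by simp_all
qed

lemma card_roots_le:
 assumes fin: "finite (carrier R)" and p: "set p <= carrier R" "~ set p <= {0.}"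
 shows "card {x : carrier R. eval p x = 0.} <= length p - 1"
 using p
proof (induction p)
 case (Cons a p)
 have c: "a : carrier R" "set p <= carrier R" using Cons.prems(1) by auto
 show ?case
 proof (cases "a = 0.")
 case True
 have e: "{x : carrier R. eval (a # p) x = 0.} = {x : carrier R. eval p x = 0.}"
 using eval_zero_prefix[OF c(2)] True by auto
 have "~ set p <= {0.}" using Cons.prems(2) True by simp
 then show ?thesis unfolding e using Cons.IH[OF c(2)] by simp
 next
 case False
 let ?p = "a # p"
 have P: "?p : carrier (poly_ring R)" unfolding sym[OF univ_poly_carrier] polynomial_def using Cons.prems(1) False by simp
 have "{x : carrier R. eval ?p x = 0.} <= set_mset (roots ?p)"
 using roots_mem_iff_is_root[OF P] unfolding is_root_def by auto
 then have "card {x : carrier R. eval ?p x = 0.} <= card (set_mset (roots ?p))" by (intro card_mono) auto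
 also have "... <= size (roots ?p)"
 unfolding size_multiset_overloaded_eq card_eq_sum by (intro sum_mono) (simp add: Suc_le_eq)
 also have "... <= degree ?p" by (rule size_roots_le_degree[OF P])
 finally show ?thesis by simp
 qed
qed simp

lemma power_card:
 assumes fin: "finite (carrier R)" and x: "x : carrier R" "x ~= 0."
 shows "x [^] (card (carrier R) - 1) = 1."
proof -
 interpret M: group "Multiplicative_Group.mult_of R" by (rule Multiplicative_Group.field.field_mult_group[OF field_axioms])
 have "x [^]\<^bsub>Multiplicative_Group.mult_of R\<^esub> order (Multiplicative_Group.mult_of R) = 1.\<^bsub>Multiplicative_Group.mult_of R\<^esub>" by (rule M.pow_order_eq_1) (use x in simp)
 moreover have "order (Multiplicative_Group.mult_of R) = card (carrier R) - 1" using order_mult_of[OF fin] unfolding order_def .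
 ultimately show ?thesis by (simp add: Multiplicative_Group.nat_pow_mult_of)
qed

text \<open>Separated out because the same step is carried out in two fields in parallel.\<close>

lemma division_step:
 assumes c: "set p <= carrier R" "set q <= carrier R" "set r <= carrier R" "set es <= carrier R" "set bs <= carrier R"
 "c : carrier R" "d : carrier R" "b : carrier R" "e : carrier R" "x : carrier R"
 and e: "r @ [c] = e # es" "d$b = e" and l: "length es = length bs"
 and h: "eval p x = eval q x$eval (b # bs) x+.eval r x"
 shows "eval (p @ [c]) x = eval (q @ [d]) x$eval (b # bs) x+.eval (map2 (%s t. s-.d$t) es bs) x"
proof -
 let ?B = "eval (b # bs) x"
 note car = eval_closed[OF c(2,10)] eval_closed[OF c(3,10)] eval_closed[OF c(4,10)] eval_closed[OF c(5,10)]
 have P: "x [^] length bs : carrier R" using c(10) by simp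
 have B: "?B : carrier R" using car c P by (simp add: eval_Cons)
 have 1: "eval (map2 (%s t. s-.d$t) es bs) x = eval es x-.d$eval bs x"
 by (rule eval_map2_minus[OF c(7,10,4,5) l])
 have 2: "eval r x$x+.c = d$b$x [^] length bs+.eval es x"
 using eval_snoc[OF c(3,6,10)] e l by (simp add: eval_Cons)
 have "eval (p @ [c]) x = (eval q x$?B+.eval r x)$x+.c" using eval_snoc[OF c(1,6,10)] h by simp
 also have "... = (eval q x$x)$?B+.(eval r x$x+.c)"
 by (reify rsimps, rule ring_id, simp add: car B c, simp, code_simp)
 also have "... = (eval q x$x+.d)$?B+.(eval es x-.d$eval bs x)"
 unfolding 2 eval_Cons by (reify rsimps, rule ring_id, simp add: car c P, simp, code_simp)
 also have "... = eval (q @ [d]) x$?B+.eval (map2 (%s t. s-.d$t) es bs) x"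
 unfolding 1 eval_snoc[OF c(2,7,10)] ..
 finally show ?thesis .
qed

end

section \<open>Extension of an embedding between finite fields\<close>

locale field_embedding = R: field R + G: field G for R (structure) and G :: "('c, 'd) ring_scheme" +
 fixes A \<tau>
 assumes A: "subfield A R" and \<tau>: "\<tau> : ring_hom (R(|carrier := A|)) G"

begin

lemmas AF = R.sf_facts[OF A]

lemmas acl = R.subcl[OF AF(1)]

lemma \<tau>_facts: "!!u. u : A ==> \<tau> u : carrier G" "\<tau> 1. = 1.\<^bsub>G\<^esub>" "\<tau> 0. = 0.\<^bsub>G\<^esub>"
 "!!u v. u : A ==> v : A ==> \<tau> (u$v) = \<tau> u $\<^bsub>G\<^esub> \<tau> v"
 "!!u v. u : A ==> v : A ==> \<tau> (u+.v) = \<tau> u +.\<^bsub>G\<^esub> \<tau> v"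
 "!!u v. u : A ==> v : A ==> \<tau> (u-.v) = \<tau> u -.\<^bsub>G\<^esub> \<tau> v"
 "!!u. u : A ==> \<tau> ( -. u) = -.\<^bsub>G\<^esub> \<tau> u"
proof -
 show c: "\<tau> u : carrier G" if "u : A" for u using ring_hom_closed[OF \<tau>, of u] that by simp
 show "\<tau> 1. = 1.\<^bsub>G\<^esub>" using ring_hom_one[OF \<tau>] by simp
 show "\<tau> (u$v) = \<tau> u $\<^bsub>G\<^esub> \<tau> v" if "u : A" "v : A" for u v using ring_hom_mult[OF \<tau>, of u v] that by simp
 show p: "\<tau> (u+.v) = \<tau> u +.\<^bsub>G\<^esub> \<tau> v" if "u : A" "v : A" for u v using ring_hom_add[OF \<tau>, of u v] that by simp
 have "\<tau> 0. +.\<^bsub>G\<^esub> \<tau> 0. = \<tau> 0." using p[OF acl(1,1)] by simp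
 then show z: "\<tau> 0. = 0.\<^bsub>G\<^esub>" using c[OF acl(1)] G.add.l_cancel_one by metis
 show n: "\<tau> ( -. u) = -.\<^bsub>G\<^esub> \<tau> u" if u: "u : A" for u
 proof -
 have "\<tau> ( -. u) +.\<^bsub>G\<^esub> \<tau> u = 0.\<^bsub>G\<^esub>" unfolding p[OF acl(3)[OF u] u, symmetric] using AF(2)[OF u] z by (simp add: R.l_neg)
 then show ?thesis using G.minus_equality[of "\<tau> ( -. u)" "\<tau> u"] c[OF u] c[OF acl(3)[OF u]] by simp
 qed
 show "\<tau> (u-.v) = \<tau> u -.\<^bsub>G\<^esub> \<tau> v" if u: "u : A" "v : A" for u v
 unfolding a_minus_def using p[OF u(1) acl(3)[OF u(2)]] n[OF u(2)] by simp
qed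

lemma \<tau>_nonzero: assumes u: "u : A" "u ~= 0." shows "\<tau> u ~= 0.\<^bsub>G\<^esub>"
proof
 assume z: "\<tau> u = 0.\<^bsub>G\<^esub>"
 have i: "inv u : A" by (rule AF(3)[OF u])
 have "\<tau> (u$inv u) = 0.\<^bsub>G\<^esub>" unfolding \<tau>_facts(4)[OF u(1) i] z using \<tau>_facts(1)[OF i] by simp
 then show False using \<tau>_facts(2) AF(2)[OF u(1)] u(2) by simp
qed

lemma map_carrier: "set p <= A ==> set p <= carrier R" "set p <= A ==> set (map \<tau> p) <= carrier G"
 using AF(2) \<tau>_facts(1) by auto

lemma map_map2_minus:
 assumes d: "d : A" and l: "length es = length bs" and es: "set es <= A" and bs: "set bs <= A"
 shows "map \<tau> (map2 (%s t. s-.d$t) es bs) = map2 (%s t. s -.\<^bsub>G\<^esub> \<tau> d $\<^bsub>G\<^esub> t) (map \<tau> es) (map \<tau> bs)"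
 using l es bs
proof (induction es bs rule: list_induct2)
 case (Cons e es b bs)
 then show ?case using \<tau>_facts(6)[of e "d$b"] \<tau>_facts(4)[OF d, of b] acl(4)[OF d, of b] by simp
qed simp

text \<open>Quotient and remainder are computed once with coefficients in \<open>A\<close>. The
  division identity then holds both at \<open>x\<close> and, after applying \<tau>, at every element
  of \<open>G\<close>, which carries polynomial relations from one field to the other.\<close>

lemma division_hom:
 assumes x: "x : carrier R" and b: "b : A" "b ~= 0." and bs: "set bs <= A" and p: "set p <= A"
 shows "\<exists>q r. set q <= A & set r <= A & length r = length bs & length q <= length p - length bs &
 R.eval p x = R.eval q x$R.eval (b # bs) x+.R.eval r x &
 (\<forall>g\<in>carrier G. G.eval (map \<tau> p) g = G.eval (map \<tau> q) g $\<^bsub>G\<^esub> G.eval (map \<tau> (b # bs)) g +.\<^bsub>G\<^esub> G.eval (map \<tau> r) g)"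
 using p
proof (induct p rule: rev_induct)
 case Nil
 let ?r = "replicate (length bs) 0."
 have r: "set ?r <= A" "set ?r <= {0.}" "set (map \<tau> ?r) <= {0.\<^bsub>G\<^esub>}" using acl(1) \<tau>_facts(3) by auto
 have bb: "set (b # bs) <= A" using b bs by simp
 have "R.eval [] x = R.eval [] x$R.eval (b # bs) x+.R.eval ?r x"
 using R.eval_zeros[OF r(2) x] R.eval_closed[OF map_carrier(1)[OF bb] x] by simp
 moreover have "G.eval (map \<tau> []) g = G.eval (map \<tau> []) g $\<^bsub>G\<^esub> G.eval (map \<tau> (b # bs)) g +.\<^bsub>G\<^esub> G.eval (map \<tau> ?r) g"
 if g: "g : carrier G" for g
 using G.eval_zeros[OF r(3) g] G.eval_closed[OF map_carrier(2)[OF bb] g] by simp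
 ultimately show ?case using r(1) by (intro exI[of _ "[]"] exI[of _ ?r]) simp
next
 case (snoc c p)
 have c: "c : A" "set p <= A" "set (p @ [c]) <= A" using snoc(2) by auto
 have bb: "set (b # bs) <= A" using b bs by simp
 show ?case
 proof (cases "length (p @ [c]) <= length bs")
 case True
 let ?m = "length bs - length (p @ [c])"
 let ?r = "replicate ?m 0. @ (p @ [c])"
 have r: "set ?r <= A" using c acl(1) by auto
 have "R.eval (p @ [c]) x = R.eval [] x$R.eval (b # bs) x+.R.eval ?r x"
 using R.eval_replicate_zero[OF map_carrier(1)[OF c(3)] x, of ?m] R.eval_closed[OF map_carrier(1)[OF bb] x]
 R.eval_closed[OF map_carrier(1)[OF c(3)] x] by simp
 moreover have "G.eval (map \<tau> (p @ [c])) g = G.eval (map \<tau> []) g $\<^bsub>G\<^esub> G.eval (map \<tau> (b # bs)) g +.\<^bsub>G\<^esub> G.eval (map \<tau> ?r) g"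
 if g: "g : carrier G" for g
 proof -
 have "map \<tau> ?r = replicate ?m 0.\<^bsub>G\<^esub> @ map \<tau> (p @ [c])" using \<tau>_facts(3) by simp
 then have "G.eval (map \<tau> ?r) g = G.eval (map \<tau> (p @ [c])) g"
 using G.eval_replicate_zero[OF map_carrier(2)[OF c(3)] g, of ?m] by (simp only:)
 moreover have "G.eval (map \<tau> []) g = 0.\<^bsub>G\<^esub>" by simp
 ultimately show ?thesis using G.l_null[OF G.eval_closed[OF map_carrier(2)[OF bb] g]]
 G.l_zero[OF G.eval_closed[OF map_carrier(2)[OF c(3)] g]] by (simp only:)
 qed
 ultimately show ?thesis using r True by (intro exI[of _ "[]"] exI[of _ ?r]) simp
 next
 case False
 from snoc(1)[OF c(2)] obtain q r where q: "set q <= A" "set r <= A" "length r = length bs"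
 "length q <= length p - length bs" and qR: "R.eval p x = R.eval q x$R.eval (b # bs) x+.R.eval r x"
 and qG: "\<forall>g\<in>carrier G. G.eval (map \<tau> p) g = G.eval (map \<tau> q) g $\<^bsub>G\<^esub> G.eval (map \<tau> (b # bs)) g +.\<^bsub>G\<^esub> G.eval (map \<tau> r) g"
 by (elim exE conjE) (rule that)
 obtain e es where e: "r @ [c] = e # es" by (cases "r @ [c]") auto
 have "set (r @ [c]) <= A" using q(2) c(1) by simp
 then have ek: "e : A" "set es <= A" unfolding e by simp_all
 have les: "length es = length bs" using arg_cong[OF e, of length] q(3) by simp
 let ?d = "e$inv b"
 have d: "?d : A" by (rule acl(4)[OF ek(1) AF(3)[OF b]])
 have db: "?d$b = e" using AF(2)[OF ek(1)] AF(2)[OF b(1)] b(2) by (simp add: R.m_assoc)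
 let ?r = "map2 (%s t. s-.?d$t) es bs"
 have rA: "set ?r <= A" by (rule R.set_map2_minus[OF AF(1) d ek(2) bs])
 have "R.eval (p @ [c]) x = R.eval (q @ [?d]) x$R.eval (b # bs) x+.R.eval ?r x"
 by (rule R.division_step[OF map_carrier(1)[OF c(2)] map_carrier(1)[OF q(1)] map_carrier(1)[OF q(2)] map_carrier(1)[OF ek(2)]
 map_carrier(1)[OF bs] AF(2)[OF c(1)] AF(2)[OF d] AF(2)[OF b(1)] AF(2)[OF ek(1)] x e db les qR])
 moreover have "G.eval (map \<tau> (p @ [c])) g = G.eval (map \<tau> (q @ [?d])) g $\<^bsub>G\<^esub> G.eval (map \<tau> (b # bs)) g +.\<^bsub>G\<^esub> G.eval (map \<tau> ?r) g"
 if g: "g : carrier G" for g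
 proof -
 have e': "map \<tau> r @ [\<tau> c] = \<tau> e # map \<tau> es" using arg_cong[OF e, of "map \<tau>"] by simp
 have db': "\<tau> ?d $\<^bsub>G\<^esub> \<tau> b = \<tau> e" using \<tau>_facts(4)[OF d b(1)] db by simp
 have l': "length (map \<tau> es) = length (map \<tau> bs)" using les by simp
 have h': "G.eval (map \<tau> p) g = G.eval (map \<tau> q) g $\<^bsub>G\<^esub> G.eval (\<tau> b # map \<tau> bs) g +.\<^bsub>G\<^esub> G.eval (map \<tau> r) g" using qG g by simp
 show ?thesis using G.division_step[OF map_carrier(2)[OF c(2)] map_carrier(2)[OF q(1)] map_carrier(2)[OF q(2)] map_carrier(2)[OF ek(2)]
 map_carrier(2)[OF bs] \<tau>_facts(1)[OF c(1)] \<tau>_facts(1)[OF d] \<tau>_facts(1)[OF b(1)] \<tau>_facts(1)[OF ek(1)] g e' db' l' h']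
 unfolding map_map2_minus[OF d les ek(2) bs] by simp
 qed
 moreover have "length ?r = length bs" "length (q @ [?d]) <= length (p @ [c]) - length bs" "set (q @ [?d]) <= A"
 using les q(1,4) d False by simp_all
 ultimately show ?thesis using rA by blast
 qed
qed

text \<open>The minimal polynomial of a generator \<alpha> of the multiplicative group divides
  X^(Q-1) - 1, so its image under \<tau> has a root \<beta> in \<open>G\<close>, which has as many
  elements. Sending f(\<alpha>) to f(\<beta>) is well defined.\<close>

theorem finite_extension_isomorphism:
 assumes fin: "finite (carrier R)" "finite (carrier G)" "card (carrier G) = card (carrier R)"
 shows "\<exists>\<psi>\<in>ring_hom R G. bij_betw \<psi> (carrier R) (carrier G) & (\<forall>c\<in>A. \<psi> c = \<tau> c)"
proof -
 let ?Q = "card (carrier R)"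
 have Q2: "2 <= ?Q"
 proof -
 have "card {0., 1.} <= ?Q" using fin(1) by (intro card_mono) auto
 then show ?thesis by simp
 qed
 obtain \<alpha> where \<alpha>0: "\<alpha> : carrier (Multiplicative_Group.mult_of R)" "carrier (Multiplicative_Group.mult_of R) = {\<alpha> [^]\<^bsub>R\<^esub> i | i::nat. i : UNIV}"
 using R.finite_field_mult_group_has_gen[OF fin(1)] unfolding Multiplicative_Group.nat_pow_mult_of by (elim bexE) (rule that)
 have \<alpha>: "\<alpha> : carrier R" "\<alpha> ~= 0." using \<alpha>0(1) by simp_all
 have gen: "\<exists>i::nat. u = \<alpha> [^] i" if u: "u : carrier R" "u ~= 0." for u
 proof -
 have "u : {\<alpha> [^]\<^bsub>R\<^esub> i | i::nat. i : UNIV}" unfolding \<alpha>0(2)[symmetric] using u by simp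
 then show ?thesis by blast
 qed
 \<comment> \<open>Coefficients of X^(Q-1) - 1, a list of length Q, where Q is the number of
   elements.\<close>
 define XX where "XX = ( 1. # replicate (?Q - 2) 0.) @ [-. 1.]"
 have XA: "set XX <= A" "length XX = ?Q" unfolding XX_def using acl(1,2) acl(3)[OF acl(2)] Q2 by auto
 have mono: "R.eval ( 1. # replicate i 0.) u = u [^] i" if "u : carrier R" for u i
 proof -
 have "set (replicate i 0.) <= {0.}" by auto
 then have "R.eval (replicate i 0.) u = 0." using R.eval_zeros that by blast
 then show ?thesis using that by (simp add: R.eval_Cons)
 qed
 have monoG: "G.eval (map \<tau> ( 1. # replicate i 0.)) g = g [^]\<^bsub>G\<^esub> i" if "g : carrier G" for g i
 proof -
 have "set (replicate i 0.\<^bsub>G\<^esub>) <= {0.\<^bsub>G\<^esub>}" by auto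
 then have "G.eval (replicate i 0.\<^bsub>G\<^esub>) g = 0.\<^bsub>G\<^esub>" using G.eval_zeros that by blast
 then show ?thesis using that \<tau>_facts(2,3) by (simp add: G.eval_Cons)
 qed
 have monA: "set ( 1. # replicate i 0.) <= A" for i using acl(1,2) by auto
 have Xe: "R.eval XX u = u [^] (?Q - 1)-.1." if u: "u : carrier R" for u
 proof -
 have "?Q - 1 = Suc (?Q - 2)" using Q2 by simp
 then show ?thesis unfolding XX_def R.eval_snoc[OF map_carrier(1)[OF monA] R.a_inv_closed[OF R.one_closed] u] mono[OF u]
 by (simp add: R.minus_eq)
 qed
 have XeG: "G.eval (map \<tau> XX) g = g [^]\<^bsub>G\<^esub> (?Q - 1) -.\<^bsub>G\<^esub> 1.\<^bsub>G\<^esub>" if g: "g : carrier G" for g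
 proof -
 have "?Q - 1 = Suc (?Q - 2)" using Q2 by simp
 moreover have "map \<tau> XX = map \<tau> ( 1. # replicate (?Q - 2) 0.) @ [-.\<^bsub>G\<^esub> 1.\<^bsub>G\<^esub>]"
 unfolding XX_def using \<tau>_facts(7)[OF acl(2)] \<tau>_facts(2) by simp
 ultimately show ?thesis
 using G.eval_snoc[OF map_carrier(2)[OF monA] G.a_inv_closed[OF G.one_closed] g, of "?Q - 2"] monoG[OF g]
 by (simp add: G.minus_eq)
 qed
 \<comment> \<open>The shortest nonzero relation of \<alpha> is its minimal polynomial up to a
   constant. Any remainder is shorter, so it is zero as a list and remains zero after
   \<tau>.\<close>
 define V where "V m \<longleftrightarrow> (\<exists>p. set p <= A & ~ set p <= {0.} & R.eval p \<alpha> = 0. & length p = m)" for m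
 have "V ?Q" unfolding V_def
 proof (intro exI[of _ XX] conjI XA)
 show "~ set XX <= {0.}" unfolding XX_def by simp
 show "R.eval XX \<alpha> = 0." using Xe[OF \<alpha>(1)] R.power_card[OF fin(1) \<alpha>] by (simp add: R.minus_eq R.r_neg)
 qed
 define m where "m = (LEAST m. V m)"
 have "V m" unfolding m_def using LeastI[of V, OF \<open>V ?Q\<close>] .
 have least: "set r <= {0.}" if r: "set r <= A" "R.eval r \<alpha> = 0." "length r < m" for r
 using not_less_Least[of "length r" V] r unfolding m_def V_def by blast
 obtain p where p: "set p <= A" "~ set p <= {0.}" "R.eval p \<alpha> = 0." "length p = m" using \<open>V m\<close> unfolding V_def by blast
 obtain b bs where pb: "p = b # bs" using p(2) by (cases p) auto
 have bA: "b : A" "set bs <= A" and lb: "length bs < m" using p(1,4) pb by auto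
 have b0: "b ~= 0."
 proof
 assume z: "b = 0."
 have "R.eval bs \<alpha> = 0." using p(3) R.eval_zero_prefix[OF map_carrier(1)[OF bA(2)] \<alpha>(1)] unfolding pb z by simp
 then have "set bs <= {0.}" by (rule least[OF bA(2) _ lb])
 then show False using p(2) pb z by simp
 qed
 have bs0: "bs ~= []" using p(3) b0 AF(2)[OF bA(1)] unfolding pb by (auto simp: R.eval_Cons)
 have rem0: "set r <= {0.}" if "set q <= A" "set r <= A" "length r = length bs" "R.eval f \<alpha> = 0."
 "R.eval f \<alpha> = R.eval q \<alpha>$R.eval (b # bs) \<alpha>+.R.eval r \<alpha>" for f q r
 proof -
 have "R.eval r \<alpha> = 0." using that(4,5) p(3) pb R.eval_closed[OF map_carrier(1)[OF that(1)] \<alpha>(1)]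
 R.eval_closed[OF map_carrier(1)[OF that(2)] \<alpha>(1)] by simp
 then show ?thesis using least[OF that(2)] that(3) lb by simp
 qed
 have map0: "G.eval (map \<tau> r) g = 0.\<^bsub>G\<^esub>" if r: "set r <= {0.}" and g: "g : carrier G" for r g
 proof -
 have "set (map \<tau> r) <= {0.\<^bsub>G\<^esub>}" using r \<tau>_facts(3) by auto
 then show ?thesis by (rule G.eval_zeros[OF _ g])
 qed
 have "\<exists>\<beta>\<in>carrier G. G.eval (map \<tau> p) \<beta> = 0.\<^bsub>G\<^esub>"
 \<comment> \<open>Without a root of \<open>p\<close>, all Q - 1 nonzero elements of
   \<open>G\<close> would be roots of the cofactor \<open>q\<close>, whose degree is at most Q -
   2.\<close>
 proof (rule ccontr)
 assume n: "~ ?thesis"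
 have Xa: "R.eval XX \<alpha> = 0." using Xe[OF \<alpha>(1)] R.power_card[OF fin(1) \<alpha>] by (simp add: R.minus_eq R.r_neg)
 from division_hom[OF \<alpha>(1) bA(1) b0 bA(2) XA(1)]
 obtain q r where q: "set q <= A" "set r <= A" "length r = length bs" "length q <= length XX - length bs"
 and qR: "R.eval XX \<alpha> = R.eval q \<alpha>$R.eval (b # bs) \<alpha>+.R.eval r \<alpha>"
 and qG: "\<forall>g\<in>carrier G. G.eval (map \<tau> XX) g = G.eval (map \<tau> q) g $\<^bsub>G\<^esub> G.eval (map \<tau> (b # bs)) g +.\<^bsub>G\<^esub> G.eval (map \<tau> r) g"
 by (elim exE conjE) (rule that)
 have r0: "set r <= {0.}" by (rule rem0[OF q(1,2,3) Xa qR])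
 let ?q = "map \<tau> q"
 note qc = map_carrier(2)[OF q(1)] and pc = map_carrier(2)[OF p(1)]
 have fac: "G.eval (map \<tau> XX) g = G.eval ?q g $\<^bsub>G\<^esub> G.eval (map \<tau> p) g" if g: "g : carrier G" for g
 using qG g map0[OF r0 g] G.eval_closed[OF qc g] G.eval_closed[OF pc g] unfolding pb by simp
 have "~ set ?q <= {0.\<^bsub>G\<^esub>}"
 proof
 assume "set ?q <= {0.\<^bsub>G\<^esub>}"
 then have "G.eval ?q 0.\<^bsub>G\<^esub> = 0.\<^bsub>G\<^esub>" by (rule G.eval_zeros) simp
 then have "G.eval (map \<tau> XX) 0.\<^bsub>G\<^esub> = 0.\<^bsub>G\<^esub>" using fac[of "0.\<^bsub>G\<^esub>"] G.eval_closed[OF pc G.zero_closed] by simp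
 moreover have "?Q - 1 = Suc (?Q - 2)" using Q2 by simp
 then have "0.\<^bsub>G\<^esub> [^]\<^bsub>G\<^esub> (?Q - 1) = 0.\<^bsub>G\<^esub>" by simp
 ultimately have "0.\<^bsub>G\<^esub> -.\<^bsub>G\<^esub> 1.\<^bsub>G\<^esub> = 0.\<^bsub>G\<^esub>" using XeG[OF G.zero_closed] by (simp only:)
 then show False using G.r_right_minus_eq[OF G.zero_closed G.one_closed] G.one_not_zero by metis
 qed
 then have "card {g : carrier G. G.eval ?q g = 0.\<^bsub>G\<^esub>} <= length ?q - 1" by (rule G.card_roots_le[OF fin(2) qc])
 moreover have "carrier G - {0.\<^bsub>G\<^esub>} <= {g : carrier G. G.eval ?q g = 0.\<^bsub>G\<^esub>}"
 proof
 fix g assume "g : carrier G - {0.\<^bsub>G\<^esub>}"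
 then have g: "g : carrier G" "g ~= 0.\<^bsub>G\<^esub>" by simp_all
 have "G.eval (map \<tau> XX) g = 0.\<^bsub>G\<^esub>" using XeG[OF g(1)] G.power_card[OF fin(2) g] fin(3) by (simp add: G.minus_eq G.r_neg)
 then have "G.eval ?q g $\<^bsub>G\<^esub> G.eval (map \<tau> p) g = 0.\<^bsub>G\<^esub>" using fac[OF g(1)] by simp
 then show "g : {g : carrier G. G.eval ?q g = 0.\<^bsub>G\<^esub>}"
 using n g(1) G.eval_closed[OF qc g(1)] G.eval_closed[OF pc g(1)] G.integral by blast
 qed
 then have "card (carrier G - {0.\<^bsub>G\<^esub>}) <= card {g : carrier G. G.eval ?q g = 0.\<^bsub>G\<^esub>}" using fin(2) by (intro card_mono) auto
 moreover have "card (carrier G - {0.\<^bsub>G\<^esub>}) = ?Q - 1" using fin(2,3) by simp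
 moreover have "length ?q <= ?Q - 1" using q(4) XA(2) bs0 by (cases bs) auto
 ultimately show False using Q2 by linarith
 qed
 then obtain \<beta> where \<beta>: "\<beta> : carrier G" "G.eval (map \<tau> p) \<beta> = 0.\<^bsub>G\<^esub>" by blast
 have transfer: "G.eval (map \<tau> f) \<beta> = 0.\<^bsub>G\<^esub>" if f: "set f <= A" "R.eval f \<alpha> = 0." for f
 proof -
 from division_hom[OF \<alpha>(1) bA(1) b0 bA(2) f(1)]
 obtain q r where q: "set q <= A" "set r <= A" "length r = length bs"
 and qR: "R.eval f \<alpha> = R.eval q \<alpha>$R.eval (b # bs) \<alpha>+.R.eval r \<alpha>"
 and qG: "\<forall>g\<in>carrier G. G.eval (map \<tau> f) g = G.eval (map \<tau> q) g $\<^bsub>G\<^esub> G.eval (map \<tau> (b # bs)) g +.\<^bsub>G\<^esub> G.eval (map \<tau> r) g"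
 by (elim exE conjE) (rule that)
 have "set r <= {0.}" by (rule rem0[OF q f(2) qR])
 then show ?thesis using qG \<beta> map0[of r \<beta>] G.eval_closed[OF map_carrier(2)[OF q(1)] \<beta>(1)] unfolding pb by simp
 qed
 \<comment> \<open>The graph of the isomorphism; \<open>transfer\<close> makes it single
   valued.\<close>
 define S where "S u v \<longleftrightarrow> (\<exists>f. set f <= A & u = R.eval f \<alpha> & v = G.eval (map \<tau> f) \<beta>)" for u v
 have SG: "v : carrier G" if s: "S u v" for u v
 using s G.eval_closed[OF map_carrier(2) \<beta>(1)] unfolding S_def by blast
 have Sminus: "S (u-.u') (v -.\<^bsub>G\<^esub> v')" if s: "S u v" "S u' v'" for u v u' v'
 proof -
 obtain f where f: "set f <= A" "u = R.eval f \<alpha>" "v = G.eval (map \<tau> f) \<beta>" using s(1) unfolding S_def by blast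
 obtain f' where f': "set f' <= A" "u' = R.eval f' \<alpha>" "v' = G.eval (map \<tau> f') \<beta>" using s(2) unfolding S_def by blast
 let ?l = "length f + length f'"
 let ?f = "replicate (?l - length f) 0. @ f" and ?f' = "replicate (?l - length f') 0. @ f'"
 have fA: "set ?f <= A" "set ?f' <= A" "length ?f = length ?f'" using f(1) f'(1) acl(1) by auto
 have e: "R.eval ?f \<alpha> = u" "R.eval ?f' \<alpha> = u'"
 using R.eval_replicate_zero[OF map_carrier(1)[OF f(1)] \<alpha>(1)] R.eval_replicate_zero[OF map_carrier(1)[OF f'(1)] \<alpha>(1)] f(2) f'(2) by simp_all
 have eG: "G.eval (map \<tau> ?f) \<beta> = v" "G.eval (map \<tau> ?f') \<beta> = v'"
 using G.eval_replicate_zero[OF map_carrier(2)[OF f(1)] \<beta>(1)] G.eval_replicate_zero[OF map_carrier(2)[OF f'(1)] \<beta>(1)] f(3) f'(3)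
 by (simp_all add: \<tau>_facts(3))
 let ?g = "map2 (%s t. s-.1.$t) ?f ?f'"
 have g1: "set ?g <= A" by (rule R.set_map2_minus[OF AF(1) acl(2) fA(1,2)])
 have uc: "u : carrier R" "u' : carrier R" "v : carrier G" "v' : carrier G"
 using R.eval_closed[OF map_carrier(1)[OF f(1)] \<alpha>(1)] R.eval_closed[OF map_carrier(1)[OF f'(1)] \<alpha>(1)] f(2) f'(2) SG[OF s(1)] SG[OF s(2)] by simp_all
 have "R.eval ?g \<alpha> = u-.1.$u'"
 using R.eval_map2_minus[OF R.one_closed \<alpha>(1) map_carrier(1)[OF fA(1)] map_carrier(1)[OF fA(2)] fA(3)] unfolding e .
 then have g2: "u-.u' = R.eval ?g \<alpha>" using uc by simp
 have l: "length (map \<tau> ?f) = length (map \<tau> ?f')" using fA(3) by simp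
 have "G.eval (map \<tau> ?g) \<beta> = v -.\<^bsub>G\<^esub> 1.\<^bsub>G\<^esub> $\<^bsub>G\<^esub> v'"
 using G.eval_map2_minus[OF G.one_closed \<beta>(1) map_carrier(2)[OF fA(1)] map_carrier(2)[OF fA(2)] l]
 unfolding eG map_map2_minus[OF acl(2) fA(3,1,2)] \<tau>_facts(2) .
 then have "v -.\<^bsub>G\<^esub> v' = G.eval (map \<tau> ?g) \<beta>" using uc by simp
 then show ?thesis unfolding S_def using g1 g2 by blast
 qed
 have S0: "S 0. 0.\<^bsub>G\<^esub>" unfolding S_def by (intro exI[of _ "[]"]) simp
 have Su: "v = v'" if s: "S u v" "S u v'" for u v v'
 proof -
 have uc: "u : carrier R" using s(1) R.eval_closed[OF map_carrier(1) \<alpha>(1)] unfolding S_def by blast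
 have "S (u-.u) (v -.\<^bsub>G\<^esub> v')" by (rule Sminus[OF s])
 then have "v -.\<^bsub>G\<^esub> v' = 0.\<^bsub>G\<^esub>" unfolding S_def using transfer uc by (auto simp: R.minus_eq R.r_neg)
 then show ?thesis using SG[OF s(1)] SG[OF s(2)] by simp
 qed
 have Sp: "S (\<alpha> [^] i) (\<beta> [^]\<^bsub>G\<^esub> i)" for i :: nat
 unfolding S_def using mono[OF \<alpha>(1), of i] monoG[OF \<beta>(1), of i] monA[of i] by metis
 define \<psi> where "\<psi> u = (THE v. S u v)" for u
 have \<psi>I: "\<psi> u = v" if "S u v" for u v unfolding \<psi>_def using Su that by blast
 have total: "S u (\<psi> u)" if u: "u : carrier R" for u
 proof -
 have "\<exists>v. S u v" using S0 Sp gen[OF u] by (cases "u = 0.") auto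
 then show ?thesis using \<psi>I by blast
 qed
 have \<psi>p: "\<psi> (\<alpha> [^] i) = \<beta> [^]\<^bsub>G\<^esub> i" for i :: nat by (rule \<psi>I[OF Sp])
 have \<psi>0: "\<psi> 0. = 0.\<^bsub>G\<^esub>" by (rule \<psi>I[OF S0])
 have \<psi>c: "\<psi> u : carrier G" if "u : carrier R" for u using SG[OF total[OF that]] .
 have \<psi>m: "\<psi> (u-.v) = \<psi> u -.\<^bsub>G\<^esub> \<psi> v" if "u : carrier R" "v : carrier R" for u v
 by (rule \<psi>I[OF Sminus[OF total[OF that(1)] total[OF that(2)]]])
 \<comment> \<open>Subtraction is respected because relations can be subtracted; for products it
   suffices that nonzero elements are powers of \<alpha>.\<close>
 have \<psi>t: "\<psi> (u$v) = \<psi> u $\<^bsub>G\<^esub> \<psi> v" if u: "u : carrier R" and v: "v : carrier R" for u v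
 proof (cases "u = 0. \<or> v = 0.")
 case True
 then show ?thesis using u v \<psi>0 \<psi>c[OF u] \<psi>c[OF v] by auto
 next
 case False
 obtain i j :: nat where "u = \<alpha> [^] i" "v = \<alpha> [^] j" using gen u v False by metis
 then show ?thesis using R.nat_pow_mult[OF \<alpha>(1)] G.nat_pow_mult[OF \<beta>(1)] \<psi>p by simp
 qed
 have \<psi>1: "\<psi> 1. = 1.\<^bsub>G\<^esub>" using \<psi>p[of 0] by simp
 have hom: "\<psi> : ring_hom R G"
 proof (rule ring_hom_memI)
 fix u v assume uv: "u : carrier R" "v : carrier R"
 have "u+.v = u-.( 0.-.v)" using uv by (simp add: R.minus_eq)
 then have "\<psi> (u+.v) = \<psi> u -.\<^bsub>G\<^esub> ( 0.\<^bsub>G\<^esub> -.\<^bsub>G\<^esub> \<psi> v)" using \<psi>m[OF uv(1), of "0.-.v"] \<psi>m[OF R.zero_closed uv(2)] uv \<psi>0 by simp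
 then show "\<psi> (u+.v) = \<psi> u +.\<^bsub>G\<^esub> \<psi> v" using \<psi>c[OF uv(1)] \<psi>c[OF uv(2)] by (simp add: G.minus_eq)
 qed (use \<psi>c \<psi>t \<psi>1 in simp_all)
 have inj: "inj_on \<psi> (carrier R)"
 proof (rule inj_onI)
 fix u v assume uv: "u : carrier R" "v : carrier R" "\<psi> u = \<psi> v"
 show "u = v"
 proof (rule ccontr)
 assume "u ~= v"
 then have w: "u-.v : carrier R" "u-.v ~= 0." using uv(1,2) R.r_right_minus_eq by auto
 have z: "\<psi> (u-.v) = 0.\<^bsub>G\<^esub>" using \<psi>m[OF uv(1,2)] uv(3) \<psi>c[OF uv(2)] by (simp add: G.minus_eq G.r_neg)
 have "\<psi> ((u-.v)$inv (u-.v)) = 0.\<^bsub>G\<^esub>" unfolding \<psi>t[OF w(1) R.inv_closed[OF w]] z using \<psi>c[OF R.inv_closed[OF w]] by simp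
 then show False using \<psi>1 w by simp
 qed
 qed
 have "\<psi> ` carrier R = carrier G"
 using card_image[OF inj] fin \<psi>c by (intro card_subset_eq) auto
 then have bij: "bij_betw \<psi> (carrier R) (carrier G)" using inj unfolding bij_betw_def by blast
 have "\<psi> c = \<tau> c" if c: "c : A" for c
 proof (rule \<psi>I)
 show "S c (\<tau> c)" unfolding S_def
 using c AF(2)[OF c] \<tau>_facts(1)[OF c] by (intro exI[of _ "[c]"]) (simp add: R.eval_Cons G.eval_Cons)
 qed
 then show ?thesis using hom bij by blast
qed

end

section \<open>Characteristic and prime field\<close>

context field

begin

lemma nat_mult_one: "[(n::nat)] #. 1.$[(m::nat)] #. 1. = [(n * m)] #. 1."
 using add_pow_ldistr[of \<one> "[m] #. 1." n] add.nat_pow_pow[of \<one> n m] by (simp add: mult.commute)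

lemma nat_add_one: "[(n::nat)] #. 1.+.[(m::nat)] #. 1. = [(n + m)] #. 1."
 by (rule add.nat_pow_mult[OF one_closed])

lemma nat_one_eq_zero_iff:
 assumes p: "Factorial_Ring.prime (p::nat)" "[p] #. 1. = 0."
 shows "[n] #. 1. = 0. \<longleftrightarrow> p dvd n"
proof
 assume "p dvd n"
 then obtain m where "n = p * m" by auto
 then show "[n] #. 1. = 0." using nat_mult_one[of p m] p(2) by simp
next
 assume n: "[n] #. 1. = 0."
 show "p dvd n"
 proof (rule ccontr)
 assume d: "~ p dvd n"
 then have n0: "n ~= 0" by (cases n) auto
 have "coprime n p" using prime_imp_coprime[OF p(1) d] by (simp add: coprime_commute)
 then obtain u v where uv: "n * u = p * v + 1" using bezout_nat[OF n0, of p] by (auto simp: coprime_iff_gcd_eq_1)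
 have "[(n * u)] #. 1. = 0." using nat_mult_one[of n u] n by simp
 moreover have "[(p * v + 1)] #. 1. = [(p * v)] #. 1.+.1." by simp
 moreover have "[(p * v)] #. 1. = 0." using nat_mult_one[of p v] p(2) by simp
 ultimately show False using uv by simp
 qed
qed

lemma nat_one_eq_iff:
 assumes p: "Factorial_Ring.prime (p::nat)" "[p] #. 1. = 0."
 shows "[n] #. 1. = [m] #. 1. \<longleftrightarrow> n mod p = m mod p"
proof -
 have 1: "[n] #. 1. = [m] #. 1. \<longleftrightarrow> p dvd m - n" if h: "n <= m" for n m :: nat
 proof -
 have "[m] #. 1. = [n] #. 1.+.[(m - n)] #. 1." using nat_add_one[of n "m - n"] h by simp
 then have "[n] #. 1. = [m] #. 1. \<longleftrightarrow> [(m - n)] #. 1. = 0."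
 using add.l_cancel_one[of "[n] #. 1." "[(m - n)] #. 1."] by (metis add.nat_pow_closed one_closed)
 then show ?thesis using nat_one_eq_zero_iff[OF p] by simp
 qed
 show ?thesis
 proof (cases "n <= m")
 case True
 then show ?thesis using 1[OF True] mod_eq_dvd_iff_nat[OF True, of p] by metis
 next
 case False
 then have h: "m <= n" by simp
 show ?thesis using 1[OF h] mod_eq_dvd_iff_nat[OF h, of p] by metis
 qed
qed

lemma prime_subfield:
 assumes p: "Factorial_Ring.prime (p::nat)" "[p] #. 1. = 0."
 shows "subfield (range (%n::nat. [n] #. 1.)) R" "card (range (%n::nat. [n] #. 1.)) = p" "finite (range (%n::nat. [n] #. 1.))"
proof -
 let ?A = "range (%n::nat. [n] #. 1.)"
 have p1: "p > 1" using prime_gt_1_nat[OF p(1)] .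
 have cl: "u+.v : ?A" "u$v : ?A" if uv: "u : ?A" "v : ?A" for u v
 proof -
 obtain n m :: nat where nm: "u = [n] #. 1." "v = [m] #. 1." using uv by blast
 show "u+.v : ?A" unfolding nm by (rule range_eqI[of _ _ "n + m"]) (rule nat_add_one)
 show "u$v : ?A" unfolding nm by (rule range_eqI[of _ _ "n * m"]) (rule nat_mult_one)
 qed
 have one: "1. : ?A" by (rule range_eqI[of _ _ "Suc 0"]) simp
 have neg: "-. u : ?A" if u: "u : ?A" for u
 proof -
 obtain n :: nat where n: "u = [n] #. 1." using u by blast
 have "[((p - 1) * n + n)] #. 1. = 0." using nat_one_eq_zero_iff[OF p, of "(p - 1) * n + n"] p1
 by (metis Suc_diff_1 add.commute dvd_triv_left mult_Suc order_less_trans zero_less_one)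
 then have "[((p - 1) * n)] #. 1.+.u = 0." unfolding n nat_add_one .
 then have "-. u = [((p - 1) * n)] #. 1." unfolding n by (intro minus_equality) auto
 then show ?thesis by (rule range_eqI)
 qed
 have A: "subring ?A R" by (rule subringI) (use cl neg one in auto)
 show "subfield ?A R"
 proof (rule subfieldI_inv[OF A])
 fix u assume u: "u : ?A" "u ~= 0."
 obtain n :: nat where n: "u = [n] #. 1." using u by blast
 have d: "~ p dvd n" using u(2) nat_one_eq_zero_iff[OF p, of n] n by simp
 then have n0: "n ~= 0" by (cases n) auto
 have "coprime n p" using prime_imp_coprime[OF p(1) d] by (simp add: coprime_commute)
 then obtain s v where sv: "n * s = p * v + 1" using bezout_nat[OF n0, of p] by (auto simp: coprime_iff_gcd_eq_1)
 have "[(p * v)] #. 1. = 0." using nat_mult_one[of p v] p(2) by simp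
 then have "u$[s] #. 1. = 1." unfolding n nat_mult_one sv by simp
 then have "inv u = [s] #. 1." unfolding n by (intro inv_unique_field) auto
 then show "inv u : ?A" by (rule range_eqI)
 qed
 have "?A = (%n. [n] #. 1.) ` {..<p}"
 proof
 show "?A <= (%n. [n] #. 1.) ` {..<p}"
 proof
 fix u assume "u : ?A"
 then obtain n :: nat where n: "u = [n] #. 1." by blast
 have "u = [(n mod p)] #. 1." unfolding n using nat_one_eq_iff[OF p, of n "n mod p"] by simp
 then show "u : (%n. [n] #. 1.) ` {..<p}" using p1 by auto
 qed
 qed auto
 moreover have "inj_on (%n. [n] #. 1.) {..<p}"
 by (rule inj_onI) (use nat_one_eq_iff[OF p] in auto)
 ultimately show "card ?A = p" "finite ?A" by (simp_all add: card_image)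
qed

lemma card_subfield_prime_power:
 assumes p: "Factorial_Ring.prime (p::nat)" "[p] #. 1. = 0." and k: "subfield k R" "finite k"
 shows "\<exists>d. card k = p ^ d"
proof -
 let ?A = "range (%n::nat. [n] #. 1.)"
 note A = prime_subfield[OF p] and kf = sf_facts[OF k(1)]
 have Ak: "?A <= k" using subcl(8)[OF kf(1) subcl(2)[OF kf(1)]] by blast
 obtain xs where xs: "set xs = k" using finite_list[OF k(2)] by blast
 have xc: "set xs <= carrier R" using xs kf(2) by blast
 have "Span ?A xs = k"
 proof
 show "k <= Span ?A xs" using Span_base_incl[OF A(1) xc] xs by simp
 show "Span ?A xs <= k"
 proof
 fix z assume "z : Span ?A xs"
 then obtain Ks where Ks: "set Ks <= ?A" "z = combine Ks xs" unfolding Span_eq_combine_set[OF A(1) xc] by blast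
 have "set Ks <= k" "set xs <= k" using Ks(1) Ak xs by blast+
 then show "z : k" unfolding Ks(2)
 proof (induction Ks xs rule: combine.induct)
 case (1 q Ks u Us)
 then show ?case using subcl(4,5)[OF kf(1)] by simp
 qed (use subcl(1)[OF kf(1)] in simp_all)
 qed
 qed
 then obtain d where "dimension d ?A k" using Span_finite_dimension[OF A(1) xc] unfolding finite_dimension_def by auto
 then show ?thesis using card_dimension(2)[OF A(1,3)] A(2) by auto
qed

text \<open>The order of the additive group annihilates 1, so a power of \<open>[p] #. 1.\<close>
  vanishes.\<close>

lemma characteristic_of_card:
 assumes fin: "finite (carrier R)" and c: "card (carrier R) = p ^ d"
 shows "[(p::nat)] #. 1. = 0."
proof -
 have "[(order (add_monoid R))] #. 1. = 0."
 using group.pow_order_eq_1[OF a_group, of \<one>] unfolding add_pow_def by simp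
 then have z: "[(p ^ d)] #. 1. = 0." using c unfolding order_def by simp
 have "[(p ^ e)] #. 1. = ([p] #. 1.) [^] e" for e
 proof (induction e)
 case (Suc e)
 have "[(p ^ Suc e)] #. 1. = [(p ^ e)] #. 1.$[p] #. 1." unfolding nat_mult_one by (simp add: mult.commute)
 then show ?case using Suc by simp
 qed simp
 then have "([p] #. 1.) [^] d = 0." using z by simp
 then show ?thesis using pow_nonzero[of "[p] #. 1." d] by (metis add.nat_pow_closed one_closed)
qed

end

text \<open>Both prime fields are the natural numbers modulo \<open>p\<close>; their identification
  extends to the whole fields.\<close>

lemma finite_fields_isomorphic:
 fixes R :: "('a, 'b) ring_scheme" and G :: "('c, 'd) ring_scheme"
 assumes R: "field R" and G: "field G" and fin: "finite (carrier R)" "finite (carrier G)" "card (carrier G) = card (carrier R)"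
 and p: "Factorial_Ring.prime (p::nat)" "[p] #.\<^bsub>R\<^esub> 1.\<^bsub>R\<^esub> = 0.\<^bsub>R\<^esub>" "[p] #.\<^bsub>G\<^esub> 1.\<^bsub>G\<^esub> = 0.\<^bsub>G\<^esub>"
 shows "\<exists>\<psi>\<in>ring_hom R G. bij_betw \<psi> (carrier R) (carrier G)"
proof -
 interpret R: field R by (rule R)
 interpret G: field G by (rule G)
 let ?A = "range (%n::nat. [n] #.\<^bsub>R\<^esub> 1.\<^bsub>R\<^esub>)"
 define \<tau> where "\<tau> u = [(SOME n::nat. u = [n] #.\<^bsub>R\<^esub> 1.\<^bsub>R\<^esub>)] #.\<^bsub>G\<^esub> 1.\<^bsub>G\<^esub>" for u
 have t: "\<tau> ([n] #.\<^bsub>R\<^esub> 1.\<^bsub>R\<^esub>) = [n] #.\<^bsub>G\<^esub> 1.\<^bsub>G\<^esub>" for n :: nat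
 proof -
 have "[n] #.\<^bsub>R\<^esub> 1.\<^bsub>R\<^esub> = [(SOME m::nat. [n] #.\<^bsub>R\<^esub> 1.\<^bsub>R\<^esub> = [m] #.\<^bsub>R\<^esub> 1.\<^bsub>R\<^esub>)] #.\<^bsub>R\<^esub> 1.\<^bsub>R\<^esub>"
 by (rule someI[of "%m::nat. [n] #.\<^bsub>R\<^esub> 1.\<^bsub>R\<^esub> = [m] #.\<^bsub>R\<^esub> 1.\<^bsub>R\<^esub>" n]) simp
 then show ?thesis unfolding \<tau>_def R.nat_one_eq_iff[OF p(1,2)] G.nat_one_eq_iff[OF p(1,3)] by simp
 qed
 have "\<tau> : ring_hom (R(|carrier := ?A|)) G"
 proof (rule ring_hom_memI)
 fix u v assume "u : carrier (R(|carrier := ?A|))" "v : carrier (R(|carrier := ?A|))"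
 then obtain n m :: nat where nm: "u = [n] #.\<^bsub>R\<^esub> 1.\<^bsub>R\<^esub>" "v = [m] #.\<^bsub>R\<^esub> 1.\<^bsub>R\<^esub>" by auto
 show "\<tau> (u $\<^bsub>R(|carrier := ?A|)\<^esub> v) = \<tau> u $\<^bsub>G\<^esub> \<tau> v" unfolding nm using t R.nat_mult_one G.nat_mult_one by simp
 show "\<tau> (u +.\<^bsub>R(|carrier := ?A|)\<^esub> v) = \<tau> u +.\<^bsub>G\<^esub> \<tau> v"
 unfolding nm using t R.nat_add_one G.nat_add_one by simp
 next
 show "\<tau> 1.\<^bsub>R(|carrier := ?A|)\<^esub> = 1.\<^bsub>G\<^esub>" using t[of 1] by simp
 next
 fix u assume "u : carrier (R(|carrier := ?A|))"
 then obtain n :: nat where "u = [n] #.\<^bsub>R\<^esub> 1.\<^bsub>R\<^esub>" by auto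
 then show "\<tau> u : carrier G" using t by simp
 qed
 then interpret field_embedding R G ?A \<tau>
 by (intro field_embedding.intro field_embedding_axioms.intro R G R.prime_subfield(1)[OF p(1,2)])
 show ?thesis using finite_extension_isomorphism[OF fin] by (elim bexE conjE) (rule bexI)
qed

section \<open>From the general to the short Weierstrass equation\<close>

locale long_weierstrass = field R for R (structure) +
 fixes k x y a1 a2 a3 a4 a6
 assumes kR: "subfield k R"
 and ell: "elliptic_function_field R k (Weierstrass a1 a2 a3 a4 a6) x y"
 and two: "1.+.1. ~= 0." and three: "1.+.1.+.1. ~= 0."

begin

abbreviation "W \<equiv> Weierstrass a1 a2 a3 a4 a6"

lemmas kF = sf_facts[OF kR]

lemmas kcl = subcl[OF kF(1)]

lemma basics: "a1 : k" "a2 : k" "a3 : k" "a4 : k" "a6 : k" "discriminant R W ~= 0." "x : carrier R" "y : carrier R"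
 "transcendental k x" "generate_field R (k \<union> {x, y}) = carrier R"
 "y [^] (2::nat)+.a1$x$y+.a3$y = x [^] (3::nat)+.a2$x [^] (2::nat)+.a4$x+.a6"
 using ell unfolding elliptic_function_field_def elliptic_curves_def by simp_all

lemma ac: "a1 : carrier R" "a2 : carrier R" "a3 : carrier R" "a4 : carrier R" "a6 : carrier R" "x : carrier R" "y : carrier R"
 using basics(1-5,7,8) kF(2) by simp_all

lemma curve: "y$y+.a1$x$y+.a3$y = x$x$x+.a2$x$x+.a4$x+.a6"
 using basics(11) ac by (simp add: numeral_2_eq_2 numeral_3_eq_3 m_assoc)

definition "b2 = wei_b2 R W"

definition "b4 = wei_b4 R W"

definition "b6 = wei_b6 R W"

definition "b8 = wei_b8 R W"

text \<open>The classical substitution 36x + 3 b2 and 108(2y + a1 x + a3), with coefficients -27 c4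
  and -54 c6. Large multiples are written as iterated small ones.\<close>

definition "sx = [(36::nat)] #. x+.[(3::nat)] #. b2"

definition "sy = [(4::nat)] #. ([(27::nat)] #. ([(2::nat)] #. y+.a1$x+.a3))"

definition "sa =-.([(27::nat)] #. (b2$b2-.[(24::nat)] #. b4))"

definition "sb = [(27::nat)] #. ([(2::nat)] #. (b2$b2$b2))-.[(27::nat)] #. ([(2::nat)] #. ([(36::nat)] #. (b2$b4)))
 +.[(16::nat)] #. ([(27::nat)] #. ([(27::nat)] #. b6))"

lemma bk: "b2 : k" "b4 : k" "b6 : k" "b8 : k"
proof -
 note b = basics
 show "b2 : k" unfolding b2_def wei_b2.simps by (rule kcl(5)[OF kcl(7)[OF b(1)] kcl(8)[OF b(2)]])
 show "b4 : k" unfolding b4_def wei_b4.simps by (rule kcl(5)[OF kcl(8)[OF b(4)] kcl(4)[OF b(1,3)]])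
 show "b6 : k" unfolding b6_def wei_b6.simps by (rule kcl(5)[OF kcl(7)[OF b(3)] kcl(8)[OF b(5)]])
 show "b8 : k" unfolding b8_def wei_b8.simps
 by (rule kcl(6)[OF kcl(5)[OF kcl(6)[OF kcl(5)[OF kcl(4)[OF kcl(7)[OF b(1)] b(5)] kcl(8)[OF kcl(4)[OF b(2,5)]]]
 kcl(4)[OF kcl(4)[OF b(1,3)] b(4)]] kcl(4)[OF b(2) kcl(7)[OF b(3)]]] kcl(7)[OF b(4)]])
qed

lemma bc: "b2 : carrier R" "b4 : carrier R" "b6 : carrier R" "b8 : carrier R"
 using bk kF(2) by simp_all

lemma sk: "sa : k" "sb : k"
proof -
 show "sa : k" unfolding sa_def by (rule kcl(3)[OF kcl(8)[OF kcl(6)[OF kcl(4)[OF bk(1,1)] kcl(8)[OF bk(2)]]]])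
 show "sb : k" unfolding sb_def
 by (rule kcl(5)[OF kcl(6)[OF kcl(8)[OF kcl(8)[OF kcl(4)[OF kcl(4)[OF bk(1,1)] bk(1)]]]
 kcl(8)[OF kcl(8)[OF kcl(8)[OF kcl(4)[OF bk(1,2)]]]]] kcl(8)[OF kcl(8)[OF kcl(8)[OF bk(3)]]]])
qed

lemma sc: "sx : carrier R" "sy : carrier R" "sa : carrier R" "sb : carrier R"
 using sk kF(2) bc ac unfolding sx_def sy_def by simp_all

lemma b_relation: "[(4::nat)] #. b8 = b2$b6-.b4$b4"
 unfolding b2_def b4_def b6_def b8_def wei_b2.simps wei_b4.simps wei_b6.simps wei_b8.simps
 by (reify rsimps, rule ring_id, simp add: ac, simp, code_simp)

lemma c4: "wei_c4 R W = b2$b2-.[(24::nat)] #. b4" unfolding wei_c4_def b2_def[symmetric] b4_def[symmetric]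
 using bc by (simp add: numeral_2_eq_2)

lemma disc: "discriminant R W = [(9::nat)] #. (b2$b4$b6)-.b2$b2$b8-.[(8::nat)] #. (b4$b4$b4)-.[(27::nat)] #. (b6$b6)"
 unfolding discriminant_def b2_def[symmetric] b4_def[symmetric] b6_def[symmetric] b8_def[symmetric]
 using bc by (simp add: numeral_2_eq_2 numeral_3_eq_3 m_assoc)

text \<open>The factor is 2^8 3^12, nonzero in characteristic other than 2 and 3. The identity in
  b2, b4, b6, b8 holds only modulo the relation 4 b8 = b2 b6 - b4^2, hence the explicit multiple of
  \<open>?rel\<close>.\<close>

lemma short_disc: "[(4::nat)] #. (sa$sa$sa)+.[(27::nat)] #. (sb$sb) =
 -.([(16::nat)] #. ([(16::nat)] #. ([(27::nat)] #. ([(27::nat)] #. ([(27::nat)] #. ([(27::nat)] #. discriminant R W))))))"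
proof -
 let ?rel = "[(4::nat)] #. b8-.(b2$b6-.b4$b4)"
 let ?D = "[(9::nat)] #. (b2$b4$b6)-.b2$b2$b8-.[(8::nat)] #. (b4$b4$b4)-.[(27::nat)] #. (b6$b6)"
 have "[(4::nat)] #. (sa$sa$sa)+.[(27::nat)] #. (sb$sb) =
 -.([(16::nat)] #. ([(16::nat)] #. ([(27::nat)] #. ([(27::nat)] #. ([(27::nat)] #. ([(27::nat)] #. ?D))))))
 -.[(16::nat)] #. ([(4::nat)] #. ([(27::nat)] #. ([(27::nat)] #. ([(27::nat)] #. ([(27::nat)] #. (b2$b2$?rel))))))"
 unfolding sa_def sb_def by (reify rsimps, rule ring_id, simp add: bc, simp, code_simp)
 moreover have "?rel = 0." using b_relation bc by (simp add: minus_eq r_neg)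
 ultimately show ?thesis unfolding disc using bc by (simp add: minus_eq)
qed

lemma short_curve: "sy$sy = sx$sx$sx+.sa$sx+.sb"
proof -
 let ?l = "y$y+.a1$x$y+.a3$y" and ?r = "x$x$x+.a2$x$x+.a4$x+.a6"
 let ?z = "[(2::nat)] #. y+.a1$x+.a3"
 have "?z$?z = [(4::nat)] #. (x$x$x)+.b2$x$x+.[(2::nat)] #. (b4$x)+.b6+.[(4::nat)] #. (?l-.?r)"
 unfolding b2_def b4_def b6_def wei_b2.simps wei_b4.simps wei_b6.simps
 by (reify rsimps, rule ring_id, simp add: ac, simp, code_simp)
 also have "?l-.?r = 0." unfolding curve using ac by (simp add: minus_eq r_neg)
 finally have z: "?z$?z = [(4::nat)] #. (x$x$x)+.b2$x$x+.[(2::nat)] #. (b4$x)+.b6" using ac bc by simp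
 have "sy$sy = [(16::nat)] #. ([(27::nat)] #. ([(27::nat)] #. (?z$?z)))"
 unfolding sy_def by (reify rsimps, rule ring_id, simp add: ac, simp, code_simp)
 also have "... = sx$sx$sx+.sa$sx+.sb"
 unfolding z sx_def sa_def sb_def by (reify rsimps, rule ring_id, simp add: ac bc, simp, code_simp)
 finally show ?thesis .
qed

end

section \<open>Rational points of the plane cubic as places\<close>

context long_weierstrass

begin

lemma nat_one_nonzero: "[(16::nat)] #. 1. ~= 0." "[(27::nat)] #. 1. ~= 0." "[(36::nat)] #. 1. ~= 0." "[(4::nat)] #. ([(27::nat)] #. ([(2::nat)] #. 1.)) ~= 0."
proof -
 let ?t = "1.+.1." and ?h = "1.+.1.+.1."
 have 1: "[(16::nat)] #. 1. = ?t$?t$?t$?t" "[(27::nat)] #. 1. = ?h$?h$?h" "[(36::nat)] #. 1. = ?t$?t$(?h$?h)"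
 by (reify rsimps, rule ring_id, simp, simp, code_simp)+
 show 2: "[(16::nat)] #. 1. ~= 0." "[(27::nat)] #. 1. ~= 0." "[(36::nat)] #. 1. ~= 0." unfolding 1 using two three by simp_all
 have 3: "[(4::nat)] #. ([(27::nat)] #. ([(2::nat)] #. 1.)) = ?t$?t$(?h$?h$?h)$?t"
 by (reify rsimps, rule ring_id, simp, simp, code_simp)
 show "[(4::nat)] #. ([(27::nat)] #. ([(2::nat)] #. 1.)) ~= 0." unfolding 3 using two three by simp
qed

lemma nat_nonzero: "u : carrier R ==> [(n::nat)] #. 1. ~= 0. ==> u ~= 0. ==> [n] #. u ~= 0."
 using add_pow_ldistr[of \<one> u n] by auto

lemma inverse36: "inv ([(36::nat)] #. 1.) : k" "x = inv ([(36::nat)] #. 1.)$(sx-.[(3::nat)] #. b2)"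
 "inv ([(4::nat)] #. ([(27::nat)] #. ([(2::nat)] #. 1.))) : k" "y = inv ([(4::nat)] #. ([(27::nat)] #. ([(2::nat)] #. 1.)))$(sy-.[(4::nat)] #. ([(27::nat)] #. (a1$x+.a3)))"
proof -
 show "inv ([(36::nat)] #. 1.) : k" "inv ([(4::nat)] #. ([(27::nat)] #. ([(2::nat)] #. 1.))) : k"
 using kF(3)[OF kcl(8)[OF kcl(2)] nat_one_nonzero(3)] kF(3)[OF kcl(8)[OF kcl(8)[OF kcl(8)[OF kcl(2)]]] nat_one_nonzero(4)] .
 have "sx-.[(3::nat)] #. b2 = [(36::nat)] #. 1.$x"
 unfolding sx_def by (reify rsimps, rule ring_id, simp add: ac bc, simp, code_simp)
 then show "x = inv ([(36::nat)] #. 1.)$(sx-.[(3::nat)] #. b2)" using nat_one_nonzero(3) ac by simp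
 have "sy-.[(4::nat)] #. ([(27::nat)] #. (a1$x+.a3)) = [(4::nat)] #. ([(27::nat)] #. ([(2::nat)] #. 1.))$y"
 unfolding sy_def by (reify rsimps, rule ring_id, simp add: ac bc, simp, code_simp)
 then show "y = inv ([(4::nat)] #. ([(27::nat)] #. ([(2::nat)] #. 1.)))$(sy-.[(4::nat)] #. ([(27::nat)] #. (a1$x+.a3)))"
 using nat_one_nonzero(4) ac by simp
qed

lemma coordinates_in:
 assumes T: "subring T R" "k <= T"
 shows "sx : T ==> x : T" "x : T ==> sx : T" "x : T ==> sy : T ==> y : T" "x : T ==> y : T ==> sy : T"
proof -
 note tcl = subcl[OF T(1)]
 have kT: "inv ([(36::nat)] #. 1.) : T" "inv ([(4::nat)] #. ([(27::nat)] #. ([(2::nat)] #. 1.))) : T" "b2 : T" "a1 : T" "a3 : T"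
 using T(2) inverse36(1,3) bk(1) basics(1,3) by blast+
 show "x : T" if "sx : T" using tcl(4)[OF kT(1) tcl(6)[OF that tcl(8)[OF kT(3), of 3]]] unfolding inverse36(2)[symmetric] .
 show "sx : T" if "x : T" unfolding sx_def by (rule tcl(5)[OF tcl(8)[OF that] tcl(8)[OF kT(3)]])
 show "y : T" if "x : T" "sy : T"
 using tcl(4)[OF kT(2) tcl(6)[OF that(2) tcl(8)[OF tcl(8)[OF tcl(5)[OF tcl(4)[OF kT(4) that(1)] kT(5)], of 27], of 4]]] unfolding inverse36(4)[symmetric] .
 show "sy : T" if "x : T" "y : T"
 unfolding sy_def by (rule tcl(8)[OF tcl(8)[OF tcl(5)[OF tcl(5)[OF tcl(8)[OF that(2)] tcl(4)[OF kT(4) that(1)]] kT(5)]]])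
qed

lemma short_weierstrass: "weierstrass_function_field R k sx sy sa sb"
proof (intro weierstrass_function_field.intro weierstrass_function_field_axioms.intro)
 show "field R" by (rule field_axioms)
 show "subfield k R" by (rule kR)
 show "sx : carrier R" "sy : carrier R" "sa : k" "sb : k" using sc sk by simp_all
 have "~ ~ transcendental k sx"
 proof
 assume t: "~ transcendental k sx"
 note al = algebraics_subfield[OF kR]
 have "x : {z : carrier R. ~ transcendental k z}"
 by (rule coordinates_in(1)[OF sf_facts(1)[OF al(1)] al(2)]) (use t sc in simp)
 then show False using basics(9) by simp
 qed
 then show "transcendental k sx" by simp
 show "sy$sy = sx$sx$sx+.sa$sx+.sb" by (rule short_curve)
 have d: "discriminant R W : carrier R" unfolding disc using bc by simp
 show "[(4::nat)] #. (sa$sa$sa)+.[(27::nat)] #. (sb$sb) ~= 0."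
 unfolding short_disc using nat_nonzero nat_one_nonzero basics(6) d by (simp add: add.inv_eq_1_iff)
 show "1.+.1. ~= 0." by (rule two)
 have s: "k \<union> {sx, sy} <= carrier R" using kF(2) sc by blast
 let ?E = "generate_field R (k \<union> {sx, sy})"
 note g = generate_field_is_subfield[OF s]
 have gi: "k <= ?E" "sx : ?E" "sy : ?E" by (blast intro: generate_field.incl)+
 have x: "x : ?E" by (rule coordinates_in(1)[OF sf_facts(1)[OF g] gi(1,2)])
 have y: "y : ?E" by (rule coordinates_in(3)[OF sf_facts(1)[OF g] gi(1) x gi(3)])
 have "generate_field R (k \<union> {x, y}) <= ?E" by (rule generate_field_min_subfield1[OF _ g]) (use kF(2) ac gi(1) x y in blast)+
 then show "?E = carrier R" using basics(10) sf_facts(2)[OF g] by blast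
qed

sublocale S: weierstrass_function_field R k sx sy sa sb by (rule short_weierstrass)

text \<open>Division-free form of j = 1728 * 4a^3/(4a^3 + 27b^2), since 16 * 16 * 27 = 4 * 1728. In
  this form it is homogeneous under scaling and passes to reductions.\<close>

lemma j_short: "j_invariant R W$([(4::nat)] #. (sa$sa$sa)+.[(27::nat)] #. (sb$sb)) = [(16::nat)] #. ([(16::nat)] #. ([(27::nat)] #. (sa$sa$sa)))"
proof -
 let ?D = "discriminant R W" and ?c = "b2$b2-.[(24::nat)] #. b4"
 have d: "?D : carrier R" "?D ~= 0." "?c : carrier R" "inv ?D : carrier R" unfolding disc using bc basics(6) disc by simp_all
 have j: "j_invariant R W = ?c$?c$?c$inv ?D" unfolding j_invariant_def c4 using d by (simp add: numeral_3_eq_3 m_assoc)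
 have "?c$?c$?c$inv ?D$( -. ([(16::nat)] #. ([(16::nat)] #. ([(27::nat)] #. ([(27::nat)] #. ([(27::nat)] #. ([(27::nat)] #. ?D))))))) =
 [(16::nat)] #. ([(16::nat)] #. ([(27::nat)] #. (sa$sa$sa)))$(?D$inv ?D)"
 unfolding sa_def by (reify rsimps, rule ring_id, simp add: d bc, simp, code_simp)
 then show ?thesis unfolding j short_disc using d sc by simp
qed

lemma y0: "y ~= 0." and x0: "x ~= 0."
proof -
 show "x ~= 0." using transcendental_inv(1)[OF kR ac(6) basics(9)] .
 show "y ~= 0."
 proof
 assume "y = 0."
 moreover have x: "x : S.E"
 by (rule coordinates_in(1)[OF S.ef(1) S.ff(3) S.ff(4)])
 ultimately have "sy : S.E" by (intro coordinates_in(4)[OF S.ef(1) S.ff(3) x]) (simp add: S.ecl(1))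
 then show False using S.y_notin by blast
 qed
qed

lemma inv_c: "inv x : carrier R" "inv y : carrier R" "x$inv x = 1." "y$inv y = 1."
 using x0 y0 ac by simp_all

text \<open>At infinity \<open>sy\<close> is \<open>y\<close> times the unit \<open>D\<close>, whose
  value there is 216.\<close>

lemma infinity_short:
 assumes T: "local_subring R T" "k <= T" and u: "x$inv y : nonunits R T" "inv y : nonunits R T"
 shows "sx$inv sy : nonunits R T" "inv sy : nonunits R T"
proof -
 note TD = lsubD[OF T(1)] and tcl = subcl[OF lsubD(1)[OF T(1)]] and tc = subcarr[OF lsubD(1)[OF T(1)]]
 let ?u = "x$inv y" and ?v = "inv y"
 have uT: "?u : T" "?v : T" using u nonunits_iff[OF TD(1)] by blast+
 have kT: "a1 : T" "a3 : T" "b2 : T" using T(2) basics(1,3) bk(1) by blast+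
 let ?n = "?u$([(4::nat)] #. ([(27::nat)] #. a1))+.?v$([(4::nat)] #. ([(27::nat)] #. a3))"
 have n: "?n : nonunits R T"
 by (rule TD(2)[OF nonunits_mult[OF TD(1) u(1) tcl(8)[OF tcl(8)[OF kT(1)]]] nonunits_mult[OF TD(1) u(2) tcl(8)[OF tcl(8)[OF kT(2)]]]])
 define D where "D = [(4::nat)] #. ([(27::nat)] #. ([(2::nat)] #. 1.))+.?n"
 have "[(4::nat)] #. ([(27::nat)] #. ([(2::nat)] #. 1.)) : T" "[(4::nat)] #. ([(27::nat)] #. ([(2::nat)] #. 1.)) ~: nonunits R T"
 using subfield_unit[OF kR T(2) TD(1) kcl(8)[OF kcl(8)[OF kcl(8)[OF kcl(2)]]] nat_one_nonzero(4)] .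
 then have D: "D : T" "D ~: nonunits R T" unfolding D_def using unit_add_nonunit[OF T(1) _ _ n] by blast+
 note Di = unit_inv[OF TD(1) D] and Dc = tc[OF D(1)]
 note uc = tc[OF uT(1)] tc[OF uT(2)]
 have "y$D = [(4::nat)] #. ([(27::nat)] #. ([(2::nat)] #. y))+.[(4::nat)] #. ([(27::nat)] #. (a1$x))$(y$inv y)+.[(4::nat)] #. ([(27::nat)] #. a3)$(y$inv y)"
 unfolding D_def by (reify rsimps, rule ring_id, simp add: ac inv_c, simp, code_simp)
 also have "... = [(4::nat)] #. ([(27::nat)] #. ([(2::nat)] #. y))+.[(4::nat)] #. ([(27::nat)] #. (a1$x))$1.+.[(4::nat)] #. ([(27::nat)] #. a3)$1." unfolding inv_c(4) ..
 also have "... = sy" unfolding sy_def by (reify rsimps, rule ring_id, simp add: ac, simp, code_simp)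
 finally have yD: "sy = y$D" by simp
 then have i: "inv sy = inv y$inv D" using inv_mult_distrib[OF ac(7) y0 Dc Di(1)] by simp
 show "inv sy : nonunits R T" unfolding i by (rule nonunits_mult[OF TD(1) u(2) Di(2)])
 have m: "?u$([(36::nat)] #. 1.)+.?v$([(3::nat)] #. b2) : nonunits R T"
 by (rule TD(2)[OF nonunits_mult[OF TD(1) u(1) tcl(8)[OF tcl(2)]] nonunits_mult[OF TD(1) u(2) tcl(8)[OF kT(3)]]])
 note iDc = tc[OF Di(2)]
 have "sx$inv sy = (?u$([(36::nat)] #. 1.)+.?v$([(3::nat)] #. b2))$inv D"
 unfolding i sx_def by (reify rsimps, rule ring_id, simp add: ac bc inv_c iDc, simp, code_simp)
 then show "sx$inv sy : nonunits R T" using nonunits_mult[OF TD(1) m Di(2)] by simp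
qed

lemma local_model_place:
 assumes T: "local_subring R T" "rational_over R k T"
 and c: "x : T & y : T \<or> x$inv y : nonunits R T & inv y : nonunits R T"
 shows "place R k T"
proof (rule S.local_place[OF T])
 have kT: "k <= T" using T(2) unfolding rational_over_def by blast
 show "sx : T & sy : T \<or> S.x1 : nonunits R T & S.Y : nonunits R T"
 using c
 proof
 assume h: "x : T & y : T"
 then show ?thesis using coordinates_in(2,4)[OF lsubD(1)[OF T(1)] kT] by blast
 next
 assume h: "x$inv y : nonunits R T & inv y : nonunits R T"
 then have "sx$inv sy : nonunits R T" "inv sy : nonunits R T" using infinity_short[OF T(1) kT] by blast+
 from S.infinity_coordinates[OF T(1) kT this] show ?thesis by blast
 qed
qed

text \<open>The line at infinity meets the cubic only in the origin: (x/y)^3 is a multiple of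
  1/y.\<close>

lemma chart_y_nonunit:
 assumes T: "local_subring R T" "k <= T" and u: "x$inv y : T" "inv y : nonunits R T"
 shows "x$inv y : nonunits R T"
proof (rule ccontr)
 note TD = lsubD[OF T(1)] and tcl = subcl[OF lsubD(1)[OF T(1)]] and tc = subcarr[OF lsubD(1)[OF T(1)]]
 let ?u = "x$inv y" and ?v = "inv y"
 assume n: "?u ~: nonunits R T"
 have vT: "?v : T" using u(2) nonunits_iff[OF TD(1)] by blast
 have kT: "a1 : T" "a2 : T" "a3 : T" "a4 : T" "a6 : T" using T(2) basics(1-5) by blast+
 let ?g = "1.+.a1$?u+.a3$?v-.a2$?u$?u-.a4$?u$?v-.a6$?v$?v"
 have g: "?g : T"
 by (rule tcl(6)[OF tcl(6)[OF tcl(6)[OF tcl(5)[OF tcl(5)[OF tcl(2) tcl(4)[OF kT(1) u(1)]] tcl(4)[OF kT(3) vT]]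
 tcl(4)[OF tcl(4)[OF kT(2) u(1)] u(1)]] tcl(4)[OF tcl(4)[OF kT(4) u(1)] vT]] tcl(4)[OF tcl(4)[OF kT(5) vT] vT]])
 let ?e = "y$?v"
 have "?u$?u$?u = (x$x$x+.a2$x$x+.a4$x+.a6)$?v$?v$?v-.?v$(a2$?u$?u+.a4$?u$?v+.a6$?v$?v)"
 by (reify rsimps, rule ring_id, simp add: ac inv_c, simp, code_simp)
 also have "... = ?v$(?e$?e+.a1$?u$?e+.a3$?v$?e)-.?v$(a2$?u$?u+.a4$?u$?v+.a6$?v$?v)"
 unfolding curve[symmetric] by (reify rsimps, rule ring_id, simp add: ac inv_c, simp, code_simp)
 also have "... = ?v$?g" unfolding inv_c(4) by (reify rsimps, rule ring_id, simp add: ac inv_c, simp, code_simp)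
 finally have "?u$?u$?u : nonunits R T" using nonunits_mult[OF TD(1) u(2) g] by simp
 moreover have "?u$?u$?u ~: nonunits R T"
 using unit_mult[OF TD(1) unit_mult[OF TD(1) u(1) n u(1) n] u(1) n] by blast
 ultimately show False by blast
qed

text \<open>The chart on which \<open>x\<close> does not vanish contains no point at infinity:
  dividing the equation by x^2 expresses \<open>x\<close> as a polynomial in y/x and 1/x.\<close>

lemma chart_x_unit:
 assumes T: "local_subring R T" "k <= T" and u: "y$inv x : T" "inv x : T"
 shows "x : T"
proof -
 note TD = lsubD[OF T(1)] and tcl = subcl[OF lsubD(1)[OF T(1)]]
 let ?t = "y$inv x" and ?s = "inv x"
 have kT: "a1 : T" "a2 : T" "a3 : T" "a4 : T" "a6 : T" using T(2) basics(1-5) by blast+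
 let ?e = "x$?s"
 have "x$?e$?e = (x$x$x+.a2$x$x+.a4$x+.a6)$?s$?s-.(a2$?e$?e+.a4$?e$?s+.a6$?s$?s)"
 by (reify rsimps, rule ring_id, simp add: ac inv_c, simp, code_simp)
 also have "... = ?t$?t+.a1$?t$?e+.a3$?t$?s-.(a2$?e$?e+.a4$?e$?s+.a6$?s$?s)"
 unfolding curve[symmetric] by (reify rsimps, rule ring_id, simp add: ac inv_c, simp, code_simp)
 finally have "x = ?t$?t+.a1$?t+.a3$?t$?s-.(a2+.a4$?s+.a6$?s$?s)"
 unfolding inv_c(3) using ac inv_c by simp
 moreover have "?t$?t+.a1$?t+.a3$?t$?s-.(a2+.a4$?s+.a6$?s$?s) : T"
 by (rule tcl(6)[OF tcl(5)[OF tcl(5)[OF tcl(4)[OF u(1,1)] tcl(4)[OF kT(1) u(1)]] tcl(4)[OF tcl(4)[OF kT(3) u(1)] u(2)]]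
 tcl(5)[OF tcl(5)[OF kT(2) tcl(4)[OF kT(4) u(2)]] tcl(4)[OF tcl(4)[OF kT(5) u(2)] u(2)]]])
 ultimately show ?thesis by simp
qed

lemma place_pole:
 assumes V: "place R k V" and x: "x ~: V"
 shows "x$inv y : nonunits R V" "inv y : nonunits R V"
proof -
 note P = placeD[OF V] note VD = valuation_ringD[OF P(1)] and vcl = subcl[OF P(5)]
 have n1: False if t: "y$inv x : V"
 proof -
 have "inv x : V" using VD(4)[OF ac(6) x0] x by blast
 then show False using chart_x_unit[OF P(3,4) t] x by blast
 qed
 have w: "y$inv x : carrier R" "y$inv x ~= 0." using ac inv_c x0 y0 by simp_all
 have "inv (y$inv x) : nonunits R V" by (rule VD(3)[OF w(1)]) (use n1 in blast)
 moreover have iw: "inv (y$inv x) = x$inv y" using fraction_inv[OF ac(7,6) x0 y0] .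
 ultimately show u: "x$inv y : nonunits R V" by simp
 have "(x$inv y)$inv x = (x$inv x)$inv y"
 by (reify rsimps, rule ring_id, simp add: ac inv_c, simp, code_simp)
 then have "inv y = (x$inv y)$inv x" unfolding inv_c(3) using inv_c by simp
 moreover have "inv x : V" using VD(4)[OF ac(6) x0] x by blast
 ultimately show "inv y : nonunits R V" using nonunits_mult[OF P(5) u] by metis
qed

text \<open>The localization of the chart at the center of \<open>V\<close> has residue field
  \<open>k\<close>, so it is a place by nonsingularity; being contained in \<open>V\<close>, it
  equals \<open>V\<close>.\<close>

lemma place_localization:
 assumes V: "place R k V" and A: "subring A R" "k <= A" "A <= V"
 and c: "x : A & y : A \<or> x$inv y : A & inv y : A & x$inv y : nonunits R V & inv y : nonunits R V"
 shows "localization R A (A \<inter> nonunits R V) = V" "prime_in R A (A \<inter> nonunits R V)"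
proof -
 note P = placeD[OF V]
 let ?I = "A \<inter> nonunits R V"
 show pr: "prime_in R A ?I" by (rule prime_in_center[OF A(1) P(3) A(3)])
 have r: "\<exists>c\<in>k. a-.c : ?I" if a: "a : A" for a
 proof -
 obtain c where c: "c : k" "a-.c : nonunits R V" using P(2) a A(3) unfolding rational_over_def by blast
 then show ?thesis using subcl(6)[OF A(1) a] A(2) by blast
 qed
 have I: "?I <= A" "0. : ?I" "1. ~: ?I" using pr unfolding prime_in_def by blast+
 have rat: "rational_over R k (localization R A ?I)"
 by (rule rational_prime(2)[OF A(1) kR A(2) I]) (use pr r in \<open>unfold prime_in_def, blast+\<close>)
 note lf = localization_facts[OF A(1) pr]
 have sub: "localization R A ?I <= V" using localization_least(1)[OF A(1) pr P(3) A(3)] by blast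
 have "place R k (localization R A ?I)"
 proof (rule local_model_place[OF lf(1) rat])
 have AL: "A <= localization R A ?I" using subset_localization[OF A(1) pr] by blast
 have IL: "?I <= nonunits R (localization R A ?I)" using lf(3) by blast
 show "x : localization R A ?I & y : localization R A ?I \<or>
 x$inv y : nonunits R (localization R A ?I) & inv y : nonunits R (localization R A ?I)"
 using c AL IL by blast
 qed
 then show "localization R A ?I = V" using place_eq[OF kR _ P(3,2) sub] by simp
qed

text \<open>Every rational local ring of a chart is either affine or centered at the origin, hence a
  place. Conversely a place is found on the affine chart if \<open>x\<close> is integral and on the
  chart of \<open>y\<close> otherwise.\<close>

theorem rational_model_points:
 "{S : weierstrass_model R k x y. rational_over R k S} = {S. place R k S}"
proof
 have gen: "k \<union> {w$inv z | w. w : set [x, y, 1.]} <= carrier R" if "z : {x, y, 1.}" for z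
 using that kF(2) ac inv_c inv_one by auto
 have ch: "subring (chart R k [x, y, 1.] z) R" "k <= chart R k [x, y, 1.] z"
 "x$inv z : chart R k [x, y, 1.] z" "y$inv z : chart R k [x, y, 1.] z" "1.$inv z : chart R k [x, y, 1.] z"
 if z: "z : {x, y, 1.}" for z
 proof -
 note g = generate_ringE[OF gen[OF z] refl, folded chart_def]
 show "subring (chart R k [x, y, 1.] z) R" by (rule g(1))
 show "k <= chart R k [x, y, 1.] z" "x$inv z : chart R k [x, y, 1.] z" "y$inv z : chart R k [x, y, 1.] z"
 "1.$inv z : chart R k [x, y, 1.] z" using g(2) by auto
 qed
 show "{S : weierstrass_model R k x y. rational_over R k S} <= {S. place R k S}"
 proof
 fix S assume "S : {S : weierstrass_model R k x y. rational_over R k S}"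
 then obtain z \<pp> where z: "z : {x, y, 1.}" and pp: "primeideal \<pp> (R(|carrier := chart R k [x, y, 1.] z|))"
 and S: "S = localization R (chart R k [x, y, 1.] z) \<pp>" and rat: "rational_over R k S"
 unfolding weierstrass_model_def proj_model_def affine_model_def by auto
 note c = ch[OF z]
 have pr: "prime_in R (chart R k [x, y, 1.] z) \<pp>" using prime_in_iff[OF c(1)] pp by blast
 have L: "local_subring R S" unfolding S by (rule localization_facts(1)[OF c(1) pr])
 have cS: "chart R k [x, y, 1.] z <= S" unfolding S using subset_localization[OF c(1) pr] by blast
 have kS: "k <= S" using c(2) cS by blast
 note SD = lsubD[OF L] and scl = subcl[OF lsubD(1)[OF L]]
 have in1: "x$inv z : S" "y$inv z : S" "1.$inv z : S" using c(3-5) cS by blast+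
 consider "z = x" | "z = y" | "z = 1." using z by blast
 then have "x : S & y : S \<or> x$inv y : nonunits R S & inv y : nonunits R S"
 proof cases
 case 1
 have s: "inv x : S" using in1(3) 1 inv_c by simp
 have xS: "x : S" using chart_x_unit[OF L kS _ s] in1(2) 1 by simp
 have "y = (y$inv x)$x" using ac inv_c x0 by (simp add: m_assoc)
 then show ?thesis using xS scl(4)[OF in1(2) xS] 1 by simp
 next
 case 2
 have s: "inv y : S" using in1(3) 2 inv_c by simp
 have u: "x$inv y : S" using in1(1) 2 by simp
 show ?thesis
 proof (cases "inv y : nonunits R S")
 case True
 then show ?thesis using chart_y_nonunit[OF L kS u] by blast
 next
 case False
 have yS: "y : S" using unit_inv(2)[OF SD(1) s False] ac y0 by simp
 have "x = (x$inv y)$y" using ac inv_c y0 by (simp add: m_assoc)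
 then show ?thesis using yS scl(4)[OF u yS] by simp
 qed
 next
 case 3
 then show ?thesis using in1 ac inv_one by simp
 qed
 then have "place R k S" by (rule local_model_place[OF L rat])
 then show "S : {S. place R k S}" by simp
 qed
 show "{S. place R k S} <= {S : weierstrass_model R k x y. rational_over R k S}"
 proof
 fix V assume "V : {S. place R k S}"
 then have V: "place R k V" by simp
 note P = placeD[OF V] note vcl = subcl[OF P(5)]
 have "\<exists>z\<in>{x, y, 1.}. \<exists>I. prime_in R (chart R k [x, y, 1.] z) I & V = localization R (chart R k [x, y, 1.] z) I"
 proof (cases "x : V")
 case True
 have sxV: "sx : V" by (rule coordinates_in(2)[OF P(5,4) True])
 have yV: "y : V" by (rule coordinates_in(3)[OF P(5,4) True S.pole_of_y[OF P(1,4) sxV]])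
 have z: "1. : {x, y, 1.}" by simp
 note c = ch[OF z]
 have "chart R k [x, y, 1.] 1. <= V"
 unfolding chart_def
 proof (rule generate_ring_min_subring1[OF gen[OF z] P(5)])
 show "k \<union> {w$inv 1. | w. w : set [x, y, 1.]} <= V" using P(4) True yV vcl(2) ac inv_one by auto
 qed
 moreover have "x : chart R k [x, y, 1.] 1." "y : chart R k [x, y, 1.] 1." using c(3,4) ac inv_one by simp_all
 ultimately show ?thesis using place_localization[OF V c(1,2)] z by metis
 next
 case False
 note pp = place_pole[OF V False]
 have V1: "x$inv y : V" "inv y : V" using pp nonunits_iff[OF P(5)] by blast+
 have z: "y : {x, y, 1.}" by simp
 note c = ch[OF z]
 have "chart R k [x, y, 1.] y <= V"
 unfolding chart_def
 proof (rule generate_ring_min_subring1[OF gen[OF z] P(5)])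
 show "k \<union> {w$inv y | w. w : set [x, y, 1.]} <= V" using P(4) V1 vcl(2) inv_c by auto
 qed
 moreover have "x$inv y : chart R k [x, y, 1.] y" "inv y : chart R k [x, y, 1.] y" using c(3,5) inv_c by simp_all
 ultimately show ?thesis using place_localization[OF V c(1,2)] z pp by metis
 qed
 then obtain z I where z: "z : {x, y, 1.}" "prime_in R (chart R k [x, y, 1.] z) I" "V = localization R (chart R k [x, y, 1.] z) I" by blast
 have "primeideal I (R(|carrier := chart R k [x, y, 1.] z|))" using prime_in_iff[OF ch(1)[OF z(1)]] z(2) by blast
 then have "V : weierstrass_model R k x y"
 unfolding weierstrass_model_def proj_model_def affine_model_def using z(1,3) by auto
 then show "V : {S : weierstrass_model R k x y. rational_over R k S}" using P(2) by simp
 qed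
qed

end

section \<open>Points of projective models, isomorphisms of short equations\<close>

context field

begin

lemma subring_hom_facts:
 assumes P: "subring P R" and L: "ring L" and h: "h : ring_hom (R(|carrier := P|)) L"
 shows "!!u. u : P ==> h u : carrier L" "h 1. = 1.\<^bsub>L\<^esub>" "h 0. = 0.\<^bsub>L\<^esub>"
 "!!u v. u : P ==> v : P ==> h (u$v) = h u $\<^bsub>L\<^esub> h v"
 "!!u v. u : P ==> v : P ==> h (u+.v) = h u +.\<^bsub>L\<^esub> h v"
 "!!u v. u : P ==> v : P ==> h (u-.v) = h u -.\<^bsub>L\<^esub> h v"
 "!!u n. u : P ==> h ([(n::nat)] #. u) = [n] #.\<^bsub>L\<^esub> h u"
proof -
 interpret L: ring L by (rule L)
 note pcl = subcl[OF P] and pc = subcarr[OF P]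
 show c: "h u : carrier L" if "u : P" for u using ring_hom_closed[OF h, of u] that by simp
 show "h 1. = 1.\<^bsub>L\<^esub>" using ring_hom_one[OF h] by simp
 show "h (u$v) = h u $\<^bsub>L\<^esub> h v" if "u : P" "v : P" for u v using ring_hom_mult[OF h, of u v] that by simp
 show a: "h (u+.v) = h u +.\<^bsub>L\<^esub> h v" if "u : P" "v : P" for u v using ring_hom_add[OF h, of u v] that by simp
 have "h 0. +.\<^bsub>L\<^esub> h 0. = h 0." using a[OF pcl(1,1)] by simp
 then show z: "h 0. = 0.\<^bsub>L\<^esub>" using c[OF pcl(1)] L.add.l_cancel_one by metis
 have n: "h ( -. v) = -.\<^bsub>L\<^esub> h v" if v: "v : P" for v
 proof -
 have "h ( -. v) +.\<^bsub>L\<^esub> h v = 0.\<^bsub>L\<^esub>" unfolding a[OF pcl(3)[OF v] v, symmetric] using pc[OF v] z by (simp add: l_neg)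
 then show ?thesis using L.minus_equality[of "h ( -. v)" "h v"] c[OF v] c[OF pcl(3)[OF v]] by simp
 qed
 show "h (u-.v) = h u -.\<^bsub>L\<^esub> h v" if "u : P" "v : P" for u v
 unfolding a_minus_def using a[OF that(1) pcl(3)[OF that(2)]] n[OF that(2)] by simp
 show "h ([n] #. u) = [n] #.\<^bsub>L\<^esub> h u" if u: "u : P" for u and n :: nat
 proof (induction n)
 case 0
 then show ?case using z by simp
 next
 case (Suc n)
 then show ?case using a[OF pcl(8)[OF u, of n] u] by simp
 qed
qed

lemma residue_eq_iff:
 assumes P: "local_subring R P" and uv: "u : P" "v : P"
 shows "residue R P u = residue R P v \<longleftrightarrow> u-.v : nonunits R P"
proof -
 note rf = residue_field_facts[OF P] and PD = lsubD(1)[OF P]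
 interpret L: field "residue_field R P" by (rule rf(1))
 note hf = subring_hom_facts[OF PD L.ring_axioms rf(2)]
 show ?thesis
 unfolding rf(4)[OF subcl(6)[OF PD uv], symmetric] hf(6)[OF uv] using L.r_right_minus_eq[OF hf(1)[OF uv(1)] hf(1)[OF uv(2)]] by simp
qed

text \<open>A single chart already has the full function field as its fractions, because every ratio
  w/z' of coordinates is the quotient of w/z by z'/z.\<close>

lemma model_point:
 assumes k: "subfield k R" and K: "subfield K R" "k <= K" and M: "projective_variety R k K M" and S: "S : M"
 shows "local_subring R S" "k <= S" "S <= K" "\<forall>z\<in>K. \<exists>a\<in>S. \<exists>b\<in>S. b ~= 0. & z = a$inv b"
proof -
 note Kf = sf_facts[OF K(1)] and Kcl = subcl[OF sf_facts(1)[OF K(1)]]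
 obtain zs where zs: "set zs <= K - {0.}"
 and gen: "generate_field R (k \<union> {w$inv z | w z. w : set zs & z : set zs}) = K" and M: "M = proj_model R k zs"
 using M unfolding projective_variety_def by blast
 obtain z I where z: "z : set zs" and I: "primeideal I (R(|carrier := chart R k zs z|))" "S = localization R (chart R k zs z) I"
 using S unfolding M proj_model_def affine_model_def by blast
 have zK: "w : K" "w ~= 0." "w : carrier R" "inv w : K" "inv w : carrier R" if w: "w : set zs" for w
 proof -
 show 1: "w : K" "w ~= 0." using zs w by blast+
 show 2: "inv w : K" by (rule Kf(3)[OF 1])
 show "w : carrier R" "inv w : carrier R" by (rule Kf(2)[OF 1(1)], rule Kf(2)[OF 2])
 qed
 let ?H = "k \<union> {w$inv z | w. w : set zs}" and ?A = "chart R k zs z"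
 have HK: "?H <= K"
 proof
 fix v assume "v : ?H"
 then show "v : K" using K(2) Kcl(4)[OF zK(1) zK(4)[OF z]] by blast
 qed
 have HC: "?H <= carrier R" using HK Kf(2) by blast
 note g = generate_ringE[OF HC refl, folded chart_def]
 have pr: "prime_in R ?A I" using prime_in_iff[OF g(1)] I(1) by blast
 show L: "local_subring R S" unfolding I(2) by (rule localization_facts(1)[OF g(1) pr])
 have AS: "?A <= S" unfolding I(2) using subset_localization[OF g(1) pr] by blast
 show "k <= S" using g(2) AS by blast
 have AK: "?A <= K" by (rule g(3)[OF Kf(1) HK])
 show "S <= K"
 proof
 fix v assume "v : S"
 then obtain u s where us: "v = u$inv s" "u : ?A" "s : ?A - I" unfolding I(2) localization_def by blast
 have "s ~= 0." using us(3) pr unfolding prime_in_def by blast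
 then have "inv s : K" using Kf(3) us(3) AK by blast
 then show "v : K" unfolding us(1) using Kcl(4) us(2) AK by blast
 qed
 let ?Q = "localization R ?A {0.}"
 have Q: "subfield ?Q R" by (rule fractions_subfield[OF g(1)])
 have AQ: "?A <= ?Q" using subset_localization[OF g(1) zero_prime[OF g(1)]] by blast
 have GQ: "k \<union> {w$inv z | w z. w : set zs & z : set zs} <= ?Q"
 proof
 fix v assume v: "v : k \<union> {w$inv z | w z. w : set zs & z : set zs}"
 show "v : ?Q"
 proof (cases "v : k")
 case True
 then show ?thesis using g(2) AQ by blast
 next
 case False
 then obtain w z' where w: "v = w$inv z'" "w : set zs" "z' : set zs" using v by blast
 have m: "w$inv z : ?A" "z'$inv z : ?A" using g(2) w(2,3) by blast+
 have n: "z'$inv z ~= 0." using zK[OF w(3)] zK[OF z] by simp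
 have "(w$inv z)$inv (z'$inv z) = (w$inv z)$(z$inv z')"
 using fraction_inv[OF zK(3)[OF w(3)] zK(3)[OF z] zK(2)[OF z] zK(2)[OF w(3)]] by simp
 also have "... = (z$inv z)$(w$inv z')"
 by (reify rsimps, rule ring_id, simp add: zK[OF w(2)] zK[OF w(3)] zK[OF z], simp, code_simp)
 also have "... = v" unfolding w(1) using zK[OF w(2)] zK[OF w(3)] zK[OF z] by simp
 finally have "v = (w$inv z)$inv (z'$inv z)" by simp
 then show ?thesis using localizationI[OF m, of "{0.}"] n by simp
 qed
 qed
 have QC: "?Q <= carrier R" using sf_facts(2)[OF Q] by blast
 have KQ: "K <= ?Q" using generate_field_min_subfield1[OF subset_trans[OF GQ QC] Q GQ] unfolding gen .
 show "\<forall>z\<in>K. \<exists>a\<in>S. \<exists>b\<in>S. b ~= 0. & z = a$inv b"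
 proof
 fix v assume "v : K"
 then obtain u s where us: "v = u$inv s" "u : ?A" "s : ?A - {0.}" using KQ unfolding localization_def by blast
 then show "\<exists>a\<in>S. \<exists>b\<in>S. b ~= 0. & v = a$inv b" using AS by blast
 qed
qed

lemma weierstrass_eq_short:
 assumes "a : carrier R" "b : carrier R" "u : carrier R" "v : carrier R"
 shows "weierstrass_eq R (Weierstrass 0. 0. 0. a b) u v \<longleftrightarrow> v$v = u$u$u+.a$u+.b"
 using assms by (simp add: numeral_2_eq_2 numeral_3_eq_3 m_assoc)

lemma short_discriminant:
 assumes "a : carrier R" "b : carrier R"
 shows "discriminant R (Weierstrass 0. 0. 0. a b) =-.([(16::nat)] #. ([(4::nat)] #. (a$a$a)+.[(27::nat)] #. (b$b)))"
 unfolding discriminant_def wei_b2.simps wei_b4.simps wei_b6.simps wei_b8.simps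
 by (reify rsimps, rule ring_id, simp add: assms, simp, code_simp)

lemma natmult_nonzero:
 assumes "[(n::nat)] #. 1. ~= 0." "u : carrier R" "u ~= 0."
 shows "[n] #. u ~= 0."
 using add_pow_ldistr[of \<one> u n] assms by auto

text \<open>With 2 and 3 invertible, a change of variables between short equations has r = s = t =
  0, so a = u^4 a' and b = u^6 b'. Both sides of the relation for j have weight 12.\<close>

lemma short_isomorphism_j:
 assumes two: "[(2::nat)] #. 1. ~= 0." and three: "[(3::nat)] #. 1. ~= 0."
 and c: "a : carrier R" "b : carrier R" "a' : carrier R" "b' : carrier R" "j : carrier R" "j' : carrier R"
 and i: "(Weierstrass 0. 0. 0. a b, Weierstrass 0. 0. 0. a' b') : weierstrass_iso R"
 and d: "[(4::nat)] #. (a$a$a)+.[(27::nat)] #. (b$b) ~= 0."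
 and j: "j$([(4::nat)] #. (a$a$a)+.[(27::nat)] #. (b$b)) = [(16::nat)] #. ([(16::nat)] #. ([(27::nat)] #. (a$a$a)))"
 and j': "j'$([(4::nat)] #. (a'$a'$a')+.[(27::nat)] #. (b'$b')) = [(16::nat)] #. ([(16::nat)] #. ([(27::nat)] #. (a'$a'$a')))"
 shows "j = j'"
proof -
 obtain u r s t where u: "u : carrier R" and rst: "r : carrier R" "s : carrier R" "t : carrier R"
 and ch: "weierstrass_change R u r s t (Weierstrass 0. 0. 0. a b) (Weierstrass 0. 0. 0. a' b')"
 using i unfolding weierstrass_iso_def by blast
 have h: "u$0. = 0.+.[(2::nat)] #. s"
 "u [^] (2::nat)$0. = 0.-.s$0.+.[(3::nat)] #. r-.s [^] (2::nat)"
 "u [^] (3::nat)$0. = 0.+.r$0.+.[(2::nat)] #. t"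
 "u [^] (4::nat)$a' = a-.s$0.+.[(2::nat)] #. (r$0.)-.(t+.r$s)$0.+.[(3::nat)] #. (r [^] (2::nat))-.[(2::nat)] #. (s$t)"
 "u [^] (6::nat)$b' = b+.r$a+.r [^] (2::nat)$0.+.r [^] (3::nat)-.t$0.-.t [^] (2::nat)-.r$t$0."
 using ch unfolding weierstrass_change.simps by blast+
 have s0: "s = 0." using h(1) natmult_nonzero[OF two rst(2)] u rst by auto
 have t0: "t = 0." using h(3) natmult_nonzero[OF two rst(3)] u rst by auto
 have r0: "r = 0." using h(2) natmult_nonzero[OF three rst(1)] u rst unfolding s0 by (auto simp: minus_eq numeral_2_eq_2)
 have a: "a = u [^] (4::nat)$a'" using h(4) u c unfolding s0 t0 r0 by (simp add: minus_eq numeral_2_eq_2)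
 have b: "b = u [^] (6::nat)$b'" using h(5) u c unfolding s0 t0 r0 by (simp add: minus_eq numeral_2_eq_2 numeral_3_eq_3)
 let ?U = "u [^] (12::nat)" and ?D = "[(4::nat)] #. (a$a$a)+.[(27::nat)] #. (b$b)" and ?D' = "[(4::nat)] #. (a'$a'$a')+.[(27::nat)] #. (b'$b')"
 have D: "?D = ?U$?D'" unfolding a b by (reify rsimps, rule ring_id, simp add: u c, simp, code_simp)
 have "j'$?D = ?U$(j'$?D')" unfolding D by (reify rsimps, rule ring_id, simp add: u c, simp, code_simp)
 also have "... = [(16::nat)] #. ([(16::nat)] #. ([(27::nat)] #. (a$a$a)))"
 unfolding j' a by (reify rsimps, rule ring_id, simp add: u c, simp, code_simp)
 finally have "j'$?D = j$?D" using j by simp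
 then show ?thesis using m_rcancel[of ?D j' j] d c by simp
qed

text \<open>Reflexivity turns equality of two classes into an isomorphism between the curves that
  define them.\<close>

lemma weierstrass_iso_refl:
 assumes W: "W : elliptic_curves R (carrier R)"
 shows "(W, W) : weierstrass_iso R"
proof -
 obtain a1 a2 a3 a4 a6 where W': "W = Weierstrass a1 a2 a3 a4 a6" by (cases W)
 have c: "a1 : carrier R" "a2 : carrier R" "a3 : carrier R" "a4 : carrier R" "a6 : carrier R"
 using W unfolding W' elliptic_curves_def by simp_all
 have "weierstrass_change R 1. 0. 0. 0. W W" unfolding W' using c by (simp add: minus_eq numeral_2_eq_2 numeral_3_eq_3)
 then show ?thesis unfolding weierstrass_iso_def using W
 by (simp only: mem_Collect_eq case_prod_conv) (intro conjI W exI[of _ \<one>] exI[of _ \<zero>], auto)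
qed

end

section \<open>Counting by fibres\<close>

lemma finite_elliptic_curves:
 assumes "finite (carrier G)"
 shows "finite (elliptic_curves G (carrier G))"
proof -
 let ?c = "carrier G"
 have "elliptic_curves G ?c <= (%(a1, a2, a3, a4, a6). Weierstrass a1 a2 a3 a4 a6) ` (?c \<times> ?c \<times> ?c \<times> ?c \<times> ?c)"
 proof
 fix W assume W: "W : elliptic_curves G ?c"
 obtain a1 a2 a3 a4 a6 where W': "W = Weierstrass a1 a2 a3 a4 a6" by (cases W)
 have "(a1, a2, a3, a4, a6) : ?c \<times> ?c \<times> ?c \<times> ?c \<times> ?c" using W unfolding W' elliptic_curves_def by simp
 then show "W : (%(a1, a2, a3, a4, a6). Weierstrass a1 a2 a3 a4 a6) ` (?c \<times> ?c \<times> ?c \<times> ?c \<times> ?c)"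
 unfolding W' by (rule rev_image_eqI) simp
 qed
 then show ?thesis by (rule finite_subset) (use assms in simp)
qed

lemma finite_quotient_of_finite: "finite A ==> finite (A // r)"
 unfolding quotient_def by simp

lemma finite_card_bounded:
 assumes "\<forall>Y. finite Y --> Y <= A --> card Y <= n"
 shows "finite A & card A <= n"
proof -
 have "finite A"
 proof (rule ccontr)
 assume "infinite A"
 then obtain Y where Y: "finite Y" "card Y = Suc n" "Y <= A" using infinite_arbitrarily_large[of A "Suc n"] by blast
 have "card Y <= n" using assms Y(1,3) by blast
 then show False using Y(2) by simp
 qed
 then show ?thesis using assms by blast
qed

text \<open>The bound is asked for finite subsets of the fibres because \<open>card\<close> is 0 on
  infinite sets; finiteness of \<open>A\<close> is part of the result.\<close>

lemma card_le_fibres: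
 assumes fib: "\<forall>v\<in>f ` A. \<forall>Y. finite Y --> Y <= {a : A. f a = v} --> card Y <= n"
 and S: "f ` A <= S" "finite S"
 shows "finite A & card A <= card S * n"
proof -
 have fi: "finite {a : A. f a = v} & card {a : A. f a = v} <= n" if "v : f ` A" for v
 by (rule finite_card_bounded) (use fib that in blast)
 have fA: "finite (f ` A)" using S finite_subset by blast
 have e: "A = (\<Union>v\<in>f ` A. {a : A. f a = v})" by blast
 have "finite (\<Union>v\<in>f ` A. {a : A. f a = v})" using fA fi by blast
 then have fin: "finite A" using e by simp
 have "card A <= (\<Sum>v\<in>f ` A. card {a : A. f a = v})" using card_UN_le[OF fA, of "%v. {a : A. f a = v}"] e by simp
 also have "... <= (\<Sum>v\<in>f ` A. n)" using fi by (intro sum_mono) blast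
 also have "... = card (f ` A) * n" by simp
 also have "... <= card S * n" using card_mono[OF S(2,1)] by simp
 finally show ?thesis using fin by simp
qed

section \<open>Identification of residue fields with a given finite field\<close>

context function_field

begin

lemma point_degree_card:
 assumes fin: "finite k" and P: "discrete_valuation_ring R K P" "k <= P"
 shows "finite (carrier (residue_field R P))" "card (carrier (residue_field R P)) = card k ^ point_degree R k P" "point_degree R k P \<ge> 1"
proof -
 let ?L = "residue_field R P" and ?h = "residue R P"
 have V: "valuation_ring R K P" using P(1) unfolding discrete_valuation_ring_def by blast
 interpret L: field ?L by (rule residue_field_facts(1)[OF valuation_ring_local[OF V KR]])
 note r = residue_field_finite[OF P]
 obtain n where n: "L.dimension n (?h ` k) (carrier ?L)" using r(1) unfolding L.finite_dimension_def by blast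
 have d: "point_degree R k P = n"
 unfolding point_degree_def ext_degree_def
 by (rule the_equality, rule n, erule L.dimension_is_inj[OF r(2) _ n])
 have ck: "card (?h ` k) = card k" by (rule card_image[OF r(3)])
 show f: "finite (carrier ?L)" "card (carrier ?L) = card k ^ point_degree R k P"
 using L.card_dimension[OF r(2) finite_imageI[OF fin] n] unfolding d ck by simp_all
 have "card {0.\<^bsub>?L\<^esub>, 1.\<^bsub>?L\<^esub>} <= card (carrier ?L)" using f(1) by (intro card_mono) auto
 then have "point_degree R k P ~= 0" using f(2) by (intro notI) simp
 then show "point_degree R k P \<ge> 1" by simp
qed

text \<open>The embedding \<tau> of \<open>k\<close> is fixed before the points. For polynomials
  over \<open>k\<close>, the value at \<open>j\<close> under any of these maps then depends only on
  the image of \<open>j\<close>, so equal images have equal kernels on k[j].\<close>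

lemma compatible_reductions:
 assumes fin: "finite k" and p: "Factorial_Ring.prime (p::nat)" "[p] #. 1. = 0."
 and G: "field G" "card (carrier G) = card k ^ n" "n \<ge> 1"
 shows "\<exists>\<tau>. \<forall>P. discrete_valuation_ring R K P & k <= P & point_degree R k P = n -->
 (\<exists>h. h : ring_hom (R(|carrier := P|)) G & h ` P = carrier G & (\<forall>v\<in>P. h v = 0.\<^bsub>G\<^esub> \<longleftrightarrow> v : nonunits R P) & (\<forall>c\<in>k. h c = \<tau> c))"
proof (cases "\<exists>P. discrete_valuation_ring R K P & k <= P & point_degree R k P = n")
 case False
 then show ?thesis by blast
next
 case True
 then obtain P0 where P0: "discrete_valuation_ring R K P0" "k <= P0" "point_degree R k P0 = n" by blast
 interpret G: field G by (rule G(1))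
 obtain d where d: "card k = p ^ d" using card_subfield_prime_power[OF p kR fin] by blast
 have dn: "card k ^ n = p ^ (d * n)" unfolding d by (simp add: power_mult)
 have k0: "card k ~= 0" using fin subcl(1)[OF kF(1)] by auto
 have Gfin: "finite (carrier G)" using G(2) k0 card_gt_0_iff[of "carrier G"] by simp
 have Gp: "[p] #.\<^bsub>G\<^esub> 1.\<^bsub>G\<^esub> = 0.\<^bsub>G\<^esub>" by (rule G.characteristic_of_card[OF Gfin, of p "d * n"]) (simp add: G(2) dn)
 have facts: "local_subring R P & field (residue_field R P) & finite (carrier (residue_field R P)) & card (carrier G) = card (carrier (residue_field R P))"
 if P: "discrete_valuation_ring R K P" "k <= P" "point_degree R k P = n" for P
 proof -
 have V: "valuation_ring R K P" using P(1) unfolding discrete_valuation_ring_def by blast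
 have L: "local_subring R P" by (rule valuation_ring_local[OF V KR])
 show ?thesis using L residue_field_facts(1)[OF L] point_degree_card(1,2)[OF fin P(1,2)] P(3) G(2) by simp
 qed
 note f0 = facts[OF P0]
 interpret L0: field "residue_field R P0" using f0 by blast
 have L0p: "[p] #.\<^bsub>residue_field R P0\<^esub> 1.\<^bsub>residue_field R P0\<^esub> = 0.\<^bsub>residue_field R P0\<^esub>"
 by (rule L0.characteristic_of_card[of p "d * n"]) (use f0 G(2) dn in simp_all)
 obtain \<psi>0 where \<psi>0: "\<psi>0 : ring_hom (residue_field R P0) G"
 using finite_fields_isomorphic[OF L0.field_axioms G(1) _ Gfin _ p(1) L0p Gp] f0 by blast
 define \<tau> where "\<tau> c = \<psi>0 (residue R P0 c)" for c
 have L0l: "local_subring R P0" using f0 by blast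
 note h0 = subring_hom_facts[OF lsubD(1)[OF L0l] L0.ring_axioms residue_field_facts(2)[OF L0l]]
 have kP0: "c : P0" if "c : k" for c using that P0(2) by blast
 note kcl = subcl[OF kF(1)]
 have \<tau>: "\<tau> c : carrier G" "\<tau> 1. = 1.\<^bsub>G\<^esub>" "\<tau> (c$e) = \<tau> c $\<^bsub>G\<^esub> \<tau> e" "\<tau> (c+.e) = \<tau> c +.\<^bsub>G\<^esub> \<tau> e" if "c : k" "e : k" for c e
 unfolding \<tau>_def using h0(1)[OF kP0] h0(2) h0(4)[OF kP0 kP0] h0(5)[OF kP0 kP0] that
 ring_hom_closed[OF \<psi>0] ring_hom_one[OF \<psi>0] ring_hom_mult[OF \<psi>0] ring_hom_add[OF \<psi>0] by simp_all
 have main: "\<exists>h. h : ring_hom (R(|carrier := P|)) G & h ` P = carrier G & (\<forall>v\<in>P. h v = 0.\<^bsub>G\<^esub> \<longleftrightarrow> v : nonunits R P) & (\<forall>c\<in>k. h c = \<tau> c)"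
 if P: "discrete_valuation_ring R K P" "k <= P" "point_degree R k P = n" for P
 proof -
 note f = facts[OF P]
 have Ll: "local_subring R P" using f by blast
 note rf = residue_field_facts[OF Ll]
 interpret L: field "residue_field R P" by (rule rf(1))
 note hh = subring_hom_facts[OF lsubD(1)[OF Ll] L.ring_axioms rf(2)]
 note r = residue_field_finite[OF P(1,2)]
 let ?L = "residue_field R P" and ?A = "residue R P ` k"
 \<comment> \<open>The embedding transported to the copy of \<open>k\<close> inside the residue
   field.\<close>
 define \<tau>' where "\<tau>' u = \<tau> (inv_into k (residue R P) u)" for u
 have \<tau>': "\<tau>' (residue R P c) = \<tau> c" if "c : k" for c unfolding \<tau>'_def using inv_into_f_f[OF r(3) that] by simp
 have kP: "c : P" if "c : k" for c using that P(2) by blast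
 have "\<tau>' : ring_hom (?L(|carrier := ?A|)) G"
 proof (rule ring_hom_memI)
 fix u v assume "u : carrier (?L(|carrier := ?A|))" "v : carrier (?L(|carrier := ?A|))"
 then obtain c e where ce: "c : k" "e : k" "u = residue R P c" "v = residue R P e" by auto
 show "\<tau>' (u $\<^bsub>?L(|carrier := ?A|)\<^esub> v) = \<tau>' u $\<^bsub>G\<^esub> \<tau>' v"
 using hh(4)[OF kP[OF ce(1)] kP[OF ce(2)]] \<tau>'[OF kcl(4)[OF ce(1,2)]] \<tau>(3)[OF ce(1,2)] \<tau>'[OF ce(1)] \<tau>'[OF ce(2)] ce(3,4) by simp
 show "\<tau>' (u +.\<^bsub>?L(|carrier := ?A|)\<^esub> v) = \<tau>' u +.\<^bsub>G\<^esub> \<tau>' v"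
 using hh(5)[OF kP[OF ce(1)] kP[OF ce(2)]] \<tau>'[OF kcl(5)[OF ce(1,2)]] \<tau>(4)[OF ce(1,2)] \<tau>'[OF ce(1)] \<tau>'[OF ce(2)] ce(3,4) by simp
 next
 show "\<tau>' 1.\<^bsub>?L(|carrier := ?A|)\<^esub> = 1.\<^bsub>G\<^esub>" using \<tau>'[OF kcl(2)] \<tau>(2)[OF kcl(2,2)] hh(2) by simp
 next
 fix u assume "u : carrier (?L(|carrier := ?A|))"
 then obtain c where "c : k" "u = residue R P c" by auto
 then show "\<tau>' u : carrier G" using \<tau>' \<tau>(1) by simp
 qed
 then interpret FE: field_embedding ?L G ?A \<tau>'
 by (intro field_embedding.intro field_embedding_axioms.intro L.field_axioms G(1) r(2))
 obtain \<psi> where \<psi>: "\<psi> : ring_hom ?L G" "bij_betw \<psi> (carrier ?L) (carrier G)" "\<forall>c\<in>?A. \<psi> c = \<tau>' c"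
 using FE.finite_extension_isomorphism[OF _ Gfin] f by (metis (no_types, lifting))
 define h where "h v = \<psi> (residue R P v)" for v
 have h1: "h : ring_hom (R(|carrier := P|)) G"
 proof (rule ring_hom_memI)
 fix u v assume "u : carrier (R(|carrier := P|))" "v : carrier (R(|carrier := P|))"
 then have uv: "u : P" "v : P" by simp_all
 show "h (u $\<^bsub>R(|carrier := P|)\<^esub> v) = h u $\<^bsub>G\<^esub> h v"
 unfolding h_def using hh(4)[OF uv] ring_hom_mult[OF \<psi>(1) hh(1)[OF uv(1)] hh(1)[OF uv(2)]] by simp
 show "h (u +.\<^bsub>R(|carrier := P|)\<^esub> v) = h u +.\<^bsub>G\<^esub> h v"
 unfolding h_def using hh(5)[OF uv] ring_hom_add[OF \<psi>(1) hh(1)[OF uv(1)] hh(1)[OF uv(2)]] by simp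
 next
 show "h 1.\<^bsub>R(|carrier := P|)\<^esub> = 1.\<^bsub>G\<^esub>" unfolding h_def using hh(2) ring_hom_one[OF \<psi>(1)] by simp
 next
 fix u assume "u : carrier (R(|carrier := P|))"
 then show "h u : carrier G" unfolding h_def using hh(1) ring_hom_closed[OF \<psi>(1)] by simp
 qed
 have h2: "h ` P = carrier G"
 unfolding h_def using rf(3) \<psi>(2) unfolding bij_betw_def by (metis image_image)
 have z: "\<psi> 0.\<^bsub>?L\<^esub> = 0.\<^bsub>G\<^esub>" using subring_hom_facts(3)[OF lsubD(1)[OF Ll] G.ring_axioms h1] hh(3) unfolding h_def by simp
 have h3: "\<forall>v\<in>P. h v = 0.\<^bsub>G\<^esub> \<longleftrightarrow> v : nonunits R P"
 proof
 fix v assume v: "v : P"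
 have "h v = 0.\<^bsub>G\<^esub> \<longleftrightarrow> residue R P v = 0.\<^bsub>?L\<^esub>"
 unfolding h_def z[symmetric] using inj_on_eq_iff[OF bij_betw_imp_inj_on[OF \<psi>(2)] hh(1)[OF v] L.zero_closed] .
 then show "h v = 0.\<^bsub>G\<^esub> \<longleftrightarrow> v : nonunits R P" using rf(4)[OF v] by simp
 qed
 have "\<forall>c\<in>k. h c = \<tau> c" unfolding h_def using \<psi>(3) \<tau>' by simp
 then show ?thesis using h1 h2 h3 by blast
 qed
 show ?thesis by (rule exI[of _ \<tau>], intro allI impI, elim conjE, rule main)
qed

end

lemma bij_betw_Collect_preimage:
 assumes "bij_betw f A B"
 shows "bij_betw f {a : A. Q (f a)} {b : B. Q b}"
proof (rule bij_betw_imageI)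
 show "inj_on f {a : A. Q (f a)}" by (rule inj_on_subset[OF bij_betw_imp_inj_on[OF assms]]) simp
 show "f ` {a : A. Q (f a)} = {b : B. Q b}" using bij_betw_imp_surj_on[OF assms] by auto
qed

lemma image_eq_iff_representatives:
 assumes "A <= B"
 shows "(\<forall>u\<in>B. \<exists>c\<in>A. f u = f c) \<longleftrightarrow> f ` A = f ` B"
proof
 assume "\<forall>u\<in>B. \<exists>c\<in>A. f u = f c"
 then have "f ` B <= f ` A" by blast
 with image_mono[OF assms, of f] show "f ` A = f ` B" by (rule subset_antisym)
next
 assume e: "f ` A = f ` B"
 show "\<forall>u\<in>B. \<exists>c\<in>A. f u = f c"
 proof
 fix u assume "u : B"
 then have "f u : f ` A" unfolding e by (rule imageI)
 then show "\<exists>c\<in>A. f u = f c" by blast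
 qed
qed

section \<open>The fibre over a good point\<close>

locale elliptic_fibration = FF: function_field F k K + WW: long_weierstrass F K x y a1 a2 a3 a4 a6
 for F (structure) and k K x y a1 a2 a3 a4 a6 +
 fixes C M p
 assumes finite_base: "finite k" and p: "Factorial_Ring.prime (p::nat)" "p > 3" "[p] #. 1. = 0."
 and curve: "smooth_projective_curve F k K C"
 and model: "minimal_regular_model F k K C (weierstrass_model F K x y) M"
 and j_transcendental: "FF.transcendental k (j_invariant F (Weierstrass a1 a2 a3 a4 a6))"

begin

abbreviation "j \<equiv> j_invariant F (Weierstrass a1 a2 a3 a4 a6)"

lemma closed_point:
 assumes P: "P : closed_points K C"
 shows "discrete_valuation_ring F K P" "k <= P" "local_subring F P"
proof -
 have PC: "P : C" "P ~= K" using P unfolding closed_points_def by blast+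
 have pv: "projective_variety F k K C" and reg: "regular_local_ring (F(|carrier := P|))"
 using curve PC unfolding smooth_projective_curve_def by blast+
 note mp = FF.model_point[OF FF.kR FF.KR FF.kK pv PC(1)]
 show "k <= P" "local_subring F P" by (rule mp(2), rule mp(1))
 obtain \<pi> where u: "uniformizer F P \<pi>" using FF.regular_uniformizer[OF mp(1,2,3) PC(2) mp(4) reg] by blast
 have "valuation_ring F K P" by (rule FF.uniformizer_valuation_ring[OF FF.lsubD(1)[OF mp(1)] mp(3) u FF.KR mp(4)])
 then show "discrete_valuation_ring F K P" unfolding discrete_valuation_ring_def using u by blast
qed

lemma small_nat_nonzero:
 assumes G: "field G" and "[p] #.\<^bsub>G\<^esub> 1.\<^bsub>G\<^esub> = 0.\<^bsub>G\<^esub>"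
 shows "[(2::nat)] #.\<^bsub>G\<^esub> 1.\<^bsub>G\<^esub> ~= 0.\<^bsub>G\<^esub>" "[(3::nat)] #.\<^bsub>G\<^esub> 1.\<^bsub>G\<^esub> ~= 0.\<^bsub>G\<^esub>" "[(16::nat)] #.\<^bsub>G\<^esub> 1.\<^bsub>G\<^esub> ~= 0.\<^bsub>G\<^esub>"
 "1.\<^bsub>G\<^esub> +.\<^bsub>G\<^esub> 1.\<^bsub>G\<^esub> ~= 0.\<^bsub>G\<^esub>" "1.\<^bsub>G\<^esub> +.\<^bsub>G\<^esub> 1.\<^bsub>G\<^esub> +.\<^bsub>G\<^esub> 1.\<^bsub>G\<^esub> ~= 0.\<^bsub>G\<^esub>"
proof -
 interpret G: field G by (rule G)
 have d: "~ p dvd 2" "~ p dvd 3" using p(2) dvd_imp_le[of p 2] dvd_imp_le[of p 3] by auto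
 have "~ p dvd 2 ^ 4" using prime_dvd_power[OF p(1), of 2 4] d(1) by blast
 then have d16: "~ p dvd 16" by simp
 note iff = G.nat_one_eq_zero_iff[OF p(1) assms(2)]
 show "[(2::nat)] #.\<^bsub>G\<^esub> 1.\<^bsub>G\<^esub> ~= 0.\<^bsub>G\<^esub>" "[(3::nat)] #.\<^bsub>G\<^esub> 1.\<^bsub>G\<^esub> ~= 0.\<^bsub>G\<^esub>" "[(16::nat)] #.\<^bsub>G\<^esub> 1.\<^bsub>G\<^esub> ~= 0.\<^bsub>G\<^esub>"
 using iff[of 2] iff[of 3] iff[of 16] d d16 by blast+
 moreover have "[(2::nat)] #.\<^bsub>G\<^esub> 1.\<^bsub>G\<^esub> = 1.\<^bsub>G\<^esub> +.\<^bsub>G\<^esub> 1.\<^bsub>G\<^esub>" "[(3::nat)] #.\<^bsub>G\<^esub> 1.\<^bsub>G\<^esub> = 1.\<^bsub>G\<^esub> +.\<^bsub>G\<^esub> 1.\<^bsub>G\<^esub> +.\<^bsub>G\<^esub> 1.\<^bsub>G\<^esub>"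
 by (simp_all add: numeral_2_eq_2 numeral_3_eq_3)
 ultimately show "1.\<^bsub>G\<^esub> +.\<^bsub>G\<^esub> 1.\<^bsub>G\<^esub> ~= 0.\<^bsub>G\<^esub>" "1.\<^bsub>G\<^esub> +.\<^bsub>G\<^esub> 1.\<^bsub>G\<^esub> +.\<^bsub>G\<^esub> 1.\<^bsub>G\<^esub> ~= 0.\<^bsub>G\<^esub>" by simp_all
qed

text \<open>The reduced equation is given by elements \<open>A\<close>, \<open>B\<close> of
  \<open>P\<close> and the map \<open>h\<close> into \<open>G\<close>, so that points with different
  residue fields become comparable over one field. Its point count comes from the chain: rational
  local rings of the fibre, rational local rings of the given cubic, places of the residue function
  field, points of the reduced equation.\<close>

lemma fibre_points:
 assumes P: "P : good_points F K C M Z" and G: "field G" "finite (carrier G)"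
 and h: "h : ring_hom (F(|carrier := P|)) G" "h ` P = carrier G" "\<forall>v\<in>P. h v = 0.\<^bsub>G\<^esub> \<longleftrightarrow> v : nonunits F P"
 shows "\<exists>A\<in>P. \<exists>B\<in>P. [(4::nat)] #.\<^bsub>G\<^esub> (h A $\<^bsub>G\<^esub> h A $\<^bsub>G\<^esub> h A) +.\<^bsub>G\<^esub> [(27::nat)] #.\<^bsub>G\<^esub> (h B $\<^bsub>G\<^esub> h B) ~= 0.\<^bsub>G\<^esub> &
 card (rational_points F M P) = card (weierstrass_points G (Weierstrass 0.\<^bsub>G\<^esub> 0.\<^bsub>G\<^esub> 0.\<^bsub>G\<^esub> (h A) (h B))) &
 j$([(4::nat)] #. (A$A$A)+.[(27::nat)] #. (B$B)) = [(16::nat)] #. ([(16::nat)] #. ([(27::nat)] #. (A$A$A)))"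
proof -
 interpret G: field G by (rule G(1))
 have Pc: "P : closed_points K C" and ef: "elliptic_fibre F M Z P" using P unfolding good_points_def by blast+
 note cp = closed_point[OF Pc]
 obtain \<pi> where PV: "valuation_ring F K P" and \<pi>: "uniformizer F P \<pi>" using cp(1) unfolding discrete_valuation_ring_def by (elim conjE exE) (rule that)
 note PD = FF.valuation_ringD[OF PV]
 note uf = FF.uniformizer_facts[OF PD(1) \<pi>]
 obtain \<eta> W' x' y' where int: "integral_fibre F M P \<eta>"
 and ell: "elliptic_function_field (residue_field F \<eta>) (residue F \<eta> ` P) W' x' y'"
 and bij: "bij_betw (%S. residue F \<eta> ` S) (fibre F M P) (weierstrass_model (residue_field F \<eta>) (residue F \<eta> ` P) x' y')"
 using ef unfolding elliptic_fibre_def by (elim exE conjE) (rule that)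
 have "regular_model F k K C (weierstrass_model F K x y) M" using model unfolding minimal_regular_model_def by (rule conjunct1)
 then have rm': "projective_variety F k (carrier F) M & (\<forall>S\<in>M. regular_local_ring (F(|carrier := S|))) &
 (\<forall>S\<in>M. \<exists>P\<in>C. dominates F S P) & {S : M. K <= S} = weierstrass_model F K x y"
 unfolding regular_model_def .
 note rm = conjunct1[OF rm'] conjunct1[OF conjunct2[OF rm']]
 have kc: "k <= carrier F" using FF.kF(2) by blast
 have mp: "local_subring F S" "k <= S" "\<forall>z\<in>carrier F. \<exists>a\<in>S. \<exists>b\<in>S. b ~= 0. & z = a$inv b" if "S : fibre F M P" for S
 proof -
 have S: "S : M" using that unfolding fibre_def by simp
 note m = FF.model_point[OF FF.kR FF.carrier_is_subfield kc rm(1) S]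
 show "local_subring F S" "k <= S" "\<forall>z\<in>carrier F. \<exists>a\<in>S. \<exists>b\<in>S. b ~= 0. & z = a$inv b" by (rule m(1), rule m(2), rule m(4))
 qed
 have dom': "P <= S & nonunits F P = P \<inter> nonunits F S" if "S : fibre F M P" for S
 proof -
 have "dominates F S P" using that unfolding fibre_def by simp
 then show ?thesis unfolding dominates_def .
 qed
 note dom = conjunct1[OF dom'] conjunct2[OF dom']
 have \<eta>f: "\<eta> : fibre F M P" using int unfolding integral_fibre_def by (rule conjunct1)
 have all: "\<forall>S\<in>fibre F M P. S <= \<eta> & genideal (F(|carrier := S|)) (nonunits F P) = S \<inter> nonunits F \<eta>"
 using int unfolding integral_fibre_def by (rule conjunct2)
 have sub: "S <= \<eta>" and gid: "genideal (F(|carrier := S|)) (nonunits F P) = S \<inter> nonunits F \<eta>" if "S : fibre F M P" for S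
 by (rule conjunct1[OF bspec[OF all that]], rule conjunct2[OF bspec[OF all that]])
 note \<eta>p = mp[OF \<eta>f] and \<eta>d = dom[OF \<eta>f]
 note \<eta>D = FF.lsubD[OF \<eta>p(1)]
 note \<eta>cl = FF.subcl[OF \<eta>D(1)] and \<eta>c = FF.subcarr[OF \<eta>D(1)]
 interpret \<eta>R: domain "F(|carrier := \<eta>|)" by (rule FF.subring_is_domain[OF \<eta>D(1)])
 have \<pi>\<eta>: "\<pi> : nonunits F \<eta>" using uf(4) \<eta>d(2) by blast
 have \<pi>\<eta>': "\<pi> : \<eta>" using uf(1) \<eta>d(1) by blast
 \<comment> \<open>\<open>integral_fibre\<close>, applied to the generic point \<eta> itself, says
   that the nonunits of \<open>P\<close> generate those of \<eta>. So a uniformizer of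
   \<open>P\<close> is one of \<eta>.\<close>
 have unif: "\<forall>v\<in>nonunits F \<eta>. \<exists>w\<in>\<eta>. v = \<pi>$w"
 proof
 fix v assume v: "v : nonunits F \<eta>"
 have "v : \<eta>" using v FF.nonunits_iff[OF \<eta>D(1)] by blast
 then have "v : genideal (F(|carrier := \<eta>|)) (nonunits F P)" unfolding gid[OF \<eta>f] using v by blast
 moreover have "genideal (F(|carrier := \<eta>|)) (nonunits F P) <= cgenideal (F(|carrier := \<eta>|)) \<pi>"
 proof (rule \<eta>R.genideal_minimal[OF \<eta>R.cgenideal_ideal])
 show "\<pi> : carrier (F(|carrier := \<eta>|))" using \<pi>\<eta>' by simp
 show "nonunits F P <= cgenideal (F(|carrier := \<eta>|)) \<pi>"
 proof
 fix u assume "u : nonunits F P"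
 then obtain w where w: "w : P" "u = \<pi>$w" using \<pi> unfolding uniformizer_def by blast
 have "w : \<eta>" using w(1) \<eta>d(1) by blast
 then show "u : cgenideal (F(|carrier := \<eta>|)) \<pi>" unfolding cgenideal_def w(2) using FF.m_comm[OF uf(2) \<eta>c[OF \<open>w \<in> \<eta>\<close>]] by auto
 qed
 qed
 ultimately have "v : cgenideal (F(|carrier := \<eta>|)) \<pi>" by blast
 then obtain w where "w : \<eta>" "v = w$\<pi>" unfolding cgenideal_def by auto
 then show "\<exists>w\<in>\<eta>. v = \<pi>$w" using FF.m_comm[OF \<eta>c uf(2)] by blast
 qed
 have "noetherian_ring (F(|carrier := \<eta>|))" using rm(2) \<eta>f unfolding fibre_def regular_local_ring_def by blast
 then have u\<eta>: "uniformizer F \<eta> \<pi>" using FF.uniformizerI[OF \<eta>D(1) _ \<pi>\<eta> uf(3) unif] by blast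
 have \<eta>V: "valuation_ring F (carrier F) \<eta>"
 by (rule FF.uniformizer_valuation_ring[OF \<eta>D(1) _ u\<eta> FF.carrier_is_subfield \<eta>p(3)]) (use \<eta>c in blast)
 \<comment> \<open>This ring dominates the valuation ring \<open>P\<close>; hence the residues of
   \<open>K\<close> at \<eta> are exactly those of \<open>P\<close>.\<close>
 have KP: "K \<inter> \<eta> = P"
 proof (rule FF.dominating_eq[OF PV])
 note Ks = FF.subcl[OF FF.KF(1)]
 show s: "subring (K \<inter> \<eta>) F" using FF.subring_inter[OF FF.KF(1) \<eta>D(1)] .
 show "K \<inter> \<eta> <= K" "P <= K \<inter> \<eta>" using PD(2) \<eta>d(1) by blast+
 show "nonunits F P <= nonunits F (K \<inter> \<eta>)"
 proof
 fix v assume v: "v : nonunits F P"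
 have "v : nonunits F \<eta>" "v : P" using v \<eta>d(2) by blast+
 then show "v : nonunits F (K \<inter> \<eta>)" using FF.nonunits_iff[OF s] FF.nonunits_iff[OF \<eta>D(1)] PD(2) by blast
 qed
 qed
 define L where "L = residue_field F \<eta>"
 define \<rho> where "\<rho> = residue F \<eta>"
 define \<kappa> where "\<kappa> = \<rho> ` P"
 note rf = FF.residue_field_facts[OF \<eta>p(1), folded L_def \<rho>_def]
 interpret L: field L by (rule rf(1))
 note rh = FF.subring_hom_facts[OF \<eta>D(1) L.ring_axioms rf(2)]
 have hh: "!!u. u : P ==> h u : carrier G" "h 1. = 1.\<^bsub>G\<^esub>" "h 0. = 0.\<^bsub>G\<^esub>"
 "!!u v. u : P ==> v : P ==> h (u$v) = h u $\<^bsub>G\<^esub> h v"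
 "!!u v. u : P ==> v : P ==> h (u+.v) = h u +.\<^bsub>G\<^esub> h v"
 "!!u v. u : P ==> v : P ==> h (u-.v) = h u -.\<^bsub>G\<^esub> h v"
 "!!u n. u : P ==> h ([(n::nat)] #. u) = [n] #.\<^bsub>G\<^esub> h u"
 by (fact FF.subring_hom_facts[OF PD(1) G.ring_axioms h(1)])+
 note pcl = FF.subcl[OF PD(1)]
 have P\<eta>: "u : \<eta>" if "u : P" for u using that \<eta>d(1) by blast
 have same: "\<rho> u = \<rho> v \<longleftrightarrow> h u = h v" if uv: "u : P" "v : P" for u v
 proof -
 have m: "u-.v : P" by (rule pcl(6)[OF uv])
 have "\<rho> u = \<rho> v \<longleftrightarrow> u-.v : nonunits F \<eta>" unfolding \<rho>_def by (rule FF.residue_eq_iff[OF \<eta>p(1) P\<eta>[OF uv(1)] P\<eta>[OF uv(2)]])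
 also have "... \<longleftrightarrow> u-.v : nonunits F P" using \<eta>d(2) m by blast
 also have "... \<longleftrightarrow> h (u-.v) = 0.\<^bsub>G\<^esub>" using h(3) m by blast
 also have "... \<longleftrightarrow> h u = h v" unfolding hh(6)[OF uv] by (rule G.r_right_minus_eq[OF hh(1)[OF uv(1)] hh(1)[OF uv(2)]])
 finally show ?thesis .
 qed
 \<comment> \<open>\<rho> and \<open>h\<close> have the same kernel on \<open>P\<close>, so
   \<open>h\<close> induces an isomorphism of \<kappa> with \<open>G\<close>.\<close>
 define g where "g z = h (SOME u. u : P & \<rho> u = z)" for z
 have g: "g (\<rho> u) = h u" if u: "u : P" for u
 proof -
 have s: "(SOME v. v : P & \<rho> v = \<rho> u) : P & \<rho> (SOME v. v : P & \<rho> v = \<rho> u) = \<rho> u"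
 by (rule someI[of "%v. v : P & \<rho> v = \<rho> u" u]) (use u in simp)
 then show ?thesis unfolding g_def using same u by blast
 qed
 have gbij: "bij_betw g \<kappa> (carrier G)"
 unfolding bij_betw_def
 proof
 show "inj_on g \<kappa>"
 proof (rule inj_onI)
 fix z w assume "z : \<kappa>" "w : \<kappa>" "g z = g w"
 then obtain u v where "u : P" "v : P" "z = \<rho> u" "w = \<rho> v" "g (\<rho> u) = g (\<rho> v)" unfolding \<kappa>_def by blast
 then show "z = w" using g same by metis
 qed
 have "g ` \<kappa> = h ` P" unfolding \<kappa>_def image_image using g by (intro image_cong) simp_all
 then show "g ` \<kappa> = carrier G" using h(2) by simp
 qed
 have \<kappa>s: "subring \<kappa> L"
 proof (rule L.subringI)
 show "\<kappa> <= carrier L" unfolding \<kappa>_def using rh(1) P\<eta> by blast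
 show "1.\<^bsub>L\<^esub> : \<kappa>" unfolding \<kappa>_def using rh(2) pcl(2) by (metis image_eqI)
 fix z w assume "z : \<kappa>" "w : \<kappa>"
 then obtain u v where uv: "u : P" "v : P" "z = \<rho> u" "w = \<rho> v" unfolding \<kappa>_def by blast
 note e = P\<eta>[OF uv(1)] P\<eta>[OF uv(2)]
 have "0.-.u : P" "\<rho> ( 0.-.u) = -.\<^bsub>L\<^esub> z"
 using pcl(6)[OF pcl(1) uv(1)] rh(6)[OF \<eta>cl(1) e(1)] rh(3) rh(1)[OF e(1)] uv(3) by (simp_all add: L.minus_eq)
 then show "-.\<^bsub>L\<^esub> z : \<kappa>" unfolding \<kappa>_def by (metis image_eqI)
 show "z $\<^bsub>L\<^esub> w : \<kappa>" unfolding \<kappa>_def uv(3,4) rh(4)[OF e, symmetric] using pcl(4)[OF uv(1,2)] by blast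
 show "z +.\<^bsub>L\<^esub> w : \<kappa>" unfolding \<kappa>_def uv(3,4) rh(5)[OF e, symmetric] using pcl(5)[OF uv(1,2)] by blast
 qed
 have \<kappa>F: "subfield \<kappa> L"
 proof (rule L.subfieldI_inv[OF \<kappa>s])
 fix z assume z: "z : \<kappa>" "z ~= 0.\<^bsub>L\<^esub>"
 then obtain u where u: "u : P" "z = \<rho> u" unfolding \<kappa>_def by blast
 have n: "u ~: nonunits F P" using z(2) rf(4)[OF P\<eta>[OF u(1)]] \<eta>d(2) u by blast
 note i = FF.unit_inv[OF PD(1) u(1) n]
 have "z $\<^bsub>L\<^esub> \<rho> (inv u) = 1.\<^bsub>L\<^esub>"
 unfolding u(2) rh(4)[OF P\<eta>[OF u(1)] P\<eta>[OF i(2)], symmetric] using i(1) \<eta>c[OF P\<eta>[OF u(1)]] rh(2) by simp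
 then have "inv\<^bsub>L\<^esub> z = \<rho> (inv u)" using L.inv_unique_field rh(1)[OF P\<eta>[OF u(1)]] rh(1)[OF P\<eta>[OF i(2)]] u(2) by blast
 then show "inv\<^bsub>L\<^esub> z : \<kappa>" unfolding \<kappa>_def using i(2) by blast
 qed
 have \<kappa>fin: "finite \<kappa>" using bij_betw_finite[OF gbij] G(2) by simp
 have "[p] #.\<^bsub>L\<^esub> 1.\<^bsub>L\<^esub> = 0.\<^bsub>L\<^esub>" using rh(7)[OF \<eta>cl(2), of p] p(3) rh(2,3) by simp
 note small = small_nat_nonzero[OF L.field_axioms this]
 obtain b1 b2 b3 b4 b6 where W': "W' = Weierstrass b1 b2 b3 b4 b6" by (cases W')
 interpret LW: long_weierstrass L \<kappa> x' y' b1 b2 b3 b4 b6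
 using ell[folded L_def \<rho>_def, folded \<kappa>_def] unfolding W'
 by (intro long_weierstrass.intro long_weierstrass_axioms.intro L.field_axioms \<kappa>F small(4,5))
 \<comment> \<open>Short coordinates on both sides: those of the generic equation over
   \<open>K\<close>, and those of the cubic that describes the fibre over \<kappa>.\<close>
 interpret CR: curve_reduction F K WW.sx WW.sy WW.sa WW.sb L \<kappa> LW.sx LW.sy LW.sa LW.sb \<eta> \<rho> \<pi>
 proof (intro curve_reduction.intro curve_reduction_axioms.intro WW.short_weierstrass LW.short_weierstrass)
 show "valuation_ring F (carrier F) \<eta>" by (rule \<eta>V)
 show "\<rho> : ring_hom (F(|carrier := \<eta>|)) L" "\<rho> ` \<eta> = carrier L" by (rule rf(2), rule rf(3))
 show "\<rho> v = 0.\<^bsub>L\<^esub> \<longleftrightarrow> v : nonunits F \<eta>" if "v : \<eta>" for v by (rule rf(4)[OF that])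
 show "\<kappa> = \<rho> ` (K \<inter> \<eta>)" unfolding KP \<kappa>_def ..
 show "finite \<kappa>" by (rule \<kappa>fin)
 show "\<pi> : K" "\<pi> : nonunits F \<eta>" "\<pi> ~= 0." using uf(1) PD(2) \<pi>\<eta> uf(3) by blast+
 show "\<exists>w\<in>\<eta>. v = \<pi>$w" if "v : nonunits F \<eta>" for v using unif that by blast
 show "\<exists>n::nat. \<forall>w\<in>\<eta>. v ~= \<pi> [^] n$w" if "v : \<eta>" "v ~= 0." for v using u\<eta> that unfolding uniformizer_def by blast
 show "1.\<^bsub>L\<^esub> +.\<^bsub>L\<^esub> 1.\<^bsub>L\<^esub> +.\<^bsub>L\<^esub> 1.\<^bsub>L\<^esub> ~= 0.\<^bsub>L\<^esub>" by (rule small(5))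
 qed
 from CR.reduced_weierstrass obtain \<mu> u' v' where \<mu>: "\<mu> : K" "\<mu> ~= 0."
 and AB\<eta>: "\<mu>$\<mu>$\<mu>$\<mu>$WW.sa : \<eta>" "\<mu>$\<mu>$\<mu>$\<mu>$\<mu>$\<mu>$WW.sb : \<eta>"
 and wf: "weierstrass_function_field L \<kappa> u' v' (\<rho> (\<mu>$\<mu>$\<mu>$\<mu>$WW.sa)) (\<rho> (\<mu>$\<mu>$\<mu>$\<mu>$\<mu>$\<mu>$WW.sb))"
 by (elim bexE exE conjE) (rule that)
 define A where "A = \<mu>$\<mu>$\<mu>$\<mu>$WW.sa"
 define B where "B = \<mu>$\<mu>$\<mu>$\<mu>$\<mu>$\<mu>$WW.sb"
 note Kcl = FF.subcl[OF FF.KF(1)]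
 have AP: "A : P" and BP: "B : P"
 proof -
 have "A : K" unfolding A_def by (rule Kcl(4)[OF Kcl(4)[OF Kcl(4)[OF Kcl(4)[OF \<mu>(1,1)] \<mu>(1)] \<mu>(1)] WW.sk(1)])
 then show "A : P" using AB\<eta>(1) KP unfolding A_def by blast
 have "B : K" unfolding B_def
 by (rule Kcl(4)[OF Kcl(4)[OF Kcl(4)[OF Kcl(4)[OF Kcl(4)[OF Kcl(4)[OF \<mu>(1,1)] \<mu>(1)] \<mu>(1)] \<mu>(1)] \<mu>(1)] WW.sk(2)])
 then show "B : P" using AB\<eta>(2) KP unfolding B_def by blast
 qed
 interpret RW: weierstrass_function_field L \<kappa> u' v' "\<rho> A" "\<rho> B" using wf unfolding A_def B_def .
 have \<kappa>P: "\<rho> u : \<kappa>" if "u : P" for u unfolding \<kappa>_def using that by blast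
 have gh: "g (u $\<^bsub>L\<^esub> v) = g u $\<^bsub>G\<^esub> g v" "g (u +.\<^bsub>L\<^esub> v) = g u +.\<^bsub>G\<^esub> g v" if uv: "u : \<kappa>" "v : \<kappa>" for u v
 proof -
 obtain c d where cd: "c : P" "d : P" "u = \<rho> c" "v = \<rho> d" using uv unfolding \<kappa>_def by blast
 note e = P\<eta>[OF cd(1)] P\<eta>[OF cd(2)]
 show "g (u $\<^bsub>L\<^esub> v) = g u $\<^bsub>G\<^esub> g v"
 unfolding cd(3,4) rh(4)[OF e, symmetric] g[OF pcl(4)[OF cd(1,2)]] g[OF cd(1)] g[OF cd(2)] by (rule hh(4)[OF cd(1,2)])
 show "g (u +.\<^bsub>L\<^esub> v) = g u +.\<^bsub>G\<^esub> g v"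
 unfolding cd(3,4) rh(5)[OF e, symmetric] g[OF pcl(5)[OF cd(1,2)]] g[OF cd(1)] g[OF cd(2)] by (rule hh(5)[OF cd(1,2)])
 qed
 note \<kappa>cl = L.subcl[OF \<kappa>s]
 have gc: "g u : carrier G" if "u : \<kappa>" for u using gbij that unfolding bij_betw_def by blast
 have hAB: "h A : carrier G" "h B : carrier G" by (rule hh(1)[OF AP], rule hh(1)[OF BP])
 let ?cu = "%(e, f). (g e, g f)"
 let ?S = "{(e, f). e : \<kappa> & f : \<kappa> & f $\<^bsub>L\<^esub> f = e $\<^bsub>L\<^esub> e $\<^bsub>L\<^esub> e +.\<^bsub>L\<^esub> \<rho> A $\<^bsub>L\<^esub> e +.\<^bsub>L\<^esub> \<rho> B}"
 let ?T = "{(e, f). e : carrier G & f : carrier G & weierstrass_eq G (Weierstrass 0.\<^bsub>G\<^esub> 0.\<^bsub>G\<^esub> 0.\<^bsub>G\<^esub> (h A) (h B)) e f}"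
 have equiv: "f $\<^bsub>L\<^esub> f = e $\<^bsub>L\<^esub> e $\<^bsub>L\<^esub> e +.\<^bsub>L\<^esub> \<rho> A $\<^bsub>L\<^esub> e +.\<^bsub>L\<^esub> \<rho> B \<longleftrightarrow>
 weierstrass_eq G (Weierstrass 0.\<^bsub>G\<^esub> 0.\<^bsub>G\<^esub> 0.\<^bsub>G\<^esub> (h A) (h B)) (g e) (g f)" if ef: "e : \<kappa>" "f : \<kappa>" for e f
 proof -
 have m: "f $\<^bsub>L\<^esub> f : \<kappa>" "e $\<^bsub>L\<^esub> e : \<kappa>" "e $\<^bsub>L\<^esub> e $\<^bsub>L\<^esub> e : \<kappa>" "\<rho> A $\<^bsub>L\<^esub> e : \<kappa>" by (rule \<kappa>cl(4) ef \<kappa>P[OF AP])+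
 have s: "e $\<^bsub>L\<^esub> e $\<^bsub>L\<^esub> e +.\<^bsub>L\<^esub> \<rho> A $\<^bsub>L\<^esub> e : \<kappa>" by (rule \<kappa>cl(5)[OF m(3,4)])
 have s2: "e $\<^bsub>L\<^esub> e $\<^bsub>L\<^esub> e +.\<^bsub>L\<^esub> \<rho> A $\<^bsub>L\<^esub> e +.\<^bsub>L\<^esub> \<rho> B : \<kappa>" by (rule \<kappa>cl(5)[OF s \<kappa>P[OF BP]])
 have 1: "f $\<^bsub>L\<^esub> f = e $\<^bsub>L\<^esub> e $\<^bsub>L\<^esub> e +.\<^bsub>L\<^esub> \<rho> A $\<^bsub>L\<^esub> e +.\<^bsub>L\<^esub> \<rho> B \<longleftrightarrow>
 g (f $\<^bsub>L\<^esub> f) = g (e $\<^bsub>L\<^esub> e $\<^bsub>L\<^esub> e +.\<^bsub>L\<^esub> \<rho> A $\<^bsub>L\<^esub> e +.\<^bsub>L\<^esub> \<rho> B)"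
 using inj_on_eq_iff[OF _ m(1) s2, of g] gbij unfolding bij_betw_def by simp
 show ?thesis unfolding 1 gh(2)[OF s \<kappa>P[OF BP]] gh(2)[OF m(3,4)] gh(1)[OF m(2) ef(1)] gh(1)[OF ef(1,1)] gh(1)[OF \<kappa>P[OF AP] ef(1)]
 gh(1)[OF ef(2,2)] g[OF AP] g[OF BP] G.weierstrass_eq_short[OF hAB gc[OF ef(1)] gc[OF ef(2)]] ..
 qed
 have inj: "inj_on g \<kappa>" and img: "g ` \<kappa> = carrier G" using gbij unfolding bij_betw_def by blast+
 have ST: "bij_betw ?cu ?S ?T"
 unfolding bij_betw_def
 proof
 show "inj_on ?cu ?S" using inj unfolding inj_on_def by auto
 show "?cu ` ?S = ?T"
 proof
 show "?cu ` ?S <= ?T"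
 proof
 fix z assume "z : ?cu ` ?S"
 then obtain w where w: "w : ?S" "z = ?cu w" by (rule imageE)
 obtain e f where ef: "w = (e, f)" by (cases w)
 have s: "e : \<kappa>" "f : \<kappa>" "f $\<^bsub>L\<^esub> f = e $\<^bsub>L\<^esub> e $\<^bsub>L\<^esub> e +.\<^bsub>L\<^esub> \<rho> A $\<^bsub>L\<^esub> e +.\<^bsub>L\<^esub> \<rho> B" using w(1) unfolding ef by simp_all
 have "weierstrass_eq G (Weierstrass 0.\<^bsub>G\<^esub> 0.\<^bsub>G\<^esub> 0.\<^bsub>G\<^esub> (h A) (h B)) (g e) (g f)" using equiv[OF s(1,2)] s(3) by (rule iffD1)
 then show "z : ?T" unfolding w(2) ef using gc[OF s(1)] gc[OF s(2)] by (simp only: mem_Collect_eq case_prod_conv simp_thms)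
 qed
 show "?T <= ?cu ` ?S"
 proof
 fix z assume "z : ?T"
 then obtain e f where ef: "z = (e, f)" "e : carrier G" "f : carrier G"
 "weierstrass_eq G (Weierstrass 0.\<^bsub>G\<^esub> 0.\<^bsub>G\<^esub> 0.\<^bsub>G\<^esub> (h A) (h B)) e f" by blast
 obtain e0 f0 where 0: "e0 : \<kappa>" "e = g e0" "f0 : \<kappa>" "f = g f0" using ef(2,3) img by blast
 have "(e0, f0) : ?S" using equiv[OF 0(1,3)] ef(4) 0 by simp
 then show "z : ?cu ` ?S" unfolding ef(1) 0(2,4) by (rule rev_image_eqI) simp
 qed
 qed
 qed
 have finS: "finite ?S" by (rule finite_subset[of _ "\<kappa> \<times> \<kappa>"]) (use \<kappa>fin in auto)
 have "card (weierstrass_points (L(|carrier := \<kappa>|)) (Weierstrass 0.\<^bsub>L\<^esub> 0.\<^bsub>L\<^esub> 0.\<^bsub>L\<^esub> (\<rho> A) (\<rho> B))) = Suc (card ?S)"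
 unfolding RW.weierstrass_points_short using finS by (simp add: card_insert_if card_image)
 moreover have "card (weierstrass_points G (Weierstrass 0.\<^bsub>G\<^esub> 0.\<^bsub>G\<^esub> 0.\<^bsub>G\<^esub> (h A) (h B))) = Suc (card ?T)"
 unfolding weierstrass_points_def using bij_betw_finite[OF ST] finS by (simp add: card_insert_if card_image)
 ultimately have pts: "card (weierstrass_points (L(|carrier := \<kappa>|)) (Weierstrass 0.\<^bsub>L\<^esub> 0.\<^bsub>L\<^esub> 0.\<^bsub>L\<^esub> (\<rho> A) (\<rho> B))) =
 card (weierstrass_points G (Weierstrass 0.\<^bsub>G\<^esub> 0.\<^bsub>G\<^esub> 0.\<^bsub>G\<^esub> (h A) (h B)))"
 using bij_betw_same_card[OF ST] by simp
 \<comment> \<open>Elements of \<open>S\<close> that vanish at \<eta> lie in the ideal generated by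
   the nonunits of \<open>P\<close>, hence are nonunits of \<open>S\<close>. So \<rho> maps
   \<open>S\<close> onto a ring with the same units and the same residue field.\<close>
 have rat: "rational_over L \<kappa> (\<rho> ` S) \<longleftrightarrow> residue F S ` P = carrier (residue_field F S)" if S: "S : fibre F M P" for S
 proof -
 note Sp = mp[OF S] and Sd = dom[OF S]
 note SD = FF.lsubD[OF Sp(1)]
 note scl = FF.subcl[OF SD(1)] and sc = FF.subcarr[OF SD(1)]
 have S\<eta>: "u : \<eta>" if "u : S" for u using that sub[OF S] by blast
 interpret SR: domain "F(|carrier := S|)" by (rule FF.subring_is_domain[OF SD(1)])
 have idS: "ideal (nonunits F S) (F(|carrier := S|))"
 using FF.prime_in_iff[OF SD(1)] FF.nonunits_prime[OF Sp(1)] primeideal.axioms(1) by blast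
 have "genideal (F(|carrier := S|)) (nonunits F P) <= nonunits F S"
 by (rule SR.genideal_minimal[OF idS]) (use Sd(2) in blast)
 then have ker: "u : nonunits F S" if "u : S" "u : nonunits F \<eta>" for u using that gid[OF S] by blast
 have imS: "subring (\<rho> ` S) L"
 proof (rule L.subringI)
 show "\<rho> ` S <= carrier L" using rh(1) S\<eta> by blast
 show "1.\<^bsub>L\<^esub> : \<rho> ` S" using rh(2) scl(2) by (metis image_eqI)
 fix z w assume "z : \<rho> ` S" "w : \<rho> ` S"
 then obtain u v where uv: "u : S" "v : S" "z = \<rho> u" "w = \<rho> v" by blast
 note e = S\<eta>[OF uv(1)] S\<eta>[OF uv(2)]
 have "0.-.u : S" "\<rho> ( 0.-.u) = -.\<^bsub>L\<^esub> z"
 using scl(6)[OF scl(1) uv(1)] rh(6)[OF \<eta>cl(1) e(1)] rh(3) rh(1)[OF e(1)] uv(3) by (simp_all add: L.minus_eq)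
 then show "-.\<^bsub>L\<^esub> z : \<rho> ` S" by (metis image_eqI)
 show "z $\<^bsub>L\<^esub> w : \<rho> ` S" unfolding uv(3,4) rh(4)[OF e, symmetric] using scl(4)[OF uv(1,2)] by blast
 show "z +.\<^bsub>L\<^esub> w : \<rho> ` S" unfolding uv(3,4) rh(5)[OF e, symmetric] using scl(5)[OF uv(1,2)] by blast
 qed
 have nu: "\<rho> u : nonunits L (\<rho> ` S) \<longleftrightarrow> u : nonunits F S" if u: "u : S" for u
 proof
 assume n: "\<rho> u : nonunits L (\<rho> ` S)"
 show "u : nonunits F S"
 proof (rule ccontr)
 assume nn: "u ~: nonunits F S"
 note i = FF.unit_inv[OF SD(1) u nn]
 have e: "\<rho> u $\<^bsub>L\<^esub> \<rho> (inv u) = 1.\<^bsub>L\<^esub>"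
 unfolding rh(4)[OF S\<eta>[OF u] S\<eta>[OF i(2)], symmetric] using i(1) sc[OF u] rh(2) by simp
 then have "inv\<^bsub>L\<^esub> \<rho> u = \<rho> (inv u)" using L.inv_unique_field rh(1)[OF S\<eta>[OF u]] rh(1)[OF S\<eta>[OF i(2)]] by blast
 moreover have "\<rho> u ~= 0.\<^bsub>L\<^esub>" using e rh(1)[OF S\<eta>[OF i(2)]] L.one_not_zero by auto
 ultimately show False using n L.nonunits_iff[OF imS] i(2) by blast
 qed
 next
 assume n: "u : nonunits F S"
 have "inv\<^bsub>L\<^esub> \<rho> u ~: \<rho> ` S" if nz: "\<rho> u ~= 0.\<^bsub>L\<^esub>"
 proof
 assume "inv\<^bsub>L\<^esub> \<rho> u : \<rho> ` S"
 then obtain s where s: "s : S" "inv\<^bsub>L\<^esub> \<rho> u = \<rho> s" by blast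
 have us: "u$s : S" by (rule scl(4)[OF u s(1)])
 have "\<rho> (u$s) = \<rho> 1." unfolding rh(4)[OF S\<eta>[OF u] S\<eta>[OF s(1)]] s(2)[symmetric] rh(2) using nz rh(1)[OF S\<eta>[OF u]] by simp
 then have "u$s-.1. : nonunits F \<eta>" unfolding \<rho>_def using FF.residue_eq_iff[OF \<eta>p(1) S\<eta>[OF us] \<eta>cl(2)] by blast
 then have 1: "u$s-.1. : nonunits F S" by (rule ker[OF scl(6)[OF us scl(2)]])
 have 2: "u$s : nonunits F S" by (rule FF.nonunits_mult[OF SD(1) n s(1)])
 have "1. = u$s-.(u$s-.1.)" using sc[OF us]
 by (simp add: FF.minus_eq FF.minus_add FF.r_neg flip: FF.a_assoc)
 then show False using SD(3)[OF 2 1] FF.one_unit[OF SD(1)] by simp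
 qed
 then show "\<rho> u : nonunits L (\<rho> ` S)" using L.nonunits_iff[OF imS] u by blast
 qed
 have PS: "u : S" if "u : P" for u using that Sd(1) by blast
 have "rational_over L \<kappa> (\<rho> ` S) \<longleftrightarrow> (\<forall>u\<in>S. \<exists>c\<in>P. \<rho> u -.\<^bsub>L\<^esub> \<rho> c : nonunits L (\<rho> ` S))"
 unfolding rational_over_def \<kappa>_def using Sd(1) by blast
 also have "... \<longleftrightarrow> (\<forall>u\<in>S. \<exists>c\<in>P. u-.c : nonunits F S)"
 proof -
 have "\<rho> u -.\<^bsub>L\<^esub> \<rho> c : nonunits L (\<rho> ` S) \<longleftrightarrow> u-.c : nonunits F S" if "u : S" "c : P" for u c
 using nu[OF scl(6)[OF that(1) PS[OF that(2)]]] rh(6)[OF S\<eta>[OF that(1)] S\<eta>[OF PS[OF that(2)]]] by simp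
 then show ?thesis by simp
 qed
 also have "... \<longleftrightarrow> (\<forall>u\<in>S. \<exists>c\<in>P. residue F S u = residue F S c)" using FF.residue_eq_iff[OF Sp(1)] PS by simp
 also have "... \<longleftrightarrow> residue F S ` P = residue F S ` S" by (rule image_eq_iff_representatives[OF Sd(1)])
 finally show ?thesis unfolding FF.residue_field_facts(3)[OF Sp(1)] .
 qed
 let ?M = "weierstrass_model L \<kappa> x' y'"
 have bij': "bij_betw (%S. \<rho> ` S) (fibre F M P) ?M" using bij unfolding L_def \<kappa>_def \<rho>_def .
 have "bij_betw (%S. \<rho> ` S) {S : fibre F M P. rational_over L \<kappa> (\<rho> ` S)} {S : ?M. rational_over L \<kappa> S}"
 by (rule bij_betw_Collect_preimage[OF bij'])
 then have "card {S : fibre F M P. rational_over L \<kappa> (\<rho> ` S)} = card {S : ?M. rational_over L \<kappa> S}" by (rule bij_betw_same_card)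
 moreover have "rational_points F M P = {S : fibre F M P. rational_over L \<kappa> (\<rho> ` S)}"
 unfolding rational_points_def using rat by blast
 moreover have "{S : ?M. rational_over L \<kappa> S} = {S. place L \<kappa> S}" by (rule LW.rational_model_points)
 moreover obtain f where "bij_betw f (weierstrass_points (L(|carrier := \<kappa>|)) (Weierstrass 0.\<^bsub>L\<^esub> 0.\<^bsub>L\<^esub> 0.\<^bsub>L\<^esub> (\<rho> A) (\<rho> B))) {S. place L \<kappa> S}"
 using RW.bij_points_places by blast
 then have "card (weierstrass_points (L(|carrier := \<kappa>|)) (Weierstrass 0.\<^bsub>L\<^esub> 0.\<^bsub>L\<^esub> 0.\<^bsub>L\<^esub> (\<rho> A) (\<rho> B))) = card {S. place L \<kappa> S}"
 by (rule bij_betw_same_card)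
 ultimately have c1: "card (rational_points F M P) = card (weierstrass_points G (Weierstrass 0.\<^bsub>G\<^esub> 0.\<^bsub>G\<^esub> 0.\<^bsub>G\<^esub> (h A) (h B)))"
 using pts by simp
 let ?D = "[(4::nat)] #. (A$A$A)+.[(27::nat)] #. (B$B)"
 have m: "A$A : P" "A$A$A : P" "B$B : P" by (rule pcl(4) AP BP)+
 have D: "[(4::nat)] #. (A$A$A) : P" "[(27::nat)] #. (B$B) : P" "?D : P"
 by (rule pcl(8)[OF m(2)], rule pcl(8)[OF m(3)], rule pcl(5)[OF pcl(8)[OF m(2)] pcl(8)[OF m(3)]])
 have "\<rho> ?D = [(4::nat)] #.\<^bsub>L\<^esub> (\<rho> A $\<^bsub>L\<^esub> \<rho> A $\<^bsub>L\<^esub> \<rho> A) +.\<^bsub>L\<^esub> [(27::nat)] #.\<^bsub>L\<^esub> (\<rho> B $\<^bsub>L\<^esub> \<rho> B)"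
 unfolding rh(5)[OF P\<eta>[OF D(1)] P\<eta>[OF D(2)]] rh(7)[OF P\<eta>[OF m(2)]] rh(7)[OF P\<eta>[OF m(3)]] rh(4)[OF P\<eta>[OF m(1)] P\<eta>[OF AP]]
 rh(4)[OF P\<eta>[OF AP] P\<eta>[OF AP]] rh(4)[OF P\<eta>[OF BP] P\<eta>[OF BP]] ..
 then have "\<rho> ?D ~= \<rho> 0." using RW.disc rh(3) by simp
 then have "h ?D ~= h 0." using same[OF D(3) pcl(1)] by blast
 moreover have "h ?D = [(4::nat)] #.\<^bsub>G\<^esub> (h A $\<^bsub>G\<^esub> h A $\<^bsub>G\<^esub> h A) +.\<^bsub>G\<^esub> [(27::nat)] #.\<^bsub>G\<^esub> (h B $\<^bsub>G\<^esub> h B)"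
 unfolding hh(5)[OF D(1,2)] hh(7)[OF m(2)] hh(7)[OF m(3)] hh(4)[OF m(1) AP] hh(4)[OF AP AP] hh(4)[OF BP BP] ..
 ultimately have c2: "[(4::nat)] #.\<^bsub>G\<^esub> (h A $\<^bsub>G\<^esub> h A $\<^bsub>G\<^esub> h A) +.\<^bsub>G\<^esub> [(27::nat)] #.\<^bsub>G\<^esub> (h B $\<^bsub>G\<^esub> h B) ~= 0.\<^bsub>G\<^esub>" using hh(3) by simp
 have \<mu>c: "\<mu> : carrier F" by (rule FF.KF(2)[OF \<mu>(1)])
 have jc: "j : carrier F"
 proof -
 have d: "discriminant F WW.W : carrier F" "discriminant F WW.W ~= 0." using WW.disc WW.bc WW.basics(6) by simp_all
 show ?thesis unfolding j_invariant_def using WW.c4 WW.bc d by simp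
 qed
 \<comment> \<open>Both a^3 and b^2 have weight 12 under scaling by \<mu>, so the relation for
   \<open>j\<close> is multiplied through by this power.\<close>
 let ?U = "\<mu> [^] (12::nat)"
 have "j$?D = ?U$(j$([(4::nat)] #. (WW.sa$WW.sa$WW.sa)+.[(27::nat)] #. (WW.sb$WW.sb)))"
 unfolding A_def B_def by (reify FF.rsimps, rule FF.ring_id, simp add: \<mu>c jc WW.sc, simp, code_simp)
 also have "... = [(16::nat)] #. ([(16::nat)] #. ([(27::nat)] #. (A$A$A)))"
 unfolding WW.j_short A_def by (reify FF.rsimps, rule FF.ring_id, simp add: \<mu>c WW.sc, simp, code_simp)
 finally show ?thesis using c1 c2 AP BP by blast
qed

end

section \<open>Polynomials under reduction, and angles versus traces\<close>

lemma (in field) subring_hom_eval: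
 assumes P: "subring P R" and G: "field G" and h: "h : ring_hom (R(|carrier := P|)) G" and z: "z : P" and l: "set l <= P"
 shows "h (eval l z) = ring.eval G (map h l) (h z)"
 using l
proof (induction l)
 case Nil
 interpret G: field G by (rule G)
 show ?case using subring_hom_facts(3)[OF P G.ring_axioms h] by simp
next
 case (Cons c l)
 interpret G: field G by (rule G)
 note hf = subring_hom_facts[OF P G.ring_axioms h] and pcl = subcl[OF P]
 have pw: "h (z [^] n) = h z [^]\<^bsub>G\<^esub> n" for n :: nat
 proof (induction n)
 case 0
 then show ?case using hf(2) by simp
 next
 case (Suc n)
 then show ?case using hf(4)[OF pcl(7)[OF z] z, of n] by simp
 qed
 have c: "c : P" "set l <= P" using Cons.prems by simp_all
 show ?case
 using hf(5)[OF pcl(4)[OF c(1) pcl(7)[OF z]] eval_in_subring[OF P z c(2)], of "length l"] hf(4)[OF c(1) pcl(7)[OF z], of "length l"]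
 Cons.IH[OF c(2)] pw by (simp add: eval_Cons G.eval_Cons)
qed

text \<open>The cosine decreases on the interval from 0 to pi, so \<beta> gives the lower and
  \<alpha> the upper bound for the trace.\<close>

lemma frobenius_angle_bounds:
 assumes a: "frobenius_angle F k M P \<theta>" and t: "\<alpha> <= \<theta>" "\<theta> <= \<beta>" "0 <= \<alpha>" "\<beta> <= pi" and q: "card k = q" "q > 0"
 and n: "point_degree F k P = n"
 shows "trace_bound q \<beta> n <= of_int (frobenius_trace F k M P)" "of_int (frobenius_trace F k M P) <= trace_bound q \<alpha> n"
 "frobenius_trace F k M P ^ 2 <= 4 * int q ^ n"
proof -
 let ?t = "frobenius_trace F k M P"
 let ?s = "2 * sqrt (real (q ^ n))"
 have tt: "of_int ?t = ?s * cos \<theta>" using a unfolding frobenius_angle_def q(1) n by blast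
 have "real q powr (real n / 2) = (real q powr real n) powr (1 / 2)" by (simp add: powr_powr)
 also have "... = sqrt (real (q ^ n))" using q(2) by (simp add: powr_realpow powr_half_sqrt)
 finally have b: "trace_bound q \<gamma> n = ?s * cos \<gamma>" for \<gamma> unfolding trace_bound_def by simp
 have s0: "0 <= ?s" by simp
 have "cos \<beta> <= cos \<theta>" "cos \<theta> <= cos \<alpha>" using t by (auto intro!: cos_monotone_0_pi_le)
 then show "trace_bound q \<beta> n <= of_int ?t" "of_int ?t <= trace_bound q \<alpha> n" unfolding b tt using s0 by (auto intro!: mult_left_mono)
 have "(of_int ?t :: real) ^ 2 = 4 * real (q ^ n) * cos \<theta> ^ 2" unfolding tt by (simp add: power_mult_distrib)
 also have "... <= 4 * real (q ^ n) * 1" by (intro mult_left_mono) (auto simp: abs_square_le_1)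
 finally have "real_of_int (?t ^ 2) <= real_of_int (4 * int q ^ n)" by simp
 then show "?t ^ 2 <= 4 * int q ^ n" by (simp only: of_int_le_iff)
qed

lemma finite_trace_range: "finite {(n :: nat, t :: int). 1 <= n & n <= B & L n <= real_of_int t & real_of_int t <= U n & t ^ 2 <= 4 * int q ^ n}"
proof (rule finite_subset)
 show "{(n :: nat, t :: int). 1 <= n & n <= B & L n <= real_of_int t & real_of_int t <= U n & t ^ 2 <= 4 * int q ^ n} <=
 (SIGMA n:{1 ..B}. {\<lceil>L n\<rceil>..\<lfloor>U n\<rfloor>})"
 by (auto simp: ceiling_le_iff le_floor_iff)
 show "finite (SIGMA n:{1 ..B}. {\<lceil>L n\<rceil>..\<lfloor>U n\<rfloor>})" by auto
qed

section \<open>The counting argument\<close>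

context elliptic_fibration

begin

lemma j_in_K: "j : K"
proof -
 note kcl = WW.kcl and bk = WW.bk
 have "wei_c4 F WW.W : K" unfolding WW.c4 by (rule kcl(6)[OF kcl(4)[OF bk(1,1)] kcl(8)[OF bk(2)]])
 moreover have d: "discriminant F WW.W : K" unfolding WW.disc
 by (rule kcl(6)[OF kcl(6)[OF kcl(6)[OF kcl(8)[OF kcl(4)[OF kcl(4)[OF bk(1,2)] bk(3)]] kcl(4)[OF kcl(4)[OF bk(1,1)] bk(4)]]
 kcl(8)[OF kcl(4)[OF kcl(4)[OF bk(2,2)] bk(2)]]] kcl(8)[OF kcl(4)[OF bk(3,3)]]])
 ultimately show ?thesis unfolding j_invariant_def using kcl(4)[OF kcl(7) WW.kF(3)[OF d WW.basics(6)]] by blast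
qed

text \<open>The short discriminant is a unit at \<open>P\<close>, so \<open>j\<close> is integral
  there and its reduction is the j-invariant of the reduced equation.\<close>

lemma j_at_point:
 assumes P: "local_subring F P" and G: "field G" and h: "h : ring_hom (F(|carrier := P|)) G" "\<forall>v\<in>P. h v = 0.\<^bsub>G\<^esub> \<longleftrightarrow> v : nonunits F P"
 and AB: "A : P" "B : P"
 and D: "[(4::nat)] #.\<^bsub>G\<^esub> (h A $\<^bsub>G\<^esub> h A $\<^bsub>G\<^esub> h A) +.\<^bsub>G\<^esub> [(27::nat)] #.\<^bsub>G\<^esub> (h B $\<^bsub>G\<^esub> h B) ~= 0.\<^bsub>G\<^esub>"
 and jr: "j$([(4::nat)] #. (A$A$A)+.[(27::nat)] #. (B$B)) = [(16::nat)] #. ([(16::nat)] #. ([(27::nat)] #. (A$A$A)))"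
 shows "j : P"
 "h j $\<^bsub>G\<^esub> ([(4::nat)] #.\<^bsub>G\<^esub> (h A $\<^bsub>G\<^esub> h A $\<^bsub>G\<^esub> h A) +.\<^bsub>G\<^esub> [(27::nat)] #.\<^bsub>G\<^esub> (h B $\<^bsub>G\<^esub> h B)) =
 [(16::nat)] #.\<^bsub>G\<^esub> ([(16::nat)] #.\<^bsub>G\<^esub> ([(27::nat)] #.\<^bsub>G\<^esub> (h A $\<^bsub>G\<^esub> h A $\<^bsub>G\<^esub> h A)))"
proof -
 interpret G: field G by (rule G)
 note PD = FF.lsubD(1)[OF P]
 note hf = FF.subring_hom_facts[OF PD G.ring_axioms h(1)] and pcl = FF.subcl[OF PD] and pc = FF.subcarr[OF PD]
 let ?D = "[(4::nat)] #. (A$A$A)+.[(27::nat)] #. (B$B)" and ?N = "[(16::nat)] #. ([(16::nat)] #. ([(27::nat)] #. (A$A$A)))"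
 have m: "A$A : P" "A$A$A : P" "B$B : P" by (rule pcl(4) AB)+
 have d: "[(4::nat)] #. (A$A$A) : P" "[(27::nat)] #. (B$B) : P" "?D : P"
 by (rule pcl(8)[OF m(2)], rule pcl(8)[OF m(3)], rule pcl(5)[OF pcl(8)[OF m(2)] pcl(8)[OF m(3)]])
 have n: "[(27::nat)] #. (A$A$A) : P" "[(16::nat)] #. ([(27::nat)] #. (A$A$A)) : P" "?N : P" by (rule pcl(8) m(2))+
 have hD: "h ?D = [(4::nat)] #.\<^bsub>G\<^esub> (h A $\<^bsub>G\<^esub> h A $\<^bsub>G\<^esub> h A) +.\<^bsub>G\<^esub> [(27::nat)] #.\<^bsub>G\<^esub> (h B $\<^bsub>G\<^esub> h B)"
 unfolding hf(5)[OF d(1,2)] hf(7)[OF m(2)] hf(7)[OF m(3)] hf(4)[OF m(1) AB(1)] hf(4)[OF AB(1,1)] hf(4)[OF AB(2,2)] ..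
 have hN: "h ?N = [(16::nat)] #.\<^bsub>G\<^esub> ([(16::nat)] #.\<^bsub>G\<^esub> ([(27::nat)] #.\<^bsub>G\<^esub> (h A $\<^bsub>G\<^esub> h A $\<^bsub>G\<^esub> h A)))"
 unfolding hf(7)[OF n(2)] hf(7)[OF n(1)] hf(7)[OF m(2)] hf(4)[OF m(1) AB(1)] hf(4)[OF AB(1,1)] ..
 have u: "?D ~: nonunits F P"
 proof
 assume a: "?D : nonunits F P"
 have "h ?D = 0.\<^bsub>G\<^esub>" by (rule iffD2[OF bspec[OF h(2) d(3)] a])
 with D show False unfolding hD by (rule notE)
 qed
 note i = FF.unit_inv[OF PD d(3) u]
 have jc: "j : carrier F" by (rule FF.KF(2)[OF j_in_K])
 have "j = (j$?D)$inv ?D" using jc pc[OF d(3)] i(1) by (simp add: FF.m_assoc)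
 then have "j = ?N$inv ?D" unfolding jr .
 then show jP: "j : P" using pcl(4)[OF n(3) i(2)] by simp
 show "h j $\<^bsub>G\<^esub> ([(4::nat)] #.\<^bsub>G\<^esub> (h A $\<^bsub>G\<^esub> h A $\<^bsub>G\<^esub> h A) +.\<^bsub>G\<^esub> [(27::nat)] #.\<^bsub>G\<^esub> (h B $\<^bsub>G\<^esub> h B)) =
 [(16::nat)] #.\<^bsub>G\<^esub> ([(16::nat)] #.\<^bsub>G\<^esub> ([(27::nat)] #.\<^bsub>G\<^esub> (h A $\<^bsub>G\<^esub> h A $\<^bsub>G\<^esub> h A)))"
 unfolding hD[symmetric] hN[symmetric] hf(4)[OF jP d(3), symmetric] jr ..
qed

text \<open>The degree and the trace are recorded along with the class, so that the target is a
  disjoint union over the pairs (n, t) of the sum and its cardinality is that sum.\<close>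

theorem angle_points_bound:
 fixes GF :: "nat => ('e, 'f) ring_scheme"
 assumes q: "card k = q" and ang: "0 <= \<alpha>" "\<beta> <= pi"
 and GF: "!!n. n \<ge> 1 ==> field (GF n) & card (carrier (GF n)) = q ^ n"
 shows "finite (angle_points F k K C M Z B \<alpha> \<beta>) & card (angle_points F k K C M Z B \<alpha> \<beta>) <=
 (\<Sum>(n, t) \<in> {(n :: nat, t :: int). 1 <= n & n <= B & trace_bound q \<beta> n <= of_int t & of_int t <= trace_bound q \<alpha> n &
 t ^ 2 <= 4 * int q ^ n}. num_iso_classes (GF n) t) * deg_j_map F k K (Weierstrass a1 a2 a3 a4 a6)"
proof -
 let ?Pts = "angle_points F k K C M Z B \<alpha> \<beta>"
 let ?I = "{(n :: nat, t :: int). 1 <= n & n <= B & trace_bound q \<beta> n <= of_int t & of_int t <= trace_bound q \<alpha> n & t ^ 2 <= 4 * int q ^ n}"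
 have q0: "q > 0" using finite_base FF.subcl(1)[OF FF.kF(1)] unfolding q[symmetric] by (auto simp: card_gt_0_iff)
 have jc: "j : carrier F" by (rule FF.KF(2)[OF j_in_K])
 note fj = FF.funfield_facts[OF FF.kF(1) jc]
 obtain d where d: "FF.dimension d (FF.funfield k j) K"
 using FF.finite_over[OF j_in_K j_transcendental] unfolding FF.finite_dimension_def by blast
 have deg: "deg_j_map F k K (Weierstrass a1 a2 a3 a4 a6) = d"
 unfolding deg_j_map_def ext_degree_def FF.generate_field_insert[OF FF.kF(1) jc]
 by (rule the_equality, rule d, erule FF.dimension_is_inj[OF fj(1) _ d])
 have finG: "finite (carrier (GF n))" if n: "n \<ge> 1" for n
 using GF[OF n] q0 by (metis card.infinite not_gr_zero zero_less_power)
 have "\<forall>n. \<exists>\<tau>. n \<ge> 1 --> (\<forall>P. discrete_valuation_ring F K P & k <= P & point_degree F k P = n -->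
 (\<exists>h. h : ring_hom (F(|carrier := P|)) (GF n) & h ` P = carrier (GF n) & (\<forall>v\<in>P. h v = 0.\<^bsub>GF n\<^esub> \<longleftrightarrow> v : nonunits F P) & (\<forall>c\<in>k. h c = \<tau> c)))"
 proof
 fix n
 show "\<exists>\<tau>. n \<ge> 1 --> (\<forall>P. discrete_valuation_ring F K P & k <= P & point_degree F k P = n -->
 (\<exists>h. h : ring_hom (F(|carrier := P|)) (GF n) & h ` P = carrier (GF n) & (\<forall>v\<in>P. h v = 0.\<^bsub>GF n\<^esub> \<longleftrightarrow> v : nonunits F P) & (\<forall>c\<in>k. h c = \<tau> c)))"
 proof (cases "n \<ge> 1")
 case True
 have G: "field (GF n)" "card (carrier (GF n)) = card k ^ n" using GF[OF True] q by simp_all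
 from FF.compatible_reductions[OF finite_base p(1,3) G True] show ?thesis by (elim exE) (rule exI, rule impI, assumption)
 qed simp
 qed
 then obtain \<tau> where \<tau>: "\<forall>n\<ge>1 . \<forall>P. discrete_valuation_ring F K P & k <= P & point_degree F k P = n -->
 (\<exists>h. h : ring_hom (F(|carrier := P|)) (GF n) & h ` P = carrier (GF n) & (\<forall>v\<in>P. h v = 0.\<^bsub>GF n\<^esub> \<longleftrightarrow> v : nonunits F P) & (\<forall>c\<in>k. h c = \<tau> n c))"
 by (rule choice[THEN exE])
 let ?n = "%P. point_degree F k P"
 \<comment> \<open>All that is used about a point: a reduction map extending \<tau>, and a reduced
   equation with its discriminant, point count and relation for \<open>j\<close>.\<close>
 define \<Phi> where "\<Phi> P h A B \<longleftrightarrow> h : ring_hom (F(|carrier := P|)) (GF (?n P)) & (\<forall>v\<in>P. h v = 0.\<^bsub>GF (?n P)\<^esub> \<longleftrightarrow> v : nonunits F P) &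
 (\<forall>c\<in>k. h c = \<tau> (?n P) c) & A : P & B : P &
 [(4::nat)] #.\<^bsub>GF (?n P)\<^esub> (h A $\<^bsub>GF (?n P)\<^esub> h A $\<^bsub>GF (?n P)\<^esub> h A) +.\<^bsub>GF (?n P)\<^esub> [(27::nat)] #.\<^bsub>GF (?n P)\<^esub> (h B $\<^bsub>GF (?n P)\<^esub> h B) ~= 0.\<^bsub>GF (?n P)\<^esub> &
 card (rational_points F M P) = card (weierstrass_points (GF (?n P)) (Weierstrass 0.\<^bsub>GF (?n P)\<^esub> 0.\<^bsub>GF (?n P)\<^esub> 0.\<^bsub>GF (?n P)\<^esub> (h A) (h B))) &
 j$([(4::nat)] #. (A$A$A)+.[(27::nat)] #. (B$B)) = [(16::nat)] #. ([(16::nat)] #. ([(27::nat)] #. (A$A$A)))" for P h A B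
 have good: "discrete_valuation_ring F K P" "k <= P" "local_subring F P" "?n P \<ge> 1" "P : good_points F K C M Z" if P: "P : ?Pts" for P
 proof -
 show g: "P : good_points F K C M Z" using P unfolding angle_points_def by simp
 have c: "P : closed_points K C" using g unfolding good_points_def by simp
 show 1: "discrete_valuation_ring F K P" "k <= P" "local_subring F P" using closed_point[OF c] .
 show "?n P \<ge> 1" by (rule FF.point_degree_card(3)[OF finite_base 1(1,2)])
 qed
 have ex: "\<exists>h A B. \<Phi> P h A B" if P: "P : ?Pts" for P
 proof -
 note g = good[OF P]
 have "discrete_valuation_ring F K P & k <= P & ?n P = ?n P" using g(1,2) by simp
 with \<tau>[rule_format, OF g(4)] obtain h where h: "h : ring_hom (F(|carrier := P|)) (GF (?n P))" "h ` P = carrier (GF (?n P))"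
 "\<forall>v\<in>P. h v = 0.\<^bsub>GF (?n P)\<^esub> \<longleftrightarrow> v : nonunits F P" "\<forall>c\<in>k. h c = \<tau> (?n P) c" by blast
 have G: "field (GF (?n P))" using GF[OF g(4)] by blast
 from fibre_points[OF g(5) G finG[OF g(4)] h(1,2,3)] show ?thesis
 unfolding \<Phi>_def using h(1,3,4) by (elim bexE conjE) (intro exI conjI, assumption+)
 qed
 \<comment> \<open>One choice of these data for every point; the reduced curve, and with it the map
   to classes, depends on the choice.\<close>
 define hh where "hh P = (SOME h. \<exists>A B. \<Phi> P h A B)" for P
 define AA where "AA P = (SOME A. \<exists>B. \<Phi> P (hh P) A B)" for P
 define BB where "BB P = (SOME B. \<Phi> P (hh P) (AA P) B)" for P
 have \<Phi>: "\<Phi> P (hh P) (AA P) (BB P)" if P: "P : ?Pts" for P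
 proof -
 have "\<exists>A B. \<Phi> P (hh P) A B" unfolding hh_def by (rule someI_ex[OF ex[OF P]])
 then have "\<exists>B. \<Phi> P (hh P) (AA P) B" unfolding AA_def by (rule someI_ex)
 then show ?thesis unfolding BB_def by (rule someI_ex)
 qed
 define EE where "EE P = Weierstrass 0.\<^bsub>GF (?n P)\<^esub> 0.\<^bsub>GF (?n P)\<^esub> 0.\<^bsub>GF (?n P)\<^esub> (hh P (AA P)) (hh P (BB P))" for P
 have facts: "hh P : ring_hom (F(|carrier := P|)) (GF (?n P))" "\<forall>v\<in>P. hh P v = 0.\<^bsub>GF (?n P)\<^esub> \<longleftrightarrow> v : nonunits F P"
 "\<forall>c\<in>k. hh P c = \<tau> (?n P) c" "AA P : P" "BB P : P"
 "[(4::nat)] #.\<^bsub>GF (?n P)\<^esub> (hh P (AA P) $\<^bsub>GF (?n P)\<^esub> hh P (AA P) $\<^bsub>GF (?n P)\<^esub> hh P (AA P)) +.\<^bsub>GF (?n P)\<^esub> [(27::nat)] #.\<^bsub>GF (?n P)\<^esub> (hh P (BB P) $\<^bsub>GF (?n P)\<^esub> hh P (BB P)) ~= 0.\<^bsub>GF (?n P)\<^esub>"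
 "card (rational_points F M P) = card (weierstrass_points (GF (?n P)) (EE P))"
 "j$([(4::nat)] #. (AA P$AA P$AA P)+.[(27::nat)] #. (BB P$BB P)) = [(16::nat)] #. ([(16::nat)] #. ([(27::nat)] #. (AA P$AA P$AA P)))"
 if P: "P : ?Pts" for P
 using \<Phi>[OF P] unfolding \<Phi>_def EE_def by ((elim conjE, assumption)+ | blast+)
 have Gsmall: "[(2::nat)] #.\<^bsub>GF n\<^esub> 1.\<^bsub>GF n\<^esub> ~= 0.\<^bsub>GF n\<^esub>" "[(3::nat)] #.\<^bsub>GF n\<^esub> 1.\<^bsub>GF n\<^esub> ~= 0.\<^bsub>GF n\<^esub>" "[(16::nat)] #.\<^bsub>GF n\<^esub> 1.\<^bsub>GF n\<^esub> ~= 0.\<^bsub>GF n\<^esub>"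
 if n: "n \<ge> 1" for n
 proof -
 have G: "field (GF n)" "card (carrier (GF n)) = q ^ n" using GF[OF n] by simp_all
 obtain e where e: "card k = p ^ e" using FF.card_subfield_prime_power[OF p(1,3) FF.kR finite_base] by blast
 have c: "card (carrier (GF n)) = p ^ (e * n)" using G(2) e q by (simp add: power_mult)
 have "[p] #.\<^bsub>GF n\<^esub> 1.\<^bsub>GF n\<^esub> = 0.\<^bsub>GF n\<^esub>" by (rule field.characteristic_of_card[OF G(1) finG[OF n] c])
 note sn = small_nat_nonzero[OF G(1) this]
 show "[(2::nat)] #.\<^bsub>GF n\<^esub> 1.\<^bsub>GF n\<^esub> ~= 0.\<^bsub>GF n\<^esub>" "[(3::nat)] #.\<^bsub>GF n\<^esub> 1.\<^bsub>GF n\<^esub> ~= 0.\<^bsub>GF n\<^esub>" "[(16::nat)] #.\<^bsub>GF n\<^esub> 1.\<^bsub>GF n\<^esub> ~= 0.\<^bsub>GF n\<^esub>" by (rule sn(1), rule sn(2), rule sn(3))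
 qed
 have cc: "hh P u : carrier (GF (?n P))" if P: "P : ?Pts" "u : P" for P u
 using ring_hom_closed[OF facts(1)[OF P(1)], of u] P(2) by simp
 have ell: "EE P : elliptic_curves (GF (?n P)) (carrier (GF (?n P)))" if P: "P : ?Pts" for P
 proof -
 interpret G: field "GF (?n P)" using GF[OF good(4)[OF P]] by blast
 note hc = cc[OF P facts(4)[OF P]] cc[OF P facts(5)[OF P]]
 have "discriminant (GF (?n P)) (EE P) ~= 0.\<^bsub>GF (?n P)\<^esub>"
 unfolding EE_def G.short_discriminant[OF hc]
 using G.natmult_nonzero[OF Gsmall(3)[OF good(4)[OF P]] _ facts(6)[OF P]] hc by (simp add: G.add.inv_eq_1_iff)
 then show ?thesis unfolding elliptic_curves_def using hc unfolding EE_def by simp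
 qed
 define f where "f P = ((?n P, frobenius_trace F k M P), weierstrass_iso (GF (?n P)) `` {EE P})" for P
 \<comment> \<open>The classes counted by \<open>num_iso_classes\<close>, as an explicit set for
   each pair of degree and trace.\<close>
 define CC where "CC v = (case v of (n, t) => {W : elliptic_curves (GF n) (carrier (GF n)).
 int (card (weierstrass_points (GF n) W)) = int (card (carrier (GF n))) + 1 - t} // weierstrass_iso (GF n))" for v
 have CCfin: "finite (CC v)" if v: "v : ?I" for v
 proof -
 obtain n t where nt: "v = (n, t)" by (cases v)
 have "n \<ge> 1" using v nt by simp
 then have "finite (elliptic_curves (GF n) (carrier (GF n)))" by (rule finite_elliptic_curves[OF finG])
 then show ?thesis unfolding CC_def nt prod.case by (intro finite_quotient_of_finite) simp
 qed
 have CCcard: "card (CC v) = (case v of (n, t) => num_iso_classes (GF n) t)" for v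
 unfolding CC_def num_iso_classes_def by (simp split: prod.split)
 have Ifin: "finite ?I" by (rule finite_trace_range)
 have sub: "f ` ?Pts <= Sigma ?I CC"
 proof
 fix v assume "v : f ` ?Pts"
 then obtain P where P: "P : ?Pts" "v = f P" by blast
 note g = good[OF P(1)]
 obtain \<theta> where \<theta>: "frobenius_angle F k M P \<theta>" "\<alpha> <= \<theta>" "\<theta> <= \<beta>" and nB: "?n P <= B"
 using P(1) unfolding angle_points_def by blast
 note fb = frobenius_angle_bounds[OF \<theta> ang q q0 refl]
 have "(?n P, frobenius_trace F k M P) : ?I" using fb g(4) nB by simp
 moreover have "int (card (weierstrass_points (GF (?n P)) (EE P))) = int (card (carrier (GF (?n P)))) + 1 - frobenius_trace F k M P"
 unfolding frobenius_trace_def facts(7)[OF P(1)] using GF[OF g(4)] q by simp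
 then have "weierstrass_iso (GF (?n P)) `` {EE P} : CC (?n P, frobenius_trace F k M P)"
 unfolding CC_def prod.case using ell[OF P(1)] by (intro quotientI) simp
 ultimately show "v : Sigma ?I CC" unfolding P(2) f_def by (rule SigmaI)
 qed
 \<comment> \<open>All points of a fibre have the same degree n and isomorphic reduced curves over
   \<open>GF n\<close>. They lie over one prime of k[j], so at most \<open>d\<close> of them
   exist.\<close>
 have fib: "card Y <= d" if Y: "finite Y" "Y <= {P : ?Pts. f P = v}" for Y v
 proof (cases "Y = {}")
 case False
 then obtain P1 where P1: "P1 : Y" by blast
 have YP: "P : ?Pts" "f P = v" if "P : Y" for P using Y(2) that by blast+
 let ?pp = "FF.simple_extension k j \<inter> nonunits F P1"
 note P1P = YP(1)[OF P1]
 have H: "discrete_valuation_ring F K P & k <= P & j : P & FF.simple_extension k j \<inter> nonunits F P = ?pp" if PY: "P : Y" for P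
 proof -
 note P = YP(1)[OF PY]
 have "f P = f P1" using YP(2)[OF PY] YP(2)[OF P1] by simp
 note e = this[unfolded f_def prod.inject]
 have n: "?n P = ?n P1" by (rule e[THEN conjunct1, THEN conjunct1])
 have cl: "weierstrass_iso (GF (?n P)) `` {EE P} = weierstrass_iso (GF (?n P1)) `` {EE P1}" by (rule e[THEN conjunct2])
 interpret G: field "GF (?n P)" using GF[OF good(4)[OF P]] by blast
 have G1: "field (GF (?n P1))" using GF[OF good(4)[OF P1P]] by blast
 note jP = j_at_point[OF good(3)[OF P] G.field_axioms facts(1)[OF P] facts(2)[OF P] facts(4)[OF P] facts(5)[OF P] facts(6)[OF P] facts(8)[OF P]]
 note jP1 = j_at_point[OF good(3)[OF P1P] G1 facts(1)[OF P1P] facts(2)[OF P1P] facts(4)[OF P1P] facts(5)[OF P1P] facts(6)[OF P1P] facts(8)[OF P1P]]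
 have "(EE P1, EE P1) : weierstrass_iso (GF (?n P1))" by (rule field.weierstrass_iso_refl[OF G1 ell[OF P1P]])
 then have "EE P1 : weierstrass_iso (GF (?n P)) `` {EE P}" unfolding cl by simp
 then have iso: "(EE P, EE P1) : weierstrass_iso (GF (?n P))" by simp
 note c1 = cc[OF P1P facts(4)[OF P1P], folded n] cc[OF P1P facts(5)[OF P1P], folded n] cc[OF P1P jP1(1), folded n]
 note c = cc[OF P facts(4)[OF P]] cc[OF P facts(5)[OF P]] cc[OF P jP(1)]
 \<comment> \<open>Isomorphic reduced curves have the same j-invariant in
   \<open>GF n\<close>.\<close>
 have jj: "hh P j = hh P1 j"
 by (rule G.short_isomorphism_j[OF Gsmall(1,2)[OF good(4)[OF P]] c(1,2) c1(1,2) c(3) c1(3) iso[unfolded EE_def, folded n] facts(6)[OF P] jP(2) jP1(2)[folded n]])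
 \<comment> \<open>An element of k[j] is a polynomial value l(j). Since both reductions agree on
   \<open>k\<close> and on \<open>j\<close>, they agree on it, and so do their kernels.\<close>
 have mem: "z : nonunits F P \<longleftrightarrow> z : nonunits F P1" if z: "z : FF.simple_extension k j" for z
 proof -
 obtain l where l: "set l <= k" "z = FF.eval l j" using z FF.polys_iff[OF FF.kF(1) jc] by blast
 have lP: "set l <= P" "set l <= P1" using l(1) good(2)[OF P] good(2)[OF P1P] by blast+
 note PD = FF.lsubD(1)[OF good(3)[OF P]] and P1D = FF.lsubD(1)[OF good(3)[OF P1P]]
 have zP: "z : P" "z : P1" unfolding l(2) by (rule FF.eval_in_subring[OF PD jP(1) lP(1)], rule FF.eval_in_subring[OF P1D jP1(1) lP(2)])
 have "map (hh P) l = map (hh P1) l" by (rule map_cong[OF refl]) (use facts(3)[OF P] facts(3)[OF P1P] l(1) n in auto)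
 then have hz: "hh P z = hh P1 z"
 unfolding l(2) FF.subring_hom_eval[OF PD G.field_axioms facts(1)[OF P] jP(1) lP(1)]
 FF.subring_hom_eval[OF P1D G1 facts(1)[OF P1P] jP1(1) lP(2)] using n jj by (simp only:)
 have e1: "hh P z = 0.\<^bsub>GF (?n P)\<^esub> \<longleftrightarrow> z : nonunits F P" by (rule bspec[OF facts(2)[OF P] zP(1)])
 have e2: "hh P1 z = 0.\<^bsub>GF (?n P1)\<^esub> \<longleftrightarrow> z : nonunits F P1" by (rule bspec[OF facts(2)[OF P1P] zP(2)])
 show ?thesis unfolding e1[symmetric] e2[symmetric] hz n ..
 qed
 have "FF.simple_extension k j \<inter> nonunits F P = ?pp" using mem by (intro equalityI subsetI) (elim IntE, intro IntI, assumption, simp)+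
 then show ?thesis using good(1,2)[OF P] jP(1) by (intro conjI)
 qed
 show ?thesis by ((rule FF.card_points_over_prime[OF j_in_K j_transcendental d Y(1)], rule ballI, erule H)
 | (use H FF.card_points_over_prime[OF j_in_K j_transcendental d Y(1)] in blast))
 qed simp
 have "finite (Sigma ?I CC)" by (rule finite_SigmaI[OF Ifin CCfin])
 then have "finite ?Pts & card ?Pts <= card (Sigma ?I CC) * d"
 by (intro card_le_fibres[OF _ sub]) (use fib in blast)
 moreover have "card (Sigma ?I CC) = (\<Sum>v\<in>?I. card (CC v))" by (rule card_SigmaI[OF Ifin]) (use CCfin in blast)
 ultimately show ?thesis unfolding deg CCcard by simp
qed

end

theorem corollary3p10:
  fixes F :: "'a ring"
    and k K :: "'a set"
    and C \<E> :: "'a set set"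
    and W :: "'a weierstrass"
    and x y :: 'a
    and p q B :: nat
    and \<alpha> \<beta> :: real
    and GF :: "nat \<Rightarrow> 'c ring"
  assumes "field F"
    and "subfield k F" and "subfield K F" and "k \<subseteq> K"
    and "finite k" and "card k = q"
    and "Factorial_Ring.prime p" and "p > 3" and "[p] \<cdot>\<^bsub>F\<^esub> \<one>\<^bsub>F\<^esub> = \<zero>\<^bsub>F\<^esub>"
    and "smooth_projective_curve F k K C"
    and "elliptic_function_field F K W x y"
    and "ring.transcendental F k (j_invariant F W)"
    and "minimal_regular_model F k K C (weierstrass_model F K x y) \<E>"
    and "B \<ge> 1"
    and "0 \<le> \<alpha>" and "\<alpha> \<le> pi" and "0 \<le> \<beta>" and "\<beta> \<le> pi"
    and "\<And>n. n \<ge> 1 \<Longrightarrow> field (GF n) \<and> card (carrier (GF n)) = q ^ n"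
  shows "finite (angle_points F k K C \<E> (weierstrass_origin F K x y) B \<alpha> \<beta>) \<and>
    card (angle_points F k K C \<E> (weierstrass_origin F K x y) B \<alpha> \<beta>) \<le>
      (\<Sum>(n, t) \<in> {(n :: nat, t :: int). 1 \<le> n \<and> n \<le> B \<and>
            trace_bound q \<beta> n \<le> of_int t \<and> of_int t \<le> trace_bound q \<alpha> n \<and>
            t ^ 2 \<le> 4 * int q ^ n}.
         num_iso_classes (GF n) t) * deg_j_map F k K W"
proof -
 obtain a1 a2 a3 a4 a6 where W: "W = Weierstrass a1 a2 a3 a4 a6" by (cases W)
 interpret F: field F by (rule assms(1))
 \<comment> \<open>From p > 3 both 2 and 3 are nonzero in \<open>F\<close>, as the passage to the
   short equation requires.\<close>
 have "\<not> p dvd 2" "\<not> p dvd 3" using assms(8) dvd_imp_le[of p 2] dvd_imp_le[of p 3] by auto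
 then have n: "[(2::nat)] \<cdot>\<^bsub>F\<^esub> \<one>\<^bsub>F\<^esub> \<noteq> \<zero>\<^bsub>F\<^esub>" "[(3::nat)] \<cdot>\<^bsub>F\<^esub> \<one>\<^bsub>F\<^esub> \<noteq> \<zero>\<^bsub>F\<^esub>"
 using F.nat_one_eq_zero_iff[OF assms(7,9)] by blast+
 have 23: "\<one>\<^bsub>F\<^esub> \<oplus>\<^bsub>F\<^esub> \<one>\<^bsub>F\<^esub> \<noteq> \<zero>\<^bsub>F\<^esub>" "\<one>\<^bsub>F\<^esub> \<oplus>\<^bsub>F\<^esub> \<one>\<^bsub>F\<^esub> \<oplus>\<^bsub>F\<^esub> \<one>\<^bsub>F\<^esub> \<noteq> \<zero>\<^bsub>F\<^esub>"
 using n by (simp_all add: numeral_2_eq_2 numeral_3_eq_3)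
 have ff: "function_field_one_var F k K" using assms(10) unfolding smooth_projective_curve_def by (elim conjE)
 interpret elliptic_fibration F k K x y a1 a2 a3 a4 a6 C \<E> p
 using assms(10-13) unfolding W
 by (intro elliptic_fibration.intro elliptic_fibration_axioms.intro function_field.intro function_field_axioms.intro
 long_weierstrass.intro long_weierstrass_axioms.intro assms(1-5,7-9) ff 23)
 show ?thesis unfolding W by (rule angle_points_bound[OF assms(6,15,18,19)])
qed

end
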